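(* Let $K/F$, with $\{K_i\}_{i\in\omega}$ and $\{G_i\}_{i\in\omega}$, be a fully computable Galois extension, let $C\subseteq\omega$ be a cohesive set, and let $N,M\in\prod_C\mathbb{N}$ with $N<M$. For $L\in\prod_C\mathbb{N}$ let $I_L$ denote the intersection of all internal subgroups of finite index of $\prod_{C,L}G_i$. Then the following diagram commutes, and its rows are left exact (i.e. exact after placing a $0$ on the left of each row): $$\begin{array}{ccccc} \ker\Psi&\to&\mathrm{HAut}(\prod_CK/\prod_CF)&\xrightarrow{\Psi}&\mathrm{Gal}(\mathrm{Alg}(\prod_CK)/\prod_CF)\\ \|&&\|&&\|\\ \varprojlim_L I_L&\to&\varprojlim_L\prod_{C,L}G_i&\to&\varprojlim_L\mathrm{Gal}(\mathrm{Alg}(\prod_{C,L}K_i)/\prod_CF)\\ \downarrow&&\downarrow&&\downarrow\\ I_M&\to&\prod_{C,M}G_i\cong\mathrm{HAut}(\prod_{C,M}K_i/\prod_CF)&\to&\mathrm{Gal}(\mathrm{Alg}(\prod_{C,M}K_i)/\prod_CF)\\ \downarrow&&\downarrow&&\downarrow\\ I_N&\to&\prod_{C,N}G_i\cong\mathrm{HAut}(\prod_{C,N}K_i/\prod_CF)&\to&\mathrm{Gal}(\mathrm{Alg}(\prod_{C,N}K_i)/\prod_CF) \end{array}$$ Here $L$ ranges over $\prod_C\mathbb{N}$, the symbols $\|$ denote canonical isomorphisms, the left horizontal maps are inclusions, and the right horizontal maps are given by restricting the action to the algebraic part.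
   Context: For $A,B\subseteq\omega$, $A\subseteq^* B$ means $A\setminus B$ is finite. A set $C\subseteq\omega$ is cohesive if it is infinite and for every c.e. set $W$ either $C\subseteq^*W$ or $C\subseteq^*\overline{W}$. A sequence of structures is uniformly computable if their domains $\subseteq\omega$ and atomic diagrams are computable uniformly in $i$; for finite groups $G_i$ this is understood to mean that the complete finite list of elements and the multiplication table of $G_i$ are computable from $i$. The cohesive product $\prod_C\mathcal A_i$ has as domain the classes $[\varphi]$ of partial computable functions $\varphi$ with $\varphi(i)\in\mathcal A_i$ whenever $\varphi(i){\downarrow}$ and $C\subseteq^*\mathrm{dom}(\varphi)$, where $[\varphi]=[\psi]$ iff $C\subseteq^*\{i:\varphi(i){\downarrow}=\psi(i){\downarrow}\}$; operations are pointwise and a relation holds iff it holds at $i$ for almost every $i\in C$. The same definition is used for partial sequences $\{\mathcal A_i\}_{i\in W}$ with $W$ c.e. and $C\subseteq^*W$. The product of a constant sequence is the cohesive power; $\prod_C\mathbb{N}$ is linearly ordered. Brackets are omitted from elements. For $N\in\prod_C\mathbb{N}$, $\prod_{C,N}\mathcal A_i:=\prod_C\mathcal A_{N(i)}$. Field extensions are presented as triples $(K,F,\Psi)$ with $\Psi:F\to K$ a computable ring homomorphism between computable fields. A Galois extension $K/F$ is fully computable if: (1) $(K,F,\Psi)$ is a computable Galois extension; (2) there are uniformly computable finite Galois sub-extensions $K_i\subseteq K$ of $F$, with $(K,K_i,\Psi_i)$ and $(K_{i+1},K_i,\Phi_i)$ uniformly computable and $K=\bigcup_iK_i$; (3) the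 groups $G_i=\mathrm{Gal}(K_i/F)$ are uniformly computable; (4) the quotient (restriction) maps $f_{m,n}:G_m\to G_n$, $n<m$, are uniformly computable; (5) the actions $G_i\curvearrowright K_i$ are uniformly computable; (6) $K_i\subsetneq K_{i+1}$. For $N\le M$ in $\prod_C\mathbb{N}$, $\prod_CF\subseteq\prod_{C,N}K_i\subseteq\prod_{C,M}K_i\subseteq\prod_CK$. For $N<M$, $f_{M,N}:\prod_{C,M}G_i\to\prod_{C,N}G_i$ is $f_{M,N}(g)(i)=f_{M(i),N(i)}(g(i))$; these are the transition maps for the groups $\prod_{C,L}G_i$ (and, restricted, for $I_L$), and the transition maps between Galois groups are restriction maps. Vertical maps out of limits are projections and the lower vertical maps are transition maps. $\prod_{C,L}G_i$ acts on $\prod_{C,L}K_i$, and coordinatewise on $\prod_{C,L}\mathcal T_{K_i}$, by $(\sigma\alpha)(i)=\sigma(i)(\alpha(i))$, giving its identification with $\mathrm{HAut}(\prod_{C,L}K_i/\prod_CF)$. For a field $E\supseteq\prod_CF$, $\mathrm{Alg}(E)$ is the subfield of elements algebraic over $\prod_CF$; these algebraic parts are Galois over $\prod_CF$. The isomorphism $\mathrm{HAut}(\prod_CK/\prod_CF)\cong\varprojlim_L\prod_{C,L}G_i$ sends $\sigma$ to $\{\sigma\upharpoonright\prod_{C,L}K_i\}_L$. $\Psi$ in the diagram sends $\sigma$ to its restriction to $\mathrm{Alg}(\prod_CK)$. An internal subgroup of $\prod_{C,L}G_i=\prod_CG_{L(i)}$ is a subgroup of the form $\prod_CH_i$ with $\{H_i\}$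 a uniformly computable (possibly partial, defined on a c.e. set $W$ with $C\subseteq^*W$) sequence of subgroups $H_i\le G_{L(i)}$. For a structure $\mathcal A$, $\mathcal T_{\mathcal A}=(\mathcal A^{<\omega},\preceq,{}^\wedge)$ is the tree of finite tuples with extension order and concatenation. For $\vec a\in\prod_C\mathcal T_{\mathcal A_i}$, the arity $|\vec a|\in\prod_C\mathbb{N}$ is $i\mapsto|\vec a(i)|$; elements of $\prod_C\mathcal A_i$ are identified with elements of arity $1$. Elements $p\in\prod_C(\mathbb{Z}[x_1,x_2,\dots])$ are integral hyper-polynomials ($\mathbb{Z}[x_1,x_2,\dots]$ being presented so that degrees and coefficients are computable); $\mathrm{var}(p)\in\prod_C\mathbb{N}$ is $i\mapsto$ the largest index of a variable occurring in $p(i)$, and if $|\vec a|=\mathrm{var}(p)$ then $p(\vec a)$ is $i\mapsto p(i)(\vec a(i))$. For uniformly computable fields $L_i\supseteq F$, $\mathrm{HAut}(\prod_CL_i/\prod_CF)$ is the group of automorphisms $\sigma$ of $(\prod_C\mathcal T_{L_i},\preceq,{}^\wedge)$ such that $|\sigma\vec a|=|\vec a|$ for all $\vec a$, $p(\sigma(\vec a))=\sigma(p(\vec a))$ for all integral hyper-polynomials $p$ and $\vec a$ with $|\vec a|=\mathrm{var}(p)$, and $\sigma(\vec a)=\vec a$ for all $\vec a\in\prod_C\mathcal T_F$. *)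

theory Defs
  imports "HOL-Algebra.Algebra" "HOL-Library.Nat_Bijection" "HOL-Library.Sublist"
begin

section \<open>Computability\<close>

definition minimise :: "(nat \<rightharpoonup> nat) \<Rightarrow> nat option" where
  "minimise h =
     (if \<exists>k. h k = Some 0 \<and> (\<forall>j<k. \<exists>y. h j = Some y \<and> y \<noteq> 0)
      then Some (LEAST k. h k = Some 0) else None)"

text \<open>The unary partial recursive functions; several arguments are passed as one number via
  \<^const>\<open>prod_encode\<close>, whose projections and pairing are among the initial functions and closure
  conditions.\<close>

inductive partial_computable :: "(nat \<rightharpoonup> nat) \<Rightarrow> bool" where
  zero: "partial_computable (\<lambda>n. Some 0)"
| succ: "partial_computable (\<lambda>n. Some (Suc n))"
| left: "partial_computable (\<lambda>n. Some (fst (prod_decode n)))"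
| right: "partial_computable (\<lambda>n. Some (snd (prod_decode n)))"
| pair: "partial_computable f \<Longrightarrow> partial_computable g \<Longrightarrow>
    partial_computable
      (\<lambda>n. Option.bind (f n) (\<lambda>a. Option.bind (g n) (\<lambda>b. Some (prod_encode (a, b)))))"
| comp: "partial_computable f \<Longrightarrow> partial_computable g \<Longrightarrow>
    partial_computable (\<lambda>n. Option.bind (g n) f)"
| prec: "partial_computable f \<Longrightarrow> partial_computable g \<Longrightarrow>
    partial_computable (\<lambda>n. case prod_decode n of (a, m) \<Rightarrow>
      rec_nat (f a) (\<lambda>y r. Option.bind r (\<lambda>z. g (prod_encode (a, prod_encode (y, z))))) m)"
| mu: "partial_computable f \<Longrightarrow>
    partial_computable (\<lambda>a. minimise (\<lambda>k. f (prod_encode (a, k))))"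

definition ce :: "nat set \<Rightarrow> bool" where
  "ce W \<longleftrightarrow> (\<exists>f. partial_computable f \<and> W = dom f)"

definition computable_on :: "nat set \<Rightarrow> (nat \<Rightarrow> nat) \<Rightarrow> bool" where
  "computable_on S h \<longleftrightarrow>
     (\<exists>p. partial_computable p \<and> (\<forall>x\<in>S. p x = Some (h x)))"

definition computable_on2 :: "(nat \<times> nat) set \<Rightarrow> (nat \<Rightarrow> nat \<Rightarrow> nat) \<Rightarrow> bool" where
  "computable_on2 S h \<longleftrightarrow>
     (\<exists>p. partial_computable p \<and> (\<forall>(x, y)\<in>S. p (prod_encode (x, y)) = Some (h x y)))"

definition computable_on3 ::
  "(nat \<times> nat \<times> nat) set \<Rightarrow> (nat \<Rightarrow> nat \<Rightarrow> nat \<Rightarrow> nat) \<Rightarrow> bool" where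
  "computable_on3 S h \<longleftrightarrow>
     (\<exists>p. partial_computable p \<and>
        (\<forall>(x, y, z)\<in>S. p (prod_encode (x, prod_encode (y, z))) = Some (h x y z)))"

definition almost_subset :: "nat set \<Rightarrow> nat set \<Rightarrow> bool" (infix \<open>\<subseteq>\<^sup>*\<close> 50) where
  "A \<subseteq>\<^sup>* B \<longleftrightarrow> finite (A - B)"

definition cohesive :: "nat set \<Rightarrow> bool" where
  "cohesive C \<longleftrightarrow> infinite C \<and> (\<forall>W. ce W \<longrightarrow> C \<subseteq>\<^sup>* W \<or> C \<subseteq>\<^sup>* - W)"

definition uniformly_computable_fields :: "(nat \<Rightarrow> nat ring) \<Rightarrow> bool" where
  "uniformly_computable_fields A \<longleftrightarrow>
     (\<forall>i. field (A i)) \<and>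
     computable_on2 UNIV (\<lambda>i x. of_bool (x \<in> carrier (A i))) \<and>
     computable_on3 {(i, x, y). x \<in> carrier (A i) \<and> y \<in> carrier (A i)} (\<lambda>i x y. x \<oplus>\<^bsub>A i\<^esub> y) \<and>
     computable_on3 {(i, x, y). x \<in> carrier (A i) \<and> y \<in> carrier (A i)} (\<lambda>i x y. x \<otimes>\<^bsub>A i\<^esub> y)"

definition computable_field :: "nat ring \<Rightarrow> bool" where
  "computable_field R \<longleftrightarrow> uniformly_computable_fields (\<lambda>_. R)"

text \<open>For finite groups a code of the complete list of elements must be computable from the index,
  not merely membership.\<close>

definition uniformly_computable_finite_groups :: "(nat \<Rightarrow> nat monoid) \<Rightarrow> bool" where
  "uniformly_computable_finite_groups G \<longleftrightarrow>
     (\<forall>i. group (G i)) \<and>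
     (\<exists>e. computable_on UNIV e \<and> (\<forall>i. carrier (G i) = set (list_decode (e i)))) \<and>
     computable_on3 {(i, x, y). x \<in> carrier (G i) \<and> y \<in> carrier (G i)} (\<lambda>i x y. x \<otimes>\<^bsub>G i\<^esub> y)"


section \<open>Galois extensions\<close>

definition Gal :: "'a ring \<Rightarrow> 'a set \<Rightarrow> ('a \<Rightarrow> 'a) monoid" where
  "Gal E B = (BijGroup (carrier E))
     \<lparr>carrier := {\<sigma> \<in> Bij (carrier E). \<sigma> \<in> ring_hom E E \<and> (\<forall>x\<in>B. \<sigma> x = x)}\<rparr>"

definition alg_part :: "'a ring \<Rightarrow> 'a set \<Rightarrow> 'a set" where
  "alg_part E B = {x \<in> carrier E. \<not> ring.transcendental E B x}"

definition galois_extension :: "'a ring \<Rightarrow> 'a set \<Rightarrow> bool" where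
  "galois_extension E B \<longleftrightarrow>
     field E \<and> subfield B E \<and> alg_part E B = carrier E \<and>
     {x \<in> carrier E. \<forall>\<sigma>\<in>carrier (Gal E B). \<sigma> x = x} = B"

text \<open>The data of a fully computable Galois extension: \<^term>\<open>emb\<close> embeds the base field into the
  top field, \<^term>\<open>lev_emb i\<close> embeds the presented field \<^term>\<open>lev i\<close> into the top field,
  \<^term>\<open>step i\<close> embeds \<^term>\<open>lev i\<close> into \<^term>\<open>lev (Suc i)\<close>, the elements of \<^term>\<open>grp i\<close> are numbers
  acting on \<^term>\<open>lev i\<close> by \<^term>\<open>act i\<close>, and \<^term>\<open>quot m n\<close> is the restriction map from
  \<^term>\<open>grp m\<close> to \<^term>\<open>grp n\<close>.\<close>

record galois_data =
  base :: "nat ring"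
  top_field :: "nat ring"
  emb :: "nat \<Rightarrow> nat"
  lev :: "nat \<Rightarrow> nat ring"
  lev_emb :: "nat \<Rightarrow> nat \<Rightarrow> nat"
  step :: "nat \<Rightarrow> nat \<Rightarrow> nat"
  grp :: "nat \<Rightarrow> nat monoid"
  act :: "nat \<Rightarrow> nat \<Rightarrow> nat \<Rightarrow> nat"
  quot :: "nat \<Rightarrow> nat \<Rightarrow> nat \<Rightarrow> nat"

text \<open>The embedding of the base field into the \<open>n\<close>-th field, and of the \<open>n\<close>-th field into the
  \<open>m\<close>-th one (for \<open>n \<le> m\<close>), induced by inclusion of their images in the top field.\<close>

definition lev_base :: "galois_data \<Rightarrow> nat \<Rightarrow> nat \<Rightarrow> nat" where
  "lev_base E n x = the_inv_into (carrier (lev E n)) (lev_emb E n) (emb E x)"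

definition lev_incl :: "galois_data \<Rightarrow> nat \<Rightarrow> nat \<Rightarrow> nat \<Rightarrow> nat" where
  "lev_incl E m n x = the_inv_into (carrier (lev E m)) (lev_emb E m) (lev_emb E n x)"

definition fully_computable :: "galois_data \<Rightarrow> bool" where
  "fully_computable E \<longleftrightarrow>
     computable_field (base E) \<and> computable_field (top_field E) \<and>
     emb E \<in> ring_hom (base E) (top_field E) \<and> computable_on (carrier (base E)) (emb E) \<and>
     galois_extension (top_field E) (emb E ` carrier (base E)) \<and>

     uniformly_computable_fields (lev E) \<and>
     (\<forall>i. lev_emb E i \<in> ring_hom (lev E i) (top_field E)) \<and>
     computable_on2 {(i, x). x \<in> carrier (lev E i)} (lev_emb E) \<and>
     (\<forall>i. step E i \<in> ring_hom (lev E i) (lev E (Suc i))) \<and>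
     computable_on2 {(i, x). x \<in> carrier (lev E i)} (step E) \<and>
     (\<forall>i. \<forall>x\<in>carrier (lev E i). lev_emb E (Suc i) (step E i x) = lev_emb E i x) \<and>
     (\<forall>i. emb E ` carrier (base E) \<subseteq> lev_emb E i ` carrier (lev E i)) \<and>
     (\<forall>i. galois_extension (lev E i) (lev_base E i ` carrier (base E)) \<and>
          ring.finite_dimension (lev E i) (lev_base E i ` carrier (base E)) (carrier (lev E i))) \<and>
     carrier (top_field E) = (\<Union>i. lev_emb E i ` carrier (lev E i)) \<and>

     uniformly_computable_finite_groups (grp E) \<and>
     (\<forall>i. (\<lambda>g. restrict (act E i g) (carrier (lev E i))) \<in>
            iso (grp E i) (Gal (lev E i) (lev_base E i ` carrier (base E)))) \<and>

     (\<forall>m n. n < m \<longrightarrow> quot E m n \<in> carrier (grp E m) \<rightarrow> carrier (grp E n) \<and>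
        (\<forall>g\<in>carrier (grp E m). \<forall>x\<in>carrier (lev E n).
           lev_incl E m n (act E n (quot E m n g) x) = act E m g (lev_incl E m n x))) \<and>
     computable_on3 {(m, n, g). n < m \<and> g \<in> carrier (grp E m)} (quot E) \<and>

     computable_on3 {(i, g, x). g \<in> carrier (grp E i) \<and> x \<in> carrier (lev E i)} (act E) \<and>

     (\<forall>i. lev_emb E i ` carrier (lev E i) \<subset> lev_emb E (Suc i) ` carrier (lev E (Suc i)))"


section \<open>Cohesive products\<close>

text \<open>A partial sequence of sets, structures or maps is a map from \<^typ>\<open>nat\<close> to an option type.
  Elements of cohesive products are equivalence classes of partial computable functions.\<close>

type_synonym pfun = "nat \<Rightarrow> nat option"
type_synonym hyper = "pfun set"

definition cpre :: "nat set \<Rightarrow> (nat \<Rightarrow> nat set option) \<Rightarrow> pfun set" where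
  "cpre C D = {\<phi>. partial_computable \<phi> \<and>
     (\<forall>i x. \<phi> i = Some x \<longrightarrow> (\<exists>S. D i = Some S \<and> x \<in> S)) \<and> C \<subseteq>\<^sup>* dom \<phi>}"

definition ceq :: "nat set \<Rightarrow> (nat \<Rightarrow> nat set option) \<Rightarrow> (pfun \<times> pfun) set" where
  "ceq C D = {(\<phi>, \<psi>). \<phi> \<in> cpre C D \<and> \<psi> \<in> cpre C D \<and> C \<subseteq>\<^sup>* {i. \<phi> i \<noteq> None \<and> \<phi> i = \<psi> i}}"

definition cprod :: "nat set \<Rightarrow> (nat \<Rightarrow> nat set option) \<Rightarrow> hyper set" where
  "cprod C D = cpre C D // ceq C D"

definition ccls :: "nat set \<Rightarrow> (nat \<Rightarrow> nat set option) \<Rightarrow> pfun \<Rightarrow> hyper" where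
  "ccls C D \<phi> = ceq C D `` {\<phi>}"

text \<open>The unions run over all representatives; the classes united are all equal when the
  pointwise map is well defined on classes.  A pointwise result that is not partial computable
  contributes the empty set, which is not an element of any cohesive product.\<close>

definition cmap ::
  "nat set \<Rightarrow> (nat \<Rightarrow> nat set option) \<Rightarrow> (nat \<Rightarrow> (nat \<Rightarrow> nat) option) \<Rightarrow> hyper \<Rightarrow> hyper" where
  "cmap C D u P =
     (\<Union>\<phi>\<in>P. ccls C D (\<lambda>i. Option.bind (u i) (\<lambda>h. map_option h (\<phi> i))))"

definition cmap2 ::
  "nat set \<Rightarrow> (nat \<Rightarrow> nat set option) \<Rightarrow> (nat \<Rightarrow> (nat \<Rightarrow> nat \<Rightarrow> nat) option) \<Rightarrow>
     hyper \<Rightarrow> hyper \<Rightarrow> hyper" where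
  "cmap2 C D u P Q =
     (\<Union>\<phi>\<in>P. \<Union>\<psi>\<in>Q. ccls C D (\<lambda>i. Option.bind (u i)
        (\<lambda>h. Option.bind (\<phi> i) (\<lambda>x. map_option (h x) (\<psi> i)))))"

definition crel :: "nat set \<Rightarrow> (nat \<Rightarrow> nat \<Rightarrow> bool) \<Rightarrow> hyper \<Rightarrow> hyper \<Rightarrow> bool" where
  "crel C r P Q \<longleftrightarrow>
     (\<exists>\<phi>\<in>P. \<exists>\<psi>\<in>Q. C \<subseteq>\<^sup>* {i. \<exists>x y. \<phi> i = Some x \<and> \<psi> i = Some y \<and> r x y})"

definition carriers :: "(nat \<Rightarrow> (nat, 'm) partial_object_scheme option) \<Rightarrow> nat \<Rightarrow> nat set option" where
  "carriers A i = map_option carrier (A i)"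

definition cprod_group :: "nat set \<Rightarrow> (nat \<Rightarrow> nat monoid option) \<Rightarrow> hyper monoid" where
  "cprod_group C A =
     \<lparr>carrier = cprod C (carriers A),
      monoid.mult = cmap2 C (carriers A) (\<lambda>i. map_option monoid.mult (A i)),
      one = ccls C (carriers A) (\<lambda>i. map_option one (A i))\<rparr>"

definition cprod_ring :: "nat set \<Rightarrow> (nat \<Rightarrow> nat ring option) \<Rightarrow> hyper ring" where
  "cprod_ring C A =
     \<lparr>carrier = cprod C (carriers A),
      monoid.mult = cmap2 C (carriers A) (\<lambda>i. map_option monoid.mult (A i)),
      one = ccls C (carriers A) (\<lambda>i. map_option one (A i)),
      ring.zero = ccls C (carriers A) (\<lambda>i. map_option ring.zero (A i)),
      ring.add = cmap2 C (carriers A) (\<lambda>i. map_option ring.add (A i))\<rparr>"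

definition hnat :: "nat set \<Rightarrow> hyper set" where
  "hnat C = cprod C (\<lambda>_. Some UNIV)"

definition hless :: "nat set \<Rightarrow> hyper \<Rightarrow> hyper \<Rightarrow> bool" where
  "hless C = crel C (<)"

text \<open>The reindexed partial sequence \<open>i \<mapsto> A\<^bsub>l(i)\<^esub>\<close>.\<close>

definition along :: "(nat \<Rightarrow> 'a) \<Rightarrow> pfun \<Rightarrow> nat \<Rightarrow> 'a option" where
  "along A l i = map_option A (l i)"


section \<open>Trees of tuples and hyper-automorphisms\<close>

definition tuples :: "nat set \<Rightarrow> nat set" where
  "tuples S = list_encode ` lists S"

definition trees :: "(nat \<Rightarrow> nat ring option) \<Rightarrow> nat \<Rightarrow> nat set option" where
  "trees A i = map_option (\<lambda>R. tuples (carrier R)) (A i)"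

definition map_tuple :: "(nat \<Rightarrow> nat) \<Rightarrow> nat \<Rightarrow> nat" where
  "map_tuple h a = list_encode (map h (list_decode a))"

definition map_tuples :: "(nat \<Rightarrow> (nat \<Rightarrow> nat) option) \<Rightarrow> nat \<Rightarrow> (nat \<Rightarrow> nat) option" where
  "map_tuples u i = map_option map_tuple (u i)"

definition tree_le :: "nat set \<Rightarrow> hyper \<Rightarrow> hyper \<Rightarrow> bool" where
  "tree_le C = crel C (\<lambda>a b. prefix (list_decode a) (list_decode b))"

definition tree_append :: "nat set \<Rightarrow> (nat \<Rightarrow> nat ring option) \<Rightarrow> hyper \<Rightarrow> hyper \<Rightarrow> hyper" where
  "tree_append C A = cmap2 C (trees A)
     (\<lambda>i. map_option (\<lambda>_ a b. list_encode (list_decode a @ list_decode b)) (A i))"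

definition arity :: "nat set \<Rightarrow> hyper \<Rightarrow> hyper" where
  "arity C = cmap C (\<lambda>_. Some UNIV) (\<lambda>_. Some (\<lambda>a. length (list_decode a)))"

definition single :: "nat set \<Rightarrow> (nat \<Rightarrow> nat ring option) \<Rightarrow> hyper \<Rightarrow> hyper" where
  "single C A = cmap C (trees A) (\<lambda>i. map_option (\<lambda>_ x. list_encode [x]) (A i))"

text \<open>Elements of \<open>\<int>[x\<^sub>1, x\<^sub>2, \<dots>]\<close> are coded by lists of terms, a term being a coefficient and the
  list \<open>[e\<^sub>1, \<dots>, e\<^sub>k]\<close> of exponents of \<open>x\<^sub>1, \<dots>, x\<^sub>k\<close>.  Nonzero coefficients, exponent lists
  without trailing zeros, and strictly increasing codes of the exponent lists make the code of each
  polynomial unique.  Thus the length of an exponent list is the largest index of a variable in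
  that term.\<close>

definition poly_terms :: "nat \<Rightarrow> (int \<times> nat list) list" where
  "poly_terms p =
     map (\<lambda>t. (int_decode (fst (prod_decode t)), list_decode (snd (prod_decode t)))) (list_decode p)"

definition polys :: "nat set" where
  "polys = {p. (\<forall>(c, e)\<in>set (poly_terms p). c \<noteq> 0 \<and> (e \<noteq> [] \<longrightarrow> last e \<noteq> 0)) \<and>
               sorted_wrt (<) (map (\<lambda>(c, e). list_encode e) (poly_terms p))}"

definition poly_var :: "nat \<Rightarrow> nat" where
  "poly_var p = Max (insert 0 ((\<lambda>(c, e). length e) ` set (poly_terms p)))"

definition poly_eval :: "nat ring \<Rightarrow> nat \<Rightarrow> nat list \<Rightarrow> nat" where
  "poly_eval R p xs =
     foldr (\<lambda>(c, e) s.
         ([c] \<cdot>\<^bsub>R\<^esub> foldr (\<lambda>(x, k) t. (x [^]\<^bsub>R\<^esub> (k::nat)) \<otimes>\<^bsub>R\<^esub> t) (zip xs e) \<one>\<^bsub>R\<^esub>) \<oplus>\<^bsub>R\<^esub> s)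
       (poly_terms p) \<zero>\<^bsub>R\<^esub>"

definition hpolys :: "nat set \<Rightarrow> hyper set" where
  "hpolys C = cprod C (\<lambda>_. Some polys)"

definition hpoly_var :: "nat set \<Rightarrow> hyper \<Rightarrow> hyper" where
  "hpoly_var C = cmap C (\<lambda>_. Some UNIV) (\<lambda>_. Some poly_var)"

definition hpoly_eval :: "nat set \<Rightarrow> (nat \<Rightarrow> nat ring option) \<Rightarrow> hyper \<Rightarrow> hyper \<Rightarrow> hyper" where
  "hpoly_eval C A p a =
     (\<Union>\<pi>\<in>p. \<Union>\<alpha>\<in>a. ccls C (carriers A) (\<lambda>i. case (A i, \<pi> i, \<alpha> i) of
        (Some R, Some q, Some xs) \<Rightarrow>
          (if length (list_decode xs) = poly_var q
           then Some (poly_eval R q (list_decode xs)) else None)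
      | _ \<Rightarrow> None))"

text \<open>Below, \<open>A\<close> is a (partial) sequence of extensions of the field \<open>F\<close> and \<open>u\<close> the sequence of
  embeddings of \<open>F\<close> into them.\<close>

definition base_image ::
  "nat set \<Rightarrow> nat ring \<Rightarrow> (nat \<Rightarrow> nat ring option) \<Rightarrow> (nat \<Rightarrow> (nat \<Rightarrow> nat) option) \<Rightarrow> hyper set" where
  "base_image C F A u = cmap C (carriers A) u ` carrier (cprod_ring C (\<lambda>_. Some F))"

definition HAut ::
  "nat set \<Rightarrow> nat ring \<Rightarrow> (nat \<Rightarrow> nat ring option) \<Rightarrow> (nat \<Rightarrow> (nat \<Rightarrow> nat) option) \<Rightarrow>
     (hyper \<Rightarrow> hyper) monoid" where
  "HAut C F A u = (BijGroup (cprod C (trees A)))\<lparr>carrier := {\<sigma> \<in> Bij (cprod C (trees A)).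
     (\<forall>a\<in>cprod C (trees A). \<forall>b\<in>cprod C (trees A). tree_le C (\<sigma> a) (\<sigma> b) \<longleftrightarrow> tree_le C a b) \<and>
     (\<forall>a\<in>cprod C (trees A). \<forall>b\<in>cprod C (trees A).
        \<sigma> (tree_append C A a b) = tree_append C A (\<sigma> a) (\<sigma> b)) \<and>
     (\<forall>a\<in>cprod C (trees A). arity C (\<sigma> a) = arity C a) \<and>
     (\<forall>p\<in>hpolys C. \<forall>a\<in>cprod C (trees A). arity C a = hpoly_var C p \<longrightarrow>
        single C A (hpoly_eval C A p (\<sigma> a)) = \<sigma> (single C A (hpoly_eval C A p a))) \<and>
     (\<forall>a\<in>cprod C (trees (\<lambda>_. Some F)).
        \<sigma> (cmap C (trees A) (map_tuples u) a) = cmap C (trees A) (map_tuples u) a)}\<rparr>"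

definition hyper_alg ::
  "nat set \<Rightarrow> nat ring \<Rightarrow> (nat \<Rightarrow> nat ring option) \<Rightarrow> (nat \<Rightarrow> (nat \<Rightarrow> nat) option) \<Rightarrow> hyper set" where
  "hyper_alg C F A u = alg_part (cprod_ring C A) (base_image C F A u)"

definition gal_alg ::
  "nat set \<Rightarrow> nat ring \<Rightarrow> (nat \<Rightarrow> nat ring option) \<Rightarrow> (nat \<Rightarrow> (nat \<Rightarrow> nat) option) \<Rightarrow>
     (hyper \<Rightarrow> hyper) monoid" where
  "gal_alg C F A u =
     Gal ((cprod_ring C A)\<lparr>carrier := hyper_alg C F A u\<rparr>) (base_image C F A u)"

text \<open>The restriction of \<open>\<sigma>\<close> to a set \<open>S\<close> that is regarded as a subset via the embedding \<open>j\<close>.\<close>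

definition restr_along :: "('a \<Rightarrow> 'b) \<Rightarrow> 'a set \<Rightarrow> ('b \<Rightarrow> 'b) \<Rightarrow> 'a \<Rightarrow> 'a" where
  "restr_along j S \<sigma> = (\<lambda>x\<in>S. the_inv_into S j (\<sigma> (j x)))"

definition alg_restr ::
  "nat set \<Rightarrow> nat ring \<Rightarrow> (nat \<Rightarrow> nat ring option) \<Rightarrow> (nat \<Rightarrow> (nat \<Rightarrow> nat) option) \<Rightarrow>
     (hyper \<Rightarrow> hyper) \<Rightarrow> hyper \<Rightarrow> hyper" where
  "alg_restr C F A u \<sigma> = restr_along (single C A) (hyper_alg C F A u) \<sigma>"


section \<open>The objects and maps of the diagram\<close>

text \<open>Elements of \<open>\<Prod>\<^sub>C \<nat>\<close> enter the index of \<open>\<Prod>\<^bsub>C,L\<^esub>\<close> through a representative \<open>l\<close>, a partial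
  computable function.\<close>

definition HAut_top :: "nat set \<Rightarrow> galois_data \<Rightarrow> (hyper \<Rightarrow> hyper) monoid" where
  "HAut_top C E = HAut C (base E) (\<lambda>_. Some (top_field E)) (\<lambda>_. Some (emb E))"

definition Gal_top :: "nat set \<Rightarrow> galois_data \<Rightarrow> (hyper \<Rightarrow> hyper) monoid" where
  "Gal_top C E = gal_alg C (base E) (\<lambda>_. Some (top_field E)) (\<lambda>_. Some (emb E))"

definition Psi_top :: "nat set \<Rightarrow> galois_data \<Rightarrow> (hyper \<Rightarrow> hyper) \<Rightarrow> hyper \<Rightarrow> hyper" where
  "Psi_top C E = alg_restr C (base E) (\<lambda>_. Some (top_field E)) (\<lambda>_. Some (emb E))"

definition ker_top :: "nat set \<Rightarrow> galois_data \<Rightarrow> (hyper \<Rightarrow> hyper) monoid" where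
  "ker_top C E = (HAut_top C E)\<lparr>carrier := kernel (HAut_top C E) (Gal_top C E) (Psi_top C E)\<rparr>"

definition HAut_lev :: "nat set \<Rightarrow> galois_data \<Rightarrow> pfun \<Rightarrow> (hyper \<Rightarrow> hyper) monoid" where
  "HAut_lev C E l = HAut C (base E) (along (lev E) l) (along (lev_base E) l)"

definition alg_lev :: "nat set \<Rightarrow> galois_data \<Rightarrow> pfun \<Rightarrow> hyper set" where
  "alg_lev C E l = hyper_alg C (base E) (along (lev E) l) (along (lev_base E) l)"

definition Gal_lev :: "nat set \<Rightarrow> galois_data \<Rightarrow> pfun \<Rightarrow> (hyper \<Rightarrow> hyper) monoid" where
  "Gal_lev C E l = gal_alg C (base E) (along (lev E) l) (along (lev_base E) l)"

definition alg_restr_lev ::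
  "nat set \<Rightarrow> galois_data \<Rightarrow> pfun \<Rightarrow> (hyper \<Rightarrow> hyper) \<Rightarrow> hyper \<Rightarrow> hyper" where
  "alg_restr_lev C E l = alg_restr C (base E) (along (lev E) l) (along (lev_base E) l)"

definition G_lev :: "nat set \<Rightarrow> galois_data \<Rightarrow> pfun \<Rightarrow> hyper monoid" where
  "G_lev C E l = cprod_group C (along (grp E) l)"

text \<open>\<open>h\<close> codes the partial sequence \<open>H\<close>: where \<open>h i\<close> is defined, it is a code of a list of the
  elements of \<open>H\<^sub>i\<close>.\<close>

definition internal_subgroup :: "nat set \<Rightarrow> galois_data \<Rightarrow> pfun \<Rightarrow> hyper set \<Rightarrow> bool" where
  "internal_subgroup C E l S \<longleftrightarrow> subgroup S (G_lev C E l) \<and>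
     (\<exists>h. partial_computable h \<and> C \<subseteq>\<^sup>* dom h \<and>
        (\<forall>i c. h i = Some c \<longrightarrow> (\<exists>n. l i = Some n \<and> subgroup (set (list_decode c)) (grp E n))) \<and>
        S = ccls C (carriers (along (grp E) l)) ` cpre C (\<lambda>i. map_option (\<lambda>c. set (list_decode c)) (h i)))"

definition I_lev :: "nat set \<Rightarrow> galois_data \<Rightarrow> pfun \<Rightarrow> hyper monoid" where
  "I_lev C E l = (G_lev C E l)\<lparr>carrier := carrier (G_lev C E l) \<inter>
     \<Inter>{S. internal_subgroup C E l S \<and> finite (rcosets\<^bsub>G_lev C E l\<^esub> S)}\<rparr>"

definition tree_act :: "nat set \<Rightarrow> galois_data \<Rightarrow> pfun \<Rightarrow> hyper \<Rightarrow> hyper \<Rightarrow> hyper" where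
  "tree_act C E l g = (\<lambda>a\<in>cprod C (trees (along (lev E) l)).
     cmap2 C (trees (along (lev E) l)) (along (\<lambda>n s. map_tuple (act E n s)) l) g a)"

definition alg_act :: "nat set \<Rightarrow> galois_data \<Rightarrow> pfun \<Rightarrow> hyper \<Rightarrow> hyper \<Rightarrow> hyper" where
  "alg_act C E l g = (\<lambda>x\<in>alg_lev C E l.
     cmap2 C (carriers (along (lev E) l)) (along (act E) l) g x)"

definition G_trans :: "nat set \<Rightarrow> galois_data \<Rightarrow> pfun \<Rightarrow> pfun \<Rightarrow> hyper \<Rightarrow> hyper" where
  "G_trans C E m n = cmap C (carriers (along (grp E) n)) (\<lambda>i. case (m i, n i) of
     (Some a, Some b) \<Rightarrow> (if b < a then Some (quot E a b) else None) | _ \<Rightarrow> None)"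

definition lev_embed :: "nat set \<Rightarrow> galois_data \<Rightarrow> pfun \<Rightarrow> pfun \<Rightarrow> hyper \<Rightarrow> hyper" where
  "lev_embed C E m n = cmap C (carriers (along (lev E) m)) (\<lambda>i. case (m i, n i) of
     (Some a, Some b) \<Rightarrow> (if b \<le> a then Some (lev_incl E a b) else None) | _ \<Rightarrow> None)"

definition top_embed :: "nat set \<Rightarrow> galois_data \<Rightarrow> pfun \<Rightarrow> hyper \<Rightarrow> hyper" where
  "top_embed C E l = cmap C (carriers (\<lambda>_. Some (top_field E))) (along (lev_emb E) l)"

definition top_tree_embed :: "nat set \<Rightarrow> galois_data \<Rightarrow> pfun \<Rightarrow> hyper \<Rightarrow> hyper" where
  "top_tree_embed C E l =
     cmap C (trees (\<lambda>_. Some (top_field E))) (map_tuples (along (lev_emb E) l))"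

definition Gal_trans ::
  "nat set \<Rightarrow> galois_data \<Rightarrow> pfun \<Rightarrow> pfun \<Rightarrow> (hyper \<Rightarrow> hyper) \<Rightarrow> hyper \<Rightarrow> hyper" where
  "Gal_trans C E m n = restr_along (lev_embed C E m n) (alg_lev C E n)"

definition inverse_limit ::
  "'i set \<Rightarrow> ('i \<Rightarrow> 'i \<Rightarrow> bool) \<Rightarrow> ('i \<Rightarrow> 'a monoid) \<Rightarrow> ('i \<Rightarrow> 'i \<Rightarrow> 'a \<Rightarrow> 'a) \<Rightarrow> ('i \<Rightarrow> 'a) monoid" where
  "inverse_limit I lt A f = (product_group I A)\<lparr>carrier :=
     {x \<in> carrier (product_group I A). \<forall>m\<in>I. \<forall>n\<in>I. lt n m \<longrightarrow> f m n (x m) = x n}\<rparr>"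

text \<open>\<open>rep\<close> selects a representative of every element of \<open>\<Prod>\<^sub>C \<nat>\<close>.\<close>

definition lim_G :: "nat set \<Rightarrow> galois_data \<Rightarrow> (hyper \<Rightarrow> pfun) \<Rightarrow> (hyper \<Rightarrow> hyper) monoid" where
  "lim_G C E rep = inverse_limit (hnat C) (hless C)
     (\<lambda>L. G_lev C E (rep L)) (\<lambda>M N. G_trans C E (rep M) (rep N))"

definition lim_I :: "nat set \<Rightarrow> galois_data \<Rightarrow> (hyper \<Rightarrow> pfun) \<Rightarrow> (hyper \<Rightarrow> hyper) monoid" where
  "lim_I C E rep = inverse_limit (hnat C) (hless C)
     (\<lambda>L. I_lev C E (rep L)) (\<lambda>M N. G_trans C E (rep M) (rep N))"

definition lim_Gal ::
  "nat set \<Rightarrow> galois_data \<Rightarrow> (hyper \<Rightarrow> pfun) \<Rightarrow> (hyper \<Rightarrow> hyper \<Rightarrow> hyper) monoid" where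
  "lim_Gal C E rep = inverse_limit (hnat C) (hless C)
     (\<lambda>L. Gal_lev C E (rep L)) (\<lambda>M N. Gal_trans C E (rep M) (rep N))"

definition lim_alg_act ::
  "nat set \<Rightarrow> galois_data \<Rightarrow> (hyper \<Rightarrow> pfun) \<Rightarrow> (hyper \<Rightarrow> hyper) \<Rightarrow> hyper \<Rightarrow> hyper \<Rightarrow> hyper" where
  "lim_alg_act C E rep x = (\<lambda>L\<in>hnat C. alg_act C E (rep L) (x L))"

text \<open>The restriction of a hyper-automorphism to the tree over \<open>\<Prod>\<^bsub>C,L\<^esub> K\<^sub>i\<close>, read as an element of
  \<open>\<Prod>\<^bsub>C,L\<^esub> G\<^sub>i\<close> through the action of that group on the tree.\<close>

definition HAut_to_lim ::
  "nat set \<Rightarrow> galois_data \<Rightarrow> (hyper \<Rightarrow> pfun) \<Rightarrow> (hyper \<Rightarrow> hyper) \<Rightarrow> hyper \<Rightarrow> hyper" where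
  "HAut_to_lim C E rep \<sigma> = (\<lambda>L\<in>hnat C.
     the_inv_into (carrier (G_lev C E (rep L))) (tree_act C E (rep L))
       (restr_along (top_tree_embed C E (rep L)) (cprod C (trees (along (lev E) (rep L)))) \<sigma>))"

definition Gal_to_lim ::
  "nat set \<Rightarrow> galois_data \<Rightarrow> (hyper \<Rightarrow> pfun) \<Rightarrow> (hyper \<Rightarrow> hyper) \<Rightarrow> hyper \<Rightarrow> hyper \<Rightarrow> hyper" where
  "Gal_to_lim C E rep \<tau> =
     (\<lambda>L\<in>hnat C. restr_along (top_embed C E (rep L)) (alg_lev C E (rep L)) \<tau>)"

definition left_exact ::
  "'a monoid \<Rightarrow> ('a \<Rightarrow> 'b) \<Rightarrow> 'b monoid \<Rightarrow> ('b \<Rightarrow> 'c) \<Rightarrow> 'c monoid \<Rightarrow> bool" where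
  "left_exact A f B g D \<longleftrightarrow> group A \<and> group B \<and> group D \<and> f \<in> hom A B \<and> g \<in> hom B D \<and>
     inj_on f (carrier A) \<and> f ` carrier A = kernel B D g"

text \<open>The square with upper left corner \<open>A\<close> and top, right, left and bottom maps \<open>t, r, l, b\<close>.\<close>

definition commutes ::
  "'a monoid \<Rightarrow> ('a \<Rightarrow> 'b) \<Rightarrow> ('b \<Rightarrow> 'd) \<Rightarrow> ('a \<Rightarrow> 'c) \<Rightarrow> ('c \<Rightarrow> 'd) \<Rightarrow> bool" where
  "commutes A t r l b \<longleftrightarrow> (\<forall>x\<in>carrier A. r (t x) = b (l x))"

end

theory Submission
  imports Defs
begin

text \<open>On a cohesive set \<open>C\<close>, a decidable property of the values of a computable function holds almost
  everywhere or fails almost everywhere, and a witness that exists almost everywhere can be found by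
  search; these two principles transfer pointwise facts to cohesive products.

  A hyper-automorphism preserves almost everywhere the type over \<open>F\<close> of a tuple, since otherwise a
  search would produce a hyper-polynomial detecting the change. Pointwise, a tuple of the same type
  is a conjugate, so on a tuple with trivial stabiliser the hyper-automorphism is given by a unique
  element of \<open>\<Prod>\<^sub>C G\<^bsub>L(i)\<^esub>\<close>, and concatenation with this tuple shows that it acts by this element on
  every tuple. Every tuple over \<open>\<Prod>\<^sub>C K\<close> lies in some \<open>\<Prod>\<^sub>C K\<^bsub>L(i)\<^esub>\<close>, which yields the inverse limit.

  The fixed field of \<open>\<Prod>\<^sub>C G\<^bsub>L(i)\<^esub>\<close> is \<open>\<Prod>\<^sub>C F\<close>, so an element is algebraic iff its orbit is finite. Its
  stabiliser is then internal of finite index; conversely, by Artin's theorem applied pointwise, an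
  element outside an internal subgroup of finite index moves some element fixed by the subgroup,
  and the latter is algebraic because its orbit is finite. Hence the intersection of the internal
  subgroups of finite index is the kernel of the action on the algebraic part.\<close>

section \<open>Closure properties of the computable functions\<close>

text \<open>The obstacle throughout is effectivity: an element of a product exists only through a
  partial computable representative with values in the factors, so every pointwise choice (an
  inverse, a preimage in a lower field, a conjugating group element) has to be the outcome of a
  search over a decidable relation. For this reason the operations of the presentation are extended
  by the value 0 to total computable functions.

  Hyper-polynomials have integer coefficients, whereas separating two tuples up to conjugacy needs
  coefficients in F. The coefficients are therefore turned into further variables and appended to
  the tuple as entries from F, which a hyper-automorphism fixes.

  No group of the presentation acts on K itself. Statements about the product of K are proved at the
  levels and carried over: bijections are glued along a directed union, and algebraicity is
  reflected along the embeddings. Exactness of the rows is formal once every left-hand group is a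
  kernel, since kernels commute with inverse limits.\<close>

abbreviation "pfst n \<equiv> fst (prod_decode n)"
abbreviation "psnd n \<equiv> snd (prod_decode n)"
abbreviation "ppair a b \<equiv> prod_encode (a, b)"

named_theorems tc_intros

text \<open>Most constructions are total. The closure rules are stated for functions of one argument
  on which everything else may depend, so \<open>intro tc_intros\<close> proves computability along
  the syntax of a term; functions of several arguments are uncurried with \<open>pfst\<close> and
  \<open>psnd\<close>.\<close>

definition tc :: "(nat \<Rightarrow> nat) \<Rightarrow> bool" where
  "tc f \<longleftrightarrow> partial_computable (\<lambda>n. Some (f n))"

lemma pc_const: "partial_computable (\<lambda>n. Some k)"
proof (induction k)
  case 0
  show ?case by (rule partial_computable.zero)
next
  case (Suc k)
  show ?case using partial_computable.comp[OF partial_computable.succ Suc] by simp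
qed

lemma tc_const [tc_intros]: "tc (\<lambda>n. k)"
  unfolding tc_def by (rule pc_const)

lemma tc_id [tc_intros]: "tc (\<lambda>n. n)"
  unfolding tc_def using partial_computable.pair[OF partial_computable.left partial_computable.right]
  by simp

lemma tc_comp: "tc f \<Longrightarrow> tc g \<Longrightarrow> tc (\<lambda>x. f (g x))"
  unfolding tc_def using partial_computable.comp[of "\<lambda>n. Some (f n)" "\<lambda>n. Some (g n)"] by simp

lemma tc_fst [tc_intros]: "tc f \<Longrightarrow> tc (\<lambda>x. pfst (f x))"
  by (rule tc_comp[of pfst]) (simp add: tc_def partial_computable.left)

lemma tc_snd [tc_intros]: "tc f \<Longrightarrow> tc (\<lambda>x. psnd (f x))"
  by (rule tc_comp[of psnd]) (simp add: tc_def partial_computable.right)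

lemma tc_Suc [tc_intros]: "tc f \<Longrightarrow> tc (\<lambda>x. Suc (f x))"
  by (rule tc_comp[of Suc]) (simp add: tc_def partial_computable.succ)

lemma tc_pair [tc_intros]: "tc f \<Longrightarrow> tc g \<Longrightarrow> tc (\<lambda>x. ppair (f x) (g x))"
  unfolding tc_def using partial_computable.pair[of "\<lambda>n. Some (f n)" "\<lambda>n. Some (g n)"] by simp

text \<open>\<open>prec\<close> carries a parameter along; feeding the whole argument
  \<open>x\<close> in as that parameter lets \<open>f\<close>, \<open>g\<close> and the number
  \<open>h x\<close> of steps all depend on it.\<close>

lemma tc_rec [tc_intros]:
  assumes "tc f" "tc (\<lambda>z. g (pfst z) (pfst (psnd z)) (psnd (psnd z)))" "tc h"
  shows "tc (\<lambda>x. rec_nat (f x) (g x) (h x))"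
proof -
  have *: "rec_nat (Some (f a)) (\<lambda>y r. Option.bind r (\<lambda>z. Some (g a y z))) m = Some (rec_nat (f a) (g a) m)"
    for a m by (induction m) auto
  have "partial_computable (\<lambda>n. case prod_decode n of (a, m) \<Rightarrow> Some (rec_nat (f a) (g a) m))"
    using partial_computable.prec[OF assms(1,2)[unfolded tc_def]] by (simp add: *)
  then have "tc (\<lambda>n. rec_nat (f (pfst n)) (g (pfst n)) (psnd n))"
    by (simp add: tc_def case_prod_beta)
  from tc_comp[OF this tc_pair[OF tc_id assms(3)]] show ?thesis by simp
qed

lemma tc_pred: "tc f \<Longrightarrow> tc (\<lambda>x. f x - 1)"
proof -
  assume "tc f"
  then have "tc (\<lambda>x. rec_nat 0 (\<lambda>y r. y) (f x))" by (intro tc_intros)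
  moreover have "rec_nat 0 (\<lambda>y r. y) n = n - 1" for n :: nat by (cases n) auto
  ultimately show ?thesis by simp
qed

lemma tc_add [tc_intros]: assumes "tc f" "tc g" shows "tc (\<lambda>x. f x + g x)"
proof -
  have "tc (\<lambda>x. rec_nat (f x) (\<lambda>y r. Suc r) (g x))" using assms by (intro tc_intros)
  moreover have "rec_nat a (\<lambda>y r. Suc r) n = a + n" for a n :: nat by (induction n) auto
  ultimately show ?thesis by simp
qed

lemma tc_diff [tc_intros]: assumes "tc f" "tc g" shows "tc (\<lambda>x. f x - g x)"
proof -
  have "tc (\<lambda>x. rec_nat (f x) (\<lambda>y r. r - 1) (g x))" using assms by (intro tc_intros tc_pred)
  moreover have "rec_nat a (\<lambda>y r. r - 1) n = a - n" for a n :: nat by (induction n) auto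
  ultimately show ?thesis by simp
qed

section \<open>Decidable predicates and unbounded search\<close>

abbreviation "decidable P \<equiv> tc (\<lambda>x. of_bool (P x))"

lemma tc_zero [tc_intros]: assumes "tc f" shows "decidable (\<lambda>x. f x = 0)"
proof -
  have "tc (\<lambda>x. 1 - f x)" using assms by (intro tc_intros)
  moreover have "1 - f x = of_bool (f x = 0)" for x by auto
  ultimately show ?thesis by simp
qed

lemma tc_not [tc_intros]: assumes "decidable P" shows "decidable (\<lambda>x. \<not> P x)"
  using tc_zero[OF assms] by simp

lemma tc_if [tc_intros]:
  assumes "decidable P" "tc f" "tc g" shows "tc (\<lambda>x. if P x then f x else g x)"
proof -
  have "tc (\<lambda>x. rec_nat (g x) (\<lambda>y r. f x) (of_bool (P x)))"
    using assms tc_comp[OF assms(2) tc_fst[OF tc_id]] by (intro tc_intros)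
  moreover have "rec_nat (g x) (\<lambda>y r. f x) (of_bool (P x)) = (if P x then f x else g x)" for x
    by auto
  ultimately show ?thesis by simp
qed

lemma tc_conj [tc_intros]: assumes "decidable P" "decidable Q" shows "decidable (\<lambda>x. P x \<and> Q x)"
proof -
  have "tc (\<lambda>x. if P x then of_bool (Q x) else 0)" using assms by (intro tc_intros)
  moreover have "(if P x then of_bool (Q x) else 0) = (of_bool (P x \<and> Q x) :: nat)" for x by simp
  ultimately show ?thesis by simp
qed

lemma tc_disj [tc_intros]: assumes "decidable P" "decidable Q" shows "decidable (\<lambda>x. P x \<or> Q x)"
  using tc_not[OF tc_conj[OF tc_not[OF assms(1)] tc_not[OF assms(2)]]] by simp

lemma tc_imp [tc_intros]: assumes "decidable P" "decidable Q" shows "decidable (\<lambda>x. P x \<longrightarrow> Q x)"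
  using tc_disj[OF tc_not[OF assms(1)] assms(2)] by (simp only: imp_conv_disj)

lemma tc_le [tc_intros]: assumes "tc f" "tc g" shows "decidable (\<lambda>x. f x \<le> g x)"
  using tc_zero[OF tc_diff[OF assms]] by simp

lemma tc_less [tc_intros]: assumes "tc f" "tc g" shows "decidable (\<lambda>x. f x < g x)"
  using tc_not[OF tc_le[OF assms(2,1)]] by (simp add: not_le)

lemma tc_eq [tc_intros]: assumes "tc f" "tc g" shows "decidable (\<lambda>x. f x = g x)"
  using tc_conj[OF tc_le[OF assms] tc_le[OF assms(2,1)]] by (simp add: eq_iff)

lemma minimise_total:
  "minimise (\<lambda>k. Some (1 - of_bool (P k))) = (if \<exists>k. P k then Some (LEAST k. P k) else None)"
proof -
  have *: "(\<exists>k. P k \<and> (\<forall>j<k. \<not> P j)) \<longleftrightarrow> (\<exists>k. P k)"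
    using exists_least_iff[of P] by simp
  have "Some (1 - of_bool (P k)) = Some (0::nat) \<longleftrightarrow> P k"
    "(\<exists>y. Some (1 - of_bool (P k)) = Some y \<and> y \<noteq> (0::nat)) \<longleftrightarrow> \<not> P k" for k
    by (cases "P k"; simp)+
  then show ?thesis unfolding minimise_def by (simp only: *)
qed

text \<open>Minimisation applied to one minus the characteristic function. The result is undefined
  where no witness exists, so its domain is the c.e. set of inputs that have one; this is what
  cohesiveness is later applied to.\<close>

lemma pc_search:
  assumes "decidable (\<lambda>z. P (pfst z) (psnd z))"
  shows "partial_computable (\<lambda>x. if \<exists>k. P x k then Some (LEAST k. P x k) else None)"
proof -
  have "tc (\<lambda>z. 1 - of_bool (P (pfst z) (psnd z)))" using assms by (intro tc_intros)
  from partial_computable.mu[OF this[unfolded tc_def]] show ?thesis unfolding minimise_total prod_encode_inverse fst_conv snd_conv .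
qed

lemma tc_Least [tc_intros]:
  assumes "decidable (\<lambda>z. P (pfst z) (psnd z))" and "\<And>x. \<exists>k. P x k"
  shows "tc (\<lambda>x. LEAST k. P x k)"
  using pc_search[OF assms(1)] assms(2) by (simp add: tc_def)

section \<open>Primitive recursive traversal of coded lists\<close>

definition fold_step :: "(nat \<Rightarrow> nat \<Rightarrow> nat) \<Rightarrow> nat \<Rightarrow> nat" where
  "fold_step g s = (if psnd s = 0 then s
     else ppair (g (pfst (psnd s - 1)) (pfst s)) (psnd (psnd s - 1)))"

lemma list_decode_Suc: "list_decode (Suc n) = pfst n # list_decode (psnd n)"
  by (simp add: case_prod_beta)

lemma rec_fold_step_shift:
  "rec_nat s (\<lambda>_. fold_step g) (Suc k) = rec_nat (fold_step g s) (\<lambda>_. fold_step g) k"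
  by (induction k) auto

text \<open>The state pairs the accumulator with the code of the unread tail. The code 0 is the
  empty list, at which \<open>fold_step\<close> leaves the state fixed, so any number of iterations
  that is at least the length gives the fold.\<close>

lemma rec_fold_step:
  "length (list_decode l) \<le> k \<Longrightarrow>
     pfst (rec_nat (ppair a l) (\<lambda>_. fold_step g) k) = fold g (list_decode l) a"
proof (induction k arbitrary: a l)
  case 0
  then show ?case by simp
next
  case (Suc k)
  show ?case
  proof (cases l)
    case 0
    have "rec_nat (ppair a 0) (\<lambda>_. fold_step g) m = ppair a 0" for m
      by (induction m) (auto simp: fold_step_def)
    from this[of "Suc k"] show ?thesis using 0 by simp
  next
    case (Suc l')
    have "fold_step g (ppair a l) = ppair (g (pfst l') a) (psnd l')" by (simp add: fold_step_def Suc)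
    moreover have "length (list_decode (psnd l')) \<le> k"
      using Suc.prems by (simp add: Suc list_decode_Suc del: list_decode.simps(2))
    ultimately show ?thesis
      unfolding rec_fold_step_shift using Suc.IH
      by (simp add: Suc list_decode_Suc del: list_decode.simps(2))
  qed
qed

text \<open>Bounds the number of iterations by a quantity that is available without decoding, namely
  the code itself.\<close>

lemma length_list_decode_le: "length (list_decode n) \<le> n"
proof (induction n rule: less_induct)
  case (less n)
  show ?case
  proof (cases n)
    case (Suc m)
    have "psnd m \<le> m" using le_prod_encode_2[of "psnd m" "pfst m"] by simp
    then show ?thesis using less.IH[of "psnd m"] Suc
      by (simp add: list_decode_Suc del: list_decode.simps(2))
  qed simp
qed

lemma tc_comp2:
  assumes "tc (\<lambda>z. F (pfst z) (psnd z))" "tc f" "tc g"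
  shows "tc (\<lambda>x. F (f x) (g x))"
  using tc_comp[OF assms(1) tc_pair[OF assms(2,3)]] by simp

lemma tc_comp3:
  assumes "tc (\<lambda>z. F (pfst z) (pfst (psnd z)) (psnd (psnd z)))" "tc f" "tc g" "tc h"
  shows "tc (\<lambda>x. F (f x) (g x) (h x))"
  using tc_comp[OF assms(1) tc_pair[OF assms(2) tc_pair[OF assms(3,4)]]] by simp

lemma tc_fold [tc_intros]:
  assumes "tc a" "tc l" and g: "tc (\<lambda>z. g (pfst z) (pfst (psnd z)) (psnd (psnd z)))"
  shows "tc (\<lambda>x. fold (g x) (list_decode (l x)) (a x))"
proof -
  have s: "tc (\<lambda>z. fold_step (g (pfst z)) (psnd (psnd z)))"
  proof -
    have "tc (\<lambda>z. g (pfst z) (pfst (psnd (psnd (psnd z)) - 1)) (pfst (psnd (psnd z))))"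
      by (rule tc_comp3[OF g]; intro tc_intros)
    then show ?thesis unfolding fold_step_def by (intro tc_intros)
  qed
  have "tc (\<lambda>x. pfst (rec_nat (ppair (a x) (l x)) (\<lambda>_. fold_step (g x)) (l x)))"
    by (intro tc_fst tc_rec tc_pair assms s)
  then show ?thesis by (simp add: rec_fold_step length_list_decode_le)
qed

text \<open>A fold that starts at 1 and drops to 0 at a failure. Bounded quantifiers over coded
  lists thus stay decidable, which matters for quantifiers over finite groups.\<close>

lemma tc_all [tc_intros]:
  assumes "decidable (\<lambda>z. P (pfst z) (psnd z))" "tc l"
  shows "decidable (\<lambda>x. \<forall>y\<in>set (list_decode (l x)). P x y)"
proof -
  have P: "decidable (\<lambda>z. P (pfst z) (pfst (psnd z)))"
    using tc_comp2[OF assms(1) tc_fst[OF tc_id] tc_fst[OF tc_snd[OF tc_id]]] .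
  have "tc (\<lambda>x. fold (\<lambda>y acc. if P x y then acc else 0) (list_decode (l x)) 1)"
    by (intro tc_fold tc_const assms(2) tc_if P tc_snd tc_id)
  moreover have "fold (\<lambda>y acc. if P x y then acc else 0) ys a = (if \<forall>y\<in>set ys. P x y then a else 0)"
    for x ys and a :: nat by (induction ys arbitrary: a) auto
  ultimately show ?thesis by (simp only: of_bool_def)
qed

lemma tc_ex [tc_intros]:
  assumes "decidable (\<lambda>z. P (pfst z) (psnd z))" "tc l"
  shows "decidable (\<lambda>x. \<exists>y\<in>set (list_decode (l x)). P x y)"
  using tc_not[OF tc_all[OF tc_not[OF assms(1)] assms(2)]] by simp

definition lcons :: "nat \<Rightarrow> nat \<Rightarrow> nat" where "lcons x n = Suc (ppair x n)"

lemma lcons_list_encode: "lcons x (list_encode xs) = list_encode (x # xs)"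
  by (simp add: lcons_def)

lemma tc_lcons [tc_intros]: "tc f \<Longrightarrow> tc g \<Longrightarrow> tc (\<lambda>x. lcons (f x) (g x))"
  unfolding lcons_def by (intro tc_intros)

lemma fold_lcons: "fold (\<lambda>y. lcons (h y)) xs (list_encode ys) = list_encode (rev (map h xs) @ ys)"
  by (induction xs arbitrary: ys) (auto simp: lcons_list_encode simp del: list_encode.simps)

lemma tc_rev:
  assumes "tc l" shows "tc (\<lambda>x. list_encode (rev (list_decode (l x))))"
proof -
  have "tc (\<lambda>x. fold (\<lambda>y. lcons y) (list_decode (l x)) (list_encode []))"
    using assms by (intro tc_intros)
  then show ?thesis unfolding fold_lcons by simp
qed

lemma tc_foldr [tc_intros]:
  assumes "tc a" "tc l" "tc (\<lambda>z. g (pfst z) (pfst (psnd z)) (psnd (psnd z)))"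
  shows "tc (\<lambda>x. foldr (g x) (list_decode (l x)) (a x))"
proof -
  have "tc (\<lambda>x. fold (g x) (list_decode (list_encode (rev (list_decode (l x))))) (a x))"
    by (intro tc_fold assms tc_rev)
  then show ?thesis by (simp add: foldr_conv_fold)
qed

lemma tc_map [tc_intros]:
  assumes "tc l" "tc (\<lambda>z. h (pfst z) (psnd z))"
  shows "tc (\<lambda>x. list_encode (map (h x) (list_decode (l x))))"
proof -
  have h: "tc (\<lambda>z. h (pfst z) (pfst (psnd z)))"
    using tc_comp2[OF assms(2) tc_fst[OF tc_id] tc_fst[OF tc_snd[OF tc_id]]] .
  have "tc (\<lambda>x. foldr (\<lambda>y. lcons (h x y)) (list_decode (l x)) 0)"
    by (intro tc_foldr tc_const assms(1) tc_lcons h tc_snd tc_id)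
  moreover have "foldr (\<lambda>y. lcons (h x y)) ys 0 = list_encode (map (h x) ys)" for x ys
    by (induction ys) (auto simp: lcons_list_encode simp del: list_encode.simps(2))
  ultimately show ?thesis by simp
qed

lemma tc_filter [tc_intros]:
  assumes "tc l" "decidable (\<lambda>z. P (pfst z) (psnd z))"
  shows "tc (\<lambda>x. list_encode (filter (P x) (list_decode (l x))))"
proof -
  have h: "decidable (\<lambda>z. P (pfst z) (pfst (psnd z)))"
    using tc_comp2[OF assms(2) tc_fst[OF tc_id] tc_fst[OF tc_snd[OF tc_id]]] .
  have "tc (\<lambda>x. foldr (\<lambda>y a. if P x y then lcons y a else a) (list_decode (l x)) 0)"
    by (intro tc_foldr tc_const assms(1) tc_lcons h tc_snd tc_id tc_if tc_fst)
  moreover have "foldr (\<lambda>y a. if P x y then lcons y a else a) ys 0 = list_encode (filter (P x) ys)" for x ys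
    by (induction ys) (auto simp: lcons_list_encode simp del: list_encode.simps(2))
  ultimately show ?thesis by simp
qed

lemma tc_append [tc_intros]:
  assumes "tc f" "tc g"
  shows "tc (\<lambda>x. list_encode (list_decode (f x) @ list_decode (g x)))"
proof -
  have "tc (\<lambda>x. foldr lcons (list_decode (f x)) (g x))"
    by (intro tc_intros assms)
  moreover have "foldr lcons xs n = list_encode (xs @ list_decode n)" for xs n
    by (induction xs) (auto simp: lcons_list_encode simp del: list_encode.simps(2))
  ultimately show ?thesis by simp
qed

lemma tc_length [tc_intros]: assumes "tc f" shows "tc (\<lambda>x. length (list_decode (f x)))"
proof -
  have "tc (\<lambda>x. fold (\<lambda>y. Suc) (list_decode (f x)) 0)"
    by (intro tc_fold tc_const assms tc_Suc tc_snd tc_id)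
  moreover have "fold (\<lambda>y. Suc) xs n = length xs + n" for xs :: "nat list" and n
    by (induction xs arbitrary: n) auto
  ultimately show ?thesis by simp
qed

lemma tc_singleton [tc_intros]: assumes "tc f" shows "tc (\<lambda>x. list_encode [f x])"
  using assms tc_lcons[OF assms tc_const[of 0]] by (simp add: lcons_def)

lemma tuples_iff: "n \<in> tuples A \<longleftrightarrow> set (list_decode n) \<subseteq> A"
proof
  assume "set (list_decode n) \<subseteq> A"
  then have "list_encode (list_decode n) \<in> tuples A"
    unfolding tuples_def by (intro imageI) (auto simp: in_lists_conv_set)
  then show "n \<in> tuples A" by simp
qed (auto simp: tuples_def in_lists_conv_set)

lemma decidable_tuples [tc_intros]:
  assumes "decidable (\<lambda>z. psnd z \<in> S (pfst z))" "tc f" "tc g"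
  shows "decidable (\<lambda>x. g x \<in> tuples (S (f x)))"
proof -
  have "(n \<in> tuples A) = (\<forall>y\<in>set (list_decode n). y \<in> A)" for n A
    by (auto simp: tuples_iff)
  moreover have "decidable (\<lambda>z. psnd z \<in> S (f (pfst z)))"
    by (rule tc_comp2[OF assms(1)]) (intro tc_comp[OF assms(2)] tc_fst tc_snd tc_id)+
  ultimately show ?thesis using assms(3) by (simp only:) (intro tc_intros)
qed

definition lzip :: "nat \<Rightarrow> nat \<Rightarrow> nat" where
  "lzip a b = list_encode (map prod_encode (zip (list_decode a) (list_decode b)))"

lemma tc_lzip [tc_intros]:
  assumes "tc f" "tc g" shows "tc (\<lambda>x. lzip (f x) (g x))"
proof -
  \<comment> \<open>The state pairs the code of the reversed list of pairs with the code of the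
    unread part of the second list; once that part is empty the state no longer changes, as for
    \<open>zip\<close>.\<close>
  define st where "st = (\<lambda>y s. if psnd s = 0 then s
      else ppair (lcons (ppair y (pfst (psnd s - 1))) (pfst s)) (psnd (psnd s - 1)))"
  have fst: "pfst (fold st xs (ppair (list_encode r) m))
      = list_encode (rev (map prod_encode (zip xs (list_decode m))) @ r)" for xs r m
  proof (induction xs arbitrary: r m)
    case (Cons x xs)
    show ?case
    proof (cases m)
      case 0
      have "fold st ys (ppair (list_encode r) 0) = ppair (list_encode r) 0" for ys
        by (induction ys) (auto simp: st_def)
      from this[of "x # xs"] show ?thesis using 0 by simp
    next
      case (Suc m')
      have "st x (ppair (list_encode r) m) = ppair (list_encode (ppair x (pfst m') # r)) (psnd m')"
        by (simp add: st_def Suc lcons_list_encode del: list_encode.simps)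
      then show ?thesis unfolding fold_simps Suc
        by (simp only: Cons.IH) (simp add: list_decode_Suc del: list_decode.simps list_encode.simps)
    qed
  qed simp
  have "tc (\<lambda>x. pfst (fold st (list_decode (f x)) (ppair (list_encode []) (g x))))"
    unfolding st_def using assms by (intro tc_intros)
  then have "tc (\<lambda>x. list_encode (rev (map prod_encode (zip (list_decode (f x)) (list_decode (g x))))))"
    unfolding fst by simp
  from tc_rev[OF this] show ?thesis by (simp add: lzip_def)
qed

lemma list_decode_lzip: "list_decode (lzip a b) = map prod_encode (zip (list_decode a) (list_decode b))"
  by (simp add: lzip_def)

section \<open>Functions computable almost everywhere on a set\<close>

text \<open>The filter of the cofinite subsets relative to \<open>C\<close>: statements about almost
  every element of \<open>C\<close> become \<open>eventually\<close>, and finitely many of them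
  combine by \<open>eventually_elim\<close>.\<close>

definition cof :: "nat set \<Rightarrow> nat filter" where
  "cof C = inf cofinite (principal C)"

lemma eventually_cof: "eventually P (cof C) \<longleftrightarrow> finite {i \<in> C. \<not> P i}"
  by (simp add: cof_def eventually_inf_principal eventually_cofinite)

lemma almost_subset_iff: "C \<subseteq>\<^sup>* A \<longleftrightarrow> (\<forall>\<^sub>F i in cof C. i \<in> A)"
  by (simp add: almost_subset_def eventually_cof set_diff_eq)

lemma pc_bind2:
  assumes "partial_computable l" "partial_computable \<phi>" "partial_computable q"
  shows "partial_computable (\<lambda>i. Option.bind (l i) (\<lambda>n. Option.bind (\<phi> i) (\<lambda>x. q (ppair n x))))"
  using partial_computable.comp[OF assms(3) partial_computable.pair[OF assms(1,2)]] by simp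

lemma pc_bind3:
  assumes "partial_computable w" "partial_computable \<phi>" "partial_computable \<psi>" "partial_computable q"
  shows "partial_computable (\<lambda>i. Option.bind (w i) (\<lambda>k. Option.bind (\<phi> i) (\<lambda>x.
    Option.bind (\<psi> i) (\<lambda>y. q (ppair k (ppair x y))))))"
  using pc_bind2[OF assms(1) partial_computable.pair[OF assms(2,3)] assms(4)] by simp

text \<open>The guarded value is the result of a search whose only possible solution is
  \<open>F x\<close>, and which has no solution when the guard fails.\<close>

lemma pc_guard:
  assumes "decidable P" "tc F"
  shows "partial_computable (\<lambda>x. if P x then Some (F x) else None)"
proof -
  have "decidable (\<lambda>z. P (pfst z) \<and> psnd z = F (pfst z))"
    by (intro tc_intros tc_comp[OF assms(1)] tc_comp[OF assms(2)])
  from pc_search[of "\<lambda>x k. P x \<and> k = F x", OF this] show ?thesis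
    by (rule back_subst[of partial_computable]) (auto simp: fun_eq_iff intro!: Least_equality)
qed

text \<open>Only the germ of \<open>f\<close> along \<open>C\<close> is constrained. Hence
  \<open>f\<close> may be an expression such as \<open>\<lambda>i. the (l i)\<close> that is
  arbitrary off a set almost containing \<open>C\<close>, and case distinctions on definedness
  disappear.\<close>

definition hc :: "nat set \<Rightarrow> (nat \<Rightarrow> nat) \<Rightarrow> bool" where
  "hc C f \<longleftrightarrow> (\<exists>\<phi>. partial_computable \<phi> \<and> (\<forall>\<^sub>F i in cof C. \<phi> i = Some (f i)))"

lemma hc_const [simp]: "hc C (\<lambda>i. k)"
  unfolding hc_def by (intro exI[of _ "\<lambda>n. Some k"]) (simp add: pc_const)

lemma hc_comp: assumes "tc F" "hc C f" shows "hc C (\<lambda>i. F (f i))"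
proof -
  obtain \<phi> where \<phi>: "partial_computable \<phi>" "\<forall>\<^sub>F i in cof C. \<phi> i = Some (f i)"
    using assms(2) by (auto simp: hc_def)
  have "\<forall>\<^sub>F i in cof C. Option.bind (\<phi> i) (\<lambda>x. Some (F x)) = Some (F (f i))"
    using \<phi>(2) by eventually_elim simp
  then show ?thesis unfolding hc_def
    using partial_computable.comp[OF assms(1)[unfolded tc_def] \<phi>(1)] by blast
qed

lemma hc_pair: assumes "hc C f" "hc C g" shows "hc C (\<lambda>i. ppair (f i) (g i))"
proof -
  obtain \<phi> where \<phi>: "partial_computable \<phi>" "\<forall>\<^sub>F i in cof C. \<phi> i = Some (f i)"
    using assms(1) by (auto simp: hc_def)
  obtain \<psi> where \<psi>: "partial_computable \<psi>" "\<forall>\<^sub>F i in cof C. \<psi> i = Some (g i)"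
    using assms(2) by (auto simp: hc_def)
  have "\<forall>\<^sub>F i in cof C. Option.bind (\<phi> i) (\<lambda>a. Option.bind (\<psi> i) (\<lambda>b. Some (ppair a b))) = Some (ppair (f i) (g i))"
    using \<phi>(2) \<psi>(2) by eventually_elim simp
  then show ?thesis unfolding hc_def using partial_computable.pair[OF \<phi>(1) \<psi>(1)] by blast
qed

lemma hc_comp2:
  assumes "tc (\<lambda>z. F (pfst z) (psnd z))" "hc C f" "hc C g"
  shows "hc C (\<lambda>i. F (f i) (g i))"
  using hc_comp[OF assms(1) hc_pair[OF assms(2,3)]] by simp

lemma hc_comp3:
  assumes "tc (\<lambda>z. F (pfst z) (pfst (psnd z)) (psnd (psnd z)))" "hc C f" "hc C g" "hc C h"
  shows "hc C (\<lambda>i. F (f i) (g i) (h i))"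
  using hc_comp[OF assms(1) hc_pair[OF assms(2) hc_pair[OF assms(3,4)]]] by simp

lemma hc_cong:
  assumes "hc C f" "\<forall>\<^sub>F i in cof C. f i = g i" shows "hc C g"
proof -
  obtain \<phi> where \<phi>: "partial_computable \<phi>" "\<forall>\<^sub>F i in cof C. \<phi> i = Some (f i)"
    using assms(1) by (auto simp: hc_def)
  have "\<forall>\<^sub>F i in cof C. \<phi> i = Some (g i)" using \<phi>(2) assms(2) by eventually_elim simp
  then show ?thesis unfolding hc_def using \<phi>(1) by blast
qed

definition hidx :: "nat set \<Rightarrow> pfun \<Rightarrow> bool" where
  "hidx C l \<longleftrightarrow> partial_computable l \<and> (\<forall>\<^sub>F i in cof C. l i \<noteq> None)"

lemma hidx_val: "hidx C l \<Longrightarrow> hc C (\<lambda>i. the (l i))"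
  unfolding hidx_def hc_def by (intro exI[of _ l]) (auto elim: eventually_mono)

lemma hidx_const [simp]: "hidx C (\<lambda>i. Some k)"
  by (simp add: hidx_def pc_const)

lemma hidx_ex: "hidx C l \<Longrightarrow> \<forall>\<^sub>F i in cof C. \<exists>n. l i = Some n"
  unfolding hidx_def by (auto elim: eventually_mono)

lemma hidx_ae: "hidx C l \<Longrightarrow> \<forall>\<^sub>F i in cof C. l i = Some (the (l i))"
  unfolding hidx_def by (auto elim: eventually_mono)

text \<open>Elements of \<open>cpre\<close> take values in the factors wherever they are defined.
  Deciding membership uniformly in the index is what allows a representative to be cut down
  accordingly.\<close>

definition usd :: "(nat \<Rightarrow> nat set) \<Rightarrow> bool" where
  "usd S \<longleftrightarrow> decidable (\<lambda>z. psnd z \<in> S (pfst z))"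

lemma usd_decidable: "usd S \<Longrightarrow> tc f \<Longrightarrow> tc g \<Longrightarrow> decidable (\<lambda>z. g z \<in> S (f z))"
  unfolding usd_def by (rule tc_comp2[of "\<lambda>n x. of_bool (x \<in> S n)"])

lemma usd_tuples: "usd S \<Longrightarrow> usd (\<lambda>n. tuples (S n))"
  unfolding usd_def by (rule decidable_tuples) (assumption | intro tc_intros)+

lemma usd_const: "decidable (\<lambda>x. x \<in> A) \<Longrightarrow> usd (\<lambda>_. A)"
  unfolding usd_def by (rule tc_comp[of "\<lambda>x. of_bool (x \<in> A)"]) (assumption | intro tc_intros)+

lemma usd_UNIV [simp]: "usd (\<lambda>_. UNIV)"
  by (rule usd_const) (simp add: tc_const)

locale cohesive_set =
  fixes C :: "nat set"
  assumes cohesive: "cohesive C"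
begin

abbreviation F where "F \<equiv> cof C"

text \<open>\<open>C\<close> is infinite. This turns an almost everywhere contradiction into a
  contradiction, the form in which the indirect arguments over \<open>F\<close> end.\<close>

lemma F_nontrivial: "F \<noteq> bot"
proof
  assume "F = bot"
  then have "eventually (\<lambda>_. False) F" by simp
  then show False using cohesive by (simp add: eventually_cof cohesive_def)
qed

lemma ae_const [simp]: "(\<forall>\<^sub>F i in F. P) \<longleftrightarrow> P"
  using F_nontrivial by (simp add: eventually_const)

lemma hc_search:
  assumes "decidable (\<lambda>z. P (pfst z) (psnd z))" "hc C f" "\<forall>\<^sub>F i in F. \<exists>k. P (f i) k"
  obtains g where "hc C g" "\<forall>\<^sub>F i in F. P (f i) (g i)"
proof -
  obtain \<phi> where \<phi>: "partial_computable \<phi>" "\<forall>\<^sub>F i in F. \<phi> i = Some (f i)"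
    using assms(2) by (auto simp: hc_def)
  let ?g = "\<lambda>i. LEAST k. P (f i) k"
  have "\<forall>\<^sub>F i in F. Option.bind (\<phi> i) (\<lambda>x. if \<exists>k. P x k then Some (LEAST k. P x k) else None) = Some (?g i)"
    using \<phi>(2) assms(3) by eventually_elim simp
  then have "hc C ?g" unfolding hc_def using partial_computable.comp[OF pc_search[OF assms(1)] \<phi>(1)] by blast
  moreover have "\<forall>\<^sub>F i in F. P (f i) (?g i)" using assms(3) by eventually_elim (rule LeastI_ex)
  ultimately show ?thesis using that by blast
qed

text \<open>Up to finitely many elements of \<open>C\<close>, the indices with a witness form the
  domain of a search composed with a representative of \<open>f\<close>, a c.e. set. Existential
  statements are thus decided by cohesiveness in both directions, although only the positive case
  yields a computable witness.\<close>

lemma hc_dichotomy_ex: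
  assumes "decidable (\<lambda>z. P (pfst z) (psnd z))" "hc C f"
  shows "(\<forall>\<^sub>F i in F. \<exists>k. P (f i) k) \<or> (\<forall>\<^sub>F i in F. \<not> (\<exists>k. P (f i) k))"
proof -
  obtain \<phi> where \<phi>: "partial_computable \<phi>" "\<forall>\<^sub>F i in F. \<phi> i = Some (f i)"
    using assms(2) by (auto simp: hc_def)
  define r where "r = (\<lambda>i. Option.bind (\<phi> i) (\<lambda>x. if \<exists>k. P x k then Some (LEAST k. P x k) else None))"
  have "ce (dom r)" unfolding ce_def r_def
    using partial_computable.comp[OF pc_search[OF assms(1)] \<phi>(1)] by blast
  then have "(\<forall>\<^sub>F i in F. i \<in> dom r) \<or> (\<forall>\<^sub>F i in F. i \<in> - dom r)"
    using cohesive unfolding cohesive_def almost_subset_iff[symmetric] by blast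
  then show ?thesis
  proof
    assume "\<forall>\<^sub>F i in F. i \<in> dom r"
    then have "\<forall>\<^sub>F i in F. \<exists>k. P (f i) k" using \<phi>(2)
      by eventually_elim (auto simp: r_def split: if_splits)
    then show ?thesis ..
  next
    assume "\<forall>\<^sub>F i in F. i \<in> - dom r"
    then have "\<forall>\<^sub>F i in F. \<not> (\<exists>k. P (f i) k)" using \<phi>(2)
      by eventually_elim (auto simp: r_def dom_def split: if_splits)
    then show ?thesis ..
  qed
qed

lemma hc_dichotomy:
  assumes "decidable P" "hc C f"
  shows "(\<forall>\<^sub>F i in F. P (f i)) \<or> (\<forall>\<^sub>F i in F. \<not> P (f i))"
proof -
  have "decidable (\<lambda>z. P (pfst z))" by (rule tc_comp[OF assms(1)]) (intro tc_intros)
  from hc_dichotomy_ex[OF this assms(2)] show ?thesis by simp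
qed

section \<open>Calculus of cohesive products\<close>

text \<open>All factor sequences have the shape \<open>along S l\<close>; an element of the product is handled through a function \<open>f\<close> giving its values almost everywhere on \<open>C\<close>.\<close>

definition el :: "(nat \<Rightarrow> nat set) \<Rightarrow> pfun \<Rightarrow> (nat \<Rightarrow> nat) \<Rightarrow> bool" where
  "el S l f \<longleftrightarrow> hc C f \<and> (\<forall>\<^sub>F i in F. f i \<in> S (the (l i)))"

definition cl :: "(nat \<Rightarrow> nat set) \<Rightarrow> pfun \<Rightarrow> (nat \<Rightarrow> nat) \<Rightarrow> hyper" where
  "cl S l f = {\<phi> \<in> cpre C (along S l). \<forall>\<^sub>F i in F. \<phi> i = Some (f i)}"

lemma elI: "hc C f \<Longrightarrow> \<forall>\<^sub>F i in F. f i \<in> S (the (l i)) \<Longrightarrow> el S l f"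
  by (simp add: el_def)

lemma el_hc: "el S l f \<Longrightarrow> hc C f" by (simp add: el_def)
lemma el_ae: "el S l f \<Longrightarrow> \<forall>\<^sub>F i in F. f i \<in> S (the (l i))" by (simp add: el_def)

lemma el_cong: "el S l f \<Longrightarrow> \<forall>\<^sub>F i in F. f i = g i \<Longrightarrow> el S l g"
  unfolding el_def using hc_cong by (auto elim: eventually_elim2)

lemma cl_cong: "\<forall>\<^sub>F i in F. f i = g i \<Longrightarrow> cl S l f = cl S l g"
  unfolding cl_def by (auto elim: eventually_elim2)

lemma cpre_along:
  "\<phi> \<in> cpre C (along S l) \<longleftrightarrow> partial_computable \<phi> \<and> (\<forall>\<^sub>F i in F. \<phi> i \<noteq> None) \<and>
     (\<forall>i x. \<phi> i = Some x \<longrightarrow> (\<exists>n. l i = Some n \<and> x \<in> S n))"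
proof -
  have "(\<exists>T. map_option S (l i) = Some T \<and> x \<in> T) \<longleftrightarrow> (\<exists>n. l i = Some n \<and> x \<in> S n)" for i x
    by (cases "l i") auto
  then show ?thesis unfolding cpre_def almost_subset_iff along_def mem_Collect_eq dom_def by blast
qed

lemma ceq_iff:
  "(\<phi>, \<psi>) \<in> ceq C D \<longleftrightarrow> \<phi> \<in> cpre C D \<and> \<psi> \<in> cpre C D \<and> (\<forall>\<^sub>F i in F. \<phi> i \<noteq> None \<and> \<phi> i = \<psi> i)"
  unfolding ceq_def almost_subset_iff by simp

lemma cpre_el: assumes "\<phi> \<in> cpre C (along S l)"
  shows "el S l (\<lambda>i. the (\<phi> i))" "\<phi> \<in> cl S l (\<lambda>i. the (\<phi> i))"
proof -
  have 1: "\<forall>\<^sub>F i in F. \<phi> i = Some (the (\<phi> i))"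
    using assms unfolding cpre_along by (auto elim: eventually_mono)
  show "\<phi> \<in> cl S l (\<lambda>i. the (\<phi> i))" using 1 assms by (simp add: cl_def)
  have "\<forall>\<^sub>F i in F. the (\<phi> i) \<in> S (the (l i))"
    using 1 by eventually_elim (use assms in \<open>force simp: cpre_along\<close>)
  then show "el S l (\<lambda>i. the (\<phi> i))"
    using 1 assms unfolding el_def hc_def by (auto simp: cpre_along)
qed

lemma ccls_cl:
  assumes "\<phi> \<in> cpre C (along S l)" "\<forall>\<^sub>F i in F. \<phi> i = Some (f i)"
  shows "ccls C (along S l) \<phi> = cl S l f"
proof -
  have "\<psi> \<in> ccls C (along S l) \<phi> \<longleftrightarrow> \<psi> \<in> cl S l f" for \<psi>
  proof -
    have "(\<forall>\<^sub>F i in F. \<phi> i \<noteq> None \<and> \<phi> i = \<psi> i) \<longleftrightarrow> (\<forall>\<^sub>F i in F. \<psi> i = Some (f i))"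
      by (rule eventually_cong[OF assms(2)]) auto
    then show ?thesis using assms(1) by (auto simp: ccls_def ceq_iff cl_def)
  qed
  then show ?thesis by blast
qed

text \<open>A representative supplied by \<open>hc\<close> may leave the factors at indices that do
  not matter for \<open>f\<close>; it is made undefined where membership in \<open>S n\<close> fails
  or \<open>l\<close> is undefined.\<close>

lemma cl_member:
  assumes "hidx C l" "usd S" "el S l f"
  obtains \<phi> where "\<phi> \<in> cl S l f"
proof -
  obtain \<phi>0 where \<phi>0: "partial_computable \<phi>0" "\<forall>\<^sub>F i in F. \<phi>0 i = Some (f i)"
    using assms(3) by (auto simp: el_def hc_def)
  define \<phi> where "\<phi> = (\<lambda>i. Option.bind (l i) (\<lambda>n. Option.bind (\<phi>0 i)
    (\<lambda>x. if psnd (ppair n x) \<in> S (pfst (ppair n x)) then Some (psnd (ppair n x)) else None)))"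
  have "partial_computable \<phi>" unfolding \<phi>_def
    by (rule pc_bind2[OF _ \<phi>0(1) pc_guard[OF assms(2)[unfolded usd_def]]])
      (use assms(1) in \<open>auto simp: hidx_def intro: tc_intros\<close>)
  moreover have ae: "\<forall>\<^sub>F i in F. \<phi> i = Some (f i)"
    using \<phi>0(2) hidx_ex[OF assms(1)] el_ae[OF assms(3)]
  proof eventually_elim
    case (elim i)
    then obtain n where "l i = Some n" by blast
    with elim show ?case by (simp add: \<phi>_def)
  qed
  moreover have "\<exists>n. l i = Some n \<and> x \<in> S n" if "\<phi> i = Some x" for i x
    using that by (auto simp: \<phi>_def Option.bind_eq_Some_conv split: if_splits)
  moreover have "\<forall>\<^sub>F i in F. \<phi> i \<noteq> None" using ae by eventually_elim simp
  ultimately have "\<phi> \<in> cl S l f" by (simp add: cl_def cpre_along)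
  then show ?thesis using that by blast
qed

lemma cl_ccls:
  assumes "\<phi> \<in> cl S l f" shows "cl S l f = ccls C (along S l) \<phi>"
  using assms ccls_cl[of \<phi> S l f] by (simp add: cl_def)

text \<open>Equality of classes says something about values only if there is a member to compare;
  \<open>el\<close> provides one.\<close>

lemma cl_eq_iff:
  assumes "hidx C l" "usd S" "el S l f"
  shows "cl S l f = cl S l g \<longleftrightarrow> (\<forall>\<^sub>F i in F. f i = g i)"
proof
  assume *: "cl S l f = cl S l g"
  obtain \<phi> where \<phi>: "\<phi> \<in> cl S l f" using cl_member[OF assms] .
  then have "\<phi> \<in> cl S l g" using * by simp
  with \<phi> have "\<forall>\<^sub>F i in F. \<phi> i = Some (f i)" "\<forall>\<^sub>F i in F. \<phi> i = Some (g i)"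
    by (auto simp: cl_def)
  then show "\<forall>\<^sub>F i in F. f i = g i" by eventually_elim simp
qed (rule cl_cong)

lemma cprodI:
  assumes "hidx C l" "usd S" "el S l f"
  shows "cl S l f \<in> cprod C (along S l)"
proof -
  obtain \<phi> where \<phi>: "\<phi> \<in> cl S l f" using cl_member[OF assms] .
  then show ?thesis by (subst cl_ccls[OF \<phi>]) (auto simp: ccls_def cprod_def cl_def intro!: quotientI)
qed

lemma cprodE:
  assumes "T \<in> cprod C (along S l)"
  obtains f where "el S l f" "T = cl S l f"
proof -
  obtain \<phi> where \<phi>: "\<phi> \<in> cpre C (along S l)" "T = ccls C (along S l) \<phi>"
    using assms by (auto simp: ccls_def cprod_def elim: quotientE)
  then show ?thesis using that[OF cpre_el(1)[OF \<phi>(1)]] cl_ccls[OF cpre_el(2)[OF \<phi>(1)]] by simp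
qed

text \<open>The unions in \<open>cmap\<close> and its relatives run over all representatives,
  possibly including some whose pointwise image is not computable. These contribute the empty set,
  so a single good representative determines the union.\<close>

lemma UN_ccls:
  assumes "\<And>\<phi>. \<phi> \<in> P \<Longrightarrow> \<forall>\<^sub>F i in F. r \<phi> i = Some (g i)"
    and "\<phi>0 \<in> P" "r \<phi>0 \<in> cpre C (along S' l')"
  shows "(\<Union>\<phi>\<in>P. ccls C (along S' l') (r \<phi>)) = cl S' l' g"
proof -
  have "ccls C (along S' l') (r \<phi>) = (if r \<phi> \<in> cpre C (along S' l') then cl S' l' g else {})"
    if "\<phi> \<in> P" for \<phi>
  proof (cases "r \<phi> \<in> cpre C (along S' l')")
    case True
    then show ?thesis using ccls_cl[OF True assms(1)[OF that]] by simp
  next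
    case False
    then show ?thesis unfolding ccls_def Image_def ceq_iff by simp
  qed
  then show ?thesis using assms(2,3) by auto
qed

text \<open>On the factors, \<open>u i\<close> only has to agree with a computable \<open>G\<close>
  whose first argument is read off an auxiliary index \<open>w\<close>. This argument may differ
  from \<open>l i\<close>: it is the target index for maps from the constant base field, and a code
  of two indices for the transition maps.\<close>

lemma cmap_cl:
  assumes l: "hidx C l" "usd S" and f: "el S l f" and w: "hidx C w"
    and G: "tc (\<lambda>z. G (pfst z) (psnd z))"
    and u: "\<And>i k n x. w i = Some k \<Longrightarrow> l i = Some n \<Longrightarrow> x \<in> S n \<Longrightarrow>
        \<exists>h n'. u i = Some h \<and> h x = G k x \<and> l' i = Some n' \<and> G k x \<in> S' n'"
    and g: "\<forall>\<^sub>F i in F. g i = G (the (w i)) (f i)"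
  shows "cmap C (along S' l') u (cl S l f) = cl S' l' g \<and> el S' l' g"
proof (intro conjI)
  obtain \<phi>0 where \<phi>0: "\<phi>0 \<in> cl S l f" using cl_member[OF l f] .
  \<comment> \<open>The chosen representative is made undefined where \<open>w\<close> is. Otherwise
    \<open>u\<close> could be defined there with values unrelated to \<open>G\<close>, and the
    pointwise image might fail to be computable.\<close>
  define \<phi> where "\<phi> = (\<lambda>i. Option.bind (w i) (\<lambda>n. Option.bind (\<phi>0 i) (\<lambda>x. Some (psnd (ppair n x)))))"
  define r where "r = (\<lambda>\<phi> i. Option.bind (u i) (\<lambda>h. map_option h (\<phi> i)))"
  have val: "\<forall>\<^sub>F i in F. u i \<noteq> None \<and> the (u i) (f i) = g i \<and> g i \<in> S' (the (l' i)) \<and> l' i \<noteq> None"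
    using hidx_ae[OF l(1)] hidx_ae[OF w] el_ae[OF f] g
  proof eventually_elim
    case (elim i)
    from u[OF elim(2,1,3)] elim(4) show ?case by auto
  qed
  have 1: "\<forall>\<^sub>F i in F. r \<phi> i = Some (g i)" if "\<phi> \<in> cl S l f" for \<phi>
  proof -
    have "\<forall>\<^sub>F i in F. \<phi> i = Some (f i)" using that by (simp add: cl_def)
    then show ?thesis using val by eventually_elim (auto simp: r_def)
  qed
  have pc0: "partial_computable \<phi>0" "partial_computable w"
    using \<phi>0 w by (auto simp: cl_def cpre_along hidx_def)
  have \<phi>: "\<phi> \<in> cl S l f"
  proof -
    have "partial_computable \<phi>" unfolding \<phi>_def
      by (rule pc_bind2[OF pc0(2,1)]) (use tc_snd[OF tc_id] in \<open>simp add: tc_def\<close>)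
    moreover have "\<forall>\<^sub>F i in F. \<phi>0 i = Some (f i)" using \<phi>0 by (simp add: cl_def)
    then have ae: "\<forall>\<^sub>F i in F. \<phi> i = Some (f i)"
      using hidx_ex[OF w] by eventually_elim (elim exE, simp add: \<phi>_def)
    moreover have "\<forall>\<^sub>F i in F. \<phi> i \<noteq> None" using ae by eventually_elim simp
    moreover have "\<phi>0 i = Some x" if "\<phi> i = Some x" for i x
      using that by (auto simp: \<phi>_def Option.bind_eq_Some_conv)
    ultimately show ?thesis using \<phi>0 by (simp add: cl_def cpre_along)
  qed
  have r_eq: "r \<phi> i = Option.bind (w i) (\<lambda>k. Option.bind (\<phi>0 i) (\<lambda>x. Some (G k x)))" for i
  proof (cases "w i = None \<or> \<phi>0 i = None")
    case True
    then show ?thesis by (cases "w i"; cases "\<phi>0 i"; cases "u i") (simp_all add: r_def \<phi>_def)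
  next
    case False
    then obtain k x where kx: "w i = Some k" "\<phi>0 i = Some x" by auto
    then obtain n where n: "l i = Some n" "x \<in> S n" using \<phi>0 by (force simp: cl_def cpre_along)
    obtain h where "u i = Some h" "h x = G k x" using u[OF kx(1) n] by blast
    then show ?thesis by (simp add: r_def \<phi>_def kx)
  qed
  have pcr: "partial_computable (r \<phi>)"
  proof -
    have "r \<phi> = (\<lambda>i. Option.bind (w i) (\<lambda>k. Option.bind (\<phi>0 i)
        (\<lambda>x. Some (G (pfst (ppair k x)) (psnd (ppair k x))))))"
      by (rule ext) (simp only: r_eq prod_encode_inverse fst_conv snd_conv)
    then show ?thesis using pc_bind2[OF pc0(2,1) G[unfolded tc_def]] by (simp only:)
  qed
  have "r \<phi> \<in> cpre C (along S' l')" unfolding cpre_along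
  proof (intro conjI allI impI pcr)
    show "\<forall>\<^sub>F i in F. r \<phi> i \<noteq> None" using 1[OF \<phi>] by eventually_elim simp
    fix i y assume "r \<phi> i = Some y"
    then obtain k x where kx: "w i = Some k" "\<phi>0 i = Some x" "y = G k x"
      by (auto simp: r_eq Option.bind_eq_Some_conv)
    then obtain n where "l i = Some n" "x \<in> S n" using \<phi>0 by (force simp: cl_def cpre_along)
    from u[OF kx(1) this] kx show "\<exists>n. l' i = Some n \<and> y \<in> S' n" by blast
  qed
  from UN_ccls[where r = r, OF 1 \<phi> this] show "cmap C (along S' l') u (cl S l f) = cl S' l' g"
    by (simp add: cmap_def r_def)
  show "el S' l' g"
  proof (rule elI)
    show "hc C g" by (rule hc_cong[OF hc_comp2[OF G hidx_val[OF w] el_hc[OF f]]])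
        (use g in \<open>auto elim: eventually_mono\<close>)
    show "\<forall>\<^sub>F i in F. g i \<in> S' (the (l' i))" using val by eventually_elim simp
  qed
qed

lemma cmap2_cl:
  assumes l1: "hidx C l1" "usd S1" and f1: "el S1 l1 f1" and l2: "hidx C l2" "usd S2" and f2: "el S2 l2 f2"
    and w: "hidx C w"
    and G: "tc (\<lambda>z. G (pfst z) (pfst (psnd z)) (psnd (psnd z)))"
    and u: "\<And>i k n1 n2 x y. w i = Some k \<Longrightarrow> l1 i = Some n1 \<Longrightarrow> x \<in> S1 n1 \<Longrightarrow>
        l2 i = Some n2 \<Longrightarrow> y \<in> S2 n2 \<Longrightarrow>
        \<exists>h n'. u i = Some h \<and> h x y = G k x y \<and> l' i = Some n' \<and> G k x y \<in> S' n'"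
    and g: "\<forall>\<^sub>F i in F. g i = G (the (w i)) (f1 i) (f2 i)"
  shows "cmap2 C (along S' l') u (cl S1 l1 f1) (cl S2 l2 f2) = cl S' l' g \<and> el S' l' g"
proof (intro conjI)
  obtain \<phi>0 where \<phi>0: "\<phi>0 \<in> cl S1 l1 f1" using cl_member[OF l1 f1] .
  obtain \<psi>0 where \<psi>0: "\<psi>0 \<in> cl S2 l2 f2" using cl_member[OF l2 f2] .
  define \<phi> where "\<phi> = (\<lambda>i. Option.bind (w i) (\<lambda>n. Option.bind (\<phi>0 i) (\<lambda>x. Some (psnd (ppair n x)))))"
  define r where "r p i = Option.bind (u i) (\<lambda>h. Option.bind (fst p i) (\<lambda>x. map_option (h x) (snd p i)))" for p i
  have "\<forall>\<^sub>F i in F. l1 i = Some (the (l1 i)) \<and> w i = Some (the (w i)) \<and> f1 i \<in> S1 (the (l1 i))"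
    by (intro eventually_conj hidx_ae[OF l1(1)] hidx_ae[OF w] el_ae[OF f1])
  moreover have "\<forall>\<^sub>F i in F. l2 i = Some (the (l2 i)) \<and> f2 i \<in> S2 (the (l2 i))"
    by (intro eventually_conj hidx_ae[OF l2(1)] el_ae[OF f2])
  ultimately have val: "\<forall>\<^sub>F i in F. u i \<noteq> None \<and> the (u i) (f1 i) (f2 i) = g i \<and> g i \<in> S' (the (l' i)) \<and> l' i \<noteq> None"
    using g
  proof eventually_elim
    case (elim i)
    then have "w i = Some (the (w i))" "l1 i = Some (the (l1 i))" "f1 i \<in> S1 (the (l1 i))"
      "l2 i = Some (the (l2 i))" "f2 i \<in> S2 (the (l2 i))" by blast+
    from u[OF this] elim(3) show ?case by auto
  qed
  have 1: "\<forall>\<^sub>F i in F. r p i = Some (g i)" if "p \<in> cl S1 l1 f1 \<times> cl S2 l2 f2" for p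
  proof -
    have "fst p \<in> cl S1 l1 f1" "snd p \<in> cl S2 l2 f2" using that by (simp_all add: mem_Times_iff)
    then have "\<forall>\<^sub>F i in F. fst p i = Some (f1 i)" "\<forall>\<^sub>F i in F. snd p i = Some (f2 i)"
      unfolding cl_def by blast+
    then show ?thesis using val by eventually_elim (auto simp: r_def)
  qed
  have pc0: "partial_computable \<phi>0" "partial_computable w" "partial_computable \<psi>0"
    using \<phi>0 \<psi>0 w by (auto simp: cl_def cpre_along hidx_def)
  have \<phi>: "\<phi> \<in> cl S1 l1 f1"
  proof -
    have "partial_computable \<phi>" unfolding \<phi>_def
      by (rule pc_bind2[OF pc0(2,1)]) (use tc_snd[OF tc_id] in \<open>simp add: tc_def\<close>)
    moreover have "\<forall>\<^sub>F i in F. \<phi>0 i = Some (f1 i)" using \<phi>0 by (simp add: cl_def)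
    then have ae: "\<forall>\<^sub>F i in F. \<phi> i = Some (f1 i)"
      using hidx_ex[OF w] by eventually_elim (elim exE, simp add: \<phi>_def)
    moreover have "\<forall>\<^sub>F i in F. \<phi> i \<noteq> None" using ae by eventually_elim simp
    moreover have "\<phi>0 i = Some x" if "\<phi> i = Some x" for i x
      using that by (auto simp: \<phi>_def Option.bind_eq_Some_conv)
    ultimately show ?thesis using \<phi>0 by (simp add: cl_def cpre_along)
  qed
  have r_eq: "r (\<phi>, \<psi>0) i = Option.bind (w i) (\<lambda>k. Option.bind (\<phi>0 i) (\<lambda>x. Option.bind (\<psi>0 i) (\<lambda>y. Some (G k x y))))" for i
  proof (cases "w i = None \<or> \<phi>0 i = None \<or> \<psi>0 i = None")
    case True
    then show ?thesis
      by (cases "w i"; cases "\<phi>0 i"; cases "\<psi>0 i"; cases "u i") (simp_all add: r_def \<phi>_def)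
  next
    case False
    then obtain k x y where kxy: "w i = Some k" "\<phi>0 i = Some x" "\<psi>0 i = Some y" by auto
    then obtain n1 n2 where n: "l1 i = Some n1" "x \<in> S1 n1" "l2 i = Some n2" "y \<in> S2 n2"
      using \<phi>0 \<psi>0 by (force simp: cl_def cpre_along)
    obtain h where "u i = Some h" "h x y = G k x y" using u[OF kxy(1) n] by blast
    then show ?thesis by (simp add: r_def \<phi>_def kxy)
  qed
  have pcr: "partial_computable (r (\<phi>, \<psi>0))"
  proof -
    have "r (\<phi>, \<psi>0) = (\<lambda>i. Option.bind (w i) (\<lambda>k. Option.bind (\<phi>0 i) (\<lambda>x. Option.bind (\<psi>0 i)
        (\<lambda>y. (\<lambda>z. Some (G (pfst z) (pfst (psnd z)) (psnd (psnd z)))) (ppair k (ppair x y))))))"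
      by (rule ext) (simp only: r_eq prod_encode_inverse fst_conv snd_conv)
    then show ?thesis using pc_bind3[OF pc0(2,1,3) G[unfolded tc_def]] by (simp only:)
  qed
  have "r (\<phi>, \<psi>0) \<in> cpre C (along S' l')" unfolding cpre_along
  proof (intro conjI allI impI pcr)
    show "\<forall>\<^sub>F i in F. r (\<phi>, \<psi>0) i \<noteq> None" using 1[OF SigmaI[OF \<phi> \<psi>0]] by eventually_elim simp
    fix i z assume "r (\<phi>, \<psi>0) i = Some z"
    then obtain k x y where kx: "w i = Some k" "\<phi>0 i = Some x" "\<psi>0 i = Some y" "z = G k x y"
      by (auto simp: r_eq Option.bind_eq_Some_conv)
    then obtain n1 n2 where "l1 i = Some n1" "x \<in> S1 n1" "l2 i = Some n2" "y \<in> S2 n2"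
      using \<phi>0 \<psi>0 by (force simp: cl_def cpre_along)
    from u[OF kx(1) this] kx show "\<exists>n. l' i = Some n \<and> z \<in> S' n" by blast
  qed
  from UN_ccls[where r = r, OF 1 SigmaI[OF \<phi> \<psi>0] this]
  have "(\<Union>p\<in>cl S1 l1 f1 \<times> cl S2 l2 f2. ccls C (along S' l') (r p)) = cl S' l' g" .
  then show "cmap2 C (along S' l') u (cl S1 l1 f1) (cl S2 l2 f2) = cl S' l' g"
    by (simp add: cmap2_def r_def[abs_def] Sigma_def)
  show "el S' l' g"
  proof (rule elI)
    show "hc C g" by (rule hc_cong[OF hc_comp3[OF G hidx_val[OF w] el_hc[OF f1] el_hc[OF f2]]])
        (use g in \<open>auto elim: eventually_mono\<close>)
    show "\<forall>\<^sub>F i in F. g i \<in> S' (the (l' i))" using val by eventually_elim simp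
  qed
qed

lemma crel_cl:
  assumes "hidx C l1" "usd S1" "el S1 l1 f" "hidx C l2" "usd S2" "el S2 l2 g"
  shows "crel C r (cl S1 l1 f) (cl S2 l2 g) \<longleftrightarrow> (\<forall>\<^sub>F i in F. r (f i) (g i))"
proof -
  have *: "(\<forall>\<^sub>F i in F. \<exists>x y. \<phi> i = Some x \<and> \<psi> i = Some y \<and> r x y) \<longleftrightarrow> (\<forall>\<^sub>F i in F. r (f i) (g i))"
    if "\<phi> \<in> cl S1 l1 f" "\<psi> \<in> cl S2 l2 g" for \<phi> \<psi>
  proof -
    have "\<forall>\<^sub>F i in F. \<phi> i = Some (f i) \<and> \<psi> i = Some (g i)"
      using that by (auto simp: cl_def intro: eventually_conj)
    then show ?thesis by (rule eventually_cong) auto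
  qed
  obtain \<phi> \<psi> where "\<phi> \<in> cl S1 l1 f" "\<psi> \<in> cl S2 l2 g"
    using cl_member[OF assms(1-3)] cl_member[OF assms(4-6)] by metis
  then show ?thesis unfolding crel_def almost_subset_iff using * by auto
qed

end

lemma along_const: "along (\<lambda>_. A) (\<lambda>_. Some 0) = (\<lambda>_. Some A)"
  by (simp add: along_def fun_eq_iff)

lemma carriers_along: "carriers (along R l) = along (\<lambda>n. carrier (R n)) l"
  by (simp add: carriers_def along_def fun_eq_iff option.map_comp comp_def)

lemma trees_along: "trees (along R l) = along (\<lambda>n. tuples (carrier (R n))) l"
  by (simp add: trees_def along_def fun_eq_iff option.map_comp comp_def)

section \<open>Computable operations of uniformly computable structures\<close>

text \<open>A primitive recursion with \<open>of_bool (P z)\<close> steps: \<open>p\<close>, which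
  may diverge outside \<open>P\<close>, is run once if \<open>P\<close> holds and not at all
  otherwise. A conditional composed from total functions could not postpone the evaluation of
  \<open>p\<close>.\<close>

lemma tc_guarded:
  assumes "partial_computable p" "decidable P" "\<And>z. P z \<Longrightarrow> p z = Some (h z)"
  shows "tc (\<lambda>z. if P z then h z else 0)"
proof -
  have "partial_computable (\<lambda>w. Option.bind (Some (pfst w)) p)"
    using partial_computable.comp[OF assms(1) partial_computable.left] .
  then have g: "partial_computable (\<lambda>w. p (pfst w))" by simp
  define q where "q = (\<lambda>n. rec_nat (Some 0) (\<lambda>y r. Option.bind r (\<lambda>z. p (pfst n))) (psnd n))"
  have "partial_computable q"
    using partial_computable.prec[OF partial_computable.zero g] unfolding q_def case_prod_beta by simp
  from partial_computable.comp[OF this tc_pair[OF tc_id assms(2), unfolded tc_def]]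
  have "partial_computable (\<lambda>n. q (ppair n (of_bool (P n))))" by simp
  moreover have "q (ppair n (of_bool (P n))) = Some (if P n then h n else 0)" for n
    using assms(3)[of n] by (simp add: q_def)
  ultimately show ?thesis by (simp add: tc_def)
qed

lemma tc_guarded2:
  assumes "computable_on2 {(i, x). P i x} h" "decidable (\<lambda>z. P (pfst z) (psnd z))" "tc f" "tc g"
  shows "tc (\<lambda>z. if P (f z) (g z) then h (f z) (g z) else 0)"
proof -
  obtain p where p: "partial_computable p" "\<And>x y. P x y \<Longrightarrow> p (ppair x y) = Some (h x y)"
    using assms(1) unfolding computable_on2_def by auto
  have "p z = Some (h (pfst z) (psnd z))" if "P (pfst z) (psnd z)" for z
    using p(2)[OF that] by simp
  then have "tc (\<lambda>z. if P (pfst z) (psnd z) then h (pfst z) (psnd z) else 0)"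
    using assms(2) p(1) by (intro tc_guarded[of p])
  from tc_comp2[of "\<lambda>x y. if P x y then h x y else 0", OF this assms(3,4)] show ?thesis .
qed

lemma tc_guarded3:
  assumes "computable_on3 {(i, x, y). P i x y} h"
    "decidable (\<lambda>z. P (pfst z) (pfst (psnd z)) (psnd (psnd z)))" "tc f" "tc g" "tc k"
  shows "tc (\<lambda>z. if P (f z) (g z) (k z) then h (f z) (g z) (k z) else 0)"
proof -
  obtain p where p: "partial_computable p" "\<And>x y w. P x y w \<Longrightarrow> p (ppair x (ppair y w)) = Some (h x y w)"
    using assms(1) unfolding computable_on3_def by auto
  have "p z = Some (h (pfst z) (pfst (psnd z)) (psnd (psnd z)))" if "P (pfst z) (pfst (psnd z)) (psnd (psnd z))" for z
    using p(2)[OF that] by simp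
  then have "tc (\<lambda>z. if P (pfst z) (pfst (psnd z)) (psnd (psnd z))
      then h (pfst z) (pfst (psnd z)) (psnd (psnd z)) else 0)"
    using assms(2) p(1) by (intro tc_guarded[of p])
  from tc_comp3[of "\<lambda>x y w. if P x y w then h x y w else 0", OF this assms(3,4,5)] show ?thesis .
qed

text \<open>A function with decidable graph is computable. Constants and inverses that a
  presentation does not list are obtained in this way.\<close>

lemma tc_Least1:
  assumes "decidable (\<lambda>z. P (pfst z) (psnd z))" "\<And>x. P x (h x)" "\<And>x y. P x y \<Longrightarrow> y = h x"
  shows "tc h"
proof -
  have "(LEAST k. P x k) = h x" for x using assms(2,3) by (intro Least_equality) auto
  moreover have "tc (\<lambda>x. LEAST k. P x k)" using assms(1,2) by (intro tc_Least) blast+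
  ultimately show ?thesis by simp
qed

text \<open>The ring operations are unconstrained outside the carrier, where nothing makes them
  computable; the value 0 there gives a total computable function. The same convention serves
  \<open>rmul\<close>, \<open>rneg\<close> and later the group operation and the maps of the Galois
  data.\<close>

definition radd :: "(nat \<Rightarrow> nat ring) \<Rightarrow> nat \<Rightarrow> nat \<Rightarrow> nat \<Rightarrow> nat" where
  "radd R n x y = (if x \<in> carrier (R n) \<and> y \<in> carrier (R n) then x \<oplus>\<^bsub>R n\<^esub> y else 0)"

definition rmul :: "(nat \<Rightarrow> nat ring) \<Rightarrow> nat \<Rightarrow> nat \<Rightarrow> nat \<Rightarrow> nat" where
  "rmul R n x y = (if x \<in> carrier (R n) \<and> y \<in> carrier (R n) then x \<otimes>\<^bsub>R n\<^esub> y else 0)"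

definition rneg :: "(nat \<Rightarrow> nat ring) \<Rightarrow> nat \<Rightarrow> nat \<Rightarrow> nat" where
  "rneg R n x = (if x \<in> carrier (R n) then \<ominus>\<^bsub>R n\<^esub> x else 0)"

locale uniform_fields =
  fixes R :: "nat \<Rightarrow> nat ring"
  assumes ucf: "uniformly_computable_fields R"
begin

lemma field_R: "field (R n)"
  using ucf by (simp add: uniformly_computable_fields_def)

sublocale R: field "R n" for n by (rule field_R)

lemma usd_carrier: "usd (\<lambda>n. carrier (R n))"
proof -
  obtain p where p: "partial_computable p" "\<And>i x. p (ppair i x) = Some (of_bool (x \<in> carrier (R i)))"
    using ucf unfolding uniformly_computable_fields_def computable_on2_def by auto
  have "(\<lambda>z. Some (of_bool (psnd z \<in> carrier (R (pfst z))))) = p"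
  proof
    fix z show "Some (of_bool (psnd z \<in> carrier (R (pfst z)))) = p z"
      using p(2)[of "pfst z" "psnd z"] by simp
  qed
  then show ?thesis using p(1) by (simp add: tc_def usd_def)
qed

lemma dec_carrier [tc_intros]: "tc f \<Longrightarrow> tc g \<Longrightarrow> decidable (\<lambda>z. g z \<in> carrier (R (f z)))"
  by (rule usd_decidable[OF usd_carrier])

lemma tc_radd [tc_intros]: "tc f \<Longrightarrow> tc g \<Longrightarrow> tc h \<Longrightarrow> tc (\<lambda>z. radd R (f z) (g z) (h z))"
  unfolding radd_def
  by (rule tc_guarded3[of "\<lambda>n x y. x \<in> carrier (R n) \<and> y \<in> carrier (R n)"])
    (use ucf in \<open>auto simp: uniformly_computable_fields_def intro!: tc_intros\<close>)

lemma tc_rmul [tc_intros]: "tc f \<Longrightarrow> tc g \<Longrightarrow> tc h \<Longrightarrow> tc (\<lambda>z. rmul R (f z) (g z) (h z))"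
  unfolding rmul_def
  by (rule tc_guarded3[of "\<lambda>n x y. x \<in> carrier (R n) \<and> y \<in> carrier (R n)"])
    (use ucf in \<open>auto simp: uniformly_computable_fields_def intro!: tc_intros\<close>)

text \<open>A presentation computes membership, sum and product only. Zero is recovered as the sole
  solution of x + x = x in the carrier.\<close>

lemma tc_ring_zero: "tc (\<lambda>n. \<zero>\<^bsub>R n\<^esub>)"
proof (rule tc_Least1[where P = "\<lambda>n x. x \<in> carrier (R n) \<and> radd R n x x = x"])
  show "y = \<zero>\<^bsub>R x\<^esub>" if "y \<in> carrier (R x) \<and> radd R x y y = y" for x y
  proof -
    have "y \<oplus>\<^bsub>R x\<^esub> y = y \<oplus>\<^bsub>R x\<^esub> \<zero>\<^bsub>R x\<^esub>" using that by (auto simp: radd_def)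
    then show ?thesis using that by (metis R.add.l_cancel R.zero_closed)
  qed
qed (auto simp: radd_def[of _ _ "\<zero>\<^bsub>R x\<^esub>" for x] intro!: tc_intros)

lemma tc_rzero [tc_intros]: "tc f \<Longrightarrow> tc (\<lambda>z. \<zero>\<^bsub>R (f z)\<^esub>)"
  by (rule tc_comp[OF tc_ring_zero])

text \<open>One is the only nonzero idempotent of a field, so it too is found by search.\<close>

lemma tc_ring_one: "tc (\<lambda>n. \<one>\<^bsub>R n\<^esub>)"
proof (rule tc_Least1[where P = "\<lambda>n x. x \<in> carrier (R n) \<and> x \<noteq> \<zero>\<^bsub>R n\<^esub> \<and> rmul R n x x = x"])
  show "y = \<one>\<^bsub>R x\<^esub>" if "y \<in> carrier (R x) \<and> y \<noteq> \<zero>\<^bsub>R x\<^esub> \<and> rmul R x y y = y" for x y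
  proof -
    have "y \<otimes>\<^bsub>R x\<^esub> y = y \<otimes>\<^bsub>R x\<^esub> \<one>\<^bsub>R x\<^esub>" using that by (auto simp: rmul_def)
    then show ?thesis using that by (metis R.m_lcancel R.one_closed)
  qed
qed (auto simp: rmul_def[of _ _ "\<one>\<^bsub>R x\<^esub>" for x] intro!: tc_intros)

lemma tc_rone [tc_intros]: "tc f \<Longrightarrow> tc (\<lambda>z. \<one>\<^bsub>R (f z)\<^esub>)"
  by (rule tc_comp[OF tc_ring_one])

lemma tc_rneg [tc_intros]:
  assumes "tc f" "tc g" shows "tc (\<lambda>z. rneg R (f z) (g z))"
proof -
  have "tc (\<lambda>z. rneg R (pfst z) (psnd z))"
  proof (rule tc_Least1[where P = "\<lambda>z y. (psnd z \<notin> carrier (R (pfst z)) \<and> y = 0) \<or>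
      (psnd z \<in> carrier (R (pfst z)) \<and> y \<in> carrier (R (pfst z)) \<and> radd R (pfst z) (psnd z) y = \<zero>\<^bsub>R (pfst z)\<^esub>)"])
    fix x y
    show "(psnd x \<notin> carrier (R (pfst x)) \<and> y = 0) \<or>
      (psnd x \<in> carrier (R (pfst x)) \<and> y \<in> carrier (R (pfst x)) \<and> radd R (pfst x) (psnd x) y = \<zero>\<^bsub>R (pfst x)\<^esub>) \<Longrightarrow>
      y = rneg R (pfst x) (psnd x)"
      using R.sum_zero_eq_neg[of y "pfst x" "psnd x"] by (auto simp: rneg_def radd_def R.add.m_comm)
  qed (intro tc_intros, auto simp: rneg_def radd_def R.r_neg)
  from tc_comp2[OF this assms] show ?thesis .
qed

end

section \<open>Computable evaluation of coded integral polynomials\<close>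

definition half :: "nat \<Rightarrow> nat" where "half c = c div 2"

lemma tc_half [tc_intros]: assumes "tc f" shows "tc (\<lambda>x. half (f x))"
proof -
  have "tc half"
    by (rule tc_Least1[where P = "\<lambda>c k. k + k \<le> c \<and> c \<le> Suc (k + k)"], intro tc_intros)
      (auto simp: half_def)
  from tc_comp[OF this assms] show ?thesis .
qed

text \<open>Even codes stand for the nonnegative integers, an odd code \<open>c\<close> for the
  negative of \<open>half c + 1\<close>. Parity is expressed through \<open>half\<close> and
  addition, which are already known to be computable.\<close>

lemma int_decode_half: "int_decode c = (if c = half c + half c then int (half c) else - int (Suc (half c)))"
proof -
  have "c = half c + half c \<longleftrightarrow> even c" unfolding half_def by presburger
  then show ?thesis by (simp add: int_decode_def sum_decode_def half_def)
qed

context uniform_fields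
begin

definition rnat :: "nat \<Rightarrow> nat \<Rightarrow> nat \<Rightarrow> nat" where
  "rnat n k x = rec_nat \<zero>\<^bsub>R n\<^esub> (\<lambda>_ r. radd R n r x) k"

definition rpow :: "nat \<Rightarrow> nat \<Rightarrow> nat \<Rightarrow> nat" where
  "rpow n k x = rec_nat \<one>\<^bsub>R n\<^esub> (\<lambda>_ r. rmul R n r x) k"

definition rint :: "nat \<Rightarrow> nat \<Rightarrow> nat \<Rightarrow> nat" where
  "rint n c x = (if c = half c + half c then rnat n (half c) x else rneg R n (rnat n (Suc (half c)) x))"

definition rmonom :: "nat \<Rightarrow> nat \<Rightarrow> nat \<Rightarrow> nat" where
  "rmonom n e xs = foldr (\<lambda>z t. rmul R n (rpow n (psnd z) (pfst z)) t) (list_decode (lzip xs e)) \<one>\<^bsub>R n\<^esub>"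

definition rpoly :: "nat \<Rightarrow> nat \<Rightarrow> nat \<Rightarrow> nat" where
  "rpoly n p xs = foldr (\<lambda>t s. radd R n (rint n (pfst t) (rmonom n (psnd t) xs)) s) (list_decode p) \<zero>\<^bsub>R n\<^esub>"

lemma tc_rnat [tc_intros]: assumes "tc f" "tc g" "tc h" shows "tc (\<lambda>z. rnat (f z) (g z) (h z))"
  unfolding rnat_def by (intro tc_intros assms tc_comp[OF assms(1)] tc_comp[OF assms(3)])

lemma tc_rpow [tc_intros]: assumes "tc f" "tc g" "tc h" shows "tc (\<lambda>z. rpow (f z) (g z) (h z))"
  unfolding rpow_def by (intro tc_intros assms tc_comp[OF assms(1)] tc_comp[OF assms(3)])

lemma tc_rint [tc_intros]: assumes "tc f" "tc g" "tc h" shows "tc (\<lambda>z. rint (f z) (g z) (h z))"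
  unfolding rint_def by (intro tc_intros assms)

lemma tc_rmonom [tc_intros]: assumes "tc f" "tc g" "tc h" shows "tc (\<lambda>z. rmonom (f z) (g z) (h z))"
  unfolding rmonom_def by (intro tc_intros assms tc_comp[OF assms(1)])

lemma tc_rpoly [tc_intros]: assumes "tc f" "tc g" "tc h" shows "tc (\<lambda>z. rpoly (f z) (g z) (h z))"
  unfolding rpoly_def by (intro tc_intros assms tc_comp[OF assms(1)] tc_comp[OF assms(3)])

lemma rnat_eq: "x \<in> carrier (R n) \<Longrightarrow> rnat n k x = add_pow (R n) k x"
proof (induction k)
  case (Suc k)
  then show ?case using R.add.nat_pow_closed[of x n k]
    by (simp add: rnat_def radd_def)
qed (simp add: rnat_def)

lemma rpow_eq: "x \<in> carrier (R n) \<Longrightarrow> rpow n k x = x [^]\<^bsub>R n\<^esub> k"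
proof (induction k)
  case (Suc k)
  then show ?case using R.nat_pow_closed[of x n k]
    by (simp add: rpow_def rmul_def)
qed (simp add: rpow_def)

lemma rint_eq: assumes "x \<in> carrier (R n)" shows "rint n c x = add_pow (R n) (int_decode c) x"
proof (cases "c = half c + half c")
  case True
  then have "int_decode c = int (half c)" by (simp add: int_decode_half)
  then show ?thesis using True rnat_eq[OF assms]
    by (simp add: rint_def add_pow_def int_pow_int)
next
  case False
  then have c: "int_decode c = - int (Suc (half c))" by (simp add: int_decode_half)
  have "add_pow (R n) (- int (Suc (half c))) x = \<ominus>\<^bsub>R n\<^esub> (add_pow (R n) (int (Suc (half c))) x)"
    using assms by (rule R.add.int_pow_neg)
  moreover have "add_pow (R n) (int (Suc (half c))) x = add_pow (R n) (Suc (half c)) x"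
    by (simp only: add_pow_def int_pow_int)
  moreover have "add_pow (R n) (Suc (half c)) x \<in> carrier (R n)"
    by (rule R.add.nat_pow_closed[OF assms])
  ultimately show ?thesis unfolding c rint_def using False rnat_eq[OF assms, of "Suc (half c)"]
    by (simp only: rneg_def if_False if_True)
qed

lemma monom_closed:
  assumes "set xs \<subseteq> carrier (R n)"
  shows "foldr (\<lambda>(x, k) t. (x [^]\<^bsub>R n\<^esub> (k::nat)) \<otimes>\<^bsub>R n\<^esub> t) (zip xs e) \<one>\<^bsub>R n\<^esub> \<in> carrier (R n)"
proof -
  have "foldr (\<lambda>(x, k) t. (x [^]\<^bsub>R n\<^esub> (k::nat)) \<otimes>\<^bsub>R n\<^esub> t) ys \<one>\<^bsub>R n\<^esub> \<in> carrier (R n)"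
    if "fst ` set ys \<subseteq> carrier (R n)" for ys using that by (induction ys) auto
  moreover have "fst ` set (zip xs e) \<subseteq> carrier (R n)" using assms by (auto dest: set_zip_leftD)
  ultimately show ?thesis by blast
qed

lemma rmonom_eq:
  assumes "set (list_decode xs) \<subseteq> carrier (R n)"
  shows "rmonom n e xs = foldr (\<lambda>(x, k) t. (x [^]\<^bsub>R n\<^esub> (k::nat)) \<otimes>\<^bsub>R n\<^esub> t)
    (zip (list_decode xs) (list_decode e)) \<one>\<^bsub>R n\<^esub>"
proof -
  have "foldr (\<lambda>z t. rmul R n (rpow n (psnd z) (pfst z)) t) (map prod_encode ys) \<one>\<^bsub>R n\<^esub>
     = foldr (\<lambda>(x, k) t. (x [^]\<^bsub>R n\<^esub> (k::nat)) \<otimes>\<^bsub>R n\<^esub> t) ys \<one>\<^bsub>R n\<^esub> \<and>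
     foldr (\<lambda>(x, k) t. (x [^]\<^bsub>R n\<^esub> (k::nat)) \<otimes>\<^bsub>R n\<^esub> t) ys \<one>\<^bsub>R n\<^esub> \<in> carrier (R n)"
    if "fst ` set ys \<subseteq> carrier (R n)" for ys
    using that by (induction ys) (auto simp: rpow_eq rmul_def)
  moreover have "fst ` set (zip (list_decode xs) (list_decode e)) \<subseteq> carrier (R n)"
    using assms by (auto dest: set_zip_leftD)
  ultimately show ?thesis by (simp add: rmonom_def list_decode_lzip)
qed

lemma rpoly_eq:
  assumes xs: "set (list_decode xs) \<subseteq> carrier (R n)"
  shows "rpoly n p xs = poly_eval (R n) p (list_decode xs)" "poly_eval (R n) p (list_decode xs) \<in> carrier (R n)"
proof -
  have "rpoly n p xs = poly_eval (R n) p (list_decode xs) \<and> poly_eval (R n) p (list_decode xs) \<in> carrier (R n)"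
    unfolding rpoly_def poly_eval_def poly_terms_def
  proof (induction "list_decode p" arbitrary: p)
    case (Cons t ts)
    from Cons(1)[of "list_encode ts"] show ?case
      unfolding Cons(2)[symmetric] using rint_eq[OF monom_closed[OF xs, of "list_decode (psnd t)"], of "pfst t"]
        R.add.int_pow_closed[OF monom_closed[OF xs, of "list_decode (psnd t)"], of "int_decode (pfst t)"]
      by (simp add: rmonom_eq[OF xs] radd_def del: R.add.int_pow_closed)
  qed simp
  then show "rpoly n p xs = poly_eval (R n) p (list_decode xs)" "poly_eval (R n) p (list_decode xs) \<in> carrier (R n)"
    by blast+
qed

end

lemma poly_var_foldr:
  "poly_var p = foldr (\<lambda>t m. if length (list_decode (psnd t)) \<le> m then m else length (list_decode (psnd t)))
     (list_decode p) 0"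
proof -
  have "Max (insert 0 ((\<lambda>(c, e). length e) ` set (map (\<lambda>t. (int_decode (pfst t), list_decode (psnd t))) ts))) =
    foldr (\<lambda>t m. if length (list_decode (psnd t)) \<le> m then m else length (list_decode (psnd t))) ts 0" for ts
  proof (induction ts)
    case (Cons t ts)
    let ?A = "(\<lambda>(c, e). length e) ` set (map (\<lambda>t. (int_decode (pfst t), list_decode (psnd t))) ts)"
    have "Max (insert 0 (insert (length (list_decode (psnd t))) ?A)) = max (length (list_decode (psnd t))) (Max (insert 0 ?A))"
      by (subst insert_commute) (rule Max_insert, auto)
    then show ?case using Cons by (simp add: max_def)
  qed simp
  then show ?thesis by (simp add: poly_var_def poly_terms_def)
qed

lemma tc_poly_var [tc_intros]: assumes "tc f" shows "tc (\<lambda>x. poly_var (f x))"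
  unfolding poly_var_foldr by (intro tc_intros assms)

text \<open>A test for strict sortedness from the right: the value 0 records a failure, 1 the empty
  list, and k + 2 a sorted list with first key k.\<close>

lemma sorted_foldr:
  "foldr (\<lambda>t s. if s = 0 then 0 else if s = 1 then h t + 2 else if h t + 2 < s then h t + 2 else 0) ts 1
     = (if sorted_wrt (<) (map h ts) then (case ts of [] \<Rightarrow> 1 | t # _ \<Rightarrow> h t + 2) else (0::nat))"
proof (induction ts)
  case (Cons t ts)
  show ?case
  proof (cases ts)
    case (Cons a list)
    have "sorted_wrt (<) (map h (t # ts)) \<longleftrightarrow> h t < h a \<and> sorted_wrt (<) (map h ts)"
      unfolding Cons list.map by (rule sorted_wrt2) simp
    then show ?thesis using Cons.IH by (auto simp: Cons simp del: sorted_wrt.simps list.map)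
  qed simp
qed simp

lemma decidable_polys [tc_intros]: assumes "tc f" shows "decidable (\<lambda>x. f x \<in> polys)"
proof -
  have dec0: "int_decode n = 0 \<longleftrightarrow> n = 0" for n
    unfolding int_decode_half half_def by (cases "n = n div 2 + n div 2") (simp_all, presburger+)
  have last: "fold (\<lambda>x _. x) e a = (if e = [] then a else last e)" for e :: "nat list" and a
    by (induction e arbitrary: a) auto
  have empty: "list_decode n = [] \<longleftrightarrow> n = 0" for n by (cases n) (auto simp: case_prod_beta)
  \<comment> \<open>The last exponent is read by a fold that starts at 1; this nonzero start value
    lets the empty exponent list pass.\<close>
  have "p \<in> polys \<longleftrightarrow> (\<forall>t\<in>set (list_decode p). pfst t \<noteq> 0 \<and> fold (\<lambda>x _. x) (list_decode (psnd t)) 1 \<noteq> 0) \<and>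
      foldr (\<lambda>t s. if s = 0 then 0 else if s = 1 then psnd t + 2 else if psnd t + 2 < s then psnd t + 2 else 0)
        (list_decode p) 1 \<noteq> 0" for p
    unfolding sorted_foldr polys_def poly_terms_def last
    by (auto simp: dec0 comp_def split: list.splits if_splits)
  then show ?thesis by (simp only:) (intro tc_intros assms)
qed

section \<open>Cohesive products of groups and fields\<close>

lemma map_option_along: "map_option h (along R l i) = map_option (\<lambda>n. h (R n)) (l i)"
  by (simp add: along_def option.map_comp comp_def)

lemma cprod_ring_carrier: "carrier (cprod_ring C (along R l)) = cprod C (along (\<lambda>n. carrier (R n)) l)"
  by (simp add: cprod_ring_def carriers_along)

locale hyper_field = cohesive_set C + uniform_fields R for C R +
  fixes l :: pfun
  assumes l: "hidx C l"
begin

abbreviation S where "S \<equiv> \<lambda>n. carrier (R n)"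
abbreviation v where "v i \<equiv> the (l i)"
abbreviation P where "P \<equiv> cprod_ring C (along R l)"

lemmas S_cl_eq = cl_eq_iff[OF l usd_carrier]
lemmas S_cprodI = cprodI[OF l usd_carrier]

lemma mult_cl:
  assumes "el S l f" "el S l g"
  shows "cl S l f \<otimes>\<^bsub>P\<^esub> cl S l g = cl S l (\<lambda>i. f i \<otimes>\<^bsub>R (v i)\<^esub> g i)" "el S l (\<lambda>i. f i \<otimes>\<^bsub>R (v i)\<^esub> g i)"
proof -
  have ae: "\<forall>\<^sub>F i in F. f i \<otimes>\<^bsub>R (v i)\<^esub> g i = rmul R (the (l i)) (f i) (g i)"
    using el_ae[OF assms(1)] el_ae[OF assms(2)] by eventually_elim (simp add: rmul_def)
  have *: "cmap2 C (along S l) (\<lambda>i. map_option monoid.mult (along R l i)) (cl S l f) (cl S l g)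
      = cl S l (\<lambda>i. f i \<otimes>\<^bsub>R (v i)\<^esub> g i) \<and> el S l (\<lambda>i. f i \<otimes>\<^bsub>R (v i)\<^esub> g i)"
    by (rule cmap2_cl[where G = "rmul R", OF l usd_carrier assms(1) l usd_carrier assms(2) l _ _ ae], intro tc_intros)
      (auto simp: along_def rmul_def)
  then show "cl S l f \<otimes>\<^bsub>P\<^esub> cl S l g = cl S l (\<lambda>i. f i \<otimes>\<^bsub>R (v i)\<^esub> g i)" "el S l (\<lambda>i. f i \<otimes>\<^bsub>R (v i)\<^esub> g i)"
    by (simp_all add: cprod_ring_def carriers_along)
qed

lemma add_cl:
  assumes "el S l f" "el S l g"
  shows "cl S l f \<oplus>\<^bsub>P\<^esub> cl S l g = cl S l (\<lambda>i. f i \<oplus>\<^bsub>R (v i)\<^esub> g i)" "el S l (\<lambda>i. f i \<oplus>\<^bsub>R (v i)\<^esub> g i)"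
proof -
  have ae: "\<forall>\<^sub>F i in F. f i \<oplus>\<^bsub>R (v i)\<^esub> g i = radd R (the (l i)) (f i) (g i)"
    using el_ae[OF assms(1)] el_ae[OF assms(2)] by eventually_elim (simp add: radd_def)
  have *: "cmap2 C (along S l) (\<lambda>i. map_option ring.add (along R l i)) (cl S l f) (cl S l g)
      = cl S l (\<lambda>i. f i \<oplus>\<^bsub>R (v i)\<^esub> g i) \<and> el S l (\<lambda>i. f i \<oplus>\<^bsub>R (v i)\<^esub> g i)"
    by (rule cmap2_cl[where G = "radd R", OF l usd_carrier assms(1) l usd_carrier assms(2) l _ _ ae], intro tc_intros)
      (auto simp: along_def radd_def)
  then show "cl S l f \<oplus>\<^bsub>P\<^esub> cl S l g = cl S l (\<lambda>i. f i \<oplus>\<^bsub>R (v i)\<^esub> g i)" "el S l (\<lambda>i. f i \<oplus>\<^bsub>R (v i)\<^esub> g i)"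
    by (simp_all add: cprod_ring_def carriers_along)
qed

lemma const_cl:
  assumes "tc h" "\<And>n. h n \<in> S n"
  shows "ccls C (along S l) (\<lambda>i. map_option h (l i)) = cl S l (\<lambda>i. h (v i))" "el S l (\<lambda>i. h (v i))"
proof -
  have "partial_computable (\<lambda>i. map_option h (l i))"
    using partial_computable.comp[OF assms(1)[unfolded tc_def], of l] l
    by (simp add: hidx_def map_conv_bind_option comp_def)
  moreover have ae: "\<forall>\<^sub>F i in F. map_option h (l i) = Some (h (v i))"
    using hidx_ex[OF l] by (rule eventually_mono) auto
  ultimately have "(\<lambda>i. map_option h (l i)) \<in> cpre C (along S l)"
    using assms(2) l by (auto simp: cpre_along hidx_def)
  from ccls_cl[OF this ae] show "ccls C (along S l) (\<lambda>i. map_option h (l i)) = cl S l (\<lambda>i. h (v i))" .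
  show "el S l (\<lambda>i. h (v i))" by (rule elI, rule hc_comp[OF assms(1) hidx_val[OF l]]) (simp add: assms(2))
qed

lemma zero_cl: "\<zero>\<^bsub>P\<^esub> = cl S l (\<lambda>i. \<zero>\<^bsub>R (v i)\<^esub>)" "el S l (\<lambda>i. \<zero>\<^bsub>R (v i)\<^esub>)"
  using const_cl(1)[OF tc_ring_zero R.zero_closed] const_cl(2)[OF tc_ring_zero R.zero_closed]
  by (simp_all only: cprod_ring_def carriers_along map_option_along ring.simps monoid.simps partial_object.simps)

lemma one_cl: "\<one>\<^bsub>P\<^esub> = cl S l (\<lambda>i. \<one>\<^bsub>R (v i)\<^esub>)" "el S l (\<lambda>i. \<one>\<^bsub>R (v i)\<^esub>)"
  using const_cl(1)[OF tc_ring_one R.one_closed] const_cl(2)[OF tc_ring_one R.one_closed]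
  by (simp_all only: cprod_ring_def carriers_along map_option_along ring.simps monoid.simps partial_object.simps)

lemma carrier_elim:
  assumes "x \<in> carrier P" obtains f where "el S l f" "x = cl S l f"
  by (rule cprodE[OF assms[unfolded cprod_ring_carrier]])

lemma carrier_intro: "el S l f \<Longrightarrow> cl S l f \<in> carrier P"
  unfolding cprod_ring_carrier by (rule S_cprodI)

text \<open>Transfers an identity from the factors. The finite set \<open>A\<close> lists the
  operands whose membership in the factors the identity relies on, so that one rule handles any
  number of variables.\<close>

lemma cl_eqI:
  assumes "\<And>i. \<lbrakk>\<And>f. f \<in> A \<Longrightarrow> f i \<in> S (v i)\<rbrakk> \<Longrightarrow> g i = h i" "finite A" "\<And>f. f \<in> A \<Longrightarrow> el S l f"
  shows "cl S l g = cl S l h"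
proof (rule cl_cong)
  have "\<forall>\<^sub>F i in F. \<forall>f\<in>A. f i \<in> S (v i)"
    by (intro eventually_ball_finite[OF assms(2)] ballI el_ae[OF assms(3)])
  then show "\<forall>\<^sub>F i in F. g i = h i" by eventually_elim (rule assms(1), simp)
qed

lemma el_neg: assumes "el S l f" shows "el S l (\<lambda>i. \<ominus>\<^bsub>R (v i)\<^esub> f i)"
proof -
  have "el S l (\<lambda>i. rneg R (v i) (f i))"
  proof (rule elI)
    have "tc (\<lambda>z. rneg R (pfst z) (psnd z))" by (intro tc_intros)
    then show "hc C (\<lambda>i. rneg R (v i) (f i))" by (rule hc_comp2[OF _ hidx_val[OF l] el_hc[OF assms]])
    show "\<forall>\<^sub>F i in F. rneg R (v i) (f i) \<in> S (v i)" using el_ae[OF assms] by eventually_elim (simp add: rneg_def)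
  qed
  then show ?thesis
    by (rule el_cong) (use el_ae[OF assms] in \<open>auto simp: rneg_def elim: eventually_mono\<close>)
qed

lemma field_P: "field P"
proof -
  have cring: "cring P"
  proof (rule cringI)
    show "abelian_group P"
    proof (rule abelian_groupI)
      fix x y assume "x \<in> carrier P" "y \<in> carrier P"
      then show "x \<oplus>\<^bsub>P\<^esub> y \<in> carrier P"
        by (elim carrier_elim) (simp add: add_cl carrier_intro)
    next
      show "\<zero>\<^bsub>P\<^esub> \<in> carrier P" using zero_cl carrier_intro by simp
    next
      fix x y z assume "x \<in> carrier P" "y \<in> carrier P" "z \<in> carrier P"
      then obtain f g h where e: "el S l f" "el S l g" "el S l h" "x = cl S l f" "y = cl S l g" "z = cl S l h"
        by (elim carrier_elim) blast
      show "x \<oplus>\<^bsub>P\<^esub> y \<oplus>\<^bsub>P\<^esub> z = x \<oplus>\<^bsub>P\<^esub> (y \<oplus>\<^bsub>P\<^esub> z)" unfolding e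
        using e(1-3) by (simp add: add_cl) (rule cl_eqI[of "{f, g, h}"], auto simp: R.a_assoc)
    next
      fix x y assume "x \<in> carrier P" "y \<in> carrier P"
      then obtain f g where e: "el S l f" "el S l g" "x = cl S l f" "y = cl S l g"
        by (elim carrier_elim) blast
      show "x \<oplus>\<^bsub>P\<^esub> y = y \<oplus>\<^bsub>P\<^esub> x" unfolding e
        using e(1-2) by (simp add: add_cl) (rule cl_eqI[of "{f, g}"], auto simp: R.a_comm)
    next
      fix x assume "x \<in> carrier P"
      then obtain f where e: "el S l f" "x = cl S l f" by (elim carrier_elim) blast
      show "\<zero>\<^bsub>P\<^esub> \<oplus>\<^bsub>P\<^esub> x = x" unfolding e zero_cl
        using e(1) zero_cl(2) by (simp add: add_cl) (rule cl_eqI[of "{f}"], auto)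
      have "cl S l (\<lambda>i. \<ominus>\<^bsub>R (v i)\<^esub> f i) \<oplus>\<^bsub>P\<^esub> x = \<zero>\<^bsub>P\<^esub>" unfolding e zero_cl
        using e(1) el_neg[OF e(1)] by (simp add: add_cl) (rule cl_eqI[of "{f}"], auto simp: R.l_neg)
      then show "\<exists>y\<in>carrier P. y \<oplus>\<^bsub>P\<^esub> x = \<zero>\<^bsub>P\<^esub>" using carrier_intro[OF el_neg[OF e(1)]] by blast
    qed
    show "Group.comm_monoid P"
    proof (rule comm_monoidI)
      fix x y assume "x \<in> carrier P" "y \<in> carrier P"
      then show "x \<otimes>\<^bsub>P\<^esub> y \<in> carrier P"
        by (elim carrier_elim) (simp add: mult_cl carrier_intro)
    next
      show "\<one>\<^bsub>P\<^esub> \<in> carrier P" using one_cl carrier_intro by simp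
    next
      fix x y z assume "x \<in> carrier P" "y \<in> carrier P" "z \<in> carrier P"
      then obtain f g h where e: "el S l f" "el S l g" "el S l h" "x = cl S l f" "y = cl S l g" "z = cl S l h"
        by (elim carrier_elim) blast
      show "x \<otimes>\<^bsub>P\<^esub> y \<otimes>\<^bsub>P\<^esub> z = x \<otimes>\<^bsub>P\<^esub> (y \<otimes>\<^bsub>P\<^esub> z)" unfolding e
        using e(1-3) by (simp add: mult_cl) (rule cl_eqI[of "{f, g, h}"], auto simp: R.m_assoc)
    next
      fix x y assume "x \<in> carrier P" "y \<in> carrier P"
      then obtain f g where e: "el S l f" "el S l g" "x = cl S l f" "y = cl S l g"
        by (elim carrier_elim) blast
      show "x \<otimes>\<^bsub>P\<^esub> y = y \<otimes>\<^bsub>P\<^esub> x" unfolding e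
        using e(1-2) by (simp add: mult_cl) (rule cl_eqI[of "{f, g}"], auto simp: R.m_comm)
    next
      fix x assume "x \<in> carrier P"
      then obtain f where e: "el S l f" "x = cl S l f" by (elim carrier_elim) blast
      show "\<one>\<^bsub>P\<^esub> \<otimes>\<^bsub>P\<^esub> x = x" unfolding e one_cl
        using e(1) one_cl(2) by (simp add: mult_cl) (rule cl_eqI[of "{f}"], auto)
    qed
    fix x y z assume "x \<in> carrier P" "y \<in> carrier P" "z \<in> carrier P"
    then obtain f g h where e: "el S l f" "el S l g" "el S l h" "x = cl S l f" "y = cl S l g" "z = cl S l h"
      by (elim carrier_elim) blast
    show "(x \<oplus>\<^bsub>P\<^esub> y) \<otimes>\<^bsub>P\<^esub> z = x \<otimes>\<^bsub>P\<^esub> z \<oplus>\<^bsub>P\<^esub> y \<otimes>\<^bsub>P\<^esub> z" unfolding e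
      using e(1-3) by (simp add: add_cl mult_cl) (rule cl_eqI[of "{f, g, h}"], auto simp: R.l_distr)
  qed
  show ?thesis
  proof (rule cring.cring_fieldI2[OF cring])
    show "\<zero>\<^bsub>P\<^esub> \<noteq> \<one>\<^bsub>P\<^esub>" unfolding zero_cl one_cl S_cl_eq[OF zero_cl(2)] by simp
    fix x assume x: "x \<in> carrier P" "x \<noteq> \<zero>\<^bsub>P\<^esub>"
    then obtain f where e: "el S l f" "x = cl S l f" by (elim carrier_elim) blast
    have d: "decidable (\<lambda>z. psnd z = \<zero>\<^bsub>R (pfst z)\<^esub>)" by (intro tc_intros)
    \<comment> \<open>Being nonzero in the product only denies vanishing almost everywhere. Since
      equality with zero is decidable, cohesiveness strengthens this to nonvanishing almost
      everywhere, and inverses can then be searched for.\<close>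
    have "\<not> (\<forall>\<^sub>F i in F. f i = \<zero>\<^bsub>R (v i)\<^esub>)"
      using x(2) cl_cong[of f "\<lambda>i. \<zero>\<^bsub>R (v i)\<^esub>"] unfolding e(2) zero_cl(1) by blast
    then have "\<forall>\<^sub>F i in F. f i \<noteq> \<zero>\<^bsub>R (v i)\<^esub>"
      using hc_dichotomy[OF d hc_pair[OF hidx_val[OF l] el_hc[OF e(1)]]] by simp
    with el_ae[OF e(1)] have inv: "\<forall>\<^sub>F i in F. \<exists>k. k \<in> S (v i) \<and> rmul R (v i) (f i) k = \<one>\<^bsub>R (v i)\<^esub>"
    proof eventually_elim
      case (elim i)
      then have "f i \<in> Units (R (v i))" by (simp add: R.field_Units)
      then show ?case using R.Units_inv_closed R.Units_r_inv R.Units_closed by (intro exI[of _ "inv\<^bsub>R (v i)\<^esub> f i"]) (simp add: rmul_def)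
    qed
    have d: "decidable (\<lambda>w. psnd w \<in> S (pfst (pfst w)) \<and> rmul R (pfst (pfst w)) (psnd (pfst w)) (psnd w) = \<one>\<^bsub>R (pfst (pfst w))\<^esub>)"
      by (intro tc_intros)
    obtain g where g: "hc C g" "\<forall>\<^sub>F i in F. g i \<in> S (v i) \<and> rmul R (v i) (f i) (g i) = \<one>\<^bsub>R (v i)\<^esub>"
      using hc_search[of "\<lambda>z k. k \<in> S (pfst z) \<and> rmul R (pfst z) (psnd z) k = \<one>\<^bsub>R (pfst z)\<^esub>", OF d hc_pair[OF hidx_val[OF l] el_hc[OF e(1)]]] inv
      by auto
    have eg: "el S l g" using g by (auto intro!: elI elim: eventually_mono)
    have "\<forall>\<^sub>F i in F. f i \<otimes>\<^bsub>R (v i)\<^esub> g i = \<one>\<^bsub>R (v i)\<^esub>"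
      using g(2) el_ae[OF e(1)] by eventually_elim (auto simp: rmul_def)
    then have "x \<otimes>\<^bsub>P\<^esub> cl S l g = \<one>\<^bsub>P\<^esub>" unfolding e one_cl mult_cl[OF e(1) eg] by (rule cl_cong)
    then show "\<exists>b\<in>carrier P. x \<otimes>\<^bsub>P\<^esub> b = \<one>\<^bsub>P\<^esub>" using carrier_intro[OF eg] by blast
  qed
qed

end

section \<open>Groups acting on fields\<close>

text \<open>This identity and the next are the ring arithmetic of the elimination in
  \<open>dedekind_independence\<close>, stated for plain variables so that \<open>algebra\<close>
  applies.\<close>

lemma (in cring) twisted_term_identity:
  "c \<in> carrier R \<Longrightarrow> a \<in> carrier R \<Longrightarrow> t \<in> carrier R \<Longrightarrow> x \<in> carrier R \<Longrightarrow>
    c \<otimes> (a \<ominus> t) \<otimes> x = c \<otimes> (a \<otimes> x) \<oplus> (\<ominus> t) \<otimes> (c \<otimes> x)"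
  by algebra

lemma (in cring) twisted_sum_identity:
  "A \<in> carrier R \<Longrightarrow> B \<in> carrier R \<Longrightarrow> c \<in> carrier R \<Longrightarrow> u \<in> carrier R \<Longrightarrow> t \<in> carrier R \<Longrightarrow>
    A \<oplus> (\<ominus> t) \<otimes> B = (c \<otimes> (t \<otimes> u) \<oplus> A) \<ominus> t \<otimes> (c \<otimes> u \<oplus> B)"
  by algebra

text \<open>Elimination of one homomorphism: for \<open>y\<close> with
  \<open>\<chi> k y \<noteq> \<chi> j y\<close>, subtracting \<open>\<chi> j y\<close> times the
  relation at \<open>x\<close> from the relation at \<open>y \<otimes> x\<close> removes the term of
  \<open>j\<close> and multiplies the coefficient of \<open>i\<close> by
  \<open>\<chi> i y \<ominus> \<chi> j y\<close>. By induction the shorter relation is trivial, and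
  its factor at \<open>k\<close> is nonzero.\<close>

lemma (in field) dedekind_independence:
  assumes "finite I"
    and "\<And>i. i \<in> I \<Longrightarrow> \<chi> i \<in> ring_hom R R"
    and "\<And>i j. i \<in> I \<Longrightarrow> j \<in> I \<Longrightarrow> i \<noteq> j \<Longrightarrow> \<exists>x\<in>carrier R. \<chi> i x \<noteq> \<chi> j x"
    and "\<And>i. i \<in> I \<Longrightarrow> c i \<in> carrier R"
    and "\<And>x. x \<in> carrier R \<Longrightarrow> (\<Oplus>i\<in>I. c i \<otimes> \<chi> i x) = \<zero>"
    and "k \<in> I"
  shows "c k = \<zero>"
  using assms
proof (induction I arbitrary: c k rule: finite_induct)
  case (insert j I)
  note hom = insert.prems(1) and dist = insert.prems(2) and c = insert.prems(3) and sum = insert.prems(4)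
  have cl: "\<chi> i x \<in> carrier R" if "i \<in> insert j I" "x \<in> carrier R" for i x
    using ring_hom_closed[OF hom[OF that(1)] that(2)] .
  have zero: "c k = \<zero>" if k: "k \<in> I" for k
  proof -
    have "k \<noteq> j" using k insert.hyps by auto
    then obtain y where y: "y \<in> carrier R" "\<chi> k y \<noteq> \<chi> j y" using dist[of k j] k by auto
    let ?t = "\<chi> j y"
    define d where "d i = c i \<otimes> (\<chi> i y \<ominus> ?t)" for i
    have t: "?t \<in> carrier R" using cl y by blast
    have "(\<Oplus>i\<in>I. d i \<otimes> \<chi> i x) = \<zero>" if x: "x \<in> carrier R" for x
    proof -
      let ?u = "\<chi> j x" and ?A = "\<Oplus>i\<in>I. c i \<otimes> \<chi> i (y \<otimes> x)" and ?B = "\<Oplus>i\<in>I. c i \<otimes> \<chi> i x"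
      have cj: "c j \<in> carrier R" and u: "?u \<in> carrier R" using c cl x by auto
      have inB: "(\<lambda>i. c i \<otimes> \<chi> i x) \<in> I \<rightarrow> carrier R" using c cl x by auto
      have inA: "(\<lambda>i. c i \<otimes> \<chi> i (y \<otimes> x)) \<in> I \<rightarrow> carrier R" using c cl x y by auto
      have AB: "?A \<in> carrier R" "?B \<in> carrier R"
        using finsum_closed[OF inA] finsum_closed[OF inB] by simp_all
      have "c j \<otimes> \<chi> j (y \<otimes> x) \<oplus> ?A = \<zero>"
        using sum[of "y \<otimes> x"] insert.hyps x y inA cj cl by simp
      then have eA: "c j \<otimes> (?t \<otimes> ?u) \<oplus> ?A = \<zero>"
        using ring_hom_mult[OF hom[of j] y(1) x] by simp
      have eB: "c j \<otimes> ?u \<oplus> ?B = \<zero>"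
        using sum[of x] insert.hyps x inB cj cl by simp
      have "(\<Oplus>i\<in>I. d i \<otimes> \<chi> i x) = (\<Oplus>i\<in>I. c i \<otimes> \<chi> i (y \<otimes> x) \<oplus> (\<ominus> ?t) \<otimes> (c i \<otimes> \<chi> i x))"
      proof (rule finsum_cong')
        fix i assume i: "i \<in> I"
        have m: "\<chi> i (y \<otimes> x) = \<chi> i y \<otimes> \<chi> i x" using ring_hom_mult[OF hom[of i] y(1) x] i by simp
        have "c i \<in> carrier R" "\<chi> i x \<in> carrier R" "\<chi> i y \<in> carrier R" using i c cl x y by auto
        then show "d i \<otimes> \<chi> i x = c i \<otimes> \<chi> i (y \<otimes> x) \<oplus> (\<ominus> ?t) \<otimes> (c i \<otimes> \<chi> i x)"
          unfolding d_def m using t by (intro twisted_term_identity)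
      qed (use inA inB t in auto)
      also have "\<dots> = ?A \<oplus> (\<ominus> ?t) \<otimes> ?B"
        using inA inB t insert.hyps by (subst finsum_addf) (auto simp: finsum_rdistr)
      also have "\<dots> = (c j \<otimes> (?t \<otimes> ?u) \<oplus> ?A) \<ominus> ?t \<otimes> (c j \<otimes> ?u \<oplus> ?B)"
        using AB cj u t by (intro twisted_sum_identity)
      also have "\<dots> = \<zero>" unfolding eA eB using t by (simp add: a_minus_def)
      finally show ?thesis .
    qed
    moreover have "d i \<in> carrier R" if "i \<in> I" for i using that c cl y t by (auto simp: d_def)
    ultimately have "d k = \<zero>" using insert.IH[of d k] hom dist k by auto
    moreover have "\<chi> k y \<in> carrier R" using cl k y by blast
    moreover have "\<chi> k y \<ominus> ?t \<noteq> \<zero>" using y t \<open>\<chi> k y \<in> carrier R\<close> by (simp add: r_right_minus_eq)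
    ultimately show ?thesis using integral[of "c k" "\<chi> k y \<ominus> ?t"] c k t by (auto simp: d_def)
  qed
  \<comment> \<open>With all other coefficients zero, evaluation at one leaves \<open>c j\<close>
    alone.\<close>
  have "(\<Oplus>i\<in>I. c i \<otimes> \<chi> i \<one>) = (\<Oplus>i\<in>I. \<zero>)"
    using zero ring_hom_one[OF hom] by (intro finsum_cong') auto
  then have "c j = \<zero>" using sum[of \<one>] insert.hyps c ring_hom_one[OF hom[of j]] cl
    by (auto simp: Pi_def)
  then show ?case using zero insert.prems(5) by blast
qed simp

text \<open>Instantiated both by the finite Galois groups of the levels and by the product groups
  \<open>G_lev C E l\<close>, which may be infinite; finiteness and faithfulness are therefore added
  only in \<open>finite_action\<close>.\<close>

locale field_action = K: field K + G: group G for K :: "'a ring" and G :: "'g monoid" +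
  fixes act :: "'g \<Rightarrow> 'a \<Rightarrow> 'a" and B :: "'a set"
  assumes act_hom: "g \<in> carrier G \<Longrightarrow> act g \<in> ring_hom K K"
    and act_mult: "g \<in> carrier G \<Longrightarrow> h \<in> carrier G \<Longrightarrow> x \<in> carrier K \<Longrightarrow> act (g \<otimes>\<^bsub>G\<^esub> h) x = act g (act h x)"
    and act_one: "x \<in> carrier K \<Longrightarrow> act \<one>\<^bsub>G\<^esub> x = x"
    and fixed: "B = {x \<in> carrier K. \<forall>g\<in>carrier G. act g x = x}"
begin

lemma act_closed [simp]: "g \<in> carrier G \<Longrightarrow> x \<in> carrier K \<Longrightarrow> act g x \<in> carrier K"
  by (rule ring_hom_closed[OF act_hom])

lemma act_inv [simp]:
  "g \<in> carrier G \<Longrightarrow> x \<in> carrier K \<Longrightarrow> act (inv\<^bsub>G\<^esub> g) (act g x) = x"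
  "g \<in> carrier G \<Longrightarrow> x \<in> carrier K \<Longrightarrow> act g (act (inv\<^bsub>G\<^esub> g) x) = x"
  by (simp_all add: act_mult[symmetric] act_one)

lemma hom_act: "g \<in> carrier G \<Longrightarrow> ring_hom_cring K K (act g)"
  by (simp add: ring_hom_cringI act_hom K.is_cring)

definition orbit :: "'a \<Rightarrow> 'a set" where
  "orbit x = (\<lambda>g. act g x) ` carrier G"

lemma orbit_self: "x \<in> carrier K \<Longrightarrow> x \<in> orbit x"
  unfolding orbit_def by (rule image_eqI[of _ _ "\<one>\<^bsub>G\<^esub>"]) (simp_all add: act_one)

lemma orbit_closed: "x \<in> carrier K \<Longrightarrow> orbit x \<subseteq> carrier K"
  by (auto simp: orbit_def)

lemma act_orbit: assumes "g \<in> carrier G" "x \<in> carrier K" shows "act g ` orbit x = orbit x"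
proof
  show "act g ` orbit x \<subseteq> orbit x"
    using assms unfolding orbit_def by (force simp: act_mult[symmetric])
  show "orbit x \<subseteq> act g ` orbit x"
  proof
    fix y assume "y \<in> orbit x"
    then obtain h where h: "h \<in> carrier G" "y = act h x" by (auto simp: orbit_def)
    have "y = act g (act (inv\<^bsub>G\<^esub> g \<otimes>\<^bsub>G\<^esub> h) x)" using assms h by (simp add: act_mult)
    then show "y \<in> act g ` orbit x" using assms h unfolding orbit_def by blast
  qed
qed

end

text \<open>The product of the linear factors X - a. Polynomials are coefficient lists with the
  leading coefficient first, hence \<open>[\<one>, \<ominus> a]\<close>.\<close>

definition (in ring) root_poly :: "'a set \<Rightarrow> 'a list" where
  "root_poly A = finprod (poly_ring R) (\<lambda>a. [\<one>, \<ominus> a]) A"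

context field
begin

lemma linear_poly: "a \<in> carrier R \<Longrightarrow> [\<one>, \<ominus> a] \<in> carrier (poly_ring R)"
  by (auto simp: univ_poly_carrier[symmetric] polynomial_def)

lemma poly_ring_comm: "Group.comm_monoid (poly_ring R)"
  using domain.axioms(1)[OF univ_poly_is_domain[OF carrier_is_subring]] cring_def by blast

lemma root_poly_closed: "A \<subseteq> carrier R \<Longrightarrow> root_poly A \<in> carrier (poly_ring R)"
  unfolding root_poly_def
  by (rule comm_monoid.finprod_closed[OF poly_ring_comm]) (auto intro: linear_poly)

lemma root_poly_insert:
  assumes "finite A" "a \<notin> A" "insert a A \<subseteq> carrier R"
  shows "root_poly (insert a A) = poly_mult [\<one>, \<ominus> a] (root_poly A)"
  unfolding root_poly_def
  using comm_monoid.finprod_insert[OF poly_ring_comm assms(1,2), of "\<lambda>a. [\<one>, \<ominus> a]"] assms(3) linear_poly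
  by (simp add: univ_poly_mult Pi_def subset_iff)

lemma root_poly_empty: "root_poly {} = [\<one>]"
  unfolding root_poly_def using comm_monoid.finprod_empty[OF poly_ring_comm] by (simp add: univ_poly_one)

lemma poly_ring_set: "p \<in> carrier (poly_ring R) \<Longrightarrow> set p \<subseteq> carrier R"
  by (auto simp: univ_poly_carrier[symmetric] polynomial_def)

lemma root_poly_nonzero: "finite A \<Longrightarrow> A \<subseteq> carrier R \<Longrightarrow> root_poly A \<noteq> []"
proof (induction A rule: finite_induct)
  case (insert a A)
  have "domain (poly_ring R)" by (rule univ_poly_is_domain[OF carrier_is_subring])
  moreover have "[\<one>, \<ominus> a] \<in> carrier (poly_ring R)" "root_poly A \<in> carrier (poly_ring R)"
    using insert.prems linear_poly root_poly_closed by auto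
  ultimately show ?case
    using domain.integral[of "poly_ring R" "[\<one>, \<ominus> a]" "root_poly A"] insert
    by (auto simp: root_poly_insert univ_poly_mult univ_poly_zero)
qed (simp add: root_poly_empty)

text \<open>Homomorphisms of fields are injective, so distinct roots stay distinct and the image of
  the product is the product over the image of \<open>A\<close>, without repeated factors.\<close>

lemma root_poly_hom:
  assumes S: "field S" and h: "h \<in> ring_hom R S" and A: "finite A" "A \<subseteq> carrier R"
  shows "map h (root_poly A) = ring.root_poly S (h ` A)"
proof -
  interpret S: field S by (rule S)
  interpret h: ring_hom_ring R S h
    using ring_hom_ringI2[OF is_ring S.is_ring h] .
  have inj: "inj_on h (carrier R)" by (rule non_trivial_field_hom_is_inj[OF h field_axioms S])
  show ?thesis using A
  proof (induction A rule: finite_induct)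
    case (insert a A)
    have 1: "set [\<one>, \<ominus> a] \<subseteq> carrier R" "set (root_poly A) \<subseteq> carrier R"
      using insert.prems poly_ring_set[OF root_poly_closed] by auto
    have "map h (root_poly (insert a A)) \<in> carrier (poly_ring S)"
      by (rule polynomial_hom[OF h field_axioms S root_poly_closed[OF insert.prems]])
    then have "map h (root_poly (insert a A)) = S.normalize (map h (root_poly (insert a A)))"
      by (simp add: S.normalize_polynomial univ_poly_carrier)
    also have "\<dots> = S.poly_mult (map h [\<one>, \<ominus> a]) (map h (root_poly A))"
      unfolding root_poly_insert[OF insert.hyps insert.prems] by (rule h.poly_mult_hom'[OF 1])
    also have "map h [\<one>, \<ominus> a] = [\<one>\<^bsub>S\<^esub>, \<ominus>\<^bsub>S\<^esub> h a]" using insert.prems by simp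
    also have "map h (root_poly A) = S.root_poly (h ` A)" using insert by blast
    also have "S.poly_mult [\<one>\<^bsub>S\<^esub>, \<ominus>\<^bsub>S\<^esub> h a] (S.root_poly (h ` A)) = S.root_poly (insert (h a) (h ` A))"
    proof (rule S.root_poly_insert[symmetric])
      show "h a \<notin> h ` A" using insert.hyps(2) insert.prems inj by (auto dest: inj_onD)
    qed (use insert.hyps insert.prems in auto)
    finally show ?case by simp
  qed (simp add: root_poly_empty S.root_poly_empty)
qed

lemma eval_root_poly:
  assumes "finite A" "A \<subseteq> carrier R" "y \<in> carrier R"
  shows "eval (root_poly A) y = \<zero> \<longleftrightarrow> y \<in> A"
  using assms(1,2)
proof (induction A rule: finite_induct)
  case (insert a A)
  have 1: "set [\<one>, \<ominus> a] \<subseteq> carrier R" "set (root_poly A) \<subseteq> carrier R"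
    using insert.prems poly_ring_set[OF root_poly_closed] by auto
  have "eval (root_poly (insert a A)) y = (y \<ominus> a) \<otimes> eval (root_poly A) y"
    using insert eval_poly_mult[OF 1 assms(3)] assms(3) by (simp add: root_poly_insert a_minus_def)
  moreover have "eval (root_poly A) y \<in> carrier R" by (rule eval_in_carrier[OF 1(2) assms(3)])
  moreover have "y \<ominus> a = \<zero> \<longleftrightarrow> y = a" using insert.prems assms(3) by (simp add: r_right_minus_eq)
  ultimately show ?case using insert assms(3) by (auto simp: integral_iff)
qed (simp add: root_poly_empty assms(3))

end

context field_action
begin

text \<open>Each group element permutes the orbit, hence maps the product of the linear factors to
  itself and fixes every coefficient.\<close>

lemma root_poly_fixed:
  assumes "x \<in> carrier K" "finite (orbit x)"
  shows "set (K.root_poly (orbit x)) \<subseteq> B"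
proof
  fix c assume c: "c \<in> set (K.root_poly (orbit x))"
  have "c \<in> carrier K" using c K.poly_ring_set[OF K.root_poly_closed[OF orbit_closed[OF assms(1)]]] by blast
  moreover have "act g c = c" if g: "g \<in> carrier G" for g
  proof -
    have "map (act g) (K.root_poly (orbit x)) = K.root_poly (orbit x)"
      using K.root_poly_hom[OF K.field_axioms act_hom[OF g] assms(2) orbit_closed[OF assms(1)]]
      unfolding act_orbit[OF g assms(1)] .
    then show ?thesis using c by (metis list.map_ident map_eq_conv)
  qed
  ultimately show "c \<in> B" by (simp add: fixed)
qed

text \<open>A polynomial over \<open>B\<close> is fixed by the action, so along with
  \<open>x\<close> its roots contain the orbit of \<open>x\<close>, and a nonzero polynomial has
  finitely many roots. Conversely a finite orbit is the root set of a nonzero polynomial over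
  \<open>B\<close>.\<close>

lemma algebraic_iff:
  assumes B: "subring B K" and x: "x \<in> carrier K"
  shows "\<not> K.transcendental B x \<longleftrightarrow> finite (orbit x)"
proof
  assume "\<not> K.transcendental B x"
  then have "(K.algebraic over B) x" by (simp add: over_def)
  then obtain p where p: "p \<in> carrier (B[X]\<^bsub>K\<^esub>)" "p \<noteq> []" "K.eval p x = \<zero>\<^bsub>K\<^esub>"
    by (rule K.algebraicE[OF B x])
  have pK: "p \<in> carrier (poly_ring K)" and pB: "set p \<subseteq> B"
    using p(1) fixed by (auto simp: univ_poly_carrier[symmetric] polynomial_def)
  have "K.is_root p (act g x)" if g: "g \<in> carrier G" for g
  proof -
    interpret h: ring_hom_ring K K "act g" using ring_hom_ringI2[OF K.is_ring K.is_ring act_hom[OF g]] .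
    have "map (act g) p = p" using pB g fixed by (intro map_idI) auto
    then have "K.eval p (act g x) = \<zero>\<^bsub>K\<^esub>"
      using h.eval_hom'[OF x K.poly_ring_set[OF pK]] p(3) by simp
    then show ?thesis using g x p(2) by (simp add: K.is_root_def)
  qed
  then have "orbit x \<subseteq> {y. K.is_root p y}" by (auto simp: orbit_def)
  then show "finite (orbit x)" using K.finite_number_of_roots[OF pK] finite_subset by blast
next
  assume fin: "finite (orbit x)"
  let ?p = "K.root_poly (orbit x)"
  have "?p \<in> carrier (poly_ring K)" by (rule K.root_poly_closed[OF orbit_closed[OF x]])
  then have "?p \<in> carrier (B[X]\<^bsub>K\<^esub>)"
    using root_poly_fixed[OF x fin] by (auto simp: univ_poly_carrier[symmetric] polynomial_def)
  moreover have "?p \<noteq> []" by (rule K.root_poly_nonzero[OF fin orbit_closed[OF x]])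
  moreover have "K.eval ?p x = \<zero>\<^bsub>K\<^esub>"
    using K.eval_root_poly[OF fin orbit_closed[OF x] x] orbit_self[OF x] by simp
  ultimately show "\<not> K.transcendental B x"
    using K.algebraicI[of ?p B x] by (simp add: over_def)
qed

text \<open>The polynomial with root set \<open>orbit x\<close> has coefficients in \<open>B\<close>, so a homomorphism fixing the
  image of \<open>B\<close> permutes the images of its roots.\<close>

lemma hom_orbit:
  assumes L: "field L" and j: "j \<in> ring_hom K L" and A: "subring A L"
    and x: "x \<in> carrier K" "finite (orbit x)" "j x \<in> A" and jB: "j ` B \<subseteq> A"
    and \<tau>: "\<tau> \<in> ring_hom (L\<lparr>carrier := A\<rparr>) (L\<lparr>carrier := A\<rparr>)" "\<And>b. b \<in> B \<Longrightarrow> \<tau> (j b) = j b"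
  shows "\<tau> (j x) \<in> j ` orbit x"
proof -
  interpret L: field L by (rule L)
  have rA: "ring (L\<lparr>carrier := A\<rparr>)" by (rule L.subring_is_ring[OF A])
  interpret t: ring_hom_ring "L\<lparr>carrier := A\<rparr>" "L\<lparr>carrier := A\<rparr>" \<tau>
    using ring_hom_ringI2[OF rA rA \<tau>(1)] .
  let ?p = "map j (K.root_poly (orbit x))"
  have p: "?p = L.root_poly (j ` orbit x)"
    by (rule K.root_poly_hom[OF L j x(2) orbit_closed[OF x(1)]])
  have jo: "j ` orbit x \<subseteq> carrier L"
    using orbit_closed[OF x(1)] ring_hom_closed[OF j] by auto
  have "j x \<in> carrier L" using ring_hom_closed[OF j x(1)] .
  then have root: "L.eval ?p (j x) = \<zero>\<^bsub>L\<^esub>"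
    unfolding p using L.eval_root_poly[OF _ jo] x(2) orbit_self[OF x(1)] by blast
  have sub: "set ?p \<subseteq> A" using root_poly_fixed[OF x(1,2)] jB by auto
  have map_fix: "map \<tau> ?p = ?p"
  proof (rule map_idI)
    fix c assume "c \<in> set ?p"
    then obtain b where "b \<in> B" "c = j b" using root_poly_fixed[OF x(1,2)] by auto
    then show "\<tau> c = c" using \<tau>(2) by simp
  qed
  have "\<tau> (L.eval ?p (j x)) = L.eval (map \<tau> ?p) (\<tau> (j x))"
    using t.eval_hom'[of "j x" ?p] x(3) sub by (simp add: L.eval_consistent[OF A])
  moreover have "\<tau> \<zero>\<^bsub>L\<^esub> = \<zero>\<^bsub>L\<^esub>" using t.hom_zero by simp
  ultimately have "L.eval ?p (\<tau> (j x)) = \<zero>\<^bsub>L\<^esub>" unfolding map_fix root by (rule subst)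
  moreover have "\<tau> (j x) \<in> carrier L"
    using t.hom_closed[of "j x"] x(3) subringE(1)[OF A] by auto
  ultimately show ?thesis unfolding p using L.eval_root_poly[OF _ jo] x(2) by blast
qed

end

section \<open>Finite faithful actions and Artin's theorem\<close>

locale finite_action = field_action +
  assumes finite_group: "finite (carrier G)"
    and faithful: "g \<in> carrier G \<Longrightarrow> h \<in> carrier G \<Longrightarrow> (\<And>x. x \<in> carrier K \<Longrightarrow> act g x = act h x) \<Longrightarrow> g = h"
begin

lemma act_independent:
  assumes "I \<subseteq> carrier G" "\<And>g. g \<in> I \<Longrightarrow> c g \<in> carrier K"
    and "\<And>x. x \<in> carrier K \<Longrightarrow> (\<Oplus>\<^bsub>K\<^esub>g\<in>I. c g \<otimes>\<^bsub>K\<^esub> act g x) = \<zero>\<^bsub>K\<^esub>" and "k \<in> I"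
  shows "c k = \<zero>\<^bsub>K\<^esub>"
proof (rule K.dedekind_independence[of I act c])
  show "finite I" using finite_group assms(1) finite_subset by blast
  show "\<exists>x\<in>carrier K. act i x \<noteq> act j x" if "i \<in> I" "j \<in> I" "i \<noteq> j" for i j
    using faithful[of i j] that assms(1) by blast
qed (use assms act_hom in auto)

lemma sum_act:
  assumes "g \<in> carrier G" "I \<subseteq> carrier G" "y \<in> carrier K"
  shows "act g (\<Oplus>\<^bsub>K\<^esub>h\<in>I. act h y) = (\<Oplus>\<^bsub>K\<^esub>h\<in>(\<otimes>\<^bsub>G\<^esub>) g ` I. act h y)"
proof -
  interpret h: ring_hom_cring K K "act g" by (rule hom_act[OF assms(1)])
  have "act g (\<Oplus>\<^bsub>K\<^esub>h\<in>I. act h y) = (\<Oplus>\<^bsub>K\<^esub>h\<in>I. act g (act h y))"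
    using assms by (subst h.hom_finsum) (auto simp: comp_def)
  also have "\<dots> = (\<Oplus>\<^bsub>K\<^esub>h\<in>I. act (g \<otimes>\<^bsub>G\<^esub> h) y)"
    using assms by (intro K.finsum_cong') (auto simp: act_mult subset_iff)
  also have "\<dots> = (\<Oplus>\<^bsub>K\<^esub>h\<in>(\<otimes>\<^bsub>G\<^esub>) g ` I. act h y)"
  proof (rule K.finsum_reindex[symmetric])
    show "inj_on ((\<otimes>\<^bsub>G\<^esub>) g) I" using assms by (auto simp: inj_on_def subset_iff)
  qed (use assms in auto)
  finally show ?thesis .
qed

text \<open>Artin's theorem, from the linear independence of \<open>H\<close> together with the coset \<open>gH\<close>, applied to
  the trace over \<open>H\<close>.\<close>

lemma subgroup_separation:
  assumes H: "subgroup H G" and g: "g \<in> carrier G" "g \<notin> H"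
  obtains \<alpha> where "\<alpha> \<in> carrier K" "\<And>h. h \<in> H \<Longrightarrow> act h \<alpha> = \<alpha>" "act g \<alpha> \<noteq> \<alpha>"
proof -
  have sub: "H \<subseteq> carrier G" using subgroup.subset[OF H] .
  define T where "T x = (\<Oplus>\<^bsub>K\<^esub>h\<in>H. act h x)" for x
  have fin: "finite H" using finite_group sub finite_subset by blast
  have T: "T x \<in> carrier K" if "x \<in> carrier K" for x
    unfolding T_def using sub that by (intro K.finsum_closed) auto
  have fixT: "act h (T x) = T x" if h: "h \<in> H" and "x \<in> carrier K" for h x
  proof -
    have "(\<otimes>\<^bsub>G\<^esub>) h ` H = H"
    proof
      show "H \<subseteq> (\<otimes>\<^bsub>G\<^esub>) h ` H"
      proof
        fix k assume k: "k \<in> H"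
        have "k = h \<otimes>\<^bsub>G\<^esub> (inv\<^bsub>G\<^esub> h \<otimes>\<^bsub>G\<^esub> k)"
          using sub h k by (simp add: G.m_assoc[symmetric] subset_iff)
        then show "k \<in> (\<otimes>\<^bsub>G\<^esub>) h ` H"
          using subgroup.m_closed[OF H subgroup.m_inv_closed[OF H h] k] by blast
      qed
    qed (use subgroup.m_closed[OF H h] in auto)
    then show ?thesis unfolding T_def using sum_act[of h H x] sub that by auto
  qed
  have "\<exists>x\<in>carrier K. act g (T x) \<noteq> T x"
  proof (rule ccontr)
    assume "\<not> ?thesis"
    then have eq: "act g (T x) = T x" if "x \<in> carrier K" for x using that by blast
    let ?gH = "(\<otimes>\<^bsub>G\<^esub>) g ` H"
    have gH: "?gH \<subseteq> carrier G" using sub g by auto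
    have disj: "H \<inter> ?gH = {}"
    proof (rule ccontr)
      assume "H \<inter> ?gH \<noteq> {}"
      then obtain h where h: "h \<in> H" "g \<otimes>\<^bsub>G\<^esub> h \<in> H" by auto
      have "g = g \<otimes>\<^bsub>G\<^esub> h \<otimes>\<^bsub>G\<^esub> inv\<^bsub>G\<^esub> h" using g h sub by (simp add: G.m_assoc subset_iff)
      then show False using g(2) subgroup.m_closed[OF H h(2) subgroup.m_inv_closed[OF H h(1)]] by simp
    qed
    \<comment> \<open>If \<open>g\<close> fixed every trace, the sum over \<open>H\<close> would
      equal the sum over the coset of \<open>g\<close>. The coefficients 1 on \<open>H\<close> and
      -1 on the coset write this as a linear relation among distinct automorphisms.\<close>
    define c where "c k = (if k \<in> H then \<one>\<^bsub>K\<^esub> else \<ominus>\<^bsub>K\<^esub> \<one>\<^bsub>K\<^esub>)" for k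
    have c: "c k \<in> carrier K" for k by (simp add: c_def)
    have "(\<Oplus>\<^bsub>K\<^esub>k\<in>H \<union> ?gH. c k \<otimes>\<^bsub>K\<^esub> act k x) = \<zero>\<^bsub>K\<^esub>" if x: "x \<in> carrier K" for x
    proof -
      have "(\<Oplus>\<^bsub>K\<^esub>k\<in>H \<union> ?gH. c k \<otimes>\<^bsub>K\<^esub> act k x) =
          (\<Oplus>\<^bsub>K\<^esub>k\<in>H. c k \<otimes>\<^bsub>K\<^esub> act k x) \<oplus>\<^bsub>K\<^esub> (\<Oplus>\<^bsub>K\<^esub>k\<in>?gH. c k \<otimes>\<^bsub>K\<^esub> act k x)"
        using fin disj sub gH x c by (intro K.finsum_Un_disjoint) (auto simp: Pi_def subset_iff)
      also have "(\<Oplus>\<^bsub>K\<^esub>k\<in>H. c k \<otimes>\<^bsub>K\<^esub> act k x) = T x"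
        unfolding T_def using sub x by (intro K.finsum_cong') (auto simp: c_def subset_iff)
      also have "(\<Oplus>\<^bsub>K\<^esub>k\<in>?gH. c k \<otimes>\<^bsub>K\<^esub> act k x) = (\<Oplus>\<^bsub>K\<^esub>k\<in>?gH. (\<ominus>\<^bsub>K\<^esub> \<one>\<^bsub>K\<^esub>) \<otimes>\<^bsub>K\<^esub> act k x)"
      proof (rule K.finsum_cong'[OF refl])
        show "(\<lambda>k. (\<ominus>\<^bsub>K\<^esub> \<one>\<^bsub>K\<^esub>) \<otimes>\<^bsub>K\<^esub> act k x) \<in> ?gH \<rightarrow> carrier K" using gH x by auto
        show "c k \<otimes>\<^bsub>K\<^esub> act k x = (\<ominus>\<^bsub>K\<^esub> \<one>\<^bsub>K\<^esub>) \<otimes>\<^bsub>K\<^esub> act k x" if "k \<in> ?gH" for k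
          using disj that by (auto simp: c_def)
      qed
      also have "\<dots> = (\<ominus>\<^bsub>K\<^esub> \<one>\<^bsub>K\<^esub>) \<otimes>\<^bsub>K\<^esub> (\<Oplus>\<^bsub>K\<^esub>k\<in>?gH. act k x)"
        using fin gH x by (intro K.finsum_rdistr[symmetric]) auto
      also have "(\<Oplus>\<^bsub>K\<^esub>k\<in>?gH. act k x) = T x"
        using sum_act[OF g(1) sub x] eq[OF x] by (simp add: T_def)
      also have "T x \<oplus>\<^bsub>K\<^esub> (\<ominus>\<^bsub>K\<^esub> \<one>\<^bsub>K\<^esub>) \<otimes>\<^bsub>K\<^esub> T x = \<zero>\<^bsub>K\<^esub>" using T[OF x] by (simp add: K.l_minus K.r_neg)
      finally show ?thesis .
    qed
    then have "c \<one>\<^bsub>G\<^esub> = \<zero>\<^bsub>K\<^esub>"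
      using sub gH c subgroup.one_closed[OF H] by (intro act_independent[of "H \<union> ?gH" c]) auto
    then show False using subgroup.one_closed[OF H] by (simp add: c_def)
  qed
  then show ?thesis using that T fixT by blast
qed

end

section \<open>Separating polynomials\<close>

context cring
begin

text \<open>\<open>zip\<close> stops at the shorter list, so variables without an exponent
  contribute 1; this is the convention of \<open>poly_eval\<close>.\<close>

definition mon :: "'a list \<Rightarrow> nat list \<Rightarrow> 'a" where
  "mon xs e = foldr (\<lambda>(x, k) t. (x [^] (k::nat)) \<otimes> t) (zip xs e) \<one>"

text \<open>The coefficients are ring elements, in contrast to the integers of
  \<open>poly_eval\<close>. Terms are not normalised, so polynomials can be combined by
  concatenating and mapping lists.\<close>

definition evt :: "('a \<times> nat list) list \<Rightarrow> 'a list \<Rightarrow> 'a" where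
  "evt ts xs = foldr (\<lambda>(q, e) s. q \<otimes> mon xs e \<oplus> s) ts \<zero>"

lemma mon_simps [simp]: "mon [] e = \<one>" "mon xs [] = \<one>" "mon (x # xs) (k # e) = x [^] k \<otimes> mon xs e"
  by (simp_all add: mon_def)

lemma mon_closed [simp]: "set xs \<subseteq> carrier R \<Longrightarrow> mon xs e \<in> carrier R"
proof (induction xs arbitrary: e)
  case (Cons x xs)
  then show ?case by (cases e) auto
qed simp

lemma evt_simps [simp]: "evt [] xs = \<zero>" "evt ((q, e) # ts) xs = q \<otimes> mon xs e \<oplus> evt ts xs"
  by (simp_all add: evt_def)

lemma evt_closed [simp]: "set xs \<subseteq> carrier R \<Longrightarrow> fst ` set ts \<subseteq> carrier R \<Longrightarrow> evt ts xs \<in> carrier R"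
  by (induction ts) auto

lemma evt_append:
  "set xs \<subseteq> carrier R \<Longrightarrow> fst ` set ts \<subseteq> carrier R \<Longrightarrow> fst ` set us \<subseteq> carrier R \<Longrightarrow>
    evt (ts @ us) xs = evt ts xs \<oplus> evt us xs"
  by (induction ts) (auto simp: a_assoc)

lemma mon_Suc:
  "set xs \<subseteq> carrier R \<Longrightarrow> length e = length xs \<Longrightarrow> j < length xs \<Longrightarrow>
    mon xs (e[j := Suc (e ! j)]) = xs ! j \<otimes> mon xs e"
proof (induction xs arbitrary: e j)
  case (Cons x xs)
  then obtain k e' where e: "e = k # e'" by (cases e) auto
  show ?case
  proof (cases j)
    case 0
    then show ?thesis using Cons.prems by (simp add: e m_ac)
  next
    case (Suc j')
    then have "xs ! j' \<in> carrier R" using Cons.prems by (auto simp: subset_iff)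
    then show ?thesis using Cons Suc by (simp add: e m_lcomm)
  qed
qed simp

lemma mon_append:
  "set xs \<subseteq> carrier R \<Longrightarrow> set ys \<subseteq> carrier R \<Longrightarrow> length e = length xs \<Longrightarrow>
    mon (xs @ ys) (e @ f) = mon xs e \<otimes> mon ys f"
proof (induction xs arbitrary: e)
  case (Cons x xs)
  then obtain k e' where "e = k # e'" by (cases e) auto
  then show ?case using Cons by (simp add: m_assoc)
qed simp

lemma mon_unit: "set ys \<subseteq> carrier R \<Longrightarrow> t < length ys \<Longrightarrow> mon ys (replicate t 0 @ [1]) = ys ! t"
proof (induction t arbitrary: ys)
  case 0
  then show ?case by (cases ys) auto
next
  case (Suc t)
  then show ?case by (cases ys) (auto simp: subset_iff)
qed

lemma mon_zero: "set xs \<subseteq> carrier R \<Longrightarrow> mon xs (replicate n 0) = \<one>"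
proof (induction xs arbitrary: n)
  case (Cons x xs)
  then show ?case by (cases n) auto
qed simp

text \<open>A term list for the product with the linear polynomial in the \<open>j\<close>-th
  variable with root \<open>r\<close>: raising the \<open>j\<close>-th exponent multiplies by the
  variable, and the scaled copy accounts for the constant.\<close>

lemma evt_mult_linear:
  assumes "set xs \<subseteq> carrier R" "j < length xs" "r \<in> carrier R"
    and "\<And>q e. (q, e) \<in> set ts \<Longrightarrow> q \<in> carrier R \<and> length e = length xs"
  shows "evt (map (\<lambda>(q, e). (q, e[j := Suc (e ! j)])) ts @ map (\<lambda>(q, e). (\<ominus> r \<otimes> q, e)) ts) xs
    = (xs ! j \<ominus> r) \<otimes> evt ts xs"
proof -
  have xj: "xs ! j \<in> carrier R" using assms(1,2) by (auto simp: subset_iff)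
  have ts: "fst ` set ts \<subseteq> carrier R" using assms(4) by force
  have 1: "evt (map (\<lambda>(q, e). (q, e[j := Suc (e ! j)])) ts) xs = xs ! j \<otimes> evt ts xs"
    using assms(4) ts
  proof (induction ts)
    case (Cons t ts)
    obtain q e where t: "t = (q, e)" by fastforce
    then have "q \<in> carrier R" "length e = length xs" using Cons.prems by auto
    moreover have "evt (map (\<lambda>(q, e). (q, e[j := Suc (e ! j)])) ts) xs = xs ! j \<otimes> evt ts xs"
      using Cons.prems by (intro Cons.IH) auto
    ultimately show ?case using Cons.prems assms(1,2) xj by (simp add: t mon_Suc r_distr m_lcomm)
  qed (simp add: xj)
  have 2: "evt (map (\<lambda>(q, e). (\<ominus> r \<otimes> q, e)) ts) xs = \<ominus> r \<otimes> evt ts xs"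
    using ts
  proof (induction ts)
    case (Cons t ts)
    obtain q e where t: "t = (q, e)" by fastforce
    then show ?case using Cons assms(1,3) by (simp add: r_distr m_assoc)
  qed (simp add: assms(3))
  have "evt (map (\<lambda>(q, e). (q, e[j := Suc (e ! j)])) ts @ map (\<lambda>(q, e). (\<ominus> r \<otimes> q, e)) ts) xs
    = xs ! j \<otimes> evt ts xs \<oplus> \<ominus> r \<otimes> evt ts xs"
    unfolding 1[symmetric] 2[symmetric] using ts assms(1,3) by (intro evt_append) force+
  also have "\<dots> = (xs ! j \<ominus> r) \<otimes> evt ts xs"
    using xj ts assms(1,3) by (simp add: a_minus_def l_distr)
  finally show ?thesis .
qed

end

text \<open>Each \<open>a\<close> in \<open>A\<close> differs from \<open>b\<close> in some
  coordinate \<open>j\<close>. The product of the corresponding linear factors in the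
  \<open>j\<close>-th variable with root \<open>a ! j\<close> vanishes on \<open>A\<close> and, as
  there are no zero divisors, not at \<open>b\<close>.\<close>

lemma (in domain) separating_terms:
  assumes "finite A" "\<And>a. a \<in> A \<Longrightarrow> set a \<subseteq> carrier R \<and> length a = n"
    and b: "set b \<subseteq> carrier R" "length b = n" "b \<notin> A"
  shows "\<exists>ts. (\<forall>(q, e)\<in>set ts. q \<in> carrier R \<and> length e = n) \<and> (\<forall>a\<in>A. evt ts a = \<zero>) \<and> evt ts b \<noteq> \<zero>"
  using assms(1,2,5)
proof (induction A rule: finite_induct)
  case empty
  show ?case
    by (rule exI[of _ "[(\<one>, replicate n 0)]"]) (use b in \<open>simp add: mon_zero\<close>)
next
  case (insert a A)
  then obtain ts where ts: "\<forall>(q, e)\<in>set ts. q \<in> carrier R \<and> length e = n" "\<forall>a\<in>A. evt ts a = \<zero>" "evt ts b \<noteq> \<zero>"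
    by auto
  have a: "set a \<subseteq> carrier R" "length a = n" using insert.prems by auto
  then obtain j where j: "j < n" "a ! j \<noteq> b ! j" using insert.prems b(2) by (metis insertI1 nth_equalityI)
  have aj: "a ! j \<in> carrier R" and bj: "b ! j \<in> carrier R" using a b j by (auto simp: subset_iff)
  define us where "us = map (\<lambda>(q, e). (q, e[j := Suc (e ! j)])) ts @ map (\<lambda>(q, e). (\<ominus> (a ! j) \<otimes> q, e)) ts"
  have ev: "evt us xs = (xs ! j \<ominus> a ! j) \<otimes> evt ts xs" if "set xs \<subseteq> carrier R" "length xs = n" for xs
    unfolding us_def using that j aj ts(1) by (intro evt_mult_linear) auto
  have tsc: "fst ` set ts \<subseteq> carrier R" using ts(1) by force
  have "\<forall>(q, e)\<in>set us. q \<in> carrier R \<and> length e = n" using ts(1) aj by (auto simp: us_def)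
  moreover have "evt us c = \<zero>" if "c \<in> insert a A" for c
  proof (cases "c = a")
    case True
    then show ?thesis using ev[OF a] aj tsc a by (simp add: a_minus_def r_neg)
  next
    case False
    then have "evt ts c = \<zero>" "set c \<subseteq> carrier R" "length c = n" using that ts(2) insert.prems by auto
    moreover have "c ! j \<in> carrier R" using calculation j by (auto simp: subset_iff)
    ultimately show ?thesis using ev[of c] aj by simp
  qed
  moreover have "evt us b \<noteq> \<zero>"
  proof -
    have "b ! j \<ominus> a ! j \<noteq> \<zero>" using j aj bj by (simp add: r_right_minus_eq)
    then show ?thesis using ev[OF b(1,2)] ts(3) integral_iff[of "b ! j \<ominus> a ! j" "evt ts b"] aj bj tsc b(1) by simp
  qed
  ultimately show ?case by blast
qed

lemma (in ring_hom_cring) hom_nat_pow': "x \<in> carrier R \<Longrightarrow> h (x [^] (k::nat)) = h x [^]\<^bsub>S\<^esub> k"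
  by (induction k) auto

lemma (in ring_hom_cring) hom_mon: "set xs \<subseteq> carrier R \<Longrightarrow> h (R.mon xs e) = S.mon (map h xs) e"
proof (induction xs arbitrary: e)
  case (Cons x xs)
  then show ?case by (cases e) (auto simp: hom_nat_pow')
qed simp

text \<open>The orbit of \<open>a\<close> is separated from \<open>b\<close> by a polynomial over
  the whole field. Replacing every coefficient \<open>q\<close> by the trace of
  \<open>\<xi> \<otimes> q\<close> brings the coefficients into \<open>B\<close>; the result is the
  sum over \<open>g\<close> of \<open>act g \<xi>\<close> times the \<open>g\<close>-conjugate
  polynomial. At \<open>a\<close> every conjugate vanishes because the orbit is stable. At
  \<open>b\<close> the conjugate by the identity does not vanish, so linear independence of the
  automorphisms provides a \<open>\<xi>\<close> for which the sum is nonzero; the plain trace might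
  cancel.\<close>

lemma (in finite_action) invariant_separating_terms:
  assumes a: "set a \<subseteq> carrier K" and b: "set b \<subseteq> carrier K" and len: "length b = length a"
    and ne: "\<And>g. g \<in> carrier G \<Longrightarrow> map (act g) a \<noteq> b"
  obtains ts where "\<And>q e. (q, e) \<in> set ts \<Longrightarrow> q \<in> B \<and> length e = length a" "K.evt ts a = \<zero>\<^bsub>K\<^esub>" "K.evt ts b \<noteq> \<zero>\<^bsub>K\<^esub>"
proof -
  define A where "A = (\<lambda>g. map (act g) a) ` carrier G"
  have "finite A" using finite_group by (simp add: A_def)
  moreover have "b \<notin> A" using ne by (auto simp: A_def)
  moreover have "set x \<subseteq> carrier K \<and> length x = length a" if "x \<in> A" for x
    using that a by (auto simp: A_def subset_iff)
  ultimately obtain ts where ts: "\<forall>(q, e)\<in>set ts. q \<in> carrier K \<and> length e = length a"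
    "\<forall>a\<in>A. K.evt ts a = \<zero>\<^bsub>K\<^esub>" "K.evt ts b \<noteq> \<zero>\<^bsub>K\<^esub>"
    using K.separating_terms[of A "length a" b] b len by blast
  have tsc: "fst ` set ts \<subseteq> carrier K" using ts(1) by force
  define Tr where "Tr y = (\<Oplus>\<^bsub>K\<^esub>g\<in>carrier G. act g y)" for y
  have Tr: "Tr y \<in> B" if y: "y \<in> carrier K" for y
  proof -
    have "Tr y \<in> carrier K" unfolding Tr_def using y by (intro K.finsum_closed) auto
    moreover have "act g (Tr y) = Tr y" if g: "g \<in> carrier G" for g
      unfolding Tr_def using sum_act[OF g _ y, of "carrier G"] G.surj_const_mult[OF g] by simp
    ultimately show ?thesis by (simp add: fixed)
  qed
  \<comment> \<open>\<open>w xs g\<close> is the value at \<open>xs\<close> of the polynomial whose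
    coefficients have been moved by \<open>g\<close>, expressed through the original polynomial at
    the tuple moved back.\<close>
  define w where "w xs g = act g (K.evt ts (map (act (inv\<^bsub>G\<^esub> g)) xs))" for xs g
  have w: "w xs g \<in> carrier K" if "set xs \<subseteq> carrier K" "g \<in> carrier G" for xs g
    unfolding w_def using that tsc by (intro act_closed K.evt_closed) (auto simp: subset_iff)
  define us where "us \<xi> = map (\<lambda>(q, e). (Tr (\<xi> \<otimes>\<^bsub>K\<^esub> q), e)) ts" for \<xi>
  have ev: "K.evt (us \<xi>) xs = (\<Oplus>\<^bsub>K\<^esub>g\<in>carrier G. w xs g \<otimes>\<^bsub>K\<^esub> act g \<xi>)"
    if \<xi>: "\<xi> \<in> carrier K" and xs: "set xs \<subseteq> carrier K" for \<xi> xs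
    using tsc unfolding us_def w_def
  proof (induction ts)
    case Nil
    have "(\<Oplus>\<^bsub>K\<^esub>g\<in>carrier G. act g \<zero>\<^bsub>K\<^esub> \<otimes>\<^bsub>K\<^esub> act g \<xi>) = (\<Oplus>\<^bsub>K\<^esub>g\<in>carrier G. \<zero>\<^bsub>K\<^esub>)"
    proof (rule K.finsum_cong'[OF refl])
      fix g assume g: "g \<in> carrier G"
      then interpret h: ring_hom_cring K K "act g" by (rule hom_act)
      show "act g \<zero>\<^bsub>K\<^esub> \<otimes>\<^bsub>K\<^esub> act g \<xi> = \<zero>\<^bsub>K\<^esub>" using g \<xi> by simp
    qed simp
    then show ?case by simp
  next
    case (Cons t ts)
    obtain q e where t: "t = (q, e)" by fastforce
    have q: "q \<in> carrier K" and tsc: "fst ` set ts \<subseteq> carrier K" using Cons.prems by (auto simp: t)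
    let ?m = "K.mon xs e"
    have m: "?m \<in> carrier K" using xs by simp
    let ?w = "\<lambda>g. act g (K.evt ts (map (act (inv\<^bsub>G\<^esub> g)) xs))"
    have inv_closed: "set (map (act (inv\<^bsub>G\<^esub> g)) xs) \<subseteq> carrier K" if "g \<in> carrier G" for g
      using xs that by (auto simp: subset_iff)
    have wcl: "?w g \<in> carrier K" if "g \<in> carrier G" for g
      using that tsc inv_closed by (intro act_closed K.evt_closed) auto
    have "Tr (\<xi> \<otimes>\<^bsub>K\<^esub> q) \<otimes>\<^bsub>K\<^esub> ?m = (\<Oplus>\<^bsub>K\<^esub>g\<in>carrier G. act g (\<xi> \<otimes>\<^bsub>K\<^esub> q) \<otimes>\<^bsub>K\<^esub> ?m)"
      unfolding Tr_def using \<xi> q m finite_group by (intro K.finsum_ldistr) auto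
    then have "Tr (\<xi> \<otimes>\<^bsub>K\<^esub> q) \<otimes>\<^bsub>K\<^esub> ?m \<oplus>\<^bsub>K\<^esub> (\<Oplus>\<^bsub>K\<^esub>g\<in>carrier G. ?w g \<otimes>\<^bsub>K\<^esub> act g \<xi>) =
      (\<Oplus>\<^bsub>K\<^esub>g\<in>carrier G. act g (\<xi> \<otimes>\<^bsub>K\<^esub> q) \<otimes>\<^bsub>K\<^esub> ?m \<oplus>\<^bsub>K\<^esub> ?w g \<otimes>\<^bsub>K\<^esub> act g \<xi>)"
      using \<xi> q m wcl by (subst K.finsum_addf) auto
    also have "\<dots> = (\<Oplus>\<^bsub>K\<^esub>g\<in>carrier G. act g (K.evt (t # ts) (map (act (inv\<^bsub>G\<^esub> g)) xs)) \<otimes>\<^bsub>K\<^esub> act g \<xi>)"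
    proof (rule K.finsum_cong'[OF refl])
      fix g assume g: "g \<in> carrier G"
      then interpret h: ring_hom_cring K K "act g" by (rule hom_act)
      have id: "map (act g) (map (act (inv\<^bsub>G\<^esub> g)) xs) = xs"
        using xs g by (auto intro!: map_idI simp: subset_iff)
      have "act g (K.evt (t # ts) (map (act (inv\<^bsub>G\<^esub> g)) xs)) = act g q \<otimes>\<^bsub>K\<^esub> ?m \<oplus>\<^bsub>K\<^esub> ?w g"
        using h.hom_mon[OF inv_closed[OF g], of e] q inv_closed[OF g] tsc unfolding id by (simp add: t)
      then show "act g (\<xi> \<otimes>\<^bsub>K\<^esub> q) \<otimes>\<^bsub>K\<^esub> ?m \<oplus>\<^bsub>K\<^esub> ?w g \<otimes>\<^bsub>K\<^esub> act g \<xi> =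
          act g (K.evt (t # ts) (map (act (inv\<^bsub>G\<^esub> g)) xs)) \<otimes>\<^bsub>K\<^esub> act g \<xi>"
        using wcl[OF g] g \<xi> q m by (simp add: K.l_distr K.r_distr K.m_ac)
    qed (use inv_closed \<xi> Cons.prems in \<open>auto intro!: K.evt_closed\<close>)
    finally show ?case using Cons.IH[OF tsc] by (simp add: t)
  qed
  have "\<exists>\<xi>\<in>carrier K. (\<Oplus>\<^bsub>K\<^esub>g\<in>carrier G. w b g \<otimes>\<^bsub>K\<^esub> act g \<xi>) \<noteq> \<zero>\<^bsub>K\<^esub>"
  proof (rule ccontr)
    assume "\<not> ?thesis"
    then have "w b \<one>\<^bsub>G\<^esub> = \<zero>\<^bsub>K\<^esub>" using w[OF b] by (intro act_independent[of "carrier G" "w b"]) auto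
    moreover have "map (act \<one>\<^bsub>G\<^esub>) b = b" using b by (intro map_idI) (auto simp: act_one)
    ultimately show False using ts(3) tsc b by (simp add: w_def act_one)
  qed
  then obtain \<xi> where \<xi>: "\<xi> \<in> carrier K" "K.evt (us \<xi>) b \<noteq> \<zero>\<^bsub>K\<^esub>" using ev[OF _ b] by auto
  have "K.evt (us \<xi>) a = (\<Oplus>\<^bsub>K\<^esub>g\<in>carrier G. \<zero>\<^bsub>K\<^esub>)"
    unfolding ev[OF \<xi>(1) a]
  proof (rule K.finsum_cong'[OF refl])
    fix g assume g: "g \<in> carrier G"
    then interpret h: ring_hom_cring K K "act g" by (rule hom_act)
    have "K.evt ts (map (act (inv\<^bsub>G\<^esub> g)) a) = \<zero>\<^bsub>K\<^esub>" using ts(2) g by (simp add: A_def)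
    then show "w a g \<otimes>\<^bsub>K\<^esub> act g \<xi> = \<zero>\<^bsub>K\<^esub>" using g \<xi> by (simp add: w_def)
  qed simp
  then have "K.evt (us \<xi>) a = \<zero>\<^bsub>K\<^esub>" by simp
  moreover have "q \<in> B \<and> length e = length a" if "(q, e) \<in> set (us \<xi>)" for q e
    using that ts(1) \<xi>(1) Tr by (auto simp: us_def)
  ultimately show ?thesis using that \<xi>(2) by blast
qed

lemma add_pow_int:
  "add_pow R (c::int) x = (if c < 0 then \<ominus>\<^bsub>R\<^esub> (add_pow R (nat (- c)) x) else add_pow R (nat c) x)"
  unfolding add_pow_def int_pow_def2 a_inv_def by (rule refl)

lemma (in ring_hom_cring) hom_add_pow_int:
  assumes "x \<in> carrier R" shows "h (add_pow R (c::int) x) = add_pow S c (h x)"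
proof -
  have nat: "h (add_pow R (k::nat) x) = add_pow S k (h x)" for k
    using assms by (induction k) auto
  have "add_pow R (nat (- c)) x \<in> carrier R" by (rule R.add.nat_pow_closed[OF assms])
  then show ?thesis
    unfolding add_pow_int using nat[of "nat c"] nat[of "nat (- c)"] by simp
qed

lemma poly_eval_mon:
  assumes "cring R"
  shows "poly_eval R p xs = foldr (\<lambda>(c, e) s. add_pow R c (cring.mon R xs e) \<oplus>\<^bsub>R\<^esub> s) (poly_terms p) \<zero>\<^bsub>R\<^esub>"
proof -
  interpret cring R by (rule assms)
  show ?thesis by (simp add: poly_eval_def mon_def case_prod_beta')
qed

lemma (in cring) terms_closed:
  assumes "set xs \<subseteq> carrier R"
  shows "foldr (\<lambda>(c, e) s. add_pow R (c::int) (mon xs e) \<oplus> s) ts \<zero> \<in> carrier R"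
  using assms by (induction ts) (auto intro!: add.int_pow_closed)

lemma (in ring_hom_cring) hom_terms:
  assumes "set xs \<subseteq> carrier R"
  shows "h (foldr (\<lambda>(c, e) s. add_pow R (c::int) (R.mon xs e) \<oplus> s) ts \<zero>)
    = foldr (\<lambda>(c, e) s. add_pow S c (S.mon (map h xs) e) \<oplus>\<^bsub>S\<^esub> s) ts \<zero>\<^bsub>S\<^esub>"
proof (induction ts)
  case (Cons t ts)
  obtain c e where t: "t = (c, e)" by fastforce
  have "add_pow R c (R.mon xs e) \<in> carrier R" using assms by (intro R.add.int_pow_closed) simp
  then show ?case using Cons R.terms_closed[OF assms, of ts] assms
    by (simp add: t hom_add_pow_int hom_mon)
qed simp

lemma poly_eval_hom:
  assumes "cring R" "cring S" "h \<in> ring_hom R S" "set xs \<subseteq> carrier R"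
  shows "poly_eval S p (map h xs) = h (poly_eval R p xs)"
proof -
  interpret ring_hom_cring R S h using assms by (simp add: ring_hom_cringI)
  show ?thesis unfolding poly_eval_mon[OF assms(1)] poly_eval_mon[OF assms(2)]
    using hom_terms[OF assms(4)] by simp
qed

lemma (in abelian_monoid) foldr_finsum:
  "distinct L \<Longrightarrow> f \<in> set L \<rightarrow> carrier G \<Longrightarrow> foldr (\<lambda>k s. f k \<oplus> s) L \<zero> = (\<Oplus>k\<in>set L. f k)"
  by (induction L) (auto simp: Pi_def)

text \<open>Every term gets its own coefficient variable, so that all integer coefficients are 1 and the
  monomials are automatically distinct.\<close>

lemma coded_polynomial:
  fixes R :: "nat ring"
  assumes "ts \<noteq> []" and len: "\<And>q e. (q, e) \<in> set ts \<Longrightarrow> length e = n"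
  shows "\<exists>p\<in>polys. poly_var p = n + length ts \<and>
    (\<forall>xs qs. cring R \<longrightarrow> set xs \<subseteq> carrier R \<longrightarrow> length xs = n \<longrightarrow> set qs \<subseteq> carrier R \<longrightarrow> length qs = length ts \<longrightarrow>
      poly_eval R p (xs @ qs) = cring.evt R (zip qs (map snd ts)) xs)"
proof -
  define m where "m = length ts"
  \<comment> \<open>The exponents of the \<open>t\<close>-th term are followed by the unit vector of
    its coefficient variable. The lengths \<open>n + t + 1\<close> are distinct, hence so are the
    monomials, and the final 1 rules out trailing zeros.\<close>
  define ex where "ex t = snd (ts ! t) @ replicate t 0 @ [1]" for t
  have lenex: "length (ex t) = n + t + 1" if "t < m" for t
  proof -
    have "(fst (ts ! t), snd (ts ! t)) \<in> set ts" using that by (simp add: m_def)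
    from len[OF this] show ?thesis by (simp add: ex_def)
  qed
  have inj: "inj_on (\<lambda>t. list_encode (ex t)) {..<m}"
  proof (rule inj_onI)
    fix s t assume "s \<in> {..<m}" "t \<in> {..<m}" "list_encode (ex s) = list_encode (ex t)"
    then have "length (ex s) = length (ex t)" by (simp add: list_encode_eq)
    then show "s = t" using lenex \<open>s \<in> {..<m}\<close> \<open>t \<in> {..<m}\<close> by simp
  qed
  define L0 where "L0 = map (\<lambda>t. list_encode (ex t)) [0..<m]"
  have d0: "distinct L0" using inj by (simp add: L0_def distinct_map lessThan_atLeast0)
  \<comment> \<open>Membership in \<open>polys\<close> asks for increasing codes of the exponent
    lists. Sorting does not change the value, because by \<open>foldr_finsum\<close> the sum depends
    only on the set of terms.\<close>
  define L where "L = sort L0"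
  have L: "set L = set L0" "distinct L" "sorted_wrt (<) L"
    using d0 by (auto simp: L_def strict_sorted_iff)
  define p where "p = list_encode (map (\<lambda>k. ppair (int_encode 1) k) L)"
  have terms: "poly_terms p = map (\<lambda>k. (1, list_decode k)) L"
    by (simp add: poly_terms_def p_def comp_def)
  have "p \<in> polys"
  proof -
    have "list_decode k \<noteq> [] \<longrightarrow> last (list_decode k) \<noteq> 0" if "k \<in> set L" for k
      using that unfolding L(1) by (auto simp: L0_def ex_def)
    then show ?thesis using L(3) by (auto simp: polys_def terms comp_def)
  qed
  moreover have "poly_var p = n + length ts"
  proof -
    have "(\<lambda>(c, e). length e) ` set (poly_terms p) = (\<lambda>t. n + t + 1) ` {..<m}"
      unfolding terms using lenex
      by (auto simp: L(1) L0_def image_image atLeast0LessThan intro!: image_cong)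
    moreover have "Max (insert 0 ((\<lambda>t. n + t + 1) ` {..<m})) = n + m"
    proof (rule Max_eqI)
      have "m \<noteq> 0" using assms(1) by (simp add: m_def)
      then have "n + m = n + (m - 1) + 1" "m - 1 < m" by auto
      then show "n + m \<in> insert 0 ((\<lambda>t. n + t + 1) ` {..<m})" by blast
    qed auto
    ultimately show ?thesis by (simp add: poly_var_def m_def)
  qed
  moreover have "poly_eval R p (xs @ qs) = cring.evt R (zip qs (map snd ts)) xs"
    if R: "cring R" and xs: "set xs \<subseteq> carrier R" "length xs = n" and qs: "set qs \<subseteq> carrier R" "length qs = length ts"
    for xs qs
  proof -
    interpret cring R by (rule R)
    let ?ys = "xs @ qs"
    have ys: "set ?ys \<subseteq> carrier R" using xs qs by simp
    let ?f = "\<lambda>k. mon ?ys (list_decode k)"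
    have "poly_eval R p ?ys = foldr (\<lambda>k s. ?f k \<oplus>\<^bsub>R\<^esub> s) L \<zero>\<^bsub>R\<^esub>"
      unfolding poly_eval_mon[OF R] terms using mon_closed[OF ys] by (simp add: foldr_map comp_def)
    also have "\<dots> = finsum R ?f (set L)" using mon_closed[OF ys] L(2) by (intro foldr_finsum) auto
    also have "\<dots> = foldr (\<lambda>k s. ?f k \<oplus>\<^bsub>R\<^esub> s) L0 \<zero>\<^bsub>R\<^esub>"
      unfolding L(1) using mon_closed[OF ys] d0 by (intro foldr_finsum[symmetric]) auto
    also have "\<dots> = foldr (\<lambda>t s. mon ?ys (ex t) \<oplus>\<^bsub>R\<^esub> s) [0..<m] \<zero>\<^bsub>R\<^esub>"
      by (simp add: L0_def foldr_map comp_def)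
    also have "\<dots> = foldr (\<lambda>t s. qs ! t \<otimes>\<^bsub>R\<^esub> mon xs (snd (ts ! t)) \<oplus>\<^bsub>R\<^esub> s) [0..<m] \<zero>\<^bsub>R\<^esub>"
    proof (rule foldr_cong[OF refl refl])
      fix t s assume "t \<in> set [0..<m]"
      then have t: "t < m" by simp
      then have "length (snd (ts ! t)) = length xs" using lenex[OF t] xs(2) by (simp add: ex_def)
      moreover have "qs ! t \<in> carrier R" using t qs by (auto simp: m_def subset_iff)
      ultimately show "mon ?ys (ex t) \<oplus>\<^bsub>R\<^esub> s = qs ! t \<otimes>\<^bsub>R\<^esub> mon xs (snd (ts ! t)) \<oplus>\<^bsub>R\<^esub> s"
        using t xs qs mon_unit[OF qs(1), of t] unfolding ex_def
        by (subst mon_append) (simp_all add: m_def m_comm)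
    qed
    also have "\<dots> = evt (map (\<lambda>t. (qs ! t, snd (ts ! t))) [0..<m]) xs"
      by (simp add: evt_def foldr_map comp_def)
    also have "map (\<lambda>t. (qs ! t, snd (ts ! t))) [0..<m] = zip qs (map snd ts)"
      using qs(2) by (intro nth_equalityI) (auto simp: m_def)
    finally show ?thesis .
  qed
  ultimately show ?thesis by blast
qed

text \<open>The coefficients from \<open>B\<close> reappear as the arguments \<open>qs\<close>,
  which leaves an integral polynomial; in this form it can be applied to tuples moved by a
  hyper-automorphism.\<close>

lemma separating_polynomial:
  fixes R :: "nat ring"
  assumes FA: "finite_action R G ac B" and a: "set a \<subseteq> carrier R" and b: "set b \<subseteq> carrier R" "length b = length a"
    and ne: "\<And>g. g \<in> carrier G \<Longrightarrow> map (ac g) a \<noteq> b"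
  obtains p qs where "p \<in> polys" "set qs \<subseteq> B" "poly_var p = length a + length qs"
    "poly_eval R p (a @ qs) = \<zero>\<^bsub>R\<^esub>" "poly_eval R p (b @ qs) \<noteq> \<zero>\<^bsub>R\<^esub>"
proof -
  interpret finite_action R G ac B by (rule FA)
  obtain ts where ts: "\<And>q e. (q, e) \<in> set ts \<Longrightarrow> q \<in> B \<and> length e = length a"
    "K.evt ts a = \<zero>\<^bsub>R\<^esub>" "K.evt ts b \<noteq> \<zero>\<^bsub>R\<^esub>"
    using invariant_separating_terms[OF a b ne] by blast
  have "ts \<noteq> []" using ts(3) by auto
  moreover have "length e = length a" if "(q, e) \<in> set ts" for q e using ts(1)[OF that] ..
  ultimately obtain p where p: "p \<in> polys" "poly_var p = length a + length ts"
    "\<forall>xs qs. cring R \<longrightarrow> set xs \<subseteq> carrier R \<longrightarrow> length xs = length a \<longrightarrow> set qs \<subseteq> carrier R \<longrightarrow> length qs = length ts \<longrightarrow>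
      poly_eval R p (xs @ qs) = cring.evt R (zip qs (map snd ts)) xs"
    using coded_polynomial[of ts "length a" R] by blast
  have qs: "set (map fst ts) \<subseteq> B" using ts(1) by force
  then have "set (map fst ts) \<subseteq> carrier R" using fixed by auto
  then have "poly_eval R p (xs @ map fst ts) = K.evt ts xs" if "set xs \<subseteq> carrier R" "length xs = length a" for xs
    using p(3) K.is_cring that by (simp add: zip_map_fst_snd)
  then show ?thesis using that[OF p(1) qs] p(2) a b ts by simp
qed

section \<open>Uniformly computable finite groups and their products\<close>

locale uniform_groups =
  fixes H :: "nat \<Rightarrow> nat monoid"
  assumes ucg: "uniformly_computable_finite_groups H"
begin

lemma group_H: "group (H n)"
  using ucg by (simp add: uniformly_computable_finite_groups_def)

sublocale H: group "H n" for n by (rule group_H)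

text \<open>One fixed computable listing of the elements. Quantifiers over the group become
  quantifiers over a coded list and remain decidable, which a mere decision procedure for membership
  would not give.\<close>

definition gcode :: "nat \<Rightarrow> nat" where
  "gcode = (SOME e. tc e \<and> (\<forall>n. carrier (H n) = set (list_decode (e n))))"

lemma gcode: "tc gcode" "carrier (H n) = set (list_decode (gcode n))"
proof -
  obtain e p where e: "partial_computable p" "\<forall>x. p x = Some (e x)" "\<forall>n. carrier (H n) = set (list_decode (e n))"
    using ucg unfolding uniformly_computable_finite_groups_def computable_on_def by auto
  have "(\<lambda>n. Some (e n)) = p" using e(2) by (simp add: fun_eq_iff)
  then have "\<exists>e. tc e \<and> (\<forall>n. carrier (H n) = set (list_decode (e n)))"
    using e(1,3) unfolding tc_def by metis
  from someI_ex[OF this] show "tc gcode" "carrier (H n) = set (list_decode (gcode n))"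
    unfolding gcode_def by blast+
qed

lemma tc_gcode [tc_intros]: "tc f \<Longrightarrow> tc (\<lambda>z. gcode (f z))"
  by (rule tc_comp[OF gcode(1)])

lemma finite_H: "finite (carrier (H n))"
  by (simp add: gcode(2))

lemma usd_group: "usd (\<lambda>n. carrier (H n))"
proof -
  have "decidable (\<lambda>z. \<exists>y\<in>set (list_decode (gcode (pfst z))). y = psnd z)" by (intro tc_intros)
  then show ?thesis by (simp add: usd_def gcode(2))
qed

lemma dec_group [tc_intros]: "tc f \<Longrightarrow> tc g \<Longrightarrow> decidable (\<lambda>z. g z \<in> carrier (H (f z)))"
  by (rule usd_decidable[OF usd_group])

definition gmul :: "nat \<Rightarrow> nat \<Rightarrow> nat \<Rightarrow> nat" where
  "gmul n x y = (if x \<in> carrier (H n) \<and> y \<in> carrier (H n) then x \<otimes>\<^bsub>H n\<^esub> y else 0)"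

lemma tc_gmul [tc_intros]: "tc f \<Longrightarrow> tc g \<Longrightarrow> tc h \<Longrightarrow> tc (\<lambda>z. gmul (f z) (g z) (h z))"
  unfolding gmul_def
  by (rule tc_guarded3[of "\<lambda>n x y. x \<in> carrier (H n) \<and> y \<in> carrier (H n)"])
    (use ucg in \<open>auto simp: uniformly_computable_finite_groups_def intro!: tc_intros\<close>)

text \<open>Found by search, the identity being the only idempotent of a group.\<close>

lemma tc_group_one: "tc (\<lambda>n. \<one>\<^bsub>H n\<^esub>)"
proof (rule tc_Least1[where P = "\<lambda>n x. x \<in> carrier (H n) \<and> gmul n x x = x"])
  show "y = \<one>\<^bsub>H x\<^esub>" if "y \<in> carrier (H x) \<and> gmul x y y = y" for x y
  proof -
    have "y \<otimes>\<^bsub>H x\<^esub> y = y \<otimes>\<^bsub>H x\<^esub> \<one>\<^bsub>H x\<^esub>" using that by (auto simp: gmul_def)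
    then show ?thesis using that by (metis H.l_cancel H.one_closed)
  qed
qed (auto simp: gmul_def[of _ "\<one>\<^bsub>H x\<^esub>" for x] intro!: tc_intros)

lemma tc_gone [tc_intros]: "tc f \<Longrightarrow> tc (\<lambda>z. \<one>\<^bsub>H (f z)\<^esub>)"
  by (rule tc_comp[OF tc_group_one])

end

lemma (in cohesive_set) const_cl:
  assumes "hidx C l" "tc h" "\<And>n. h n \<in> S n"
  shows "ccls C (along S l) (\<lambda>i. map_option h (l i)) = cl S l (\<lambda>i. h (the (l i)))" "el S l (\<lambda>i. h (the (l i)))"
proof -
  have "partial_computable (\<lambda>i. map_option h (l i))"
    using partial_computable.comp[OF assms(2)[unfolded tc_def], of l] assms(1)
    by (simp add: hidx_def map_conv_bind_option comp_def)
  moreover have ae: "\<forall>\<^sub>F i in F. map_option h (l i) = Some (h (the (l i)))"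
    using hidx_ex[OF assms(1)] by (rule eventually_mono) auto
  ultimately have "(\<lambda>i. map_option h (l i)) \<in> cpre C (along S l)"
    using assms(1,3) by (auto simp: cpre_along hidx_def)
  from ccls_cl[OF this ae] show "ccls C (along S l) (\<lambda>i. map_option h (l i)) = cl S l (\<lambda>i. h (the (l i)))" .
  show "el S l (\<lambda>i. h (the (l i)))" by (rule elI, rule hc_comp[OF assms(2) hidx_val[OF assms(1)]]) (simp add: assms(3))
qed

locale hyper_group = cohesive_set C + uniform_groups H for C H +
  fixes l :: pfun
  assumes l: "hidx C l"
begin

abbreviation S where "S \<equiv> \<lambda>n. carrier (H n)"
abbreviation v where "v i \<equiv> the (l i)"
abbreviation P where "P \<equiv> cprod_group C (along H l)"

lemmas S_cprodI = cprodI[OF l usd_group]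

lemma P_carrier: "carrier P = cprod C (along S l)"
  by (simp add: cprod_group_def carriers_along)

lemma carrier_elim:
  assumes "x \<in> carrier P" obtains f where "el S l f" "x = cl S l f"
  by (rule cprodE[OF assms[unfolded P_carrier]])

lemma carrier_intro: "el S l f \<Longrightarrow> cl S l f \<in> carrier P"
  unfolding P_carrier by (rule S_cprodI)

lemma mult_cl:
  assumes "el S l f" "el S l g"
  shows "cl S l f \<otimes>\<^bsub>P\<^esub> cl S l g = cl S l (\<lambda>i. f i \<otimes>\<^bsub>H (v i)\<^esub> g i)" "el S l (\<lambda>i. f i \<otimes>\<^bsub>H (v i)\<^esub> g i)"
proof -
  have ae: "\<forall>\<^sub>F i in F. f i \<otimes>\<^bsub>H (v i)\<^esub> g i = gmul (v i) (f i) (g i)"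
    using el_ae[OF assms(1)] el_ae[OF assms(2)] by eventually_elim (simp add: gmul_def)
  have *: "cmap2 C (along S l) (\<lambda>i. map_option monoid.mult (along H l i)) (cl S l f) (cl S l g)
      = cl S l (\<lambda>i. f i \<otimes>\<^bsub>H (v i)\<^esub> g i) \<and> el S l (\<lambda>i. f i \<otimes>\<^bsub>H (v i)\<^esub> g i)"
    by (rule cmap2_cl[where G = gmul, OF l usd_group assms(1) l usd_group assms(2) l _ _ ae], intro tc_intros)
      (auto simp: along_def gmul_def)
  then show "cl S l f \<otimes>\<^bsub>P\<^esub> cl S l g = cl S l (\<lambda>i. f i \<otimes>\<^bsub>H (v i)\<^esub> g i)" "el S l (\<lambda>i. f i \<otimes>\<^bsub>H (v i)\<^esub> g i)"
    by (simp_all add: cprod_group_def carriers_along)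
qed

lemma one_cl: "\<one>\<^bsub>P\<^esub> = cl S l (\<lambda>i. \<one>\<^bsub>H (v i)\<^esub>)" "el S l (\<lambda>i. \<one>\<^bsub>H (v i)\<^esub>)"
  using const_cl(1)[OF l tc_group_one H.one_closed] const_cl(2)[OF l tc_group_one H.one_closed]
  by (simp_all only: cprod_group_def carriers_along map_option_along monoid.simps partial_object.simps)

lemma cl_eqI:
  assumes "\<And>i. \<lbrakk>\<And>f. f \<in> A \<Longrightarrow> f i \<in> S (v i)\<rbrakk> \<Longrightarrow> g i = h i" "finite A" "\<And>f. f \<in> A \<Longrightarrow> el S l f"
  shows "cl S l g = cl S l h"
proof (rule cl_cong)
  have "\<forall>\<^sub>F i in F. \<forall>f\<in>A. f i \<in> S (v i)"
    by (intro eventually_ball_finite[OF assms(2)] ballI el_ae[OF assms(3)])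
  then show "\<forall>\<^sub>F i in F. g i = h i" by eventually_elim (rule assms(1), simp)
qed

lemma el_inv:
  assumes "el S l f" shows "el S l (\<lambda>i. inv\<^bsub>H (v i)\<^esub> f i)"
proof -
  have d: "decidable (\<lambda>w. psnd w \<in> S (pfst (pfst w)) \<and> gmul (pfst (pfst w)) (psnd w) (psnd (pfst w)) = \<one>\<^bsub>H (pfst (pfst w))\<^esub>)"
    by (intro tc_intros)
  have ex: "\<forall>\<^sub>F i in F. \<exists>k. k \<in> S (v i) \<and> gmul (v i) k (f i) = \<one>\<^bsub>H (v i)\<^esub>"
    using el_ae[OF assms]
  proof eventually_elim
    case (elim i)
    then show ?case by (intro exI[of _ "inv\<^bsub>H (v i)\<^esub> f i"]) (simp add: gmul_def)
  qed
  obtain g where g: "hc C g" "\<forall>\<^sub>F i in F. g i \<in> S (v i) \<and> gmul (v i) (g i) (f i) = \<one>\<^bsub>H (v i)\<^esub>"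
    using hc_search[of "\<lambda>z k. k \<in> S (pfst z) \<and> gmul (pfst z) k (psnd z) = \<one>\<^bsub>H (pfst z)\<^esub>", OF d hc_pair[OF hidx_val[OF l] el_hc[OF assms]]] ex
    by auto
  have eg: "el S l g" using g by (auto intro!: elI elim: eventually_mono)
  have "\<forall>\<^sub>F i in F. g i = inv\<^bsub>H (v i)\<^esub> f i"
    using g(2) el_ae[OF assms]
  proof eventually_elim
    case (elim i)
    then show ?case using H.inv_equality[of "v i" "g i" "f i"] by (auto simp: gmul_def)
  qed
  then show ?thesis by (rule el_cong[OF eg])
qed

lemma group_P: "group P"
proof (rule groupI)
  fix x y assume "x \<in> carrier P" "y \<in> carrier P"
  then show "x \<otimes>\<^bsub>P\<^esub> y \<in> carrier P" by (elim carrier_elim) (simp add: mult_cl carrier_intro)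
next
  show "\<one>\<^bsub>P\<^esub> \<in> carrier P" using one_cl carrier_intro by simp
next
  fix x y z assume "x \<in> carrier P" "y \<in> carrier P" "z \<in> carrier P"
  then obtain f g h where e: "el S l f" "el S l g" "el S l h" "x = cl S l f" "y = cl S l g" "z = cl S l h"
    by (elim carrier_elim) blast
  show "x \<otimes>\<^bsub>P\<^esub> y \<otimes>\<^bsub>P\<^esub> z = x \<otimes>\<^bsub>P\<^esub> (y \<otimes>\<^bsub>P\<^esub> z)" unfolding e
    using e(1-3) by (simp add: mult_cl) (rule cl_eqI[of "{f, g, h}"], auto simp: H.m_assoc)
next
  fix x assume "x \<in> carrier P"
  then obtain f where e: "el S l f" "x = cl S l f" by (elim carrier_elim) blast
  show "\<one>\<^bsub>P\<^esub> \<otimes>\<^bsub>P\<^esub> x = x" unfolding e one_cl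
    using e(1) one_cl(2) by (simp add: mult_cl) (rule cl_eqI[of "{f}"], auto)
  have "cl S l (\<lambda>i. inv\<^bsub>H (v i)\<^esub> f i) \<otimes>\<^bsub>P\<^esub> x = \<one>\<^bsub>P\<^esub>" unfolding e one_cl
    using e(1) el_inv[OF e(1)] by (simp add: mult_cl) (rule cl_eqI[of "{f}"], auto)
  then show "\<exists>y\<in>carrier P. y \<otimes>\<^bsub>P\<^esub> x = \<one>\<^bsub>P\<^esub>" using carrier_intro[OF el_inv[OF e(1)]] by blast
qed

end

section \<open>Fully computable Galois extensions\<close>

lemma ucf_const: "computable_field R \<Longrightarrow> uniformly_computable_fields (\<lambda>_. R)"
  by (simp add: computable_field_def)

lemma map_preimage:
  assumes "set ys \<subseteq> f ` A" obtains xs where "set xs \<subseteq> A" "ys = map f xs"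
proof -
  have "\<exists>xs. set xs \<subseteq> A \<and> ys = map f xs" using assms
  proof (induction ys)
    case (Cons y ys)
    then obtain x xs where "x \<in> A" "y = f x" "set xs \<subseteq> A" "ys = map f xs" by auto
    then show ?case by (intro exI[of _ "x # xs"]) simp
  qed simp
  then show ?thesis using that by blast
qed

lemma the_inv_into_image:
  assumes "inj_on f A" "y \<in> f ` A"
  shows "the_inv_into A f y \<in> A" "f (the_inv_into A f y) = y"
  using assms by (auto simp: the_inv_into_f_f)

lemma map_tuple_closed: "t \<in> tuples A \<Longrightarrow> (\<And>x. x \<in> A \<Longrightarrow> h x \<in> A') \<Longrightarrow> map_tuple h t \<in> tuples A'"
  by (auto simp: tuples_iff map_tuple_def)

lemma map_tuple_cong: "t \<in> tuples A \<Longrightarrow> (\<And>x. x \<in> A \<Longrightarrow> h x = h' x) \<Longrightarrow> map_tuple h t = map_tuple h' t"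
  by (auto simp: tuples_iff map_tuple_def subset_iff intro!: arg_cong[of _ _ list_encode])

lemma map_tuple_comp: "map_tuple h (map_tuple h' t) = map_tuple (\<lambda>x. h (h' x)) t"
  by (simp add: map_tuple_def comp_def)

lemma list_decode_map_tuple [simp]: "list_decode (map_tuple h t) = map h (list_decode t)"
  by (simp add: map_tuple_def)

lemma tc_map_tuple:
  assumes "tc (\<lambda>z. h (pfst z) (psnd z))" "tc l" shows "tc (\<lambda>x. map_tuple (h x) (l x))"
  unfolding map_tuple_def by (intro tc_map assms)

declare tc_map_tuple [tc_intros]

locale galois_setup =
  fixes E :: galois_data
  assumes fc: "fully_computable E"
begin

sublocale K: uniform_fields "lev E"
  using fc by unfold_locales (simp add: fully_computable_def)

sublocale T: uniform_fields "\<lambda>_. top_field E"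
  using fc by unfold_locales (simp add: fully_computable_def ucf_const)

sublocale B: uniform_fields "\<lambda>_. base E"
  using fc by unfold_locales (simp add: fully_computable_def ucf_const)

sublocale G: uniform_groups "grp E"
  using fc by unfold_locales (simp add: fully_computable_def)

abbreviation "bimg n \<equiv> lev_base E n ` carrier (base E)"

lemma lev_emb_hom: "lev_emb E n \<in> ring_hom (lev E n) (top_field E)"
  using fc by (simp add: fully_computable_def)

lemma lev_emb_closed [simp]: "x \<in> carrier (lev E n) \<Longrightarrow> lev_emb E n x \<in> carrier (top_field E)"
  by (rule ring_hom_closed[OF lev_emb_hom])

lemma lev_emb_inj: "inj_on (lev_emb E n) (carrier (lev E n))"
  by (rule non_trivial_field_hom_is_inj[OF lev_emb_hom K.field_R T.field_R])

lemma lev_emb_eq [simp]: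
  "x \<in> carrier (lev E n) \<Longrightarrow> y \<in> carrier (lev E n) \<Longrightarrow> lev_emb E n x = lev_emb E n y \<longleftrightarrow> x = y"
  by (rule inj_on_eq_iff[OF lev_emb_inj])

lemma emb_hom: "emb E \<in> ring_hom (base E) (top_field E)"
  using fc by (simp add: fully_computable_def)

lemma lev_image_Suc: "lev_emb E n ` carrier (lev E n) \<subseteq> lev_emb E (Suc n) ` carrier (lev E (Suc n))"
proof -
  have "\<forall>i. lev_emb E i ` carrier (lev E i) \<subset> lev_emb E (Suc i) ` carrier (lev E (Suc i))"
    using fc unfolding fully_computable_def by (elim conjE)
  then show ?thesis by blast
qed

lemma lev_image_mono: "n \<le> m \<Longrightarrow> lev_emb E n ` carrier (lev E n) \<subseteq> lev_emb E m ` carrier (lev E m)"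
  by (rule lift_Suc_mono_le[of "\<lambda>n. lev_emb E n ` carrier (lev E n)", OF lev_image_Suc])

lemma top_union: "carrier (top_field E) = (\<Union>i. lev_emb E i ` carrier (lev E i))"
  using fc unfolding fully_computable_def by (elim conjE)

lemma lev_incl:
  assumes "n \<le> m" "x \<in> carrier (lev E n)"
  shows "lev_incl E m n x \<in> carrier (lev E m)" "lev_emb E m (lev_incl E m n x) = lev_emb E n x"
proof -
  have "lev_emb E n x \<in> lev_emb E m ` carrier (lev E m)" using lev_image_mono[OF assms(1)] assms(2) by blast
  from the_inv_into_image[OF lev_emb_inj this]
  show "lev_incl E m n x \<in> carrier (lev E m)" "lev_emb E m (lev_incl E m n x) = lev_emb E n x"
    by (simp_all add: lev_incl_def)
qed

lemma lev_base:
  assumes "c \<in> carrier (base E)"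
  shows "lev_base E n c \<in> carrier (lev E n)" "lev_emb E n (lev_base E n c) = emb E c"
proof -
  have "\<forall>i. emb E ` carrier (base E) \<subseteq> lev_emb E i ` carrier (lev E i)"
    using fc unfolding fully_computable_def by (elim conjE)
  then have "emb E c \<in> lev_emb E n ` carrier (lev E n)" using assms by blast
  from the_inv_into_image[OF lev_emb_inj this]
  show "lev_base E n c \<in> carrier (lev E n)" "lev_emb E n (lev_base E n c) = emb E c"
    by (simp_all add: lev_base_def)
qed

text \<open>The embedding of a level into the top field is an injective homomorphism, so a map into
  the level is a homomorphism as soon as its composite with the embedding is one. Both
  \<open>lev_incl\<close> and \<open>lev_base\<close> are defined only through the top
  field.\<close>

lemma hom_factor:
  assumes R: "field R" and h: "h \<in> ring_hom R (top_field E)"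
    and k: "\<And>x. x \<in> carrier R \<Longrightarrow> k x \<in> carrier (lev E n) \<and> lev_emb E n (k x) = h x"
  shows "k \<in> ring_hom R (lev E n)"
proof -
  interpret R: field R by (rule R)
  show ?thesis
  proof (rule ring_hom_memI)
    fix x y assume xy: "x \<in> carrier R" "y \<in> carrier R"
    then have kk: "k x \<in> carrier (lev E n)" "k y \<in> carrier (lev E n)" using k by auto
    have "lev_emb E n (k (x \<otimes>\<^bsub>R\<^esub> y)) = lev_emb E n (k x \<otimes>\<^bsub>lev E n\<^esub> k y)"
      using xy k kk by (simp add: ring_hom_mult[OF lev_emb_hom] ring_hom_mult[OF h])
    then show "k (x \<otimes>\<^bsub>R\<^esub> y) = k x \<otimes>\<^bsub>lev E n\<^esub> k y"
      using lev_emb_eq[of "k (x \<otimes>\<^bsub>R\<^esub> y)" n "k x \<otimes>\<^bsub>lev E n\<^esub> k y"] xy kk k by (simp del: lev_emb_eq)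
    have "lev_emb E n (k (x \<oplus>\<^bsub>R\<^esub> y)) = lev_emb E n (k x \<oplus>\<^bsub>lev E n\<^esub> k y)"
      using xy k kk by (simp add: ring_hom_add[OF lev_emb_hom] ring_hom_add[OF h])
    then show "k (x \<oplus>\<^bsub>R\<^esub> y) = k x \<oplus>\<^bsub>lev E n\<^esub> k y"
      using lev_emb_eq[of "k (x \<oplus>\<^bsub>R\<^esub> y)" n "k x \<oplus>\<^bsub>lev E n\<^esub> k y"] xy kk k by (simp del: lev_emb_eq)
  next
    have "lev_emb E n (k \<one>\<^bsub>R\<^esub>) = lev_emb E n \<one>\<^bsub>lev E n\<^esub>"
      using k by (simp add: ring_hom_one[OF lev_emb_hom] ring_hom_one[OF h])
    then show "k \<one>\<^bsub>R\<^esub> = \<one>\<^bsub>lev E n\<^esub>"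
      using lev_emb_eq[of "k \<one>\<^bsub>R\<^esub>" n "\<one>\<^bsub>lev E n\<^esub>"] k by (simp del: lev_emb_eq)
  qed (use k in blast)
qed

lemma lev_incl_hom: "n \<le> m \<Longrightarrow> lev_incl E m n \<in> ring_hom (lev E n) (lev E m)"
  by (rule hom_factor[OF K.field_R lev_emb_hom]) (simp add: lev_incl)

lemma lev_base_hom: "lev_base E n \<in> ring_hom (base E) (lev E n)"
  by (rule hom_factor[OF B.field_R emb_hom]) (simp add: lev_base)

lemma lev_incl_inj: "n \<le> m \<Longrightarrow> inj_on (lev_incl E m n) (carrier (lev E n))"
  by (rule non_trivial_field_hom_is_inj[OF lev_incl_hom K.field_R K.field_R])

lemma lev_incl_base: "n \<le> m \<Longrightarrow> c \<in> carrier (base E) \<Longrightarrow> lev_incl E m n (lev_base E n c) = lev_base E m c"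
  using lev_emb_eq[of "lev_incl E m n (lev_base E n c)" m "lev_base E m c"] by (simp add: lev_incl lev_base del: lev_emb_eq)

lemma act_iso: "(\<lambda>g. restrict (act E n g) (carrier (lev E n))) \<in> iso (grp E n) (Gal (lev E n) (bimg n))"
  using fc unfolding fully_computable_def by (elim conjE) blast

lemma Gal_restrict:
  fixes R :: "'x ring"
  assumes "ring R" "restrict f (carrier R) \<in> carrier (Gal R A)"
  shows "f \<in> ring_hom R R" "bij_betw f (carrier R) (carrier R)"
proof -
  interpret ring R by (rule assms(1))
  have *: "restrict f (carrier R) \<in> ring_hom R R" "restrict f (carrier R) \<in> Bij (carrier R)"
    using assms(2) by (auto simp: Gal_def)
  show "f \<in> ring_hom R R"
  proof (rule ring_hom_memI)
    show "f x \<in> carrier R" if "x \<in> carrier R" for x using ring_hom_closed[OF *(1) that] that by simp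
    show "f (x \<otimes>\<^bsub>R\<^esub> y) = f x \<otimes>\<^bsub>R\<^esub> f y" if "x \<in> carrier R" "y \<in> carrier R" for x y
      using ring_hom_mult[OF *(1) that] that by simp
    show "f (x \<oplus>\<^bsub>R\<^esub> y) = f x \<oplus>\<^bsub>R\<^esub> f y" if "x \<in> carrier R" "y \<in> carrier R" for x y
      using ring_hom_add[OF *(1) that] that by simp
    show "f \<one>\<^bsub>R\<^esub> = \<one>\<^bsub>R\<^esub>" using ring_hom_one[OF *(1)] by simp
  qed
  show "bij_betw f (carrier R) (carrier R)"
    using *(2) by (simp add: Bij_def bij_betw_restrict_eq)
qed

lemma act_props:
  assumes "g \<in> carrier (grp E n)"
  shows "act E n g \<in> ring_hom (lev E n) (lev E n)" "bij_betw (act E n g) (carrier (lev E n)) (carrier (lev E n))"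
proof -
  have "restrict (act E n g) (carrier (lev E n)) \<in> carrier (Gal (lev E n) (bimg n))"
    using hom_in_carrier[OF iso_imp_homomorphism[OF act_iso] assms] .
  from Gal_restrict[OF K.R.is_ring this]
  show "act E n g \<in> ring_hom (lev E n) (lev E n)" "bij_betw (act E n g) (carrier (lev E n)) (carrier (lev E n))"
    by blast+
qed

lemma act_closed [simp]: "g \<in> carrier (grp E n) \<Longrightarrow> x \<in> carrier (lev E n) \<Longrightarrow> act E n g x \<in> carrier (lev E n)"
  by (rule ring_hom_closed[OF act_props(1)])

lemma act_mult:
  assumes "g \<in> carrier (grp E n)" "h \<in> carrier (grp E n)" "x \<in> carrier (lev E n)"
  shows "act E n (g \<otimes>\<^bsub>grp E n\<^esub> h) x = act E n g (act E n h x)"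
proof -
  let ?r = "\<lambda>g. restrict (act E n g) (carrier (lev E n))"
  have gal: "?r g \<in> Bij (carrier (lev E n))" "?r h \<in> Bij (carrier (lev E n))"
    using hom_in_carrier[OF iso_imp_homomorphism[OF act_iso]] assms by (auto simp: Gal_def)
  have "?r (g \<otimes>\<^bsub>grp E n\<^esub> h) = ?r g \<otimes>\<^bsub>Gal (lev E n) (bimg n)\<^esub> ?r h"
    using hom_mult[OF iso_imp_homomorphism[OF act_iso] assms(1,2)] .
  then have "?r (g \<otimes>\<^bsub>grp E n\<^esub> h) x = compose (carrier (lev E n)) (?r g) (?r h) x"
    using gal by (simp add: Gal_def BijGroup_def)
  then show ?thesis using assms by (simp add: compose_def)
qed

lemma finite_action: "finite_action (lev E n) (grp E n) (act E n) (bimg n)"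
proof -
  \<comment> \<open>Multiplicativity makes the action of the identity an idempotent map, and an
    injective idempotent map is the identity.\<close>
  have one: "act E n \<one>\<^bsub>grp E n\<^esub> x = x" if x: "x \<in> carrier (lev E n)" for x
  proof -
    have "act E n \<one>\<^bsub>grp E n\<^esub> (act E n \<one>\<^bsub>grp E n\<^esub> x) = act E n \<one>\<^bsub>grp E n\<^esub> x"
      using act_mult[of "\<one>\<^bsub>grp E n\<^esub>" n "\<one>\<^bsub>grp E n\<^esub>" x] x by simp
    from inj_onD[OF bij_betw_imp_inj_on[OF act_props(2)[OF G.H.one_closed]] this _ x]
    show ?thesis using x by simp
  qed
  have gal: "galois_extension (lev E n) (bimg n)"
    using fc unfolding fully_computable_def by (elim conjE) blast
  have img: "(\<lambda>g. restrict (act E n g) (carrier (lev E n))) ` carrier (grp E n) = carrier (Gal (lev E n) (bimg n))"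
    using act_iso by (auto simp: iso_def bij_betw_def)
  have fixed: "bimg n = {x \<in> carrier (lev E n). \<forall>g\<in>carrier (grp E n). act E n g x = x}"
  proof -
    have "bimg n = {x \<in> carrier (lev E n). \<forall>\<sigma>\<in>carrier (Gal (lev E n) (bimg n)). \<sigma> x = x}"
      using gal by (simp add: galois_extension_def)
    then show ?thesis unfolding img[symmetric] by auto
  qed
  have faithful: "g = h" if "g \<in> carrier (grp E n)" "h \<in> carrier (grp E n)"
    "\<And>x. x \<in> carrier (lev E n) \<Longrightarrow> act E n g x = act E n h x" for g h
  proof -
    have "inj_on (\<lambda>g. restrict (act E n g) (carrier (lev E n))) (carrier (grp E n))"
      using act_iso by (auto simp: iso_def bij_betw_def)
    moreover have "restrict (act E n g) (carrier (lev E n)) = restrict (act E n h) (carrier (lev E n))"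
      using that(3) by auto
    ultimately show ?thesis using that(1,2) by (auto dest: inj_onD)
  qed
  have fa: "field_action (lev E n) (grp E n) (act E n) (bimg n)"
    by (rule field_action.intro[OF K.field_R G.group_H], rule field_action_axioms.intro)
      (fact act_props(1) act_mult one fixed)+
  show ?thesis
  proof (rule finite_action.intro[OF fa], rule finite_action_axioms.intro)
    show "finite (carrier (grp E n))" by (rule G.finite_H)
    show "g = h" if "g \<in> carrier (grp E n)" "h \<in> carrier (grp E n)"
      "\<And>x. x \<in> carrier (lev E n) \<Longrightarrow> act E n g x = act E n h x" for g h
      by (rule faithful[OF that])
  qed
qed

sublocale act: finite_action "lev E n" "grp E n" "act E n" "bimg n" for n
  by (rule finite_action)

lemma quot_closed: "n < m \<Longrightarrow> g \<in> carrier (grp E m) \<Longrightarrow> quot E m n g \<in> carrier (grp E n)"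
  and quot_act: "n < m \<Longrightarrow> g \<in> carrier (grp E m) \<Longrightarrow> x \<in> carrier (lev E n) \<Longrightarrow>
      lev_incl E m n (act E n (quot E m n g) x) = act E m g (lev_incl E m n x)"
proof -
  have *: "\<forall>m n. n < m \<longrightarrow> quot E m n \<in> carrier (grp E m) \<rightarrow> carrier (grp E n) \<and>
        (\<forall>g\<in>carrier (grp E m). \<forall>x\<in>carrier (lev E n).
           lev_incl E m n (act E n (quot E m n g) x) = act E m g (lev_incl E m n x))"
    using fc unfolding fully_computable_def by (elim conjE)
  show "n < m \<Longrightarrow> g \<in> carrier (grp E m) \<Longrightarrow> quot E m n g \<in> carrier (grp E n)" using * by blast
  show "n < m \<Longrightarrow> g \<in> carrier (grp E m) \<Longrightarrow> x \<in> carrier (lev E n) \<Longrightarrow>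
      lev_incl E m n (act E n (quot E m n g) x) = act E m g (lev_incl E m n x)" using * by blast
qed

lemma quot_emb:
  assumes "n < m" "g \<in> carrier (grp E m)" "x \<in> carrier (lev E n)"
  shows "lev_emb E m (act E m g (lev_incl E m n x)) = lev_emb E n (act E n (quot E m n g) x)"
  using quot_act[OF assms] lev_incl(2)[of n m "act E n (quot E m n g) x"] assms quot_closed[OF assms(1,2)] by simp

text \<open>The data only require that \<open>quot\<close> intertwines the two actions.
  Multiplicativity follows since the inclusion is injective and the action of the lower group is
  faithful.\<close>

lemma quot_mult:
  assumes "n < m" "g \<in> carrier (grp E m)" "h \<in> carrier (grp E m)"
  shows "quot E m n (g \<otimes>\<^bsub>grp E m\<^esub> h) = quot E m n g \<otimes>\<^bsub>grp E n\<^esub> quot E m n h"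
proof (rule act.faithful)
  fix x assume x: "x \<in> carrier (lev E n)"
  note q = quot_closed[OF assms(1)]
  have "lev_incl E m n (act E n (quot E m n (g \<otimes>\<^bsub>grp E m\<^esub> h)) x) =
      lev_incl E m n (act E n (quot E m n g \<otimes>\<^bsub>grp E n\<^esub> quot E m n h) x)"
    using assms x q lev_incl(1)[of n m x] by (simp add: quot_act act_mult)
  then show "act E n (quot E m n (g \<otimes>\<^bsub>grp E m\<^esub> h)) x = act E n (quot E m n g \<otimes>\<^bsub>grp E n\<^esub> quot E m n h) x"
    using lev_incl_inj[of n m] assms x q by (auto dest!: inj_onD)
qed (use assms quot_closed in auto)

text \<open>If \<open>b\<close> is not conjugate to \<open>a\<close>, a separating polynomial
  exists. Its parameters lie in the image of the base field, so it is one of the polynomials that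
  the assumption on types speaks about, and contradicts it.\<close>

lemma same_type_conjugate:
  assumes a: "set a \<subseteq> carrier (lev E n)" and b: "set b \<subseteq> carrier (lev E n)" "length b = length a"
    and type: "\<And>p c. p \<in> polys \<Longrightarrow> set c \<subseteq> carrier (base E) \<Longrightarrow> poly_var p = length a + length c \<Longrightarrow>
      poly_eval (lev E n) p (a @ map (lev_base E n) c) = \<zero>\<^bsub>lev E n\<^esub> \<Longrightarrow>
      poly_eval (lev E n) p (b @ map (lev_base E n) c) = \<zero>\<^bsub>lev E n\<^esub>"
  shows "\<exists>g\<in>carrier (grp E n). b = map (act E n g) a"
proof (rule ccontr)
  assume neg: "\<not> ?thesis"
  have "map (act E n g) a \<noteq> b" if g: "g \<in> carrier (grp E n)" for g
  proof
    assume "map (act E n g) a = b"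
    with neg bexI[of "\<lambda>g. b = map (act E n g) a", OF _ g] show False by blast
  qed
  then obtain p qs where p: "p \<in> polys" "set qs \<subseteq> bimg n" "poly_var p = length a + length qs"
    "poly_eval (lev E n) p (a @ qs) = \<zero>\<^bsub>lev E n\<^esub>" "poly_eval (lev E n) p (b @ qs) \<noteq> \<zero>\<^bsub>lev E n\<^esub>"
    using separating_polynomial[OF finite_action a b] by blast
  obtain c where "set c \<subseteq> carrier (base E)" "qs = map (lev_base E n) c"
    by (rule map_preimage[OF p(2)])
  then show False using type[of p c] p by simp
qed

text \<open>The problem is moved to a level \<open>m\<close> that contains both tuples. The
  conjugating element found there restricts to one of level \<open>n\<close>, and the restriction
  has the same effect on the entries of \<open>a\<close>.\<close>

lemma same_type_conjugate_top:
  assumes a: "set a \<subseteq> carrier (lev E n)" and b: "set b \<subseteq> carrier (top_field E)" "length b = length a"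
    and type: "\<And>p c. p \<in> polys \<Longrightarrow> set c \<subseteq> carrier (base E) \<Longrightarrow> poly_var p = length a + length c \<Longrightarrow>
      poly_eval (top_field E) p (map (lev_emb E n) a @ map (emb E) c) = \<zero>\<^bsub>top_field E\<^esub> \<Longrightarrow>
      poly_eval (top_field E) p (b @ map (emb E) c) = \<zero>\<^bsub>top_field E\<^esub>"
  shows "\<exists>g\<in>carrier (grp E n). b = map (lev_emb E n) (map (act E n g) a)"
proof -
  \<comment> \<open>The level is taken strictly above \<open>n\<close>, because \<open>quot\<close>
    is specified for strict inequality only.\<close>
  have "\<exists>m>n. set b \<subseteq> lev_emb E m ` carrier (lev E m)"
    using b(1)
  proof (induction b)
    case (Cons x b)
    then obtain m where m: "m > n" "set b \<subseteq> lev_emb E m ` carrier (lev E m)" by auto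
    obtain k where k: "x \<in> lev_emb E k ` carrier (lev E k)" using Cons.prems top_union by auto
    have "x \<in> lev_emb E (max m k) ` carrier (lev E (max m k))"
      "lev_emb E m ` carrier (lev E m) \<subseteq> lev_emb E (max m k) ` carrier (lev E (max m k))"
      using k lev_image_mono[of k "max m k"] lev_image_mono[of m "max m k"] by auto
    then show ?case using m by (intro exI[of _ "max m k"]) auto
  qed auto
  then obtain m where m: "n < m" "set b \<subseteq> lev_emb E m ` carrier (lev E m)" by blast
  obtain b' where b': "set b' \<subseteq> carrier (lev E m)" "b = map (lev_emb E m) b'"
    by (rule map_preimage[OF m(2)])
  let ?a = "map (lev_incl E m n) a"
  have a': "set ?a \<subseteq> carrier (lev E m)" using a lev_incl(1)[of n m] m(1) by auto
  have ea: "map (lev_emb E m) ?a = map (lev_emb E n) a" using a lev_incl(2)[of n m] m(1) by auto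
  have ec: "map (lev_emb E m) (map (lev_base E m) c) = map (emb E) c" if "set c \<subseteq> carrier (base E)" for c
    using that lev_base(2)[of _ m] by auto
  have cl: "set (map (lev_base E m) c) \<subseteq> carrier (lev E m)" if "set c \<subseteq> carrier (base E)" for c
    using that lev_base(1)[of _ m] by auto
  have ev: "poly_eval (top_field E) p (map (lev_emb E m) xs) = \<zero>\<^bsub>top_field E\<^esub> \<longleftrightarrow> poly_eval (lev E m) p xs = \<zero>\<^bsub>lev E m\<^esub>"
    if xs: "set xs \<subseteq> carrier (lev E m)" for p xs
  proof -
    have "lev_emb E m \<zero>\<^bsub>lev E m\<^esub> = \<zero>\<^bsub>top_field E\<^esub>"
      by (rule ring_hom_zero[OF lev_emb_hom K.R.is_ring T.R.is_ring])
    moreover have "poly_eval (lev E m) p xs \<in> carrier (lev E m)"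
      using K.rpoly_eq(2)[of "list_encode xs" m p] xs by simp
    ultimately show ?thesis
      unfolding poly_eval_hom[OF K.R.is_cring T.R.is_cring lev_emb_hom xs]
      using lev_emb_eq[of "poly_eval (lev E m) p xs" m "\<zero>\<^bsub>lev E m\<^esub>"] by simp
  qed
  have "\<exists>g\<in>carrier (grp E m). b' = map (act E m g) ?a"
  proof (rule same_type_conjugate[OF a' b'(1)])
    show "length b' = length ?a" using b(2) b'(2) by simp
    fix p c assume p: "p \<in> polys" "set c \<subseteq> carrier (base E)" "poly_var p = length ?a + length c"
      "poly_eval (lev E m) p (?a @ map (lev_base E m) c) = \<zero>\<^bsub>lev E m\<^esub>"
    have "poly_eval (top_field E) p (map (lev_emb E m) (?a @ map (lev_base E m) c)) = \<zero>\<^bsub>top_field E\<^esub>"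
      using p(4) a' cl[OF p(2)] by (subst ev) auto
    then have "poly_eval (top_field E) p (map (lev_emb E n) a @ map (emb E) c) = \<zero>\<^bsub>top_field E\<^esub>"
      unfolding map_append ea ec[OF p(2)] .
    from type[OF p(1,2) _ this] p(3) have "poly_eval (top_field E) p (b @ map (emb E) c) = \<zero>\<^bsub>top_field E\<^esub>" by simp
    then have "poly_eval (top_field E) p (map (lev_emb E m) (b' @ map (lev_base E m) c)) = \<zero>\<^bsub>top_field E\<^esub>"
      unfolding map_append ec[OF p(2)] b'(2) .
    then show "poly_eval (lev E m) p (b' @ map (lev_base E m) c) = \<zero>\<^bsub>lev E m\<^esub>"
      using b'(1) cl[OF p(2)] by (subst (asm) ev) auto
  qed
  then obtain g where g: "g \<in> carrier (grp E m)" "b' = map (act E m g) ?a" by blast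
  have "b = map (lev_emb E n) (map (act E n (quot E m n g)) a)"
    unfolding b'(2) g(2) using a quot_emb[OF m(1) g(1)] by auto
  then show ?thesis using quot_closed[OF m(1) g(1)] by blast
qed

text \<open>The group is finite and acts faithfully: one entry for every pair of distinct group
  elements, moved differently by the two, suffices.\<close>

lemma trivial_stabiliser:
  "\<exists>t\<in>tuples (carrier (lev E n)). \<forall>g\<in>carrier (grp E n). \<forall>h\<in>carrier (grp E n).
     map_tuple (act E n g) t = map_tuple (act E n h) t \<longrightarrow> g = h"
proof -
  let ?D = "carrier (grp E n) \<times> carrier (grp E n)"
  have "\<forall>g h. \<exists>x. g \<in> carrier (grp E n) \<longrightarrow> h \<in> carrier (grp E n) \<longrightarrow> g \<noteq> h \<longrightarrow>
      x \<in> carrier (lev E n) \<and> act E n g x \<noteq> act E n h x" using act.faithful by blast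
  then obtain x where x: "\<And>g h. g \<in> carrier (grp E n) \<Longrightarrow> h \<in> carrier (grp E n) \<Longrightarrow> g \<noteq> h \<Longrightarrow>
      x g h \<in> carrier (lev E n) \<and> act E n g (x g h) \<noteq> act E n h (x g h)"
    by metis
  have "finite ((\<lambda>(g, h). x g h) ` {(g, h) \<in> ?D. g \<noteq> h})"
    using G.finite_H[of n] by (intro finite_imageI finite_subset[of "{(g, h) \<in> ?D. g \<noteq> h}" ?D]) auto
  then obtain xs where xs: "set xs = (\<lambda>(g, h). x g h) ` {(g, h) \<in> ?D. g \<noteq> h}" using finite_list by blast
  show ?thesis
  proof (intro bexI[of _ "list_encode xs"] ballI impI)
    show "list_encode xs \<in> tuples (carrier (lev E n))" using xs x by (auto simp: tuples_iff)
    fix g h assume gh: "g \<in> carrier (grp E n)" "h \<in> carrier (grp E n)"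
      "map_tuple (act E n g) (list_encode xs) = map_tuple (act E n h) (list_encode xs)"
    then have eq: "\<forall>y\<in>set xs. act E n g y = act E n h y" by (simp add: map_tuple_def list_encode_eq)
    show "g = h"
    proof (rule ccontr)
      assume "g \<noteq> h"
      then have "x g h \<in> set xs" using gh xs by force
      then show False using eq x[OF gh(1,2) \<open>g \<noteq> h\<close>] by blast
    qed
  qed
qed

end

section \<open>Hyper-automorphisms\<close>

definition app :: "nat \<Rightarrow> nat \<Rightarrow> nat" where
  "app a b = list_encode (list_decode a @ list_decode b)"

lemma list_decode_app [simp]: "list_decode (app a b) = list_decode a @ list_decode b"
  by (simp add: app_def)

lemma tc_app [tc_intros]: "tc f \<Longrightarrow> tc g \<Longrightarrow> tc (\<lambda>x. app (f x) (g x))"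
  unfolding app_def by (rule tc_append)

lemma map_tuple_app: "map_tuple h (app a b) = app (map_tuple h a) (map_tuple h b)"
  by (simp add: map_tuple_def app_def)

lemma app_tuples: "app a b \<in> tuples A \<longleftrightarrow> a \<in> tuples A \<and> b \<in> tuples A"
  by (auto simp: tuples_iff)

lemma map_tuple_eq_iff:
  assumes "inj_on h A" "a \<in> tuples A" "b \<in> tuples A"
  shows "map_tuple h a = map_tuple h b \<longleftrightarrow> a = b"
proof -
  have "map h (list_decode a) = map h (list_decode b) \<longleftrightarrow> list_decode a = list_decode b"
    using assms by (intro inj_on_map_eq_map) (auto simp: tuples_iff intro: inj_on_subset)
  then show ?thesis by (simp add: map_tuple_def list_encode_eq list_decode_eq)
qed

lemma prefix_map_inj_on:
  assumes "inj_on h A" "set xs \<subseteq> A" "set ys \<subseteq> A"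
  shows "prefix (map h xs) (map h ys) \<longleftrightarrow> prefix xs ys"
proof -
  have take: "prefix us ws \<longleftrightarrow> take (length us) ws = us" for us ws :: "'x list"
    by (metis append_eq_conv_conj prefix_def take_is_prefix)
  have take': "prefix us ws \<longleftrightarrow> take (length us) ws = us" for us ws :: "'y list"
    by (metis append_eq_conv_conj prefix_def take_is_prefix)
  have "map h (take (length xs) ys) = map h xs \<longleftrightarrow> take (length xs) ys = xs"
    using assms set_take_subset[of "length xs" ys] by (intro inj_on_map_eq_map) (auto intro: inj_on_subset)
  then show ?thesis unfolding take take' by (simp add: take_map)
qed

text \<open>Serves two cases: the levels, with \<open>l\<close> the index of the product, and the
  top field, seen as a constant sequence with constant index 0.\<close>

locale hyper_ext = hyper_field C R l for C R l +
  fixes Fb :: "nat ring" and U :: "nat \<Rightarrow> nat \<Rightarrow> nat"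
  assumes Fb: "uniform_fields (\<lambda>_. Fb)"
    and U_hom: "U n \<in> ring_hom Fb (R n)"
    and U_tc: "tc (\<lambda>z. if psnd z \<in> carrier Fb then U (pfst z) (psnd z) else 0)"
begin

sublocale Fb: uniform_fields "\<lambda>_. Fb" by (rule Fb)

abbreviation A where "A \<equiv> along R l"
abbreviation u where "u \<equiv> along U l"
abbreviation ST where "ST \<equiv> \<lambda>n. tuples (carrier (R n))"
abbreviation SF where "SF \<equiv> \<lambda>_::nat. tuples (carrier Fb)"
abbreviation l0 where "l0 \<equiv> \<lambda>_::nat. Some (0::nat)"

lemma usd_ST: "usd ST" by (rule usd_tuples[OF usd_carrier])
lemma usd_SF: "usd SF" by (rule usd_tuples[OF Fb.usd_carrier])
lemma usd_polys: "usd (\<lambda>_. polys)" by (rule usd_const) (intro tc_intros)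

lemmas T_eq = cl_eq_iff[OF l usd_ST]
lemmas T_intro = cprodI[OF l usd_ST]

lemma trees_A: "trees A = along ST l" by (rule trees_along)

definition Ut :: "nat \<Rightarrow> nat \<Rightarrow> nat" where
  "Ut n c = (if c \<in> carrier Fb then U n c else 0)"

lemma tc_Ut [tc_intros]: "tc f \<Longrightarrow> tc g \<Longrightarrow> tc (\<lambda>x. Ut (f x) (g x))"
  by (rule tc_comp2[of Ut]) (use U_tc in \<open>simp add: Ut_def\<close>)

lemma U_closed: "c \<in> carrier Fb \<Longrightarrow> U n c \<in> carrier (R n)"
  by (rule ring_hom_closed[OF U_hom])

lemma append_cl:
  assumes "el ST l a" "el ST l b"
  shows "tree_append C A (cl ST l a) (cl ST l b) = cl ST l (\<lambda>i. app (a i) (b i)) \<and> el ST l (\<lambda>i. app (a i) (b i))"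
  unfolding tree_append_def trees_A
  by (rule cmap2_cl[where G = "\<lambda>_. app", OF l usd_ST assms(1) l usd_ST assms(2) l], intro tc_intros)
    (auto simp: along_def app_def[symmetric] app_tuples)

lemma arity_cl:
  assumes "el ST l a"
  shows "arity C (cl ST l a) = cl (\<lambda>_. UNIV) l0 (\<lambda>i. length (list_decode (a i))) \<and> el (\<lambda>_. UNIV) l0 (\<lambda>i. length (list_decode (a i)))"
proof -
  have "cmap C (along (\<lambda>_. UNIV) l0) (\<lambda>_. Some (\<lambda>a. length (list_decode a))) (cl ST l a) = cl (\<lambda>_. UNIV) l0 (\<lambda>i. length (list_decode (a i)))
      \<and> el (\<lambda>_. UNIV) l0 (\<lambda>i. length (list_decode (a i)))"
    by (rule cmap_cl[where G = "\<lambda>_ t. length (list_decode t)", OF l usd_ST assms l], intro tc_intros) auto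
  then show ?thesis unfolding arity_def along_const .
qed

lemma hpoly_var_cl:
  assumes "el (\<lambda>_. polys) l0 p"
  shows "hpoly_var C (cl (\<lambda>_. polys) l0 p) = cl (\<lambda>_. UNIV) l0 (\<lambda>i. poly_var (p i)) \<and> el (\<lambda>_. UNIV) l0 (\<lambda>i. poly_var (p i))"
proof -
  have "cmap C (along (\<lambda>_. UNIV) l0) (\<lambda>_. Some poly_var) (cl (\<lambda>_. polys) l0 p) = cl (\<lambda>_. UNIV) l0 (\<lambda>i. poly_var (p i))
      \<and> el (\<lambda>_. UNIV) l0 (\<lambda>i. poly_var (p i))"
    by (rule cmap_cl[where G = "\<lambda>_. poly_var", OF hidx_const usd_polys assms hidx_const[of C 0]], intro tc_intros) auto
  then show ?thesis unfolding hpoly_var_def along_const .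
qed

lemma arity_eq_iff:
  assumes "el ST l a" "el ST l b"
  shows "arity C (cl ST l a) = arity C (cl ST l b) \<longleftrightarrow> (\<forall>\<^sub>F i in F. length (list_decode (a i)) = length (list_decode (b i)))"
  using arity_cl[OF assms(1)] arity_cl[OF assms(2)] cl_eq_iff[OF hidx_const usd_UNIV] by simp

lemma arity_hpoly_iff:
  assumes "el ST l a" "el (\<lambda>_. polys) l0 p"
  shows "arity C (cl ST l a) = hpoly_var C (cl (\<lambda>_. polys) l0 p) \<longleftrightarrow> (\<forall>\<^sub>F i in F. length (list_decode (a i)) = poly_var (p i))"
  using arity_cl[OF assms(1)] hpoly_var_cl[OF assms(2)] cl_eq_iff[OF hidx_const usd_UNIV] by simp

lemma single_cl:
  assumes "el S l x"
  shows "single C A (cl S l x) = cl ST l (\<lambda>i. list_encode [x i]) \<and> el ST l (\<lambda>i. list_encode [x i])"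
  unfolding single_def trees_A
  by (rule cmap_cl[where G = "\<lambda>_ x. list_encode [x]", OF l usd_carrier assms l], intro tc_intros)
    (auto simp: along_def tuples_iff simp del: list_encode.simps)

lemma base_tree_cl:
  assumes "el SF l0 c"
  shows "cmap C (trees A) (map_tuples u) (cl SF l0 c) = cl ST l (\<lambda>i. map_tuple (U (v i)) (c i)) \<and> el ST l (\<lambda>i. map_tuple (U (v i)) (c i))"
  unfolding trees_A
proof (rule cmap_cl[where G = "\<lambda>n. map_tuple (Ut n)", OF hidx_const usd_SF assms l])
  show "tc (\<lambda>z. map_tuple (Ut (pfst z)) (psnd z))" by (intro tc_intros)
  have eq: "map_tuple (U n) t = map_tuple (Ut n) t" if "t \<in> tuples (carrier Fb)" for n t
    using that by (rule map_tuple_cong) (simp add: Ut_def)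
  show "\<forall>\<^sub>F i in F. map_tuple (U (v i)) (c i) = map_tuple (Ut (v i)) (c i)"
    using el_ae[OF assms] by eventually_elim (rule eq)
  fix i k n x assume "l i = Some k" "l0 i = Some n" "x \<in> SF n"
  moreover have "map_tuple (Ut k) x \<in> ST k"
    using \<open>x \<in> SF n\<close> by (rule map_tuple_closed) (simp add: Ut_def U_closed)
  ultimately show "\<exists>h n'. map_tuples u i = Some h \<and> h x = map_tuple (Ut k) x \<and> l i = Some n' \<and> map_tuple (Ut k) x \<in> ST n'"
    by (simp add: map_tuples_def along_def eq)
qed

lemma base_cl:
  assumes "el (\<lambda>_. carrier Fb) l0 c"
  shows "cmap C (along S l) u (cl (\<lambda>_. carrier Fb) l0 c) = cl S l (\<lambda>i. U (v i) (c i)) \<and> el S l (\<lambda>i. U (v i) (c i))"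
proof (rule cmap_cl[where G = Ut, OF hidx_const Fb.usd_carrier assms l])
  show "tc (\<lambda>z. Ut (pfst z) (psnd z))" by (intro tc_intros)
  show "\<forall>\<^sub>F i in F. U (v i) (c i) = Ut (v i) (c i)"
    using el_ae[OF assms] by eventually_elim (simp add: Ut_def)
  fix i k n x assume "l i = Some k" "l0 i = Some n" "x \<in> carrier Fb"
  then show "\<exists>h n'. u i = Some h \<and> h x = Ut k x \<and> l i = Some n' \<and> Ut k x \<in> S n'"
    by (simp add: along_def Ut_def U_closed)
qed

text \<open>Evaluation is undefined where the arity does not match, so it does not have the shape
  treated by \<open>cmap2_cl\<close>; the argument from one good representative is repeated for the
  guarded evaluation through \<open>rpoly\<close>.\<close>

lemma hpoly_eval_cl:
  assumes p: "el (\<lambda>_. polys) l0 p" and t: "el ST l t"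
    and len: "\<forall>\<^sub>F i in F. length (list_decode (t i)) = poly_var (p i)"
  shows "hpoly_eval C A (cl (\<lambda>_. polys) l0 p) (cl ST l t) = cl S l (\<lambda>i. poly_eval (R (v i)) (p i) (list_decode (t i)))
    \<and> el S l (\<lambda>i. poly_eval (R (v i)) (p i) (list_decode (t i)))"
proof
  define r2 where "r2 \<pi> \<alpha> = (\<lambda>i. case (A i, \<pi> i, \<alpha> i) of
        (Some R, Some q, Some xs) \<Rightarrow>
          (if length (list_decode xs) = poly_var q then Some (poly_eval R q (list_decode xs)) else None)
      | _ \<Rightarrow> None)" for \<pi> \<alpha> :: pfun
  define r where "r z = r2 (fst z) (snd z)" for z
  obtain \<pi> where \<pi>: "\<pi> \<in> cl (\<lambda>_. polys) l0 p" using cl_member[OF hidx_const usd_polys p] .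
  obtain \<alpha> where \<alpha>: "\<alpha> \<in> cl ST l t" using cl_member[OF l usd_ST t] .
  have 1: "\<forall>\<^sub>F i in F. r z i = Some (poly_eval (R (v i)) (p i) (list_decode (t i)))"
    if "z \<in> cl (\<lambda>_. polys) l0 p \<times> cl ST l t" for z
  proof -
    have "fst z \<in> cl (\<lambda>_. polys) l0 p" "snd z \<in> cl ST l t" using that by (simp_all add: mem_Times_iff)
    then have "\<forall>\<^sub>F i in F. fst z i = Some (p i)" "\<forall>\<^sub>F i in F. snd z i = Some (t i)"
      unfolding cl_def by blast+
    with len hidx_ex[OF l] show ?thesis
      by eventually_elim (auto simp: r_def r2_def along_def)
  qed
  have pc0: "partial_computable \<pi>" "partial_computable \<alpha>" "partial_computable l"
    using \<pi> \<alpha> l by (auto simp: cl_def cpre_along hidx_def)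
  let ?q = "\<lambda>z. if length (list_decode (psnd (psnd z))) = poly_var (pfst (psnd z))
      then Some (rpoly (pfst z) (pfst (psnd z)) (psnd (psnd z))) else None"
  have "partial_computable ?q" by (rule pc_guard; intro tc_intros)
  from pc_bind3[OF pc0(3,1,2) this]
  have pcb: "partial_computable (\<lambda>i. Option.bind (l i) (\<lambda>n. Option.bind (\<pi> i) (\<lambda>q. Option.bind (\<alpha> i) (\<lambda>xs.
      if length (list_decode xs) = poly_var q then Some (rpoly n q xs) else None))))"
    unfolding prod_encode_inverse fst_conv snd_conv .
  have r_eq: "r (\<pi>, \<alpha>) i = Option.bind (l i) (\<lambda>n. Option.bind (\<pi> i) (\<lambda>q. Option.bind (\<alpha> i) (\<lambda>xs.
      if length (list_decode xs) = poly_var q then Some (rpoly n q xs) else None)))" for i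
  proof (cases "l i = None \<or> \<pi> i = None \<or> \<alpha> i = None")
    case True
    then show ?thesis by (cases "l i"; cases "\<pi> i"; cases "\<alpha> i") (simp_all add: r_def r2_def along_def)
  next
    case False
    then obtain n q xs where nq: "l i = Some n" "\<pi> i = Some q" "\<alpha> i = Some xs" by auto
    then have "xs \<in> ST n" using \<alpha> by (force simp: cl_def cpre_along)
    then have "rpoly n q xs = poly_eval (R n) q (list_decode xs)" by (intro rpoly_eq) (simp add: tuples_iff)
    then show ?thesis by (simp add: r_def r2_def along_def nq)
  qed
  have "r (\<pi>, \<alpha>) \<in> cpre C (along S l)" unfolding cpre_along
  proof (intro conjI allI impI)
    show "partial_computable (r (\<pi>, \<alpha>))" using pcb unfolding r_eq[symmetric] by simp
    show "\<forall>\<^sub>F i in F. r (\<pi>, \<alpha>) i \<noteq> None" using 1[OF SigmaI[OF \<pi> \<alpha>]] by eventually_elim simp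
    fix i y assume "r (\<pi>, \<alpha>) i = Some y"
    then obtain n q xs where nq: "l i = Some n" "\<pi> i = Some q" "\<alpha> i = Some xs" "y = rpoly n q xs"
      unfolding r_eq by (auto simp: Option.bind_eq_Some_conv split: if_splits)
    then have "xs \<in> ST n" using \<alpha> by (force simp: cl_def cpre_along)
    then have "y \<in> S n" unfolding nq(4) using rpoly_eq[of xs n q] by (simp add: tuples_iff)
    then show "\<exists>n. l i = Some n \<and> y \<in> S n" using nq(1) by blast
  qed
  from UN_ccls[where r = r, OF 1 SigmaI[OF \<pi> \<alpha>] this]
  have "(\<Union>z\<in>cl (\<lambda>_. polys) l0 p \<times> cl ST l t. ccls C (along S l) (r z)) = cl S l (\<lambda>i. poly_eval (R (v i)) (p i) (list_decode (t i)))" .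
  then show "hpoly_eval C A (cl (\<lambda>_. polys) l0 p) (cl ST l t) = cl S l (\<lambda>i. poly_eval (R (v i)) (p i) (list_decode (t i)))"
    by (simp add: hpoly_eval_def carriers_along r_def Sigma_def) (simp add: r2_def)
  show "el S l (\<lambda>i. poly_eval (R (v i)) (p i) (list_decode (t i)))"
  proof (rule elI)
    have ae: "\<forall>\<^sub>F i in F. rpoly (v i) (p i) (t i) = poly_eval (R (v i)) (p i) (list_decode (t i)) \<and>
        poly_eval (R (v i)) (p i) (list_decode (t i)) \<in> S (v i)"
      using el_ae[OF t] by eventually_elim (simp add: rpoly_eq tuples_iff)
    have "hc C (\<lambda>i. rpoly (v i) (p i) (t i))"
      by (rule hc_comp3[of rpoly]) (intro tc_intros, rule hidx_val[OF l], rule el_hc[OF p], rule el_hc[OF t])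
    then show "hc C (\<lambda>i. poly_eval (R (v i)) (p i) (list_decode (t i)))"
      by (rule hc_cong) (rule eventually_mono[OF ae], simp)
    show "\<forall>\<^sub>F i in F. poly_eval (R (v i)) (p i) (list_decode (t i)) \<in> S (v i)"
      by (rule eventually_mono[OF ae]) simp
  qed
qed

lemma single_inj:
  assumes "el S l x" "el S l y" "single C A (cl S l x) = single C A (cl S l y)"
  shows "cl S l x = cl S l y"
proof -
  have "\<forall>\<^sub>F i in F. list_encode [x i] = list_encode [y i]"
    using assms(3) single_cl[OF assms(1)] single_cl[OF assms(2)] T_eq[of "\<lambda>i. list_encode [x i]" "\<lambda>i. list_encode [y i]"]
    by (simp only:)
  then have "\<forall>\<^sub>F i in F. x i = y i" by eventually_elim simp
  then show ?thesis by (rule cl_cong)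
qed

abbreviation Aut where "Aut \<equiv> HAut C Fb A u"

lemma Aut_D:
  assumes "\<sigma> \<in> carrier Aut"
  shows "\<sigma> \<in> Bij (cprod C (along ST l))"
    and "\<And>a b. el ST l a \<Longrightarrow> el ST l b \<Longrightarrow>
        \<sigma> (cl ST l (\<lambda>i. app (a i) (b i))) = tree_append C A (\<sigma> (cl ST l a)) (\<sigma> (cl ST l b))"
    and "\<And>a. el ST l a \<Longrightarrow> arity C (\<sigma> (cl ST l a)) = arity C (cl ST l a)"
    and "\<And>p a. el (\<lambda>_. polys) l0 p \<Longrightarrow> el ST l a \<Longrightarrow> \<forall>\<^sub>F i in F. length (list_decode (a i)) = poly_var (p i) \<Longrightarrow>
        single C A (hpoly_eval C A (cl (\<lambda>_. polys) l0 p) (\<sigma> (cl ST l a))) =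
        \<sigma> (single C A (hpoly_eval C A (cl (\<lambda>_. polys) l0 p) (cl ST l a)))"
    and "\<And>c. el SF l0 c \<Longrightarrow> \<sigma> (cl ST l (\<lambda>i. map_tuple (U (v i)) (c i))) = cl ST l (\<lambda>i. map_tuple (U (v i)) (c i))"
proof -
  have *: "\<sigma> \<in> Bij (cprod C (along ST l)) \<and>
     (\<forall>a\<in>cprod C (along ST l). \<forall>b\<in>cprod C (along ST l). tree_le C (\<sigma> a) (\<sigma> b) \<longleftrightarrow> tree_le C a b) \<and>
     (\<forall>a\<in>cprod C (along ST l). \<forall>b\<in>cprod C (along ST l).
        \<sigma> (tree_append C A a b) = tree_append C A (\<sigma> a) (\<sigma> b)) \<and>
     (\<forall>a\<in>cprod C (along ST l). arity C (\<sigma> a) = arity C a) \<and>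
     (\<forall>p\<in>hpolys C. \<forall>a\<in>cprod C (along ST l). arity C a = hpoly_var C p \<longrightarrow>
        single C A (hpoly_eval C A p (\<sigma> a)) = \<sigma> (single C A (hpoly_eval C A p a))) \<and>
     (\<forall>a\<in>cprod C (trees (\<lambda>_. Some Fb)).
        \<sigma> (cmap C (along ST l) (map_tuples u) a) = cmap C (along ST l) (map_tuples u) a)"
    using assms unfolding HAut_def trees_A by simp
  note bij = conjunct1[OF *] and st1 = conjunct2[OF *]
  note st2 = conjunct2[OF st1]
  note app = conjunct1[OF st2] and st3 = conjunct2[OF st2]
  note ar = conjunct1[OF st3] and st4 = conjunct2[OF st3]
  note pol = conjunct1[OF st4] and base = conjunct2[OF st4]
  show "\<sigma> \<in> Bij (cprod C (along ST l))" by (rule bij)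
  show "\<sigma> (cl ST l (\<lambda>i. app (a i) (b i))) = tree_append C A (\<sigma> (cl ST l a)) (\<sigma> (cl ST l b))"
    if "el ST l a" "el ST l b" for a b
    using bspec[OF bspec[OF app T_intro[OF that(1)]] T_intro[OF that(2)]]
    by (simp only: append_cl[OF that, THEN conjunct1])
  show "arity C (\<sigma> (cl ST l a)) = arity C (cl ST l a)" if "el ST l a" for a
    by (rule bspec[OF ar T_intro[OF that]])
  show "single C A (hpoly_eval C A (cl (\<lambda>_. polys) l0 p) (\<sigma> (cl ST l a))) =
        \<sigma> (single C A (hpoly_eval C A (cl (\<lambda>_. polys) l0 p) (cl ST l a)))"
    if "el (\<lambda>_. polys) l0 p" "el ST l a" "\<forall>\<^sub>F i in F. length (list_decode (a i)) = poly_var (p i)" for p a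
  proof -
    have "cl (\<lambda>_. polys) l0 p \<in> hpolys C"
      using cprodI[OF hidx_const usd_polys that(1)] by (simp add: hpolys_def along_const)
    from bspec[OF bspec[OF pol this] T_intro[OF that(2)]] show ?thesis
      using arity_hpoly_iff[OF that(2,1)] that(3) by blast
  qed
  show "\<sigma> (cl ST l (\<lambda>i. map_tuple (U (v i)) (c i))) = cl ST l (\<lambda>i. map_tuple (U (v i)) (c i))" if "el SF l0 c" for c
  proof -
    have "cl SF l0 c \<in> cprod C (trees (\<lambda>_. Some Fb))"
      using cprodI[OF hidx_const usd_SF that] unfolding trees_along[of "\<lambda>_. Fb" l0, unfolded along_const] along_const .
    from bspec[OF base this] show ?thesis
      by (simp only: base_tree_cl[OF that, unfolded trees_A, THEN conjunct1])
  qed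
qed

lemma Aut_image:
  assumes "\<sigma> \<in> carrier Aut" "el ST l a"
  obtains b where "el ST l b" "\<sigma> (cl ST l a) = cl ST l b" "\<forall>\<^sub>F i in F. length (list_decode (b i)) = length (list_decode (a i))"
proof -
  have "\<sigma> (cl ST l a) \<in> cprod C (along ST l)"
    using Bij_imp_funcset[OF Aut_D(1)[OF assms(1)]] T_intro[OF assms(2)] by blast
  then obtain b where b: "el ST l b" "\<sigma> (cl ST l a) = cl ST l b" by (rule cprodE)
  then show ?thesis using that Aut_D(3)[OF assms] arity_eq_iff[OF b(1) assms(2)] by simp
qed

text \<open>If the type were not preserved almost everywhere, cohesiveness would yield a computable choice
  of polynomials and parameters witnessing this.\<close>

lemma Aut_types:
  assumes \<sigma>: "\<sigma> \<in> carrier Aut" and a: "el ST l a" and b: "el ST l b" and ab: "\<sigma> (cl ST l a) = cl ST l b"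
  shows "\<forall>\<^sub>F i in F. \<forall>p\<in>polys. \<forall>c. set c \<subseteq> carrier Fb \<longrightarrow> poly_var p = length (list_decode (a i)) + length c \<longrightarrow>
    poly_eval (R (v i)) p (list_decode (a i) @ map (U (v i)) c) = \<zero>\<^bsub>R (v i)\<^esub> \<longrightarrow>
    poly_eval (R (v i)) p (list_decode (b i) @ map (U (v i)) c) = \<zero>\<^bsub>R (v i)\<^esub>"
proof -
  have len: "\<forall>\<^sub>F i in F. length (list_decode (b i)) = length (list_decode (a i))"
    using Aut_D(3)[OF \<sigma> a] arity_eq_iff[OF b a] unfolding ab by simp
  \<comment> \<open>\<open>z\<close> codes the index and the two tuples, \<open>k\<close> a
    polynomial together with parameters from the base field at which the types differ. The relation
    is decidable, so cohesiveness applies to the existence of \<open>k\<close>, and a search finds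
    it.\<close>
  define bad where "bad z k \<longleftrightarrow> pfst k \<in> polys \<and> psnd k \<in> tuples (carrier Fb) \<and>
      poly_var (pfst k) = length (list_decode (pfst (psnd z))) + length (list_decode (psnd k)) \<and>
      rpoly (pfst z) (pfst k) (app (pfst (psnd z)) (map_tuple (Ut (pfst z)) (psnd k))) = \<zero>\<^bsub>R (pfst z)\<^esub> \<and>
      rpoly (pfst z) (pfst k) (app (psnd (psnd z)) (map_tuple (Ut (pfst z)) (psnd k))) \<noteq> \<zero>\<^bsub>R (pfst z)\<^esub>" for z k
  have dec: "decidable (\<lambda>w. bad (pfst w) (psnd w))"
    unfolding bad_def by (intro tc_intros usd_decidable[OF usd_SF, of "\<lambda>_. 0"])
  define f where "f i = ppair (v i) (ppair (a i) (b i))" for i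
  have f: "hc C f" unfolding f_def by (intro hc_pair hidx_val[OF l] el_hc[OF a] el_hc[OF b])
  have "\<not> (\<forall>\<^sub>F i in F. \<exists>k. bad (f i) k)"
  proof
    assume "\<forall>\<^sub>F i in F. \<exists>k. bad (f i) k"
    then obtain k where k: "hc C k" "\<forall>\<^sub>F i in F. bad (f i) (k i)" using hc_search[OF dec f] by blast
    define p c where "p = (\<lambda>i. pfst (k i))" and "c = (\<lambda>i. psnd (k i))"
    have p: "el (\<lambda>_. polys) l0 p" unfolding p_def
      by (rule elI, rule hc_comp[OF _ k(1)], intro tc_intros, rule eventually_mono[OF k(2)]) (simp add: bad_def)
    have c: "el SF l0 c" unfolding c_def
      by (rule elI, rule hc_comp[OF _ k(1)], intro tc_intros, rule eventually_mono[OF k(2)]) (simp add: bad_def)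
    let ?Uc = "\<lambda>i. map_tuple (U (v i)) (c i)"
    have Uc: "el ST l ?Uc" using base_tree_cl[OF c] by blast
    have aU: "el ST l (\<lambda>i. app (a i) (?Uc i))" and bU: "el ST l (\<lambda>i. app (b i) (?Uc i))"
      using append_cl[OF a Uc] append_cl[OF b Uc] by blast+
    have \<sigma>a: "\<sigma> (cl ST l (\<lambda>i. app (a i) (?Uc i))) = cl ST l (\<lambda>i. app (b i) (?Uc i))"
      using Aut_D(2)[OF \<sigma> a Uc] append_cl[OF b Uc] unfolding ab Aut_D(5)[OF \<sigma> c] by simp
    have bad: "\<forall>\<^sub>F i in F. poly_var (p i) = length (list_decode (a i)) + length (list_decode (c i)) \<and>
        poly_eval (R (v i)) (p i) (list_decode (app (a i) (?Uc i))) = \<zero>\<^bsub>R (v i)\<^esub> \<and>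
        poly_eval (R (v i)) (p i) (list_decode (app (b i) (?Uc i))) \<noteq> \<zero>\<^bsub>R (v i)\<^esub>"
      using k(2) el_ae[OF aU] el_ae[OF bU]
    proof eventually_elim
      case (elim i)
      have "map_tuple (Ut (v i)) (c i) = ?Uc i"
        using elim(1) by (intro map_tuple_cong[of _ "carrier Fb"]) (auto simp: Ut_def c_def bad_def)
      moreover have "rpoly (v i) (p i) (app (a i) (?Uc i)) = poly_eval (R (v i)) (p i) (list_decode (app (a i) (?Uc i)))"
        "rpoly (v i) (p i) (app (b i) (?Uc i)) = poly_eval (R (v i)) (p i) (list_decode (app (b i) (?Uc i)))"
        by (rule rpoly_eq(1)[OF elim(2)[unfolded tuples_iff]], rule rpoly_eq(1)[OF elim(3)[unfolded tuples_iff]])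
      ultimately show ?case using elim(1) unfolding bad_def f_def p_def c_def
        by (simp only: prod_encode_inverse fst_conv snd_conv simp_thms)
    qed
    have la: "\<forall>\<^sub>F i in F. length (list_decode (app (a i) (?Uc i))) = poly_var (p i)"
      using bad by eventually_elim simp
    have lb: "\<forall>\<^sub>F i in F. length (list_decode (app (b i) (?Uc i))) = poly_var (p i)"
      using bad len by eventually_elim simp
    note ea = hpoly_eval_cl[OF p aU la] and eb = hpoly_eval_cl[OF p bU lb]
    have "cl S l (\<lambda>i. poly_eval (R (v i)) (p i) (list_decode (app (a i) (?Uc i)))) = cl S l (\<lambda>i. \<zero>\<^bsub>R (v i)\<^esub>)"
      by (rule cl_cong, rule eventually_mono[OF bad]) blast
    then have *: "single C A (hpoly_eval C A (cl (\<lambda>_. polys) l0 p) (cl ST l (\<lambda>i. app (a i) (?Uc i)))) = cl ST l (\<lambda>i. list_encode [\<zero>\<^bsub>R (v i)\<^esub>])"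
      using ea single_cl[OF zero_cl(2)] by simp
    \<comment> \<open>The zero of the product is the image of the zero of the base field, so as a
      tuple of length one it is fixed by \<open>\<sigma>\<close>. A polynomial that vanishes at the
      tuple must therefore vanish at its image.\<close>
    have z: "el SF l0 (\<lambda>i. list_encode [\<zero>\<^bsub>Fb\<^esub>])"
      by (rule elI) (auto simp: tuples_iff simp del: list_encode.simps)
    have "map_tuple (U (v i)) (list_encode [\<zero>\<^bsub>Fb\<^esub>]) = list_encode [\<zero>\<^bsub>R (v i)\<^esub>]" for i
      using ring_hom_zero[OF U_hom Fb.R.is_ring R.is_ring, of "v i"] by (simp add: map_tuple_def del: list_encode.simps)
    then have "\<sigma> (cl ST l (\<lambda>i. list_encode [\<zero>\<^bsub>R (v i)\<^esub>])) = cl ST l (\<lambda>i. list_encode [\<zero>\<^bsub>R (v i)\<^esub>])"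
      using Aut_D(5)[OF \<sigma> z] by simp
    then have "single C A (hpoly_eval C A (cl (\<lambda>_. polys) l0 p) (cl ST l (\<lambda>i. app (b i) (?Uc i)))) = cl ST l (\<lambda>i. list_encode [\<zero>\<^bsub>R (v i)\<^esub>])"
      using Aut_D(4)[OF \<sigma> p aU la] unfolding \<sigma>a * by simp
    then have "cl S l (\<lambda>i. poly_eval (R (v i)) (p i) (list_decode (app (b i) (?Uc i)))) = cl S l (\<lambda>i. \<zero>\<^bsub>R (v i)\<^esub>)"
      by (intro single_inj[OF eb[THEN conjunct2] zero_cl(2)])
        (simp only: eb[THEN conjunct1] single_cl[OF zero_cl(2), THEN conjunct1])
    then have "\<forall>\<^sub>F i in F. poly_eval (R (v i)) (p i) (list_decode (app (b i) (?Uc i))) = \<zero>\<^bsub>R (v i)\<^esub>"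
      by (rule S_cl_eq[OF eb[THEN conjunct2], THEN iffD1])
    with bad have "\<forall>\<^sub>F i in F. False" by eventually_elim blast
    then show False by simp
  qed
  then have "\<forall>\<^sub>F i in F. \<not> (\<exists>k. bad (f i) k)" using hc_dichotomy_ex[OF dec f] by blast
  then show ?thesis using el_ae[OF a] el_ae[OF b]
  proof eventually_elim
    case (elim i)
    show ?case
    proof (intro ballI allI impI, rule ccontr)
      fix p c assume p: "p \<in> polys" "set c \<subseteq> carrier Fb" "poly_var p = length (list_decode (a i)) + length c"
        "poly_eval (R (v i)) p (list_decode (a i) @ map (U (v i)) c) = \<zero>\<^bsub>R (v i)\<^esub>"
        "poly_eval (R (v i)) p (list_decode (b i) @ map (U (v i)) c) \<noteq> \<zero>\<^bsub>R (v i)\<^esub>"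
      have Uc: "map (Ut (v i)) c = map (U (v i)) c" "set (map (U (v i)) c) \<subseteq> S (v i)"
        using p(2) U_closed by (auto simp: Ut_def)
      have "rpoly (v i) p (app (a i) (map_tuple (Ut (v i)) (list_encode c))) = poly_eval (R (v i)) p (list_decode (a i) @ map (U (v i)) c)"
        using rpoly_eq(1)[of "app (a i) (map_tuple (Ut (v i)) (list_encode c))" "v i" p] elim(2) Uc by (simp add: tuples_iff)
      moreover have "rpoly (v i) p (app (b i) (map_tuple (Ut (v i)) (list_encode c))) = poly_eval (R (v i)) p (list_decode (b i) @ map (U (v i)) c)"
        using rpoly_eq(1)[of "app (b i) (map_tuple (Ut (v i)) (list_encode c))" "v i" p] elim(3) Uc by (simp add: tuples_iff)
      ultimately have "bad (f i) (ppair p (list_encode c))"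
        unfolding bad_def f_def using p by (simp add: tuples_iff)
      then show False using elim(1) by blast
    qed
  qed
qed

text \<open>It is enough that around every tuple \<open>\<sigma>\<close> turns images under
  \<open>j i\<close> into images under \<open>k i\<close>, for two homomorphisms from a field
  \<open>Q i\<close> under which each base element has a common preimage. Order, concatenation and
  polynomials are then preserved because field homomorphisms are injective and commute with
  evaluation. For the levels \<open>j\<close> is the identity and \<open>k\<close> the action of a
  group element; over the top field \<open>j\<close> is the embedding of a level and
  \<open>k\<close> the embedding after the action.\<close>

lemma Aut_local:
  assumes \<sigma>: "\<sigma> \<in> Bij (cprod C (along ST l))"
    and loc: "\<And>t. el ST l t \<Longrightarrow> \<exists>(Q :: nat \<Rightarrow> nat ring) j k.
      (\<forall>\<^sub>F i in F. field (Q i) \<and> j i \<in> ring_hom (Q i) (R (v i)) \<and> k i \<in> ring_hom (Q i) (R (v i)) \<and>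
        (\<forall>c\<in>carrier Fb. \<exists>q\<in>carrier (Q i). j i q = U (v i) c \<and> k i q = U (v i) c) \<and>
        set (list_decode (t i)) \<subseteq> j i ` carrier (Q i)) \<and>
      (\<forall>q. (\<forall>\<^sub>F i in F. q i \<in> tuples (carrier (Q i))) \<longrightarrow> el ST l (\<lambda>i. map_tuple (j i) (q i)) \<longrightarrow>
        el ST l (\<lambda>i. map_tuple (k i) (q i)) \<and>
        \<sigma> (cl ST l (\<lambda>i. map_tuple (j i) (q i))) = cl ST l (\<lambda>i. map_tuple (k i) (q i)))"
  shows "\<sigma> \<in> carrier Aut"
proof -
  have key: "\<exists>(Q :: nat \<Rightarrow> nat ring) j k qa qb.
      (\<forall>\<^sub>F i in F. field (Q i) \<and> j i \<in> ring_hom (Q i) (R (v i)) \<and> k i \<in> ring_hom (Q i) (R (v i)) \<and>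
        (\<forall>c\<in>carrier Fb. \<exists>q\<in>carrier (Q i). j i q = U (v i) c \<and> k i q = U (v i) c) \<and>
        qa i \<in> tuples (carrier (Q i)) \<and> qb i \<in> tuples (carrier (Q i)) \<and>
        a i = map_tuple (j i) (qa i) \<and> b i = map_tuple (j i) (qb i)) \<and>
      (\<forall>q. (\<forall>\<^sub>F i in F. q i \<in> tuples (carrier (Q i))) \<longrightarrow> el ST l (\<lambda>i. map_tuple (j i) (q i)) \<longrightarrow>
        el ST l (\<lambda>i. map_tuple (k i) (q i)) \<and>
        \<sigma> (cl ST l (\<lambda>i. map_tuple (j i) (q i))) = cl ST l (\<lambda>i. map_tuple (k i) (q i)))"
    if ab: "el ST l a" "el ST l b" for a b
  proof -
    \<comment> \<open>Applying the hypothesis to the concatenation yields one field and one pair of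
      homomorphisms for both tuples.\<close>
    have "el ST l (\<lambda>i. app (a i) (b i))" using append_cl[OF ab] by blast
    from loc[OF this] obtain Q :: "nat \<Rightarrow> nat ring" and j k where
      1: "\<forall>\<^sub>F i in F. field (Q i) \<and> j i \<in> ring_hom (Q i) (R (v i)) \<and> k i \<in> ring_hom (Q i) (R (v i)) \<and>
        (\<forall>c\<in>carrier Fb. \<exists>q\<in>carrier (Q i). j i q = U (v i) c \<and> k i q = U (v i) c) \<and>
        set (list_decode (app (a i) (b i))) \<subseteq> j i ` carrier (Q i)" and
      2: "\<forall>q. (\<forall>\<^sub>F i in F. q i \<in> tuples (carrier (Q i))) \<longrightarrow> el ST l (\<lambda>i. map_tuple (j i) (q i)) \<longrightarrow>
        el ST l (\<lambda>i. map_tuple (k i) (q i)) \<and>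
        \<sigma> (cl ST l (\<lambda>i. map_tuple (j i) (q i))) = cl ST l (\<lambda>i. map_tuple (k i) (q i))" by blast
    define pre where "pre t i = (SOME q. q \<in> tuples (carrier (Q i)) \<and> t = map_tuple (j i) q)" for t i
    have pre: "pre t i \<in> tuples (carrier (Q i)) \<and> t = map_tuple (j i) (pre t i)"
      if t: "set (list_decode t) \<subseteq> j i ` carrier (Q i)" for t i
    proof -
      obtain xs where "set xs \<subseteq> carrier (Q i)" "list_decode t = map (j i) xs" by (rule map_preimage[OF t])
      then have "list_encode xs \<in> tuples (carrier (Q i)) \<and> t = map_tuple (j i) (list_encode xs)"
        by (metis list_decode_inverse list_encode_inverse map_tuple_def tuples_iff)
      then show ?thesis unfolding pre_def by (rule someI)
    qed
    have "\<forall>\<^sub>F i in F. field (Q i) \<and> j i \<in> ring_hom (Q i) (R (v i)) \<and> k i \<in> ring_hom (Q i) (R (v i)) \<and>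
        (\<forall>c\<in>carrier Fb. \<exists>q\<in>carrier (Q i). j i q = U (v i) c \<and> k i q = U (v i) c) \<and>
        pre (a i) i \<in> tuples (carrier (Q i)) \<and> pre (b i) i \<in> tuples (carrier (Q i)) \<and>
        a i = map_tuple (j i) (pre (a i) i) \<and> b i = map_tuple (j i) (pre (b i) i)"
      using 1 by (rule eventually_mono) (use pre in simp)
    then show ?thesis using 2
      by (intro exI[of _ Q] exI[of _ j] exI[of _ k] exI[of _ "\<lambda>i. pre (a i) i"] exI[of _ "\<lambda>i. pre (b i) i"] conjI)
  qed
  have main: "(tree_le C (\<sigma> (cl ST l a)) (\<sigma> (cl ST l b)) \<longleftrightarrow> tree_le C (cl ST l a) (cl ST l b)) \<and>
      \<sigma> (tree_append C A (cl ST l a) (cl ST l b)) = tree_append C A (\<sigma> (cl ST l a)) (\<sigma> (cl ST l b)) \<and>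
      arity C (\<sigma> (cl ST l a)) = arity C (cl ST l a) \<and>
      (\<forall>p. el (\<lambda>_. polys) l0 p \<longrightarrow> arity C (cl ST l a) = hpoly_var C (cl (\<lambda>_. polys) l0 p) \<longrightarrow>
        single C A (hpoly_eval C A (cl (\<lambda>_. polys) l0 p) (\<sigma> (cl ST l a))) =
        \<sigma> (single C A (hpoly_eval C A (cl (\<lambda>_. polys) l0 p) (cl ST l a)))) \<and>
      (\<forall>c. el SF l0 c \<longrightarrow> a = (\<lambda>i. map_tuple (U (v i)) (c i)) \<longrightarrow> \<sigma> (cl ST l a) = cl ST l a)"
    if ab: "el ST l a" "el ST l b" for a b
  proof -
    from key[OF ab] obtain Q :: "nat \<Rightarrow> nat ring" and j k qa qb where
      1: "\<forall>\<^sub>F i in F. field (Q i) \<and> j i \<in> ring_hom (Q i) (R (v i)) \<and> k i \<in> ring_hom (Q i) (R (v i)) \<and>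
        (\<forall>c\<in>carrier Fb. \<exists>q\<in>carrier (Q i). j i q = U (v i) c \<and> k i q = U (v i) c) \<and>
        qa i \<in> tuples (carrier (Q i)) \<and> qb i \<in> tuples (carrier (Q i)) \<and>
        a i = map_tuple (j i) (qa i) \<and> b i = map_tuple (j i) (qb i)" and
      2: "\<forall>q. (\<forall>\<^sub>F i in F. q i \<in> tuples (carrier (Q i))) \<longrightarrow> el ST l (\<lambda>i. map_tuple (j i) (q i)) \<longrightarrow>
        el ST l (\<lambda>i. map_tuple (k i) (q i)) \<and>
        \<sigma> (cl ST l (\<lambda>i. map_tuple (j i) (q i))) = cl ST l (\<lambda>i. map_tuple (k i) (q i))"
      by (elim exE conjE) (rule that)
    have app: "\<sigma> (cl ST l x) = cl ST l y \<and> el ST l y"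
      if "\<forall>\<^sub>F i in F. q i \<in> tuples (carrier (Q i))" "\<forall>\<^sub>F i in F. x i = map_tuple (j i) (q i)"
        "\<forall>\<^sub>F i in F. y i = map_tuple (k i) (q i)" "el ST l x" for x y q
    proof -
      have "el ST l (\<lambda>i. map_tuple (j i) (q i))" by (rule el_cong[OF that(4,2)])
      note kq = 2[rule_format, OF that(1) this]
      have eq: "cl ST l x = cl ST l (\<lambda>i. map_tuple (j i) (q i))" by (rule cl_cong[OF that(2)])
      have sym: "\<forall>\<^sub>F i in F. map_tuple (k i) (q i) = y i" using that(3) by eventually_elim simp
      show ?thesis unfolding eq kq[THEN conjunct2]
        by (intro conjI cl_cong[OF sym] el_cong[OF kq[THEN conjunct1] sym])
    qed
    let ?ka = "\<lambda>i. map_tuple (k i) (qa i)" and ?kb = "\<lambda>i. map_tuple (k i) (qb i)"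
    have refl: "\<forall>\<^sub>F i in F. f i = f i" for f :: "nat \<Rightarrow> nat" by simp
    have qa: "\<forall>\<^sub>F i in F. qa i \<in> tuples (carrier (Q i))" "\<forall>\<^sub>F i in F. a i = map_tuple (j i) (qa i)"
      and qb: "\<forall>\<^sub>F i in F. qb i \<in> tuples (carrier (Q i))" "\<forall>\<^sub>F i in F. b i = map_tuple (j i) (qb i)"
      using 1 by (auto elim: eventually_mono)
    have sa: "\<sigma> (cl ST l a) = cl ST l ?ka" "el ST l ?ka" using app[OF qa refl ab(1)] by blast+
    have sb: "\<sigma> (cl ST l b) = cl ST l ?kb" "el ST l ?kb" using app[OF qb refl ab(2)] by blast+
    have inj: "\<forall>\<^sub>F i in F. inj_on (j i) (carrier (Q i)) \<and> inj_on (k i) (carrier (Q i))"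
      using 1 by (rule eventually_mono) (use non_trivial_field_hom_is_inj field_R in blast)
    have "tree_le C (\<sigma> (cl ST l a)) (\<sigma> (cl ST l b)) \<longleftrightarrow> tree_le C (cl ST l a) (cl ST l b)"
    proof -
      have "\<forall>\<^sub>F i in F. prefix (list_decode (?ka i)) (list_decode (?kb i)) \<longleftrightarrow> prefix (list_decode (a i)) (list_decode (b i))"
        using 1 inj
      proof eventually_elim
        case (elim i)
        have "set (list_decode (qa i)) \<subseteq> carrier (Q i)" "set (list_decode (qb i)) \<subseteq> carrier (Q i)"
          using elim(1) by (simp_all add: tuples_iff)
        moreover have "list_decode (a i) = map (j i) (list_decode (qa i))" "list_decode (b i) = map (j i) (list_decode (qb i))"
          using elim(1) by (metis list_decode_map_tuple)+
        ultimately show ?case using elim(2) prefix_map_inj_on by (metis list_decode_map_tuple)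
      qed
      then show ?thesis unfolding sa sb tree_le_def
        crel_cl[OF l usd_ST sa(2) l usd_ST sb(2)] crel_cl[OF l usd_ST ab(1) l usd_ST ab(2)]
        by (rule eventually_subst)
    qed
    moreover have "\<sigma> (tree_append C A (cl ST l a) (cl ST l b)) = tree_append C A (\<sigma> (cl ST l a)) (\<sigma> (cl ST l b))"
    proof -
      have q: "\<forall>\<^sub>F i in F. app (qa i) (qb i) \<in> tuples (carrier (Q i))"
        using qa(1) qb(1) by eventually_elim (simp add: app_tuples)
      have x: "\<forall>\<^sub>F i in F. app (a i) (b i) = map_tuple (j i) (app (qa i) (qb i))"
        using qa(2) qb(2) by eventually_elim (simp add: map_tuple_app)
      have y: "\<forall>\<^sub>F i in F. app (?ka i) (?kb i) = map_tuple (k i) (app (qa i) (qb i))"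
        by (simp add: map_tuple_app)
      show ?thesis using app[OF q x y] append_cl[OF ab] append_cl[OF sa(2) sb(2)] unfolding sa sb by simp
    qed
    moreover have len: "\<forall>\<^sub>F i in F. length (list_decode (?ka i)) = length (list_decode (a i))"
      using qa(2) by eventually_elim simp
    then have "arity C (\<sigma> (cl ST l a)) = arity C (cl ST l a)"
      unfolding sa using arity_eq_iff[OF sa(2) ab(1)] by blast
    moreover have "single C A (hpoly_eval C A (cl (\<lambda>_. polys) l0 p) (\<sigma> (cl ST l a))) =
        \<sigma> (single C A (hpoly_eval C A (cl (\<lambda>_. polys) l0 p) (cl ST l a)))"
      if p: "el (\<lambda>_. polys) l0 p" and ar: "arity C (cl ST l a) = hpoly_var C (cl (\<lambda>_. polys) l0 p)" for p
    proof -
      have la: "\<forall>\<^sub>F i in F. length (list_decode (a i)) = poly_var (p i)" using ar arity_hpoly_iff[OF ab(1) p] by blast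
      have lk: "\<forall>\<^sub>F i in F. length (list_decode (?ka i)) = poly_var (p i)" using la len by eventually_elim simp
      note ea = hpoly_eval_cl[OF p ab(1) la] and ek = hpoly_eval_cl[OF p sa(2) lk]
      let ?e = "\<lambda>i. poly_eval (Q i) (p i) (list_decode (qa i))"
      have e: "\<forall>\<^sub>F i in F. ?e i \<in> carrier (Q i) \<and>
          poly_eval (R (v i)) (p i) (list_decode (a i)) = j i (?e i) \<and>
          poly_eval (R (v i)) (p i) (list_decode (?ka i)) = k i (?e i)"
        using 1
      proof eventually_elim
        case (elim i)
        then interpret Q: field "Q i" by blast
        have s: "set (list_decode (qa i)) \<subseteq> carrier (Q i)" using elim by (simp add: tuples_iff)
        have "list_decode (a i) = map (j i) (list_decode (qa i))" using elim by (metis list_decode_map_tuple)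
        moreover have "?e i \<in> carrier (Q i)"
          unfolding poly_eval_mon[OF Q.is_cring] by (rule Q.terms_closed[OF s])
        ultimately show ?case
          using poly_eval_hom[OF Q.is_cring R.is_cring _ s] elim by simp
      qed
      have q: "\<forall>\<^sub>F i in F. list_encode [?e i] \<in> tuples (carrier (Q i))"
        using e by (rule eventually_mono) (simp add: tuples_iff del: list_encode.simps)
      have x: "\<forall>\<^sub>F i in F. list_encode [poly_eval (R (v i)) (p i) (list_decode (a i))] = map_tuple (j i) (list_encode [?e i])"
        using e by (rule eventually_mono) (simp add: map_tuple_def del: list_encode.simps)
      have y: "\<forall>\<^sub>F i in F. list_encode [poly_eval (R (v i)) (p i) (list_decode (?ka i))] = map_tuple (k i) (list_encode [?e i])"
        using e by (rule eventually_mono) (simp add: map_tuple_def del: list_encode.simps)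
      show ?thesis unfolding sa
        using app[OF q x y] ea ek single_cl[of "\<lambda>i. poly_eval (R (v i)) (p i) (list_decode (a i))"]
          single_cl[of "\<lambda>i. poly_eval (R (v i)) (p i) (list_decode (?ka i))"] by simp
    qed
    moreover have "\<sigma> (cl ST l a) = cl ST l a" if c: "el SF l0 c" "a = (\<lambda>i. map_tuple (U (v i)) (c i))" for c
    proof -
      define w where "w i x = (SOME q. q \<in> carrier (Q i) \<and> j i q = U (v i) x \<and> k i q = U (v i) x)" for i x
      have w: "\<forall>\<^sub>F i in F. \<forall>x\<in>carrier Fb. w i x \<in> carrier (Q i) \<and> j i (w i x) = U (v i) x \<and> k i (w i x) = U (v i) x"
        using 1
      proof eventually_elim
        case (elim i)
        show ?case
        proof
          fix x assume "x \<in> carrier Fb"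
          then have "\<exists>q. q \<in> carrier (Q i) \<and> j i q = U (v i) x \<and> k i q = U (v i) x" using elim by blast
          then show "w i x \<in> carrier (Q i) \<and> j i (w i x) = U (v i) x \<and> k i (w i x) = U (v i) x"
            unfolding w_def by (rule someI_ex)
        qed
      qed
      have all: "\<forall>\<^sub>F i in F. map_tuple (w i) (c i) \<in> tuples (carrier (Q i)) \<and>
          a i = map_tuple (j i) (map_tuple (w i) (c i)) \<and> a i = map_tuple (k i) (map_tuple (w i) (c i))"
        using w el_ae[OF c(1)]
      proof eventually_elim
        case (elim i)
        have "map_tuple (w i) (c i) \<in> tuples (carrier (Q i))" using elim by (blast intro: map_tuple_closed)
        then show ?case unfolding c(2) map_tuple_comp
          using elim by (intro conjI map_tuple_cong[OF elim(2)]) simp_all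
      qed
      have "\<forall>\<^sub>F i in F. map_tuple (w i) (c i) \<in> tuples (carrier (Q i))"
        "\<forall>\<^sub>F i in F. a i = map_tuple (j i) (map_tuple (w i) (c i))" "\<forall>\<^sub>F i in F. a i = map_tuple (k i) (map_tuple (w i) (c i))"
        using all by (simp_all add: eventually_conj_iff)
      from app[OF this ab(1)] show ?thesis by blast
    qed
    ultimately show ?thesis by blast
  qed
  have *: "\<sigma> (cmap C (along ST l) (map_tuples u) a) = cmap C (along ST l) (map_tuples u) a"
    if a: "a \<in> cprod C (trees (\<lambda>_. Some Fb))" for a
  proof -
    have "a \<in> cprod C (along SF l0)"
      using a unfolding trees_along[of "\<lambda>_. Fb" l0, unfolded along_const] along_const .
    then obtain c where c: "el SF l0 c" "a = cl SF l0 c" by (rule cprodE)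
    have "el ST l (\<lambda>i. map_tuple (U (v i)) (c i))" using base_tree_cl[OF c(1)] by blast
    from main[OF this this] show ?thesis using base_tree_cl[OF c(1)] c unfolding trees_A by auto
  qed
  show ?thesis unfolding HAut_def trees_A
  proof (simp, intro conjI ballI impI \<sigma>)
    fix a b assume ab: "a \<in> cprod C (along ST l)" "b \<in> cprod C (along ST l)"
    obtain f g where "el ST l f" "a = cl ST l f" "el ST l g" "b = cl ST l g"
      using cprodE[OF ab(1)] cprodE[OF ab(2)] by metis
    then show "tree_le C (\<sigma> a) (\<sigma> b) = tree_le C a b" "\<sigma> (tree_append C A a b) = tree_append C A (\<sigma> a) (\<sigma> b)"
      using main[of f g] by blast+
  next
    fix a assume ab: "a \<in> cprod C (along ST l)"
    obtain f where f: "el ST l f" "a = cl ST l f" using cprodE[OF ab] by metis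
    then show "arity C (\<sigma> a) = arity C a" using main[of f f] by blast
    fix p assume p: "p \<in> hpolys C" "arity C a = hpoly_var C p"
    have "p \<in> cprod C (along (\<lambda>_. polys) l0)" using p(1) by (simp add: hpolys_def along_const)
    then obtain g where "el (\<lambda>_. polys) l0 g" "p = cl (\<lambda>_. polys) l0 g" by (rule cprodE)
    then show "single C A (hpoly_eval C A p (\<sigma> a)) = \<sigma> (single C A (hpoly_eval C A p a))"
      using main[of f f] f p(2) by blast
  next
    fix a assume "a \<in> cprod C (trees (\<lambda>_. Some Fb))"
    then show "\<sigma> (cmap C (along ST l) (map_tuples u) a) = cmap C (along ST l) (map_tuples u) a" by (rule *)
  qed
qed

end

text \<open>A compatible family of bijections glues along a directed union: any two values are
  compared at a common upper index. The rule is used for the trees, giving hyper-automorphisms, and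
  for the algebraic parts, giving field automorphisms.\<close>

lemma direct_limit_bij:
  assumes cover: "\<And>x. x \<in> S \<Longrightarrow> \<exists>L\<in>I. \<exists>y\<in>SL L. x = e L y"
    and e_closed: "\<And>L x. L \<in> I \<Longrightarrow> x \<in> SL L \<Longrightarrow> e L x \<in> S"
    and e_inj: "\<And>L. L \<in> I \<Longrightarrow> inj_on (e L) (SL L)"
    and dir: "\<And>L M. L \<in> I \<Longrightarrow> M \<in> I \<Longrightarrow> \<exists>N\<in>I. lt L N \<and> lt M N"
    and mono: "\<And>L M x. L \<in> I \<Longrightarrow> M \<in> I \<Longrightarrow> lt L M \<Longrightarrow> x \<in> SL L \<Longrightarrow> \<exists>y\<in>SL M. e M y = e L x"
    and bij: "\<And>L. L \<in> I \<Longrightarrow> bij_betw (\<tau> L) (SL L) (SL L)"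
    and compat: "\<And>L M x y. L \<in> I \<Longrightarrow> M \<in> I \<Longrightarrow> lt L M \<Longrightarrow> x \<in> SL L \<Longrightarrow> y \<in> SL M \<Longrightarrow> e M y = e L x \<Longrightarrow>
      e M (\<tau> M y) = e L (\<tau> L x)"
  obtains \<sigma> where "\<sigma> \<in> Bij S" "\<And>L x. L \<in> I \<Longrightarrow> x \<in> SL L \<Longrightarrow> \<sigma> (e L x) = e L (\<tau> L x)"
proof -
  have \<tau>_closed: "\<tau> L x \<in> SL L" if "L \<in> I" "x \<in> SL L" for L x
    using bij_betwE[OF bij[OF that(1)]] that(2) by blast
  have common: "\<exists>N\<in>I. \<exists>x'\<in>SL N. \<exists>y'\<in>SL N. e N x' = e L x \<and> e N y' = e M y \<and>
      e N (\<tau> N x') = e L (\<tau> L x) \<and> e N (\<tau> N y') = e M (\<tau> M y)"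
    if LM: "L \<in> I" "M \<in> I" "x \<in> SL L" "y \<in> SL M" for L M x y
  proof -
    obtain N where N: "N \<in> I" "lt L N" "lt M N" using dir[OF LM(1,2)] by blast
    obtain x' where x': "x' \<in> SL N" "e N x' = e L x" using mono[OF LM(1) N(1,2) LM(3)] by blast
    obtain y' where y': "y' \<in> SL N" "e N y' = e M y" using mono[OF LM(2) N(1,3) LM(4)] by blast
    show ?thesis
      using compat[OF LM(1) N(1,2) LM(3) x'] compat[OF LM(2) N(1,3) LM(4) y'] N(1) x' y' by blast
  qed
  have wd: "e L (\<tau> L x) = e M (\<tau> M y)" if LM: "L \<in> I" "M \<in> I" "x \<in> SL L" "y \<in> SL M" "e L x = e M y" for L M x y
  proof -
    obtain N x' y' where N: "N \<in> I" "x' \<in> SL N" "y' \<in> SL N" "e N x' = e L x" "e N y' = e M y"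
      "e N (\<tau> N x') = e L (\<tau> L x)" "e N (\<tau> N y') = e M (\<tau> M y)" using common[OF LM(1-4)] by blast
    have "x' = y'" by (rule inj_onD[OF e_inj[OF N(1)] _ N(2,3)]) (simp add: N LM)
    then show ?thesis using N(6,7) by simp
  qed
  define P where "P y z \<longleftrightarrow> (\<exists>L\<in>I. \<exists>x\<in>SL L. y = e L x \<and> z = e L (\<tau> L x))" for y z
  define \<sigma> where "\<sigma> = (\<lambda>y\<in>S. SOME z. P y z)"
  have \<sigma>: "\<sigma> (e L x) = e L (\<tau> L x)" if Lx: "L \<in> I" "x \<in> SL L" for L x
  proof -
    have "P (e L x) (e L (\<tau> L x))" using Lx by (auto simp: P_def)
    moreover have "z = e L (\<tau> L x)" if Pz: "P (e L x) z" for z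
    proof -
      obtain M w where "M \<in> I" "w \<in> SL M" "e L x = e M w" "z = e M (\<tau> M w)"
        using Pz by (auto simp: P_def)
      then show ?thesis using wd[of L M x w] Lx by simp
    qed
    ultimately have "(SOME z. P (e L x) z) = e L (\<tau> L x)" by (rule some_equality)
    then show ?thesis using e_closed[OF that] by (simp add: \<sigma>_def)
  qed
  have "bij_betw \<sigma> S S" unfolding bij_betw_def
  proof
    show "inj_on \<sigma> S"
    proof (rule inj_onI)
      fix y z assume yz: "y \<in> S" "z \<in> S" "\<sigma> y = \<sigma> z"
      obtain L x where L: "L \<in> I" "x \<in> SL L" "y = e L x" using cover[OF yz(1)] by blast
      obtain M w where M: "M \<in> I" "w \<in> SL M" "z = e M w" using cover[OF yz(2)] by blast
      obtain N x' y' where N: "N \<in> I" "x' \<in> SL N" "y' \<in> SL N" "e N x' = e L x" "e N y' = e M w"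
        "e N (\<tau> N x') = e L (\<tau> L x)" "e N (\<tau> N y') = e M (\<tau> M w)" using common[OF L(1) M(1) L(2) M(2)] by blast
      have "e N (\<tau> N x') = e N (\<tau> N y')" using yz(3) \<sigma>[OF L(1,2)] \<sigma>[OF M(1,2)] L(3) M(3) N(6,7) by simp
      then have "\<tau> N x' = \<tau> N y'" by (rule inj_onD[OF e_inj[OF N(1)] _ \<tau>_closed[OF N(1,2)] \<tau>_closed[OF N(1,3)]])
      then have "x' = y'" by (rule inj_onD[OF bij_betw_imp_inj_on[OF bij[OF N(1)]] _ N(2,3)])
      then show "y = z" using N(4,5) L(3) M(3) by simp
    qed
    show "\<sigma> ` S = S"
    proof
      show "\<sigma> ` S \<subseteq> S"
      proof
        fix z assume "z \<in> \<sigma> ` S"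
        then obtain y where y: "y \<in> S" "z = \<sigma> y" by blast
        obtain L x where L: "L \<in> I" "x \<in> SL L" "y = e L x" using cover[OF y(1)] by blast
        then show "z \<in> S" using \<sigma>[OF L(1,2)] e_closed[OF L(1) \<tau>_closed[OF L(1,2)]] y(2) by simp
      qed
      show "S \<subseteq> \<sigma> ` S"
      proof
        fix z assume "z \<in> S"
        then obtain L x where L: "L \<in> I" "x \<in> SL L" "z = e L x" using cover by blast
        obtain w where w: "w \<in> SL L" "x = \<tau> L w" using bij_betw_imp_surj_on[OF bij[OF L(1)]] L(2) by blast
        have "z = \<sigma> (e L w)" using \<sigma>[OF L(1) w(1)] L(3) w(2) by simp
        then show "z \<in> \<sigma> ` S" using e_closed[OF L(1) w(1)] by blast
      qed
    qed
  qed
  then have "\<sigma> \<in> Bij S" by (simp add: Bij_def \<sigma>_def)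
  then show ?thesis using that \<sigma> by blast
qed

lemma map_tuple_id: "map_tuple (\<lambda>x. x) t = t"
  by (simp add: map_tuple_def)

context cohesive_set
begin

end

section \<open>Computable maps between the products of a Galois extension\<close>

locale galois_hyper = cohesive_set C + galois_setup E for C E
begin

abbreviation SK where "SK \<equiv> \<lambda>n. carrier (lev E n)"
abbreviation SG where "SG \<equiv> \<lambda>n. carrier (grp E n)"
abbreviation STK where "STK \<equiv> \<lambda>n. tuples (carrier (lev E n))"
abbreviation ST where "ST \<equiv> \<lambda>_::nat. carrier (top_field E)"
abbreviation STT where "STT \<equiv> \<lambda>_::nat. tuples (carrier (top_field E))"
abbreviation SB where "SB \<equiv> \<lambda>_::nat. carrier (base E)"
abbreviation l0 where "l0 \<equiv> \<lambda>_::nat. Some (0::nat)"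

lemma usd_STK: "usd STK" by (rule usd_tuples[OF K.usd_carrier])
lemma usd_STT: "usd STT" by (rule usd_tuples[OF T.usd_carrier])

definition actt :: "nat \<Rightarrow> nat \<Rightarrow> nat \<Rightarrow> nat" where
  "actt n g x = (if g \<in> SG n \<and> x \<in> SK n then act E n g x else 0)"
definition lembt :: "nat \<Rightarrow> nat \<Rightarrow> nat" where
  "lembt n x = (if x \<in> SK n then lev_emb E n x else 0)"
definition embt :: "nat \<Rightarrow> nat" where
  "embt c = (if c \<in> carrier (base E) then emb E c else 0)"
definition lbaset :: "nat \<Rightarrow> nat \<Rightarrow> nat" where
  "lbaset n c = (if c \<in> carrier (base E) then lev_base E n c else 0)"
definition linclt :: "nat \<Rightarrow> nat \<Rightarrow> nat \<Rightarrow> nat" where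
  "linclt m n x = (if n \<le> m \<and> x \<in> SK n then lev_incl E m n x else 0)"
definition quott :: "nat \<Rightarrow> nat \<Rightarrow> nat \<Rightarrow> nat" where
  "quott m n g = (if n < m \<and> g \<in> SG m then quot E m n g else 0)"

lemma tc_actt [tc_intros]: "tc f \<Longrightarrow> tc g \<Longrightarrow> tc h \<Longrightarrow> tc (\<lambda>z. actt (f z) (g z) (h z))"
proof -
  have c: "computable_on3 {(i, g, x). g \<in> SG i \<and> x \<in> SK i} (act E)"
    using fc unfolding fully_computable_def by (elim conjE)
  show "tc f \<Longrightarrow> tc g \<Longrightarrow> tc h \<Longrightarrow> tc (\<lambda>z. actt (f z) (g z) (h z))"
    unfolding actt_def by (rule tc_guarded3[of "\<lambda>i g x. g \<in> SG i \<and> x \<in> SK i", OF c]) (intro tc_intros)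
qed

lemma tc_lembt [tc_intros]: "tc f \<Longrightarrow> tc g \<Longrightarrow> tc (\<lambda>z. lembt (f z) (g z))"
proof -
  have c: "computable_on2 {(i, x). x \<in> SK i} (lev_emb E)"
    using fc unfolding fully_computable_def by (elim conjE)
  show "tc f \<Longrightarrow> tc g \<Longrightarrow> tc (\<lambda>z. lembt (f z) (g z))"
    unfolding lembt_def by (rule tc_guarded2[of "\<lambda>i x. x \<in> SK i", OF c]) (intro tc_intros)
qed

lemma tc_quott [tc_intros]: "tc f \<Longrightarrow> tc g \<Longrightarrow> tc h \<Longrightarrow> tc (\<lambda>z. quott (f z) (g z) (h z))"
proof -
  have c: "computable_on3 {(m, n, g). n < m \<and> g \<in> SG m} (quot E)"
    using fc unfolding fully_computable_def by (elim conjE)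
  show "tc f \<Longrightarrow> tc g \<Longrightarrow> tc h \<Longrightarrow> tc (\<lambda>z. quott (f z) (g z) (h z))"
    unfolding quott_def by (rule tc_guarded3[of "\<lambda>m n g. n < m \<and> g \<in> SG m", OF c]) (intro tc_intros)
qed

lemma tc_embt [tc_intros]: assumes "tc f" shows "tc (\<lambda>z. embt (f z))"
proof -
  have "computable_on (carrier (base E)) (emb E)"
    using fc unfolding fully_computable_def by (elim conjE)
  then obtain p where p: "partial_computable p" "\<And>x. x \<in> carrier (base E) \<Longrightarrow> p x = Some (emb E x)"
    unfolding computable_on_def by blast
  have "tc embt" unfolding embt_def[abs_def]
    by (rule tc_guarded[of p, OF p(1) _ p(2)]) (intro B.dec_carrier[of "\<lambda>_. 0"] tc_intros)
  then show ?thesis by (rule tc_comp[OF _ assms])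
qed

text \<open>The embedding of the base field into a level is not listed among the data. It is
  computed by searching the level for the element with the right image in the top field, unique by
  injectivity.\<close>

lemma tc_lbaset [tc_intros]: assumes "tc f" "tc g" shows "tc (\<lambda>z. lbaset (f z) (g z))"
proof -
  have "tc (\<lambda>z. lbaset (pfst z) (psnd z))"
  proof (rule tc_Least1[where P = "\<lambda>z y. (psnd z \<notin> carrier (base E) \<and> y = 0) \<or>
      (psnd z \<in> carrier (base E) \<and> y \<in> SK (pfst z) \<and> lembt (pfst z) y = embt (psnd z))"])
    fix x y assume "(psnd x \<notin> carrier (base E) \<and> y = 0) \<or>
      (psnd x \<in> carrier (base E) \<and> y \<in> SK (pfst x) \<and> lembt (pfst x) y = embt (psnd x))"
    then show "y = lbaset (pfst x) (psnd x)"
      using lev_base[of "psnd x" "pfst x"] inj_onD[OF lev_emb_inj[of "pfst x"], of y "lev_base E (pfst x) (psnd x)"]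
      by (auto simp: lbaset_def lembt_def embt_def simp del: lev_emb_eq)
  next
    fix x show "(psnd x \<notin> carrier (base E) \<and> lbaset (pfst x) (psnd x) = 0) \<or>
      (psnd x \<in> carrier (base E) \<and> lbaset (pfst x) (psnd x) \<in> SK (pfst x) \<and> lembt (pfst x) (lbaset (pfst x) (psnd x)) = embt (psnd x))"
      using lev_base[of "psnd x" "pfst x"] by (auto simp: lbaset_def lembt_def embt_def)
  qed (intro tc_intros B.dec_carrier[of "\<lambda>_. 0"])
  from tc_comp2[OF this assms] show ?thesis .
qed

text \<open>Inclusions over several levels are computed by the same kind of search through the top
  field rather than by iterating \<open>step\<close>.\<close>

lemma tc_linclt [tc_intros]: assumes "tc f" "tc g" "tc h" shows "tc (\<lambda>z. linclt (f z) (g z) (h z))"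
proof -
  let ?g = "\<lambda>z. pfst (psnd z) \<le> pfst z \<and> psnd (psnd z) \<in> SK (pfst (psnd z))"
  have "tc (\<lambda>z. linclt (pfst z) (pfst (psnd z)) (psnd (psnd z)))"
  proof (rule tc_Least1[where P = "\<lambda>z y. (\<not> ?g z \<and> y = 0) \<or>
      (?g z \<and> y \<in> SK (pfst z) \<and> lembt (pfst z) y = lembt (pfst (psnd z)) (psnd (psnd z)))"])
    fix x y assume "(\<not> ?g x \<and> y = 0) \<or>
      (?g x \<and> y \<in> SK (pfst x) \<and> lembt (pfst x) y = lembt (pfst (psnd x)) (psnd (psnd x)))"
    then show "y = linclt (pfst x) (pfst (psnd x)) (psnd (psnd x))"
      using lev_incl[of "pfst (psnd x)" "pfst x" "psnd (psnd x)"]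
        inj_onD[OF lev_emb_inj[of "pfst x"], of y "lev_incl E (pfst x) (pfst (psnd x)) (psnd (psnd x))"]
      by (auto simp: linclt_def lembt_def simp del: lev_emb_eq)
  next
    fix x
    show "(\<not> ?g x \<and> linclt (pfst x) (pfst (psnd x)) (psnd (psnd x)) = 0) \<or>
      (?g x \<and> linclt (pfst x) (pfst (psnd x)) (psnd (psnd x)) \<in> SK (pfst x) \<and>
        lembt (pfst x) (linclt (pfst x) (pfst (psnd x)) (psnd (psnd x))) = lembt (pfst (psnd x)) (psnd (psnd x)))"
      using lev_incl[of "pfst (psnd x)" "pfst x" "psnd (psnd x)"] by (auto simp: linclt_def lembt_def)
  qed (intro tc_intros)
  from tc_comp3[OF this assms] show ?thesis .
qed

lemma lev_ext: assumes "hidx C l" shows "hyper_ext C (lev E) l (base E) (lev_base E)"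
proof -
  have "tc (\<lambda>z. lbaset (pfst z) (psnd z))" by (intro tc_intros)
  then have "hyper_ext_axioms (lev E) (base E) (lev_base E)"
    unfolding lbaset_def by (intro hyper_ext_axioms.intro B.uniform_fields_axioms lev_base_hom)
  then show ?thesis
    by (intro hyper_ext.intro hyper_field.intro cohesive_set_axioms K.uniform_fields_axioms hyper_field_axioms.intro assms)
qed

lemma top_ext: "hyper_ext C (\<lambda>_. top_field E) l0 (base E) (\<lambda>_. emb E)"
proof -
  have "tc (\<lambda>z. embt (psnd z))" by (intro tc_intros)
  then have "hyper_ext_axioms (\<lambda>_. top_field E) (base E) (\<lambda>_. emb E)"
    unfolding embt_def by (intro hyper_ext_axioms.intro B.uniform_fields_axioms emb_hom)
  then show ?thesis
    by (intro hyper_ext.intro hyper_field.intro cohesive_set_axioms T.uniform_fields_axioms hyper_field_axioms.intro hidx_const)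
qed

lemma lev_grp: assumes "hidx C l" shows "hyper_group C (grp E) l"
  by (intro hyper_group.intro cohesive_set_axioms G.uniform_groups_axioms hyper_group_axioms.intro assms)

sublocale top: hyper_ext C "\<lambda>_. top_field E" l0 "base E" "\<lambda>_. emb E" by (rule top_ext)

lemma HAut_top_eq: "HAut_top C E = top.Aut"
  by (simp add: HAut_top_def along_const)

lemma act_tree_cl:
  assumes l: "hidx C l" and g: "el SG l g" and t: "el STK l t"
  shows "cmap2 C (along STK l) (along (\<lambda>n s. map_tuple (act E n s)) l) (cl SG l g) (cl STK l t)
      = cl STK l (\<lambda>i. map_tuple (act E (the (l i)) (g i)) (t i)) \<and> el STK l (\<lambda>i. map_tuple (act E (the (l i)) (g i)) (t i))"
proof (rule cmap2_cl[where G = "\<lambda>n s. map_tuple (actt n s)", OF l G.usd_group g l usd_STK t l])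
  show "tc (\<lambda>z. map_tuple (actt (pfst z) (pfst (psnd z))) (psnd (psnd z)))" by (intro tc_intros)
  have eq: "map_tuple (act E n g) t = map_tuple (actt n g) t" if "g \<in> SG n" "t \<in> STK n" for n g t
    using that(2) by (rule map_tuple_cong) (simp add: actt_def that(1))
  show "\<forall>\<^sub>F i in F. map_tuple (act E (the (l i)) (g i)) (t i) = map_tuple (actt (the (l i)) (g i)) (t i)"
    using el_ae[OF g] el_ae[OF t] by eventually_elim (rule eq)
  fix i k n1 n2 x y assume "l i = Some k" "l i = Some n1" "x \<in> SG n1" "l i = Some n2" "y \<in> STK n2"
  moreover from this have "map_tuple (actt k x) y \<in> STK k" by (intro map_tuple_closed[of y "SK k"]) (auto simp: actt_def)
  ultimately show "\<exists>h n'. along (\<lambda>n s. map_tuple (act E n s)) l i = Some h \<and> h x y = map_tuple (actt k x) y \<and>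
      l i = Some n' \<and> map_tuple (actt k x) y \<in> STK n'"
    by (simp add: along_def eq)
qed

lemma act_cl:
  assumes l: "hidx C l" and g: "el SG l g" and t: "el SK l t"
  shows "cmap2 C (along SK l) (along (act E) l) (cl SG l g) (cl SK l t)
      = cl SK l (\<lambda>i. act E (the (l i)) (g i) (t i)) \<and> el SK l (\<lambda>i. act E (the (l i)) (g i) (t i))"
proof (rule cmap2_cl[where G = actt, OF l G.usd_group g l K.usd_carrier t l])
  show "tc (\<lambda>z. actt (pfst z) (pfst (psnd z)) (psnd (psnd z)))" by (intro tc_intros)
  show "\<forall>\<^sub>F i in F. act E (the (l i)) (g i) (t i) = actt (the (l i)) (g i) (t i)"
    using el_ae[OF g] el_ae[OF t] by eventually_elim (simp add: actt_def)
  fix i k n1 n2 x y assume "l i = Some k" "l i = Some n1" "x \<in> SG n1" "l i = Some n2" "y \<in> SK n2"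
  then show "\<exists>h n'. along (act E) l i = Some h \<and> h x y = actt k x y \<and> l i = Some n' \<and> actt k x y \<in> SK n'"
    by (simp add: along_def actt_def)
qed

lemma emb_cl:
  assumes l: "hidx C l" and t: "el SK l t"
  shows "top_embed C E l (cl SK l t) = cl ST l0 (\<lambda>i. lev_emb E (the (l i)) (t i)) \<and> el ST l0 (\<lambda>i. lev_emb E (the (l i)) (t i))"
proof -
  have "cmap C (along ST l0) (along (lev_emb E) l) (cl SK l t)
      = cl ST l0 (\<lambda>i. lev_emb E (the (l i)) (t i)) \<and> el ST l0 (\<lambda>i. lev_emb E (the (l i)) (t i))"
  proof (rule cmap_cl[where G = lembt, OF l K.usd_carrier t l])
    show "tc (\<lambda>z. lembt (pfst z) (psnd z))" by (intro tc_intros)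
    show "\<forall>\<^sub>F i in F. lev_emb E (the (l i)) (t i) = lembt (the (l i)) (t i)"
      using el_ae[OF t] by eventually_elim (simp add: lembt_def)
    fix i k n x assume "l i = Some k" "l i = Some n" "x \<in> SK n"
    then show "\<exists>h n'. along (lev_emb E) l i = Some h \<and> h x = lembt k x \<and> l0 i = Some n' \<and> lembt k x \<in> ST n'"
      by (simp add: along_def lembt_def)
  qed
  moreover have "carriers (\<lambda>_. Some (top_field E)) = along ST l0" by (simp add: fun_eq_iff carriers_def along_def)
  ultimately show ?thesis by (simp add: top_embed_def)
qed

lemma emb_tree_cl:
  assumes l: "hidx C l" and t: "el STK l t"
  shows "top_tree_embed C E l (cl STK l t) = cl STT l0 (\<lambda>i. map_tuple (lev_emb E (the (l i))) (t i)) \<and>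
    el STT l0 (\<lambda>i. map_tuple (lev_emb E (the (l i))) (t i))"
proof -
  have "cmap C (along STT l0) (map_tuples (along (lev_emb E) l)) (cl STK l t)
      = cl STT l0 (\<lambda>i. map_tuple (lev_emb E (the (l i))) (t i)) \<and> el STT l0 (\<lambda>i. map_tuple (lev_emb E (the (l i))) (t i))"
  proof (rule cmap_cl[where G = "\<lambda>n. map_tuple (lembt n)", OF l usd_STK t l])
    show "tc (\<lambda>z. map_tuple (lembt (pfst z)) (psnd z))" by (intro tc_intros)
    have eq: "map_tuple (lev_emb E n) t = map_tuple (lembt n) t" if "t \<in> STK n" for n t
      using that by (rule map_tuple_cong) (simp add: lembt_def)
    show "\<forall>\<^sub>F i in F. map_tuple (lev_emb E (the (l i))) (t i) = map_tuple (lembt (the (l i))) (t i)"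
      using el_ae[OF t] by eventually_elim (rule eq)
    fix i k n x assume "l i = Some k" "l i = Some n" "x \<in> STK n"
    moreover from this have "map_tuple (lembt k) x \<in> STT 0" by (intro map_tuple_closed[of x "SK k"]) (auto simp: lembt_def)
    ultimately show "\<exists>h n'. map_tuples (along (lev_emb E) l) i = Some h \<and> h x = map_tuple (lembt k) x \<and>
        l0 i = Some n' \<and> map_tuple (lembt k) x \<in> STT n'"
      by (simp add: along_def map_tuples_def eq)
  qed
  moreover have "trees (\<lambda>_. Some (top_field E)) = along STT l0" by (simp add: fun_eq_iff trees_def along_def)
  ultimately show ?thesis by (simp add: top_tree_embed_def)
qed

text \<open>The transition maps depend on two indices at once. These are packed into a single index,
  which is left undefined where the order relation fails, as are the maps themselves.\<close>

lemma pair_index: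
  assumes m: "hidx C m" and n: "hidx C n" and P: "decidable (\<lambda>z. P (pfst z) (psnd z))"
    and ae: "\<forall>\<^sub>F i in F. P (the (m i)) (the (n i))"
  shows "hidx C (\<lambda>i. Option.bind (m i) (\<lambda>a. Option.bind (n i) (\<lambda>b. if P a b then Some (ppair a b) else None)))"
    "\<forall>\<^sub>F i in F. the (Option.bind (m i) (\<lambda>a. Option.bind (n i) (\<lambda>b. if P a b then Some (ppair a b) else None))) = ppair (the (m i)) (the (n i))"
proof -
  have "partial_computable (\<lambda>z. if P (pfst z) (psnd z) then Some z else None)"
    by (rule pc_guard[OF P]) (intro tc_intros)
  from pc_bind2[OF _ _ this, of m n] m n
  have pc: "partial_computable (\<lambda>i. Option.bind (m i) (\<lambda>a. Option.bind (n i) (\<lambda>b. if P a b then Some (ppair a b) else None)))"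
    unfolding hidx_def prod_encode_inverse fst_conv snd_conv by blast
  have ae2: "\<forall>\<^sub>F i in F. Option.bind (m i) (\<lambda>a. Option.bind (n i) (\<lambda>b. if P a b then Some (ppair a b) else None)) = Some (ppair (the (m i)) (the (n i)))"
    using hidx_ex[OF m] hidx_ex[OF n] ae
  proof eventually_elim
    case (elim i)
    then obtain a b where "m i = Some a" "n i = Some b" by blast
    with elim(3) show ?case by simp
  qed
  show "hidx C (\<lambda>i. Option.bind (m i) (\<lambda>a. Option.bind (n i) (\<lambda>b. if P a b then Some (ppair a b) else None)))"
    unfolding hidx_def using pc eventually_mono[OF ae2] by force
  show "\<forall>\<^sub>F i in F. the (Option.bind (m i) (\<lambda>a. Option.bind (n i) (\<lambda>b. if P a b then Some (ppair a b) else None))) = ppair (the (m i)) (the (n i))"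
    using ae2 by eventually_elim simp
qed

lemma incl_cl:
  assumes m: "hidx C m" and n: "hidx C n" and le: "\<forall>\<^sub>F i in F. the (n i) \<le> the (m i)" and t: "el SK n t"
  shows "lev_embed C E m n (cl SK n t) = cl SK m (\<lambda>i. lev_incl E (the (m i)) (the (n i)) (t i)) \<and>
    el SK m (\<lambda>i. lev_incl E (the (m i)) (the (n i)) (t i))"
proof -
  define w where "w = (\<lambda>i. Option.bind (m i) (\<lambda>a. Option.bind (n i) (\<lambda>b. if b \<le> a then Some (ppair a b) else None)))"
  have d: "decidable (\<lambda>z. psnd z \<le> pfst z)" by (intro tc_intros)
  have w: "hidx C w" "\<forall>\<^sub>F i in F. the (w i) = ppair (the (m i)) (the (n i))"
    using pair_index[of m n "\<lambda>a b. b \<le> a", OF m n d le] unfolding w_def .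
  show ?thesis unfolding lev_embed_def carriers_along
  proof (rule cmap_cl[where G = "\<lambda>z. linclt (pfst z) (psnd z)", OF n K.usd_carrier t w(1)])
    show "tc (\<lambda>z. linclt (pfst (pfst z)) (psnd (pfst z)) (psnd z))" by (intro tc_intros)
    show "\<forall>\<^sub>F i in F. lev_incl E (the (m i)) (the (n i)) (t i) = linclt (pfst (the (w i))) (psnd (the (w i))) (t i)"
      using w(2) le el_ae[OF t] by eventually_elim (simp add: linclt_def)
    fix i k n1 x assume k: "w i = Some k" and n1: "n i = Some n1" and x: "x \<in> SK n1"
    then obtain a where a: "m i = Some a" "n1 \<le> a" "k = ppair a n1"
      by (auto simp: w_def Option.bind_eq_Some_conv split: if_splits)
    then show "\<exists>h n'. (case (m i, n i) of (Some a, Some b) \<Rightarrow> if b \<le> a then Some (lev_incl E a b) else None | _ \<Rightarrow> None) = Some h \<and>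
        h x = linclt (pfst k) (psnd k) x \<and> m i = Some n' \<and> linclt (pfst k) (psnd k) x \<in> SK n'"
      using n1 x lev_incl(1)[OF a(2) x] by (simp add: linclt_def)
  qed
qed

lemma quot_cl:
  assumes m: "hidx C m" and n: "hidx C n" and less: "\<forall>\<^sub>F i in F. the (n i) < the (m i)" and g: "el SG m g"
  shows "G_trans C E m n (cl SG m g) = cl SG n (\<lambda>i. quot E (the (m i)) (the (n i)) (g i)) \<and>
    el SG n (\<lambda>i. quot E (the (m i)) (the (n i)) (g i))"
proof -
  define w where "w = (\<lambda>i. Option.bind (m i) (\<lambda>a. Option.bind (n i) (\<lambda>b. if b < a then Some (ppair a b) else None)))"
  have d: "decidable (\<lambda>z. psnd z < pfst z)" by (intro tc_intros)
  have w: "hidx C w" "\<forall>\<^sub>F i in F. the (w i) = ppair (the (m i)) (the (n i))"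
    using pair_index[of m n "\<lambda>a b. b < a", OF m n d less] unfolding w_def .
  show ?thesis unfolding G_trans_def carriers_along
  proof (rule cmap_cl[where G = "\<lambda>z. quott (pfst z) (psnd z)", OF m G.usd_group g w(1)])
    show "tc (\<lambda>z. quott (pfst (pfst z)) (psnd (pfst z)) (psnd z))" by (intro tc_intros)
    show "\<forall>\<^sub>F i in F. quot E (the (m i)) (the (n i)) (g i) = quott (pfst (the (w i))) (psnd (the (w i))) (g i)"
      using w(2) less el_ae[OF g] by eventually_elim (simp add: quott_def)
    fix i k m1 x assume k: "w i = Some k" and m1: "m i = Some m1" and x: "x \<in> SG m1"
    then obtain b where b: "n i = Some b" "b < m1" "k = ppair m1 b"
      by (auto simp: w_def Option.bind_eq_Some_conv split: if_splits)
    then show "\<exists>h n'. (case (m i, n i) of (Some a, Some b) \<Rightarrow> if b < a then Some (quot E a b) else None | _ \<Rightarrow> None) = Some h \<and>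
        h x = quott (pfst k) (psnd k) x \<and> n i = Some n' \<and> quott (pfst k) (psnd k) x \<in> SG n'"
      using m1 x quot_closed[OF b(2) x] by (simp add: quott_def)
  qed
qed

lemma tree_act_cl:
  assumes l: "hidx C l" and g: "el SG l g" and t: "el STK l t"
  shows "tree_act C E l (cl SG l g) (cl STK l t) = cl STK l (\<lambda>i. map_tuple (act E (the (l i)) (g i)) (t i))"
    "el STK l (\<lambda>i. map_tuple (act E (the (l i)) (g i)) (t i))"
proof -
  have "cl STK l t \<in> cprod C (trees (along (lev E) l))"
    unfolding trees_along by (rule cprodI[OF l usd_STK t])
  then show "tree_act C E l (cl SG l g) (cl STK l t) = cl STK l (\<lambda>i. map_tuple (act E (the (l i)) (g i)) (t i))"
    using act_tree_cl[OF assms] unfolding tree_act_def trees_along by simp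
  show "el STK l (\<lambda>i. map_tuple (act E (the (l i)) (g i)) (t i))" using act_tree_cl[OF assms] by blast
qed

text \<open>The pointwise tuple is found by search: the condition quantifies over the finite list of
  group elements, hence is decidable. The arity may vary with the index, which the tree of tuples
  permits.\<close>

lemma trivial_stabiliser_hyper:
  assumes k: "hidx C k"
  obtains t where "el STK k t"
    "\<forall>\<^sub>F i in F. \<forall>g\<in>SG (the (k i)). \<forall>h\<in>SG (the (k i)).
       map_tuple (act E (the (k i)) g) (t i) = map_tuple (act E (the (k i)) h) (t i) \<longrightarrow> g = h"
proof -
  define P where "P n t \<longleftrightarrow> t \<in> STK n \<and> (\<forall>g\<in>set (list_decode (G.gcode n)). \<forall>h\<in>set (list_decode (G.gcode n)).
      map_tuple (actt n g) t = map_tuple (actt n h) t \<longrightarrow> g = h)" for n t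
  have dec: "decidable (\<lambda>z. P (pfst z) (psnd z))"
    unfolding P_def by (intro tc_intros usd_decidable[OF usd_STK])
  have P: "P n t \<longleftrightarrow> t \<in> STK n \<and> (\<forall>g\<in>SG n. \<forall>h\<in>SG n. map_tuple (act E n g) t = map_tuple (act E n h) t \<longrightarrow> g = h)" for n t
  proof -
    have "map_tuple (act E n g) t = map_tuple (actt n g) t" if "g \<in> SG n" "t \<in> STK n" for g
      using that(2) by (rule map_tuple_cong) (simp add: actt_def that(1))
    then show ?thesis unfolding P_def G.gcode(2)[symmetric] by auto
  qed
  have "\<forall>\<^sub>F i in F. \<exists>t. P (the (k i)) t"
    by (rule always_eventually) (use trivial_stabiliser[unfolded Bex_def] in \<open>simp add: P\<close>)
  from hc_search[OF dec hidx_val[OF k] this] obtain t where t: "hc C t" "\<forall>\<^sub>F i in F. P (the (k i)) (t i)" by blast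
  show ?thesis
  proof (rule that)
    show "el STK k t" by (rule elI[OF t(1)], rule eventually_mono[OF t(2)]) (simp add: P)
    show "\<forall>\<^sub>F i in F. \<forall>g\<in>SG (the (k i)). \<forall>h\<in>SG (the (k i)).
       map_tuple (act E (the (k i)) g) (t i) = map_tuple (act E (the (k i)) h) (t i) \<longrightarrow> g = h"
      by (rule eventually_mono[OF t(2)]) (simp add: P)
  qed
qed

text \<open>\<open>J\<close> embeds a level into the field on whose tuples \<open>\<sigma>\<close>
  acts: the identity for the levels, the embedding for the top field. The assumption
  \<open>conj\<close> is the pointwise conjugacy statement, whose premise on types is supplied by
  \<open>Aut_types\<close>.\<close>

lemma Aut_acts:
  assumes X: "hyper_ext C R l (base E) U" and k: "hidx C k"
    and \<sigma>: "\<sigma> \<in> carrier (HAut C (base E) (along R l) (along U l))"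
    and J_tc: "tc (\<lambda>z. Jt (pfst z) (psnd z))" and J: "\<And>n x. x \<in> SK n \<Longrightarrow> J n x = Jt n x"
    and J_inj: "\<And>n. inj_on (J n) (SK n)"
    and J_el: "\<And>t. el STK k t \<Longrightarrow> el (\<lambda>n. tuples (carrier (R n))) l (\<lambda>i. map_tuple (J (the (k i))) (t i))"
    and conj: "\<forall>\<^sub>F i in F. \<forall>a b. set a \<subseteq> SK (the (k i)) \<longrightarrow> set b \<subseteq> carrier (R (the (l i))) \<longrightarrow> length b = length a \<longrightarrow>
      (\<forall>p\<in>polys. \<forall>c. set c \<subseteq> carrier (base E) \<longrightarrow> poly_var p = length a + length c \<longrightarrow>
        poly_eval (R (the (l i))) p (map (J (the (k i))) a @ map (U (the (l i))) c) = \<zero>\<^bsub>R (the (l i))\<^esub> \<longrightarrow>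
        poly_eval (R (the (l i))) p (b @ map (U (the (l i))) c) = \<zero>\<^bsub>R (the (l i))\<^esub>) \<longrightarrow>
      (\<exists>g\<in>SG (the (k i)). b = map (J (the (k i))) (map (act E (the (k i)) g) a))"
  shows "\<exists>g. el SG k g \<and> (\<forall>t. el STK k t \<longrightarrow>
    \<sigma> (cl (\<lambda>n. tuples (carrier (R n))) l (\<lambda>i. map_tuple (J (the (k i))) (t i))) =
    cl (\<lambda>n. tuples (carrier (R n))) l (\<lambda>i. map_tuple (J (the (k i))) (map_tuple (act E (the (k i)) (g i)) (t i))))"
proof -
  interpret X: hyper_ext C R l "base E" U by (rule X)
  interpret KX: hyper_ext C "lev E" k "base E" "lev_base E" by (rule lev_ext[OF k])
  define n where "n i = the (k i)" for i
  have conj_of: "\<forall>\<^sub>F i in F. \<exists>g\<in>SG (n i). b i = map_tuple (J (n i)) (map_tuple (act E (n i) g) (a i))"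
    if a: "el STK k a" and b: "el X.ST l b" and ab: "\<sigma> (cl X.ST l (\<lambda>i. map_tuple (J (n i)) (a i))) = cl X.ST l b" for a b
  proof -
    let ?a = "\<lambda>i. map_tuple (J (n i)) (a i)"
    have ea: "el X.ST l ?a" unfolding n_def by (rule J_el[OF a])
    have len: "\<forall>\<^sub>F i in F. length (list_decode (b i)) = length (list_decode (?a i))"
      using X.Aut_D(3)[OF \<sigma> ea] X.arity_eq_iff[OF b ea] unfolding ab by simp
    show ?thesis
      using X.Aut_types[OF \<sigma> ea b ab] conj el_ae[OF a] el_ae[OF b] len
    proof eventually_elim
      case (elim i)
      have "set (list_decode (a i)) \<subseteq> SK (the (k i))" "set (list_decode (b i)) \<subseteq> carrier (R (the (l i)))"
        "length (list_decode (b i)) = length (list_decode (a i))"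
        using elim(3-5) by (simp_all add: tuples_iff)
      moreover have "\<forall>p\<in>polys. \<forall>c. set c \<subseteq> carrier (base E) \<longrightarrow> poly_var p = length (list_decode (a i)) + length c \<longrightarrow>
        poly_eval (R (the (l i))) p (map (J (the (k i))) (list_decode (a i)) @ map (U (the (l i))) c) = \<zero>\<^bsub>R (the (l i))\<^esub> \<longrightarrow>
        poly_eval (R (the (l i))) p (list_decode (b i) @ map (U (the (l i))) c) = \<zero>\<^bsub>R (the (l i))\<^esub>"
        using elim(1) by (simp add: n_def)
      ultimately obtain g where g: "g \<in> SG (the (k i))" "list_decode (b i) = map (J (the (k i))) (map (act E (the (k i)) g) (list_decode (a i)))"
        using elim(2) by blast
      have "b i = list_encode (list_decode (b i))" by simp
      also have "\<dots> = map_tuple (J (n i)) (map_tuple (act E (n i) g) (a i))" unfolding g(2) by (simp add: map_tuple_def n_def)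
      finally show ?case using g(1) unfolding n_def by blast
    qed
  qed
  obtain t0 where t0: "el STK k t0" "\<forall>\<^sub>F i in F. \<forall>g\<in>SG (n i). \<forall>h\<in>SG (n i).
      map_tuple (act E (n i) g) (t0 i) = map_tuple (act E (n i) h) (t0 i) \<longrightarrow> g = h"
    using trivial_stabiliser_hyper[OF k] unfolding n_def by blast
  have Jt0: "el X.ST l (\<lambda>i. map_tuple (J (n i)) (t0 i))" unfolding n_def by (rule J_el[OF t0(1)])
  obtain b0 where b0: "el X.ST l b0" "\<sigma> (cl X.ST l (\<lambda>i. map_tuple (J (n i)) (t0 i))) = cl X.ST l b0"
    by (rule X.Aut_image[OF \<sigma> Jt0])
  \<comment> \<open>A group element carrying \<open>t0\<close> to its image \<open>b0\<close> is
    singled out by a decidable condition, hence can be chosen computably.\<close>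
  define P where "P z g \<longleftrightarrow> g \<in> SG (pfst z) \<and>
      pfst (psnd z) = map_tuple (Jt (pfst z)) (map_tuple (actt (pfst z) g) (psnd (psnd z)))" for z g
  have dec: "decidable (\<lambda>w. P (pfst w) (psnd w))"
    unfolding P_def by (intro tc_intros tc_comp2[OF J_tc])
  have mtJ: "map_tuple (Jt m) (map_tuple (actt m g) t) = map_tuple (J m) (map_tuple (act E m g) t)"
    if "g \<in> SG m" "t \<in> STK m" for m g t
    unfolding map_tuple_comp using that(2) by (rule map_tuple_cong) (simp add: actt_def that(1) J)
  have "\<forall>\<^sub>F i in F. \<exists>g. P (ppair (n i) (ppair (b0 i) (t0 i))) g"
    using conj_of[OF t0(1) b0] el_ae[OF t0(1)]
  proof eventually_elim
    case (elim i)
    then obtain g where "g \<in> SG (n i)" "b0 i = map_tuple (J (n i)) (map_tuple (act E (n i) g) (t0 i))" by blast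
    then show ?case using elim(2) by (intro exI[of _ g]) (simp add: P_def mtJ n_def)
  qed
  moreover have "hc C (\<lambda>i. ppair (n i) (ppair (b0 i) (t0 i)))"
    unfolding n_def by (intro hc_pair hidx_val[OF k] el_hc[OF b0(1)] el_hc[OF t0(1)])
  ultimately obtain g where g: "hc C g" "\<forall>\<^sub>F i in F. P (ppair (n i) (ppair (b0 i) (t0 i))) (g i)"
    using hc_search[OF dec] by blast
  have g': "\<forall>\<^sub>F i in F. g i \<in> SG (n i) \<and> b0 i = map_tuple (J (n i)) (map_tuple (act E (n i) (g i)) (t0 i))"
    using g(2) el_ae[OF t0(1)]
  proof eventually_elim
    case (elim i)
    then have "g i \<in> SG (n i)" "b0 i = map_tuple (Jt (n i)) (map_tuple (actt (n i) (g i)) (t0 i))" by (simp_all add: P_def)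
    then show ?case using mtJ[of "g i" "n i" "t0 i"] elim(2) by (simp add: n_def)
  qed
  have eg: "el SG k g" by (rule elI[OF g(1)], rule eventually_mono[OF g']) (simp add: n_def)
  moreover have "\<sigma> (cl X.ST l (\<lambda>i. map_tuple (J (n i)) (t i))) = cl X.ST l (\<lambda>i. map_tuple (J (n i)) (map_tuple (act E (n i) (g i)) (t i)))"
    if t: "el STK k t" for t
  proof -
    have Jt: "el X.ST l (\<lambda>i. map_tuple (J (n i)) (t i))" unfolding n_def by (rule J_el[OF t])
    obtain r where r: "el X.ST l r" "\<sigma> (cl X.ST l (\<lambda>i. map_tuple (J (n i)) (t i))) = cl X.ST l r"
      by (rule X.Aut_image[OF \<sigma> Jt])
    \<comment> \<open>Concatenating \<open>t\<close> with \<open>t0\<close> ties the two images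
      together: pointwise some \<open>h\<close> moves both tuples, and as it moves \<open>t0\<close>
      in the same way as \<open>g\<close>, it equals \<open>g\<close>.\<close>
    have at: "el STK k (\<lambda>i. app (t0 i) (t i))" using KX.append_cl[OF t0(1) t] by blast
    have br: "el X.ST l (\<lambda>i. app (b0 i) (r i))" using X.append_cl[OF b0(1) r(1)] by blast
    have "\<sigma> (cl X.ST l (\<lambda>i. map_tuple (J (n i)) (app (t0 i) (t i)))) = cl X.ST l (\<lambda>i. app (b0 i) (r i))"
      unfolding map_tuple_app X.Aut_D(2)[OF \<sigma> Jt0 Jt] b0(2) r(2) using X.append_cl[OF b0(1) r(1)] by blast
    from conj_of[OF at br this] g' t0(2) el_ae[OF t0(1)]
    have "\<forall>\<^sub>F i in F. r i = map_tuple (J (n i)) (map_tuple (act E (n i) (g i)) (t i))"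
    proof eventually_elim
      case (elim i)
      then obtain h where h: "h \<in> SG (n i)" "app (b0 i) (r i) = map_tuple (J (n i)) (map_tuple (act E (n i) h) (app (t0 i) (t i)))"
        by blast
      have eq: "list_decode (b0 i) @ list_decode (r i) =
          list_decode (map_tuple (J (n i)) (map_tuple (act E (n i) h) (t0 i))) @ list_decode (map_tuple (J (n i)) (map_tuple (act E (n i) h) (t i)))"
        using arg_cong[OF h(2), of list_decode] by (simp del: list_decode_map_tuple add: map_tuple_app)
      \<comment> \<open>The first blocks have equal length, so the concatenated equation splits into
        one for each block.\<close>
      have len: "length (list_decode (b0 i)) = length (list_decode (map_tuple (J (n i)) (map_tuple (act E (n i) h) (t0 i))))"
        using elim(2) by simp
      have "list_decode (b0 i) = list_decode (map_tuple (J (n i)) (map_tuple (act E (n i) h) (t0 i))) \<and>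
        list_decode (r i) = list_decode (map_tuple (J (n i)) (map_tuple (act E (n i) h) (t i)))"
        by (rule iffD1[OF append_eq_append_conv[OF disjI1[OF len]] eq])
      then have b: "b0 i = map_tuple (J (n i)) (map_tuple (act E (n i) h) (t0 i))"
        and r: "r i = map_tuple (J (n i)) (map_tuple (act E (n i) h) (t i))" by (simp_all only: list_decode_eq)
      have "t0 i \<in> STK (n i)" using elim(4) by (simp add: n_def)
      then have cl: "map_tuple (act E (n i) x) (t0 i) \<in> STK (n i)" if "x \<in> SG (n i)" for x
        by (rule map_tuple_closed) (simp add: that)
      have "map_tuple (act E (n i) (g i)) (t0 i) = map_tuple (act E (n i) h) (t0 i)"
        using map_tuple_eq_iff[OF J_inj cl cl] b elim(2) h(1) by metis
      then have "g i = h" using elim(2,3) h(1) by blast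
      then show ?case using r by simp
    qed
    then show ?thesis unfolding r(2) by (rule cl_cong)
  qed
  ultimately show ?thesis unfolding n_def by blast
qed

end

section \<open>The groups of hyper-automorphisms\<close>

lemma action_hom_BijGroup:
  assumes G: "group G"
    and closed: "\<And>g x. g \<in> carrier G \<Longrightarrow> x \<in> S \<Longrightarrow> a g x \<in> S"
    and mult: "\<And>g h x. g \<in> carrier G \<Longrightarrow> h \<in> carrier G \<Longrightarrow> x \<in> S \<Longrightarrow> a (g \<otimes>\<^bsub>G\<^esub> h) x = a g (a h x)"
    and one: "\<And>x. x \<in> S \<Longrightarrow> a \<one>\<^bsub>G\<^esub> x = x"
  shows "(\<lambda>g. restrict (a g) S) \<in> hom G (BijGroup S)"
proof -
  interpret group G by (rule G)
  have bij: "restrict (a g) S \<in> Bij S" if g: "g \<in> carrier G" for g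
  proof -
    have "bij_betw (a g) S S"
    proof (rule bij_betw_byWitness[where f' = "a (inv\<^bsub>G\<^esub> g)"])
      show "\<forall>x\<in>S. a (inv\<^bsub>G\<^esub> g) (a g x) = x" "\<forall>x\<in>S. a g (a (inv\<^bsub>G\<^esub> g) x) = x"
        using g by (simp_all add: mult[symmetric] one)
    qed (use g closed in auto)
    then show ?thesis by (simp add: Bij_def bij_betw_restrict_eq)
  qed
  show ?thesis
  proof (rule homI)
    show "restrict (a g) S \<in> carrier (BijGroup S)" if "g \<in> carrier G" for g
      using bij[OF that] by (simp add: BijGroup_def)
    fix g h assume gh: "g \<in> carrier G" "h \<in> carrier G"
    have "restrict (a (g \<otimes>\<^bsub>G\<^esub> h)) S = compose S (restrict (a g) S) (restrict (a h) S)"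
      using gh by (auto simp: compose_def mult closed)
    then show "restrict (a (g \<otimes>\<^bsub>G\<^esub> h)) S = restrict (a g) S \<otimes>\<^bsub>BijGroup S\<^esub> restrict (a h) S"
      using bij gh by (simp add: BijGroup_def)
  qed
qed

lemma iso_of_inverse:
  assumes G: "group G" and \<phi>: "\<phi> \<in> iso G H" and inv: "\<And>x. x \<in> carrier G \<Longrightarrow> \<psi> (\<phi> x) = x"
  shows "\<psi> \<in> iso H G"
proof -
  interpret group G by (rule G)
  have surj: "carrier H = \<phi> ` carrier G" and hom: "\<phi> \<in> hom G H" using \<phi> by (auto simp: iso_def bij_betw_def)
  have "bij_betw \<psi> (carrier H) (carrier G)"
    by (rule bij_betw_byWitness[where f' = \<phi>]) (use surj inv hom in \<open>auto simp: hom_in_carrier\<close>)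
  moreover have "\<psi> \<in> hom H G"
  proof (rule homI)
    show "\<psi> x \<in> carrier G" if "x \<in> carrier H" for x using that surj inv by auto
    fix x y assume "x \<in> carrier H" "y \<in> carrier H"
    then obtain a b where ab: "a \<in> carrier G" "b \<in> carrier G" "x = \<phi> a" "y = \<phi> b" using surj by auto
    then have "x \<otimes>\<^bsub>H\<^esub> y = \<phi> (a \<otimes>\<^bsub>G\<^esub> b)" using hom_mult[OF hom] by simp
    then show "\<psi> (x \<otimes>\<^bsub>H\<^esub> y) = \<psi> x \<otimes>\<^bsub>G\<^esub> \<psi> y" using ab inv by simp
  qed
  ultimately show ?thesis by (simp add: iso_def)
qed

lemma inverse_limit_group:
  assumes A: "\<And>i. i \<in> I \<Longrightarrow> group (A i)"
    and f: "\<And>m n. m \<in> I \<Longrightarrow> n \<in> I \<Longrightarrow> lt n m \<Longrightarrow> f m n \<in> hom (A m) (A n)"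
  shows "group (inverse_limit I lt A f)"
proof -
  let ?P = "product_group I A"
  let ?X = "{x \<in> carrier ?P. \<forall>m\<in>I. \<forall>n\<in>I. lt n m \<longrightarrow> f m n (x m) = x n}"
  have P: "group ?P" using A by simp
  have fh: "group_hom (A m) (A n) (f m n)" if "m \<in> I" "n \<in> I" "lt n m" for m n
    using A f that by (simp add: group_hom_def group_hom_axioms_def)
  have "subgroup ?X ?P"
  proof (rule group.subgroupI[OF P])
    have "\<one>\<^bsub>?P\<^esub> \<in> ?X"
    proof (intro CollectI conjI ballI impI)
      show "\<one>\<^bsub>?P\<^esub> \<in> carrier ?P" by (rule monoid.one_closed[OF group.is_monoid[OF P]])
      show "f m n (\<one>\<^bsub>?P\<^esub> m) = \<one>\<^bsub>?P\<^esub> n" if "m \<in> I" "n \<in> I" "lt n m" for m n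
        using group_hom.hom_one[OF fh[OF that]] that by simp
    qed
    then show "?X \<noteq> {}" by blast
  next
    fix x assume x: "x \<in> ?X"
    show "inv\<^bsub>?P\<^esub> x \<in> ?X"
    proof (intro CollectI conjI ballI impI)
      show "inv\<^bsub>?P\<^esub> x \<in> carrier ?P" using x by (intro group.inv_closed[OF P]) blast
      show "f m n ((inv\<^bsub>?P\<^esub> x) m) = (inv\<^bsub>?P\<^esub> x) n" if mn: "m \<in> I" "n \<in> I" "lt n m" for m n
      proof -
        have "x m \<in> carrier (A m)" using x mn by (auto simp: PiE_def Pi_def)
        then show ?thesis using group_hom.hom_inv[OF fh[OF mn]] x mn A by simp
      qed
    qed
  next
    fix x y assume xy: "x \<in> ?X" "y \<in> ?X"
    show "x \<otimes>\<^bsub>?P\<^esub> y \<in> ?X"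
    proof (intro CollectI conjI ballI impI)
      show "x \<otimes>\<^bsub>?P\<^esub> y \<in> carrier ?P" using xy by (intro monoid.m_closed[OF group.is_monoid[OF P]]) blast+
      show "f m n ((x \<otimes>\<^bsub>?P\<^esub> y) m) = (x \<otimes>\<^bsub>?P\<^esub> y) n" if mn: "m \<in> I" "n \<in> I" "lt n m" for m n
      proof -
        have "x m \<in> carrier (A m)" "y m \<in> carrier (A m)" using xy mn by (auto simp: PiE_def Pi_def)
        then show ?thesis using hom_mult[OF f[OF mn]] xy mn by simp
      qed
    qed
  qed blast
  from subgroup.subgroup_is_group[OF this P] show ?thesis by (simp add: inverse_limit_def)
qed

section \<open>Product groups as groups of hyper-automorphisms\<close>

context galois_hyper
begin

lemma G_lev_P: "hidx C l \<Longrightarrow> carrier (G_lev C E l) = cprod C (along SG l)"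
  by (simp add: G_lev_def cprod_group_def carriers_along)

lemma G_elim:
  assumes "hidx C l" "x \<in> carrier (G_lev C E l)" obtains g where "el SG l g" "x = cl SG l g"
  by (rule cprodE[OF assms(2)[unfolded G_lev_P[OF assms(1)]]])

lemma G_intro: "hidx C l \<Longrightarrow> el SG l g \<Longrightarrow> cl SG l g \<in> carrier (G_lev C E l)"
  unfolding G_lev_P by (rule cprodI[OF _ G.usd_group])

lemma G_mult:
  assumes "hidx C l" "el SG l g" "el SG l h"
  shows "cl SG l g \<otimes>\<^bsub>G_lev C E l\<^esub> cl SG l h = cl SG l (\<lambda>i. g i \<otimes>\<^bsub>grp E (the (l i))\<^esub> h i)"
    "el SG l (\<lambda>i. g i \<otimes>\<^bsub>grp E (the (l i))\<^esub> h i)"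
proof -
  interpret H: hyper_group C "grp E" l by (rule lev_grp[OF assms(1)])
  show "cl SG l g \<otimes>\<^bsub>G_lev C E l\<^esub> cl SG l h = cl SG l (\<lambda>i. g i \<otimes>\<^bsub>grp E (the (l i))\<^esub> h i)"
    "el SG l (\<lambda>i. g i \<otimes>\<^bsub>grp E (the (l i))\<^esub> h i)"
    using H.mult_cl[OF assms(2,3)] by (simp_all add: G_lev_def)
qed

lemma G_group: "hidx C l \<Longrightarrow> group (G_lev C E l)"
  unfolding G_lev_def by (rule hyper_group.group_P[OF lev_grp])

lemma G_one:
  assumes "hidx C l" shows "\<one>\<^bsub>G_lev C E l\<^esub> = cl SG l (\<lambda>i. \<one>\<^bsub>grp E (the (l i))\<^esub>)" "el SG l (\<lambda>i. \<one>\<^bsub>grp E (the (l i))\<^esub>)"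
proof -
  interpret H: hyper_group C "grp E" l by (rule lev_grp[OF assms])
  show "\<one>\<^bsub>G_lev C E l\<^esub> = cl SG l (\<lambda>i. \<one>\<^bsub>grp E (the (l i))\<^esub>)" "el SG l (\<lambda>i. \<one>\<^bsub>grp E (the (l i))\<^esub>)"
    using H.one_cl by (simp_all add: G_lev_def)
qed

lemma G_trans_hom:
  assumes m: "hidx C m" and n: "hidx C n" and less: "\<forall>\<^sub>F i in F. the (n i) < the (m i)"
  shows "G_trans C E m n \<in> hom (G_lev C E m) (G_lev C E n)"
proof (rule homI)
  fix x assume "x \<in> carrier (G_lev C E m)"
  then obtain g where "el SG m g" "x = cl SG m g" by (rule G_elim[OF m])
  then show "G_trans C E m n x \<in> carrier (G_lev C E n)"
    using quot_cl[OF m n less] G_intro[OF n] by simp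
next
  fix x y assume "x \<in> carrier (G_lev C E m)" "y \<in> carrier (G_lev C E m)"
  then obtain g h where g: "el SG m g" "x = cl SG m g" and h: "el SG m h" "y = cl SG m h"
    by (elim G_elim[OF m]) blast
  note qg = quot_cl[OF m n less g(1)] and qh = quot_cl[OF m n less h(1)]
  have "\<forall>\<^sub>F i in F. quot E (the (m i)) (the (n i)) (g i \<otimes>\<^bsub>grp E (the (m i))\<^esub> h i) =
      quot E (the (m i)) (the (n i)) (g i) \<otimes>\<^bsub>grp E (the (n i))\<^esub> quot E (the (m i)) (the (n i)) (h i)"
    using less el_ae[OF g(1)] el_ae[OF h(1)] by eventually_elim (rule quot_mult)
  then show "G_trans C E m n (x \<otimes>\<^bsub>G_lev C E m\<^esub> y) = G_trans C E m n x \<otimes>\<^bsub>G_lev C E n\<^esub> G_trans C E m n y"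
    unfolding g(2) h(2) G_mult(1)[OF m g(1) h(1)] qg[THEN conjunct1] qh[THEN conjunct1]
      G_mult(1)[OF n qg[THEN conjunct2] qh[THEN conjunct2]]
      quot_cl[OF m n less G_mult(2)[OF m g(1) h(1)], THEN conjunct1]
    by (rule cl_cong)
qed

lemma HAut_lev_eq: "HAut_lev C E l = HAut C (base E) (along (lev E) l) (along (lev_base E) l)"
  by (simp add: HAut_lev_def)

lemma tree_act_hom:
  assumes l: "hidx C l"
  shows "tree_act C E l \<in> hom (G_lev C E l) (BijGroup (cprod C (along STK l)))"
proof -
  let ?a = "cmap2 C (along STK l) (along (\<lambda>n s. map_tuple (act E n s)) l)"
  have "tree_act C E l = (\<lambda>g. restrict (?a g) (cprod C (along STK l)))"
    by (simp add: fun_eq_iff tree_act_def trees_along)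
  moreover have "(\<lambda>g. restrict (?a g) (cprod C (along STK l))) \<in> hom (G_lev C E l) (BijGroup (cprod C (along STK l)))"
  proof (rule action_hom_BijGroup[OF G_group[OF l]])
    fix G T assume "G \<in> carrier (G_lev C E l)" "T \<in> cprod C (along STK l)"
    then obtain g t where g: "el SG l g" "G = cl SG l g" and t: "el STK l t" "T = cl STK l t"
      by (elim G_elim[OF l] cprodE) blast
    show "?a G T \<in> cprod C (along STK l)"
      unfolding g(2) t(2) using act_tree_cl[OF l g(1) t(1)] cprodI[OF l usd_STK] by metis
  next
    fix G H T assume "G \<in> carrier (G_lev C E l)" "H \<in> carrier (G_lev C E l)" "T \<in> cprod C (along STK l)"
    then obtain g h t where g: "el SG l g" "G = cl SG l g" and h: "el SG l h" "H = cl SG l h" and t: "el STK l t" "T = cl STK l t"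
      by (elim G_elim[OF l] cprodE) blast
    have "\<forall>\<^sub>F i in F. map_tuple (act E (the (l i)) (g i \<otimes>\<^bsub>grp E (the (l i))\<^esub> h i)) (t i) =
        map_tuple (act E (the (l i)) (g i)) (map_tuple (act E (the (l i)) (h i)) (t i))"
      using el_ae[OF g(1)] el_ae[OF h(1)] el_ae[OF t(1)]
    proof eventually_elim
      case (elim i)
      show ?case unfolding map_tuple_comp using elim(3) by (rule map_tuple_cong) (rule act_mult[OF elim(1,2)])
    qed
    then have *: "cl STK l (\<lambda>i. map_tuple (act E (the (l i)) (g i \<otimes>\<^bsub>grp E (the (l i))\<^esub> h i)) (t i)) =
        cl STK l (\<lambda>i. map_tuple (act E (the (l i)) (g i)) (map_tuple (act E (the (l i)) (h i)) (t i)))"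
      by (rule cl_cong)
    note ht = act_tree_cl[OF l h(1) t(1)]
    show "?a (G \<otimes>\<^bsub>G_lev C E l\<^esub> H) T = ?a G (?a H T)"
      unfolding g(2) h(2) t(2) G_mult(1)[OF l g(1) h(1)] ht[THEN conjunct1]
        act_tree_cl[OF l G_mult(2)[OF l g(1) h(1)] t(1), THEN conjunct1]
        act_tree_cl[OF l g(1) ht[THEN conjunct2], THEN conjunct1] by (rule *)
  next
    fix T assume "T \<in> cprod C (along STK l)"
    then obtain t where t: "el STK l t" "T = cl STK l t" by (rule cprodE)
    have "\<forall>\<^sub>F i in F. map_tuple (act E (the (l i)) \<one>\<^bsub>grp E (the (l i))\<^esub>) (t i) = t i"
      using el_ae[OF t(1)]
    proof eventually_elim
      case (elim i)
      have "map_tuple (act E (the (l i)) \<one>\<^bsub>grp E (the (l i))\<^esub>) (t i) = map_tuple (\<lambda>x. x) (t i)"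
        using elim by (rule map_tuple_cong) (rule act.act_one)
      then show ?case by (simp add: map_tuple_id)
    qed
    then have "cl STK l (\<lambda>i. map_tuple (act E (the (l i)) \<one>\<^bsub>grp E (the (l i))\<^esub>) (t i)) = cl STK l t" by (rule cl_cong)
    then show "?a \<one>\<^bsub>G_lev C E l\<^esub> T = T"
      unfolding t(2) G_one(1)[OF l] act_tree_cl[OF l G_one(2)[OF l] t(1), THEN conjunct1] .
  qed
  ultimately show ?thesis by simp
qed

lemma tree_act_Bij: "hidx C l \<Longrightarrow> G \<in> carrier (G_lev C E l) \<Longrightarrow> tree_act C E l G \<in> Bij (cprod C (along STK l))"
  using hom_in_carrier[OF tree_act_hom] by (simp add: BijGroup_def)

text \<open>A tuple with trivial stabiliser detects equality of group elements almost
  everywhere.\<close>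

lemma tree_act_inj:
  assumes l: "hidx C l" shows "inj_on (tree_act C E l) (carrier (G_lev C E l))"
proof (rule inj_onI)
  fix G H assume "G \<in> carrier (G_lev C E l)" "H \<in> carrier (G_lev C E l)" and eq: "tree_act C E l G = tree_act C E l H"
  then obtain g h where g: "el SG l g" "G = cl SG l g" and h: "el SG l h" "H = cl SG l h"
    by (elim G_elim[OF l]) blast
  obtain t where t: "el STK l t" "\<forall>\<^sub>F i in F. \<forall>g\<in>SG (the (l i)). \<forall>h\<in>SG (the (l i)).
       map_tuple (act E (the (l i)) g) (t i) = map_tuple (act E (the (l i)) h) (t i) \<longrightarrow> g = h"
    by (rule trivial_stabiliser_hyper[OF l])
  have "cl STK l (\<lambda>i. map_tuple (act E (the (l i)) (g i)) (t i)) = cl STK l (\<lambda>i. map_tuple (act E (the (l i)) (h i)) (t i))"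
    using tree_act_cl(1)[OF l g(1) t(1)] tree_act_cl(1)[OF l h(1) t(1)] eq g(2) h(2) by simp
  then have "\<forall>\<^sub>F i in F. map_tuple (act E (the (l i)) (g i)) (t i) = map_tuple (act E (the (l i)) (h i)) (t i)"
    by (rule iffD1[OF cl_eq_iff[OF l usd_STK tree_act_cl(2)[OF l g(1) t(1)]]])
  then have "\<forall>\<^sub>F i in F. g i = h i"
    using t(2) el_ae[OF g(1)] el_ae[OF h(1)] by eventually_elim blast
  then show "G = H" unfolding g(2) h(2) by (rule cl_cong)
qed

lemma base_fixed:
  assumes "g \<in> SG n" "c \<in> carrier (base E)" shows "act E n g (lev_base E n c) = lev_base E n c"
proof -
  have "lev_base E n c \<in> bimg n" using assms(2) by blast
  then show ?thesis using assms(1) act.fixed[of n] by blast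
qed

lemma id_ring_hom: "(\<lambda>x. x) \<in> ring_hom R R"
  by (rule ring_hom_memI) auto

lemma tree_act_Aut:
  assumes l: "hidx C l" and G: "G \<in> carrier (G_lev C E l)"
  shows "tree_act C E l G \<in> carrier (HAut_lev C E l)"
proof -
  interpret X: hyper_ext C "lev E" l "base E" "lev_base E" by (rule lev_ext[OF l])
  obtain g where g: "el SG l g" "G = cl SG l g" by (rule G_elim[OF l G])
  show ?thesis unfolding HAut_lev_eq
  proof (rule X.Aut_local[OF tree_act_Bij[OF l G]])
    fix t assume t: "el STK l t"
    show "\<exists>(Q :: nat \<Rightarrow> nat ring) j k.
      (\<forall>\<^sub>F i in F. field (Q i) \<and> j i \<in> ring_hom (Q i) (lev E (the (l i))) \<and> k i \<in> ring_hom (Q i) (lev E (the (l i))) \<and>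
        (\<forall>c\<in>carrier (base E). \<exists>q\<in>carrier (Q i). j i q = lev_base E (the (l i)) c \<and> k i q = lev_base E (the (l i)) c) \<and>
        set (list_decode (t i)) \<subseteq> j i ` carrier (Q i)) \<and>
      (\<forall>q. (\<forall>\<^sub>F i in F. q i \<in> tuples (carrier (Q i))) \<longrightarrow> el STK l (\<lambda>i. map_tuple (j i) (q i)) \<longrightarrow>
        el STK l (\<lambda>i. map_tuple (k i) (q i)) \<and>
        tree_act C E l G (cl STK l (\<lambda>i. map_tuple (j i) (q i))) = cl STK l (\<lambda>i. map_tuple (k i) (q i)))"
    proof (rule exI[of _ "\<lambda>i. lev E (the (l i))"], rule exI[of _ "\<lambda>i x. x"], rule exI[of _ "\<lambda>i. act E (the (l i)) (g i)"], intro conjI allI impI)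
      show "\<forall>\<^sub>F i in F. field (lev E (the (l i))) \<and> (\<lambda>x. x) \<in> ring_hom (lev E (the (l i))) (lev E (the (l i))) \<and>
        act E (the (l i)) (g i) \<in> ring_hom (lev E (the (l i))) (lev E (the (l i))) \<and>
        (\<forall>c\<in>carrier (base E). \<exists>q\<in>SK (the (l i)). q = lev_base E (the (l i)) c \<and> act E (the (l i)) (g i) q = lev_base E (the (l i)) c) \<and>
        set (list_decode (t i)) \<subseteq> (\<lambda>x. x) ` SK (the (l i))"
        using el_ae[OF g(1)] el_ae[OF t]
      proof eventually_elim
        case (elim i)
        then show ?case using lev_base(1) base_fixed[OF elim(1)] act_props(1)[OF elim(1)]
          by (auto simp: id_ring_hom K.field_R tuples_iff)
      qed
    next
      fix q assume "el STK l (\<lambda>i. map_tuple (\<lambda>x. x) (q i))"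
      then have q: "el STK l q" by (simp add: map_tuple_id)
      show "el STK l (\<lambda>i. map_tuple (act E (the (l i)) (g i)) (q i))" by (rule tree_act_cl(2)[OF l g(1) q])
      show "tree_act C E l G (cl STK l (\<lambda>i. map_tuple (\<lambda>x. x) (q i))) = cl STK l (\<lambda>i. map_tuple (act E (the (l i)) (g i)) (q i))"
        unfolding map_tuple_id g(2) by (rule tree_act_cl(1)[OF l g(1) q])
    qed
  qed
qed

lemma Aut_tree_act:
  assumes l: "hidx C l" and \<sigma>: "\<sigma> \<in> carrier (HAut_lev C E l)"
  shows "\<sigma> \<in> tree_act C E l ` carrier (G_lev C E l)"
proof -
  interpret X: hyper_ext C "lev E" l "base E" "lev_base E" by (rule lev_ext[OF l])
  have \<sigma>': "\<sigma> \<in> carrier X.Aut" using \<sigma> by (simp add: HAut_lev_eq)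
  have "\<exists>g. el SG l g \<and> (\<forall>t. el STK l t \<longrightarrow>
    \<sigma> (cl STK l (\<lambda>i. map_tuple (\<lambda>x. x) (t i))) =
    cl STK l (\<lambda>i. map_tuple (\<lambda>x. x) (map_tuple (act E (the (l i)) (g i)) (t i))))"
  proof (rule Aut_acts[where J = "\<lambda>n x. x" and Jt = "\<lambda>n x. x", OF lev_ext[OF l] l \<sigma>'])
    show "\<forall>\<^sub>F i in F. \<forall>a b. set a \<subseteq> SK (the (l i)) \<longrightarrow> set b \<subseteq> SK (the (l i)) \<longrightarrow> length b = length a \<longrightarrow>
      (\<forall>p\<in>polys. \<forall>c. set c \<subseteq> carrier (base E) \<longrightarrow> poly_var p = length a + length c \<longrightarrow>
        poly_eval (lev E (the (l i))) p (map (\<lambda>x. x) a @ map (lev_base E (the (l i))) c) = \<zero>\<^bsub>lev E (the (l i))\<^esub> \<longrightarrow>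
        poly_eval (lev E (the (l i))) p (b @ map (lev_base E (the (l i))) c) = \<zero>\<^bsub>lev E (the (l i))\<^esub>) \<longrightarrow>
      (\<exists>g\<in>SG (the (l i)). b = map (\<lambda>x. x) (map (act E (the (l i)) g) a))"
      by (intro always_eventually allI impI, unfold list.map_ident, rule same_type_conjugate) blast+
  qed (auto simp: map_tuple_id intro: tc_intros)
  then obtain g where g: "el SG l g" "\<And>t. el STK l t \<Longrightarrow> \<sigma> (cl STK l t) = cl STK l (\<lambda>i. map_tuple (act E (the (l i)) (g i)) (t i))"
    unfolding map_tuple_id by blast
  have "\<sigma> = tree_act C E l (cl SG l g)"
  proof (rule extensionalityI[OF Bij_imp_extensional[OF X.Aut_D(1)[OF \<sigma>']] Bij_imp_extensional[OF tree_act_Bij[OF l G_intro[OF l g(1)]]]])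
    fix T assume "T \<in> cprod C (along STK l)"
    then obtain t where t: "el STK l t" "T = cl STK l t" by (rule cprodE)
    show "\<sigma> T = tree_act C E l (cl SG l g) T" unfolding t(2) g(2)[OF t(1)] tree_act_cl(1)[OF l g(1) t(1)] ..
  qed
  then show ?thesis using G_intro[OF l g(1)] by blast
qed

theorem tree_act_iso:
  assumes l: "hidx C l" shows "tree_act C E l \<in> iso (G_lev C E l) (HAut_lev C E l)"
proof -
  have img: "carrier (HAut_lev C E l) = tree_act C E l ` carrier (G_lev C E l)"
    using tree_act_Aut[OF l] Aut_tree_act[OF l] by blast
  have "tree_act C E l \<in> hom (G_lev C E l) (HAut_lev C E l)"
  proof (rule homI)
    show "tree_act C E l x \<in> carrier (HAut_lev C E l)" if "x \<in> carrier (G_lev C E l)" for x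
      using that img by blast
    show "tree_act C E l (x \<otimes>\<^bsub>G_lev C E l\<^esub> y) = tree_act C E l x \<otimes>\<^bsub>HAut_lev C E l\<^esub> tree_act C E l y"
      if "x \<in> carrier (G_lev C E l)" "y \<in> carrier (G_lev C E l)" for x y
      using hom_mult[OF tree_act_hom[OF l] that] by (simp add: HAut_lev_eq HAut_def trees_along)
  qed
  then show ?thesis using tree_act_inj[OF l] img by (simp add: iso_def bij_betw_def)
qed

end

section \<open>Hyper-automorphisms over the top field as an inverse limit\<close>

locale galois_limit = galois_hyper +
  fixes rep :: "hyper \<Rightarrow> pfun"
  assumes rep: "L \<in> hnat C \<Longrightarrow> rep L \<in> L"
begin

abbreviation I where "I \<equiv> hnat C"
abbreviation val where "val L i \<equiv> the (rep L i)"
abbreviation Sup :: "hyper \<Rightarrow> hyper \<Rightarrow> bool" where "Sup L M \<equiv> hless C L M"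
abbreviation TL where "TL L \<equiv> cprod C (along STK (rep L))"
abbreviation TT where "TT \<equiv> cprod C (along STT l0)"
abbreviation te where "te L \<equiv> top_tree_embed C E (rep L)"

lemma rep_cl:
  assumes "L \<in> I" shows "rep L \<in> cl (\<lambda>_. UNIV) l0 (val L)" "L = cl (\<lambda>_. UNIV) l0 (val L)" "el (\<lambda>_. UNIV) l0 (val L)"
proof -
  have "L \<in> cprod C (along (\<lambda>_. UNIV) l0)" using assms unfolding hnat_def along_const .
  then obtain f where f: "el (\<lambda>_. UNIV) l0 f" "L = cl (\<lambda>_. UNIV) l0 f" by (rule cprodE)
  then have r: "rep L \<in> cl (\<lambda>_. UNIV) l0 f" using rep[OF assms] by simp
  then have ae: "\<forall>\<^sub>F i in F. rep L i = Some (f i)" by (simp add: cl_def)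
  then have ae': "\<forall>\<^sub>F i in F. f i = val L i" by eventually_elim simp
  show L: "L = cl (\<lambda>_. UNIV) l0 (val L)" using f(2) cl_cong[OF ae'] by simp
  show "rep L \<in> cl (\<lambda>_. UNIV) l0 (val L)" using rep[OF assms] L by simp
  show "el (\<lambda>_. UNIV) l0 (val L)" by (rule el_cong[OF f(1) ae'])
qed

lemma rep_hidx: assumes "L \<in> I" shows "hidx C (rep L)"
proof -
  have "rep L \<in> cpre C (along (\<lambda>_. UNIV) l0)" using rep_cl(1)[OF assms] by (simp add: cl_def)
  then show ?thesis by (simp add: cpre_along hidx_def)
qed

lemma less_iff:
  assumes "L \<in> I" "M \<in> I" shows "Sup L M \<longleftrightarrow> (\<forall>\<^sub>F i in F. val L i < val M i)"
proof -
  have "crel C (<) (cl (\<lambda>_. UNIV) l0 (val L)) (cl (\<lambda>_. UNIV) l0 (val M)) \<longleftrightarrow> (\<forall>\<^sub>F i in F. val L i < val M i)"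
    by (rule crel_cl[OF hidx_const usd_UNIV rep_cl(3)[OF assms(1)] hidx_const usd_UNIV rep_cl(3)[OF assms(2)]])
  then show ?thesis using rep_cl(2)[OF assms(1)] rep_cl(2)[OF assms(2)] by (simp add: hless_def)
qed

text \<open>Makes levels that were found pointwise by a search into an index of the limit; the
  chosen representative of that index agrees with them almost everywhere.\<close>

lemma index_of:
  assumes "hc C f" obtains L where "L \<in> I" "\<forall>\<^sub>F i in F. val L i = f i"
proof -
  have e: "el (\<lambda>_. UNIV) l0 f" by (rule elI[OF assms]) simp
  let ?L = "cl (\<lambda>_. UNIV) l0 f"
  have L: "?L \<in> I" using cprodI[OF hidx_const usd_UNIV e] unfolding hnat_def along_const .
  have "rep ?L \<in> ?L" by (rule rep[OF L])
  then have "\<forall>\<^sub>F i in F. rep ?L i = Some (f i)" by (simp add: cl_def)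
  then have "\<forall>\<^sub>F i in F. val ?L i = f i" by eventually_elim simp
  then show ?thesis using that L by blast
qed

lemma directed:
  assumes "L \<in> I" "M \<in> I" shows "\<exists>N\<in>I. Sup L N \<and> Sup M N"
proof -
  \<comment> \<open>The successor makes the upper bound strict, as the transition maps
    require.\<close>
  have "tc (\<lambda>z. Suc (pfst z + psnd z))" by (intro tc_intros)
  then have "hc C (\<lambda>i. Suc (val L i + val M i))"
    by (rule hc_comp2[OF _ hidx_val[OF rep_hidx[OF assms(1)]] hidx_val[OF rep_hidx[OF assms(2)]]])
  then obtain N where N: "N \<in> I" "\<forall>\<^sub>F i in F. val N i = Suc (val L i + val M i)" by (rule index_of)
  have "\<forall>\<^sub>F i in F. val L i < val N i" "\<forall>\<^sub>F i in F. val M i < val N i"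
    using N(2) by (auto elim: eventually_mono)
  then show ?thesis using N(1) less_iff[OF assms(1) N(1)] less_iff[OF assms(2) N(1)] by blast
qed

lemma te_cl:
  assumes "L \<in> I" "el STK (rep L) t"
  shows "te L (cl STK (rep L) t) = cl STT l0 (\<lambda>i. map_tuple (lev_emb E (val L i)) (t i))"
    "el STT l0 (\<lambda>i. map_tuple (lev_emb E (val L i)) (t i))"
  by (rule emb_tree_cl[OF rep_hidx[OF assms(1)] assms(2), THEN conjunct1], rule emb_tree_cl[OF rep_hidx[OF assms(1)] assms(2), THEN conjunct2])

lemma te_closed: assumes "L \<in> I" "T \<in> TL L" shows "te L T \<in> TT"
proof -
  obtain t where t: "el STK (rep L) t" "T = cl STK (rep L) t" by (rule cprodE[OF assms(2)])
  show ?thesis unfolding t(2) te_cl(1)[OF assms(1) t(1)] by (rule cprodI[OF hidx_const usd_STT te_cl(2)[OF assms(1) t(1)]])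
qed

lemma te_inj: assumes "L \<in> I" shows "inj_on (te L) (TL L)"
proof (rule inj_onI)
  fix T T' assume "T \<in> TL L" "T' \<in> TL L" and eq: "te L T = te L T'"
  then obtain t t' where t: "el STK (rep L) t" "T = cl STK (rep L) t" and t': "el STK (rep L) t'" "T' = cl STK (rep L) t'"
    by (elim cprodE) blast
  have "\<forall>\<^sub>F i in F. map_tuple (lev_emb E (val L i)) (t i) = map_tuple (lev_emb E (val L i)) (t' i)"
    using eq unfolding t(2) t'(2) te_cl(1)[OF assms t(1)] te_cl(1)[OF assms t'(1)]
    by (rule iffD1[OF cl_eq_iff[OF hidx_const usd_STT te_cl(2)[OF assms t(1)]]])
  then have "\<forall>\<^sub>F i in F. t i = t' i"
    using el_ae[OF t(1)] el_ae[OF t'(1)] by eventually_elim (simp only: map_tuple_eq_iff[OF lev_emb_inj])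
  then show "T = T'" unfolding t(2) t'(2) by (rule cl_cong)
qed

text \<open>Entries in the image of the level have preimages pointwise; these are found by search so
  that together they form an element of the product.\<close>

lemma te_preimage:
  assumes L: "L \<in> I" and t: "el STT l0 t" and img: "\<forall>\<^sub>F i in F. set (list_decode (t i)) \<subseteq> lev_emb E (val L i) ` SK (val L i)"
  obtains s where "el STK (rep L) s" "\<forall>\<^sub>F i in F. t i = map_tuple (lev_emb E (val L i)) (s i)"
proof -
  define P where "P z s \<longleftrightarrow> s \<in> STK (pfst z) \<and> psnd z = map_tuple (lembt (pfst z)) s" for z s
  have dec: "decidable (\<lambda>w. P (pfst w) (psnd w))" unfolding P_def by (intro tc_intros usd_decidable[OF usd_STK])
  have P: "P (ppair n u) s \<longleftrightarrow> s \<in> STK n \<and> u = map_tuple (lev_emb E n) s" for n u s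
  proof -
    have "map_tuple (lev_emb E n) s = map_tuple (lembt n) s" if "s \<in> STK n"
      using that by (rule map_tuple_cong) (simp add: lembt_def)
    then show ?thesis by (auto simp: P_def)
  qed
  have "\<forall>\<^sub>F i in F. \<exists>s. P (ppair (val L i) (t i)) s"
    using img
  proof eventually_elim
    case (elim i)
    obtain xs where xs: "set xs \<subseteq> SK (val L i)" "list_decode (t i) = map (lev_emb E (val L i)) xs" by (rule map_preimage[OF elim])
    have "t i = list_encode (list_decode (t i))" by simp
    also have "\<dots> = map_tuple (lev_emb E (val L i)) (list_encode xs)" unfolding xs(2) by (simp add: map_tuple_def)
    finally show ?case unfolding P using xs(1) by (intro exI[of _ "list_encode xs"]) (simp add: tuples_iff)
  qed
  from hc_search[OF dec hc_pair[OF hidx_val[OF rep_hidx[OF L]] el_hc[OF t]] this]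
  obtain s where s: "hc C s" "\<forall>\<^sub>F i in F. P (ppair (val L i) (t i)) (s i)" by blast
  show ?thesis
  proof (rule that)
    show "el STK (rep L) s" by (rule elI[OF s(1)], rule eventually_mono[OF s(2)]) (simp add: P)
    show "\<forall>\<^sub>F i in F. t i = map_tuple (lev_emb E (val L i)) (s i)" by (rule eventually_mono[OF s(2)]) (simp add: P)
  qed
qed

lemma te_image_mono:
  assumes LM: "L \<in> I" "M \<in> I" "Sup L M" and t: "el STK (rep L) t"
  obtains s where "el STK (rep M) s" "te M (cl STK (rep M) s) = te L (cl STK (rep L) t)"
    "\<forall>\<^sub>F i in F. map_tuple (lev_emb E (val M i)) (s i) = map_tuple (lev_emb E (val L i)) (t i)"
proof -
  have less: "\<forall>\<^sub>F i in F. val L i < val M i" using less_iff[OF LM(1,2)] LM(3) by blast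
  have "\<forall>\<^sub>F i in F. set (list_decode (map_tuple (lev_emb E (val L i)) (t i))) \<subseteq> lev_emb E (val M i) ` SK (val M i)"
    using less el_ae[OF t]
  proof eventually_elim
    case (elim i)
    have "set (list_decode (map_tuple (lev_emb E (val L i)) (t i))) \<subseteq> lev_emb E (val L i) ` SK (val L i)"
      using elim(2) by (auto simp: tuples_iff)
    then show ?case using lev_image_mono[of "val L i" "val M i"] elim(1) by (meson less_imp_le order_trans)
  qed
  from te_preimage[OF LM(2) te_cl(2)[OF LM(1) t] this] obtain s where s: "el STK (rep M) s"
    "\<forall>\<^sub>F i in F. map_tuple (lev_emb E (val L i)) (t i) = map_tuple (lev_emb E (val M i)) (s i)" by blast
  have s': "\<forall>\<^sub>F i in F. map_tuple (lev_emb E (val M i)) (s i) = map_tuple (lev_emb E (val L i)) (t i)"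
    using s(2) by eventually_elim simp
  show ?thesis using that[OF s(1) _ s'] unfolding te_cl(1)[OF LM(2) s(1)] te_cl(1)[OF LM(1) t] using cl_cong[OF s'] by blast
qed

text \<open>A search finds, index by index, a level together with a preimage of the tuple in that
  level. The levels so found form the index \<open>L\<close>; it may be nonstandard, and the limit
  ranges over such indices as well.\<close>

lemma te_cover:
  assumes t: "el STT l0 t"
  obtains L s where "L \<in> I" "el STK (rep L) s" "\<forall>\<^sub>F i in F. t i = map_tuple (lev_emb E (val L i)) (s i)"
proof -
  define P where "P z k \<longleftrightarrow> psnd k \<in> STK (pfst k) \<and> z = map_tuple (lembt (pfst k)) (psnd k)" for z k
  have dec: "decidable (\<lambda>w. P (pfst w) (psnd w))" unfolding P_def by (intro tc_intros usd_decidable[OF usd_STK])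
  have lem: "\<exists>m. set b \<subseteq> lev_emb E m ` SK m" if "set b \<subseteq> carrier (top_field E)" for b
    using that
  proof (induction b)
    case (Cons x b)
    then obtain m where m: "set b \<subseteq> lev_emb E m ` SK m" by auto
    obtain k where k: "x \<in> lev_emb E k ` SK k" using Cons.prems top_union by auto
    have "x \<in> lev_emb E (max m k) ` SK (max m k)" "lev_emb E m ` SK m \<subseteq> lev_emb E (max m k) ` SK (max m k)"
      using k lev_image_mono[of k "max m k"] lev_image_mono[of m "max m k"] by auto
    then show ?case using m by (intro exI[of _ "max m k"]) auto
  qed auto
  have "\<forall>\<^sub>F i in F. \<exists>k. P (t i) k"
    using el_ae[OF t]
  proof eventually_elim
    case (elim i)
    obtain m where m: "set (list_decode (t i)) \<subseteq> lev_emb E m ` SK m" using lem[OF elim[unfolded tuples_iff]] by blast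
    obtain xs where xs: "set xs \<subseteq> SK m" "list_decode (t i) = map (lev_emb E m) xs" by (rule map_preimage[OF m])
    have in_tuples: "list_encode xs \<in> STK m" using xs(1) by (simp add: tuples_iff)
    have "t i = list_encode (list_decode (t i))" by simp
    also have "\<dots> = map_tuple (lev_emb E m) (list_encode xs)" unfolding xs(2) by (simp add: map_tuple_def)
    also have "\<dots> = map_tuple (lembt m) (list_encode xs)"
      using in_tuples by (rule map_tuple_cong) (simp add: lembt_def)
    finally show ?case using in_tuples by (intro exI[of _ "ppair m (list_encode xs)"]) (simp add: P_def)
  qed
  from hc_search[OF dec el_hc[OF t] this] obtain k where k: "hc C k" "\<forall>\<^sub>F i in F. P (t i) (k i)" by blast
  have "hc C (\<lambda>i. pfst (k i))" by (rule hc_comp[OF _ k(1)]) (intro tc_intros)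
  then obtain L where L: "L \<in> I" "\<forall>\<^sub>F i in F. val L i = pfst (k i)" by (rule index_of)
  have "\<forall>\<^sub>F i in F. set (list_decode (t i)) \<subseteq> lev_emb E (val L i) ` SK (val L i)"
    using k(2) L(2)
  proof eventually_elim
    case (elim i)
    have t: "t i = map_tuple (lembt (val L i)) (psnd (k i))" and s: "set (list_decode (psnd (k i))) \<subseteq> SK (val L i)"
      using elim by (simp_all add: P_def tuples_iff)
    show ?case unfolding t using s by (auto simp: lembt_def)
  qed
  from te_preimage[OF L(1) t this] show ?thesis using that[OF L(1)] by blast
qed

lemma te_cover': assumes "T \<in> TT" shows "\<exists>L\<in>I. \<exists>S\<in>TL L. T = te L S"
proof -
  obtain t where t: "el STT l0 t" "T = cl STT l0 t" by (rule cprodE[OF assms])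
  obtain L s where L: "L \<in> I" "el STK (rep L) s" "\<forall>\<^sub>F i in F. t i = map_tuple (lev_emb E (val L i)) (s i)"
    by (rule te_cover[OF t(1)])
  have "T = te L (cl STK (rep L) s)" unfolding t(2) te_cl(1)[OF L(1,2)] by (rule cl_cong[OF L(3)])
  then show ?thesis using L(1) cprodI[OF rep_hidx[OF L(1)] usd_STK L(2)] by blast
qed

text \<open>A relational form of the restriction of \<open>\<sigma>\<close> to level
  \<open>L\<close>. It avoids the inverse maps in the definition of \<open>HAut_to_lim\<close>,
  which are evaluated once, in \<open>HAut_to_lim_acts\<close>.\<close>

definition acts :: "(hyper \<Rightarrow> hyper) \<Rightarrow> hyper \<Rightarrow> hyper \<Rightarrow> bool" where
  "acts \<sigma> L G \<longleftrightarrow> G \<in> carrier (G_lev C E (rep L)) \<and> (\<forall>T\<in>TL L. \<sigma> (te L T) = te L (tree_act C E (rep L) G T))"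

lemma tree_act_TL: "L \<in> I \<Longrightarrow> G \<in> carrier (G_lev C E (rep L)) \<Longrightarrow> T \<in> TL L \<Longrightarrow> tree_act C E (rep L) G T \<in> TL L"
  using Bij_imp_funcset[OF tree_act_Bij[OF rep_hidx]] by blast

lemma acts_unique:
  assumes L: "L \<in> I" and G: "acts \<sigma> L G" and H: "acts \<sigma> L H" shows "G = H"
proof -
  have cG: "G \<in> carrier (G_lev C E (rep L))" and cH: "H \<in> carrier (G_lev C E (rep L))" using G H by (auto simp: acts_def)
  have "tree_act C E (rep L) G = tree_act C E (rep L) H"
  proof (rule extensionalityI[OF Bij_imp_extensional[OF tree_act_Bij[OF rep_hidx[OF L] cG]] Bij_imp_extensional[OF tree_act_Bij[OF rep_hidx[OF L] cH]]])
    fix T assume T: "T \<in> TL L"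
    have "te L (tree_act C E (rep L) G T) = te L (tree_act C E (rep L) H T)" using G H T by (simp add: acts_def)
    then show "tree_act C E (rep L) G T = tree_act C E (rep L) H T"
      by (rule inj_onD[OF te_inj[OF L] _ tree_act_TL[OF L cG T] tree_act_TL[OF L cH T]])
  qed
  then show ?thesis by (rule inj_onD[OF tree_act_inj[OF rep_hidx[OF L]] _ cG cH])
qed

lemma acts_exists:
  assumes L: "L \<in> I" and \<sigma>: "\<sigma> \<in> carrier (HAut_top C E)" shows "\<exists>G. acts \<sigma> L G"
proof -
  let ?l = "rep L"
  note l = rep_hidx[OF L]
  have \<sigma>': "\<sigma> \<in> carrier top.Aut" using \<sigma> by (simp only: HAut_top_eq)
  have "\<exists>g. el SG ?l g \<and> (\<forall>t. el STK ?l t \<longrightarrow>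
    \<sigma> (cl STT l0 (\<lambda>i. map_tuple (lev_emb E (val L i)) (t i))) =
    cl STT l0 (\<lambda>i. map_tuple (lev_emb E (val L i)) (map_tuple (act E (val L i) (g i)) (t i))))"
  proof (rule Aut_acts[where Jt = lembt, OF top_ext l \<sigma>'])
    show "\<forall>\<^sub>F i in F. \<forall>a b. set a \<subseteq> SK (val L i) \<longrightarrow> set b \<subseteq> carrier (top_field E) \<longrightarrow> length b = length a \<longrightarrow>
      (\<forall>p\<in>polys. \<forall>c. set c \<subseteq> carrier (base E) \<longrightarrow> poly_var p = length a + length c \<longrightarrow>
        poly_eval (top_field E) p (map (lev_emb E (val L i)) a @ map (emb E) c) = \<zero>\<^bsub>top_field E\<^esub> \<longrightarrow>
        poly_eval (top_field E) p (b @ map (emb E) c) = \<zero>\<^bsub>top_field E\<^esub>) \<longrightarrow>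
      (\<exists>g\<in>SG (val L i). b = map (lev_emb E (val L i)) (map (act E (val L i) g) a))"
      by (intro always_eventually allI impI, rule same_type_conjugate_top) blast+
    show "tc (\<lambda>z. lembt (pfst z) (psnd z))" by (intro tc_intros)
    show "lev_emb E n x = lembt n x" if "x \<in> SK n" for n x using that by (simp add: lembt_def)
    show "inj_on (lev_emb E n) (SK n)" for n by (rule lev_emb_inj)
    show "el STT l0 (\<lambda>i. map_tuple (lev_emb E (val L i)) (t i))" if "el STK ?l t" for t by (rule te_cl(2)[OF L that])
  qed
  then obtain g where g: "el SG ?l g" "\<And>t. el STK ?l t \<Longrightarrow>
    \<sigma> (cl STT l0 (\<lambda>i. map_tuple (lev_emb E (val L i)) (t i))) =
    cl STT l0 (\<lambda>i. map_tuple (lev_emb E (val L i)) (map_tuple (act E (val L i) (g i)) (t i)))" by blast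
  have "\<sigma> (te L T) = te L (tree_act C E ?l (cl SG ?l g) T)" if T: "T \<in> TL L" for T
  proof -
    obtain t where t: "el STK ?l t" "T = cl STK ?l t" by (rule cprodE[OF T])
    show ?thesis unfolding t(2) te_cl(1)[OF L t(1)] tree_act_cl(1)[OF l g(1) t(1)] te_cl(1)[OF L tree_act_cl(2)[OF l g(1) t(1)]]
      by (rule g(2)[OF t(1)])
  qed
  then show ?thesis using G_intro[OF l g(1)] by (auto simp: acts_def)
qed

text \<open>Pointwise this is \<open>quot_emb\<close>; injectivity of the embedding of the upper
  level identifies the entries of \<open>T'\<close> with the included entries of
  \<open>T\<close>.\<close>

lemma acts_compat:
  assumes LM: "L \<in> I" "M \<in> I" "Sup L M" and G: "G \<in> carrier (G_lev C E (rep M))"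
    and T: "T \<in> TL L" and T': "T' \<in> TL M" and eq: "te M T' = te L T"
  shows "te M (tree_act C E (rep M) G T') = te L (tree_act C E (rep L) (G_trans C E (rep M) (rep L) G) T)"
proof -
  note l = rep_hidx[OF LM(1)] and m = rep_hidx[OF LM(2)]
  have less: "\<forall>\<^sub>F i in F. val L i < val M i" using less_iff[OF LM(1,2)] LM(3) by blast
  obtain g where g: "el SG (rep M) g" "G = cl SG (rep M) g" by (rule G_elim[OF m G])
  obtain t where t: "el STK (rep L) t" "T = cl STK (rep L) t" by (rule cprodE[OF T])
  obtain s where s: "el STK (rep M) s" "T' = cl STK (rep M) s" by (rule cprodE[OF T'])
  note q = quot_cl[OF m l less g(1)]
  have "\<forall>\<^sub>F i in F. map_tuple (lev_emb E (val M i)) (s i) = map_tuple (lev_emb E (val L i)) (t i)"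
    using eq unfolding t(2) s(2) te_cl(1)[OF LM(1) t(1)] te_cl(1)[OF LM(2) s(1)]
    by (rule iffD1[OF cl_eq_iff[OF hidx_const usd_STT te_cl(2)[OF LM(2) s(1)]]])
  then have "\<forall>\<^sub>F i in F. map_tuple (lev_emb E (val M i)) (map_tuple (act E (val M i) (g i)) (s i)) =
      map_tuple (lev_emb E (val L i)) (map_tuple (act E (val L i) (quot E (val M i) (val L i) (g i))) (t i))"
    using less el_ae[OF g(1)] el_ae[OF t(1)] el_ae[OF s(1)]
  proof eventually_elim
    case (elim i)
    have cl: "map_tuple (lev_incl E (val M i) (val L i)) (t i) \<in> STK (val M i)"
      using elim(4) by (rule map_tuple_closed) (rule lev_incl(1), use elim(2) in simp_all)
    have "map_tuple (lev_emb E (val M i)) (map_tuple (lev_incl E (val M i) (val L i)) (t i)) = map_tuple (lev_emb E (val L i)) (t i)"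
      unfolding map_tuple_comp using elim(4) by (rule map_tuple_cong) (rule lev_incl(2), use elim(2) in simp_all)
    then have s: "s i = map_tuple (lev_incl E (val M i) (val L i)) (t i)"
      using map_tuple_eq_iff[OF lev_emb_inj elim(5) cl] elim(1) by simp
    show ?case unfolding s map_tuple_comp using elim(4) by (rule map_tuple_cong) (rule quot_emb[OF elim(2,3)])
  qed
  then show ?thesis
    unfolding g(2) t(2) s(2) q[THEN conjunct1] tree_act_cl(1)[OF m g(1) s(1)] tree_act_cl(1)[OF l q[THEN conjunct2] t(1)]
      te_cl(1)[OF LM(2) tree_act_cl(2)[OF m g(1) s(1)]] te_cl(1)[OF LM(1) tree_act_cl(2)[OF l q[THEN conjunct2] t(1)]]
    by (rule cl_cong)
qed

lemma te_mono': assumes "L \<in> I" "M \<in> I" "Sup L M" "T \<in> TL L" shows "\<exists>S\<in>TL M. te M S = te L T"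
proof -
  obtain t where t: "el STK (rep L) t" "T = cl STK (rep L) t" by (rule cprodE[OF assms(4)])
  obtain s where "el STK (rep M) s" "te M (cl STK (rep M) s) = te L (cl STK (rep L) t)"
    by (rule te_image_mono[OF assms(1-3) t(1)])
  then show ?thesis unfolding t(2) using cprodI[OF rep_hidx[OF assms(2)] usd_STK] by blast
qed

lemma acts_trans:
  assumes LM: "L \<in> I" "M \<in> I" "Sup L M" and G: "acts \<sigma> M G"
  shows "acts \<sigma> L (G_trans C E (rep M) (rep L) G)"
proof -
  have less: "\<forall>\<^sub>F i in F. val L i < val M i" using less_iff[OF LM(1,2)] LM(3) by blast
  have cG: "G \<in> carrier (G_lev C E (rep M))" using G by (simp add: acts_def)
  have "\<sigma> (te L T) = te L (tree_act C E (rep L) (G_trans C E (rep M) (rep L) G) T)" if T: "T \<in> TL L" for T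
  proof -
    obtain S where S: "S \<in> TL M" "te M S = te L T" using te_mono'[OF LM T] by blast
    have "\<sigma> (te L T) = te M (tree_act C E (rep M) G S)" using G S by (simp add: acts_def flip: S(2))
    then show ?thesis using acts_compat[OF LM cG T S] by simp
  qed
  then show ?thesis
    using hom_in_carrier[OF G_trans_hom[OF rep_hidx[OF LM(2)] rep_hidx[OF LM(1)] less] cG] by (simp add: acts_def)
qed

lemma HAut_to_lim_acts:
  assumes L: "L \<in> I" and G: "acts \<sigma> L G" shows "HAut_to_lim C E rep \<sigma> L = G"
proof -
  have cG: "G \<in> carrier (G_lev C E (rep L))" using G by (simp add: acts_def)
  have "restr_along (te L) (TL L) \<sigma> = tree_act C E (rep L) G"
  proof (rule extensionalityI[of _ "TL L"])
    fix T assume T: "T \<in> TL L"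
    show "restr_along (te L) (TL L) \<sigma> T = tree_act C E (rep L) G T"
      using T G the_inv_into_f_f[OF te_inj[OF L] tree_act_TL[OF L cG T]] by (simp add: restr_along_def acts_def)
  qed (simp_all add: restr_along_def Bij_imp_extensional[OF tree_act_Bij[OF rep_hidx[OF L] cG]])
  then show ?thesis using L the_inv_into_f_f[OF tree_act_inj[OF rep_hidx[OF L]] cG]
    by (simp add: HAut_to_lim_def trees_along)
qed

lemma acts_Aut:
  assumes \<sigma>: "\<sigma> \<in> Bij TT" and x: "\<And>L. L \<in> I \<Longrightarrow> acts \<sigma> L (x L)"
  shows "\<sigma> \<in> carrier (HAut_top C E)"
  unfolding HAut_top_eq
proof (rule top.Aut_local[OF \<sigma>])
  fix t assume t: "el STT l0 t"
  obtain L s where L: "L \<in> I" "el STK (rep L) s" "\<forall>\<^sub>F i in F. t i = map_tuple (lev_emb E (val L i)) (s i)"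
    by (rule te_cover[OF t])
  note l = rep_hidx[OF L(1)]
  have "x L \<in> carrier (G_lev C E (rep L))" using x[OF L(1)] by (simp add: acts_def)
  then obtain g where g: "el SG (rep L) g" "x L = cl SG (rep L) g" by (rule G_elim[OF l])
  let ?k = "\<lambda>i y. lev_emb E (val L i) (act E (val L i) (g i) y)"
  show "\<exists>(Q :: nat \<Rightarrow> nat ring) j k.
      (\<forall>\<^sub>F i in F. field (Q i) \<and> j i \<in> ring_hom (Q i) (top_field E) \<and> k i \<in> ring_hom (Q i) (top_field E) \<and>
        (\<forall>c\<in>carrier (base E). \<exists>q\<in>carrier (Q i). j i q = emb E c \<and> k i q = emb E c) \<and>
        set (list_decode (t i)) \<subseteq> j i ` carrier (Q i)) \<and>
      (\<forall>q. (\<forall>\<^sub>F i in F. q i \<in> tuples (carrier (Q i))) \<longrightarrow> el STT l0 (\<lambda>i. map_tuple (j i) (q i)) \<longrightarrow>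
        el STT l0 (\<lambda>i. map_tuple (k i) (q i)) \<and>
        \<sigma> (cl STT l0 (\<lambda>i. map_tuple (j i) (q i))) = cl STT l0 (\<lambda>i. map_tuple (k i) (q i)))"
  proof (rule exI[of _ "\<lambda>i. lev E (val L i)"], rule exI[of _ "\<lambda>i. lev_emb E (val L i)"], rule exI[of _ ?k], intro conjI allI impI)
    show "\<forall>\<^sub>F i in F. field (lev E (val L i)) \<and> lev_emb E (val L i) \<in> ring_hom (lev E (val L i)) (top_field E) \<and>
        ?k i \<in> ring_hom (lev E (val L i)) (top_field E) \<and>
        (\<forall>c\<in>carrier (base E). \<exists>q\<in>SK (val L i). lev_emb E (val L i) q = emb E c \<and> ?k i q = emb E c) \<and>
        set (list_decode (t i)) \<subseteq> lev_emb E (val L i) ` SK (val L i)"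
      using el_ae[OF g(1)] el_ae[OF L(2)] L(3)
    proof eventually_elim
      case (elim i)
      have "?k i \<in> ring_hom (lev E (val L i)) (top_field E)"
        using ring_hom_trans[OF act_props(1)[OF elim(1)] lev_emb_hom] by (simp add: comp_def)
      moreover have "\<exists>q\<in>SK (val L i). lev_emb E (val L i) q = emb E c \<and> ?k i q = emb E c" if c: "c \<in> carrier (base E)" for c
        using lev_base[OF c, of "val L i"] base_fixed[OF elim(1) c] by (intro bexI[of _ "lev_base E (val L i) c"]) simp_all
      moreover have "set (list_decode (t i)) \<subseteq> lev_emb E (val L i) ` SK (val L i)"
        unfolding elim(3) using elim(2) by (auto simp: tuples_iff)
      ultimately show ?case using lev_emb_hom K.field_R by blast
    qed
  next
    fix q assume q: "\<forall>\<^sub>F i in F. q i \<in> tuples (carrier (lev E (val L i)))" "el STT l0 (\<lambda>i. map_tuple (lev_emb E (val L i)) (q i))"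
    have "\<forall>\<^sub>F i in F. set (list_decode (map_tuple (lev_emb E (val L i)) (q i))) \<subseteq> lev_emb E (val L i) ` SK (val L i)"
      using q(1) by eventually_elim (auto simp: tuples_iff)
    \<comment> \<open>Only the image of \<open>q\<close> is known to be an element of the tree.
      Comparison with the computable preimage \<open>s\<close> shows that \<open>q\<close> itself is
      an element.\<close>
    from te_preimage[OF L(1) q(2) this] obtain s where s: "el STK (rep L) s"
      "\<forall>\<^sub>F i in F. map_tuple (lev_emb E (val L i)) (q i) = map_tuple (lev_emb E (val L i)) (s i)" by blast
    have "\<forall>\<^sub>F i in F. s i = q i"
      using s(2) q(1) el_ae[OF s(1)] by eventually_elim (metis map_tuple_eq_iff[OF lev_emb_inj])
    then have q': "el STK (rep L) q" by (rule el_cong[OF s(1)])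
    note a = tree_act_cl[OF l g(1) q']
    show "el STT l0 (\<lambda>i. map_tuple (?k i) (q i))" using te_cl(2)[OF L(1) a(2)] by (simp add: map_tuple_comp)
    have "\<sigma> (te L (cl STK (rep L) q)) = te L (tree_act C E (rep L) (x L) (cl STK (rep L) q))"
      using x[OF L(1)] cprodI[OF l usd_STK q'] by (simp add: acts_def)
    then show "\<sigma> (cl STT l0 (\<lambda>i. map_tuple (lev_emb E (val L i)) (q i))) = cl STT l0 (\<lambda>i. map_tuple (?k i) (q i))"
      unfolding te_cl(1)[OF L(1) q'] g(2) a(1) te_cl(1)[OF L(1) a(2)] map_tuple_comp .
  qed
qed

lemma lim_G_group: "group (lim_G C E rep)"
  unfolding lim_G_def
proof (rule inverse_limit_group)
  show "group (G_lev C E (rep L))" if "L \<in> I" for L by (rule G_group[OF rep_hidx[OF that]])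
  show "G_trans C E (rep M) (rep L) \<in> hom (G_lev C E (rep M)) (G_lev C E (rep L))"
    if "M \<in> I" "L \<in> I" "Sup L M" for L M
    using that less_iff[of L M] by (intro G_trans_hom rep_hidx) blast+
qed

lemma lim_G_D:
  assumes "x \<in> carrier (lim_G C E rep)"
  shows "L \<in> I \<Longrightarrow> x L \<in> carrier (G_lev C E (rep L))"
    "L \<in> I \<Longrightarrow> M \<in> I \<Longrightarrow> Sup L M \<Longrightarrow> G_trans C E (rep M) (rep L) (x M) = x L"
    "x \<in> extensional I"
proof -
  have x: "x \<in> (\<Pi>\<^sub>E L\<in>I. carrier (G_lev C E (rep L)))"
    "\<forall>M\<in>I. \<forall>L\<in>I. Sup L M \<longrightarrow> G_trans C E (rep M) (rep L) (x M) = x L"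
    using assms by (simp_all add: lim_G_def inverse_limit_def)
  show "L \<in> I \<Longrightarrow> x L \<in> carrier (G_lev C E (rep L))" using x(1) by (rule PiE_mem)
  show "L \<in> I \<Longrightarrow> M \<in> I \<Longrightarrow> Sup L M \<Longrightarrow> G_trans C E (rep M) (rep L) (x M) = x L" using x(2) by blast
  show "x \<in> extensional I" using x(1) by (simp add: PiE_def)
qed

lemma realise:
  assumes x: "x \<in> carrier (lim_G C E rep)"
  shows "\<exists>\<sigma>\<in>Bij TT. \<forall>L\<in>I. acts \<sigma> L (x L)"
proof -
  note bij = tree_act_Bij[OF rep_hidx lim_G_D(1)[OF x], unfolded Bij_def, THEN IntD2, simplified]
  have compat: "te M (tree_act C E (rep M) (x M) y) = te L (tree_act C E (rep L) (x L) z)"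
    if "L \<in> I" "M \<in> I" "Sup L M" "z \<in> TL L" "y \<in> TL M" "te M y = te L z" for L M y z
    using acts_compat[OF that(1-3) lim_G_D(1)[OF x that(2)] that(4-6)] unfolding lim_G_D(2)[OF x that(1-3)] .
  obtain \<sigma> where \<sigma>: "\<sigma> \<in> Bij TT" "\<And>L T. L \<in> I \<Longrightarrow> T \<in> TL L \<Longrightarrow> \<sigma> (te L T) = te L (tree_act C E (rep L) (x L) T)"
    by (rule direct_limit_bij[where S = TT and I = I and SL = TL and e = te and lt = Sup and \<tau> = "\<lambda>L. tree_act C E (rep L) (x L)",
      OF te_cover' te_closed te_inj directed te_mono' bij compat]; (assumption | (rule that, assumption, blast)))
  then show ?thesis unfolding acts_def using lim_G_D(1)[OF x] by blast
qed

lemma acts_determine: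
  assumes "\<sigma> \<in> Bij TT" "\<tau> \<in> Bij TT" "\<And>L. L \<in> I \<Longrightarrow> acts \<sigma> L (x L)" "\<And>L. L \<in> I \<Longrightarrow> acts \<tau> L (x L)"
  shows "\<sigma> = \<tau>"
proof (rule extensionalityI[OF Bij_imp_extensional[OF assms(1)] Bij_imp_extensional[OF assms(2)]])
  fix T assume "T \<in> TT"
  then obtain L S where "L \<in> I" "S \<in> TL L" "T = te L S" using te_cover' by blast
  then show "\<sigma> T = \<tau> T" using assms(3)[of L] assms(4)[of L] by (simp add: acts_def)
qed

definition realisation :: "(hyper \<Rightarrow> hyper) \<Rightarrow> hyper \<Rightarrow> hyper" where
  "realisation x = (SOME \<sigma>. \<sigma> \<in> Bij TT \<and> (\<forall>L\<in>I. acts \<sigma> L (x L)))"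

lemma realisation:
  assumes "x \<in> carrier (lim_G C E rep)" shows "realisation x \<in> Bij TT" "L \<in> I \<Longrightarrow> acts (realisation x) L (x L)"
proof -
  have "\<exists>\<sigma>. \<sigma> \<in> Bij TT \<and> (\<forall>L\<in>I. acts \<sigma> L (x L))" using realise[OF assms] by blast
  from someI_ex[OF this] show "realisation x \<in> Bij TT" "L \<in> I \<Longrightarrow> acts (realisation x) L (x L)"
    unfolding realisation_def by blast+
qed

lemma Aut_Bij: "\<sigma> \<in> carrier (HAut_top C E) \<Longrightarrow> \<sigma> \<in> Bij TT"
  unfolding HAut_top_eq by (rule top.Aut_D(1))

lemma HAut_to_lim_carrier:
  assumes \<sigma>: "\<sigma> \<in> carrier (HAut_top C E)"
  shows "HAut_to_lim C E rep \<sigma> \<in> carrier (lim_G C E rep)" "L \<in> I \<Longrightarrow> acts \<sigma> L (HAut_to_lim C E rep \<sigma> L)"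
proof -
  have ac: "acts \<sigma> L (HAut_to_lim C E rep \<sigma> L)" if "L \<in> I" for L
    using acts_exists[OF that \<sigma>] HAut_to_lim_acts[OF that] by metis
  show "L \<in> I \<Longrightarrow> acts \<sigma> L (HAut_to_lim C E rep \<sigma> L)" by (rule ac)
  have "HAut_to_lim C E rep \<sigma> \<in> (\<Pi>\<^sub>E L\<in>I. carrier (G_lev C E (rep L)))"
    using ac by (auto simp: acts_def HAut_to_lim_def)
  moreover have "G_trans C E (rep M) (rep L) (HAut_to_lim C E rep \<sigma> M) = HAut_to_lim C E rep \<sigma> L"
    if "M \<in> I" "L \<in> I" "Sup L M" for L M
    by (rule acts_unique[OF that(2) acts_trans[OF that(2,1,3) ac[OF that(1)]] ac[OF that(2)]])
  ultimately show "HAut_to_lim C E rep \<sigma> \<in> carrier (lim_G C E rep)" by (simp add: lim_G_def inverse_limit_def)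
qed

lemma compose_acts:
  assumes L: "L \<in> I" and \<sigma>: "acts \<sigma> L G" and \<tau>: "acts \<tau> L H"
  shows "acts (compose TT \<sigma> \<tau>) L (G \<otimes>\<^bsub>G_lev C E (rep L)\<^esub> H)"
proof -
  have c: "G \<in> carrier (G_lev C E (rep L))" "H \<in> carrier (G_lev C E (rep L))" using \<sigma> \<tau> by (auto simp: acts_def)
  have "tree_act C E (rep L) (G \<otimes>\<^bsub>G_lev C E (rep L)\<^esub> H) T = tree_act C E (rep L) G (tree_act C E (rep L) H T)"
    if T: "T \<in> TL L" for T
    using hom_mult[OF tree_act_hom[OF rep_hidx[OF L]] c] tree_act_Bij[OF rep_hidx[OF L]] c T
    by (simp add: BijGroup_def compose_def)
  then show ?thesis
    using \<sigma> \<tau> c tree_act_TL[OF L c(2)] te_closed[OF L] monoid.m_closed[OF group.is_monoid[OF G_group[OF rep_hidx[OF L]]] c]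
    by (simp add: acts_def compose_def)
qed

lemma HAut_to_lim_realisation:
  assumes x: "x \<in> carrier (lim_G C E rep)" shows "HAut_to_lim C E rep (realisation x) = x"
proof (rule extensionalityI[of _ I])
  show "HAut_to_lim C E rep (realisation x) \<in> extensional I" by (simp add: HAut_to_lim_def)
  show "x \<in> extensional I" by (rule lim_G_D(3)[OF x])
  show "HAut_to_lim C E rep (realisation x) L = x L" if "L \<in> I" for L by (rule HAut_to_lim_acts[OF that realisation(2)[OF x that]])
qed

text \<open>The limit isomorphism is proved in the direction from threads to automorphisms: the
  composite realises the product of two threads, and a bijection of the tree is determined by its
  action on the levels.\<close>

theorem realisation_iso: "realisation \<in> iso (lim_G C E rep) (HAut_top C E)"
proof -
  have closed: "realisation x \<in> carrier (HAut_top C E)" if "x \<in> carrier (lim_G C E rep)" for x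
    by (rule acts_Aut[OF realisation(1)[OF that] realisation(2)[OF that]])
  have inv: "realisation (HAut_to_lim C E rep \<sigma>) = \<sigma>" if \<sigma>: "\<sigma> \<in> carrier (HAut_top C E)" for \<sigma>
    by (rule acts_determine[OF realisation(1)[OF HAut_to_lim_carrier(1)[OF \<sigma>]] Aut_Bij[OF \<sigma>] realisation(2)[OF HAut_to_lim_carrier(1)[OF \<sigma>]] HAut_to_lim_carrier(2)[OF \<sigma>]])
  have "bij_betw realisation (carrier (lim_G C E rep)) (carrier (HAut_top C E))"
    by (rule bij_betw_byWitness[where f' = "HAut_to_lim C E rep"]) (use closed inv HAut_to_lim_realisation HAut_to_lim_carrier(1) in auto)
  moreover have "realisation \<in> hom (lim_G C E rep) (HAut_top C E)"
  proof (rule homI[OF closed])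
    fix x y assume xy: "x \<in> carrier (lim_G C E rep)" "y \<in> carrier (lim_G C E rep)"
    let ?xy = "x \<otimes>\<^bsub>lim_G C E rep\<^esub> y"
    have xyc: "?xy \<in> carrier (lim_G C E rep)" by (rule monoid.m_closed[OF group.is_monoid[OF lim_G_group] xy])
    have "realisation ?xy = compose TT (realisation x) (realisation y)"
    proof (rule acts_determine[OF realisation(1)[OF xyc] compose_Bij[OF realisation(1)[OF xy(1)] realisation(1)[OF xy(2)]] realisation(2)[OF xyc]])
      fix L assume L: "L \<in> I"
      have "?xy L = x L \<otimes>\<^bsub>G_lev C E (rep L)\<^esub> y L" using L by (simp add: lim_G_def inverse_limit_def)
      then show "acts (compose TT (realisation x) (realisation y)) L (?xy L)"
        using compose_acts[OF L realisation(2)[OF xy(1) L] realisation(2)[OF xy(2) L]] by simp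
    qed
    also have "\<dots> = realisation x \<otimes>\<^bsub>HAut_top C E\<^esub> realisation y"
      using realisation(1)[OF xy(1)] realisation(1)[OF xy(2)] by (simp add: HAut_top_eq HAut_def trees_along BijGroup_def)
    finally show "realisation ?xy = realisation x \<otimes>\<^bsub>HAut_top C E\<^esub> realisation y" .
  qed
  ultimately show ?thesis by (simp add: iso_def)
qed

theorem HAut_to_lim_iso: "HAut_to_lim C E rep \<in> iso (HAut_top C E) (lim_G C E rep)"
  by (rule iso_of_inverse[OF lim_G_group realisation_iso]) (rule HAut_to_lim_realisation)

text \<open>The carrier is the image of the limit group under a homomorphism into
  \<open>BijGroup\<close>, and is a subgroup for that reason; inverses of hyper-automorphisms are
  not examined directly.\<close>

lemma HAut_top_group: "group (HAut_top C E)"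
proof -
  have "monoid (HAut_top C E)"
  proof -
    have hom: "realisation \<in> hom (lim_G C E rep) (BijGroup TT)"
    proof (rule homI)
      show "realisation x \<in> carrier (BijGroup TT)" if "x \<in> carrier (lim_G C E rep)" for x
        using realisation(1)[OF that] by (simp add: BijGroup_def)
      show "realisation (x \<otimes>\<^bsub>lim_G C E rep\<^esub> y) = realisation x \<otimes>\<^bsub>BijGroup TT\<^esub> realisation y"
        if "x \<in> carrier (lim_G C E rep)" "y \<in> carrier (lim_G C E rep)" for x y
        using hom_mult[OF iso_imp_homomorphism[OF realisation_iso] that] by (simp add: HAut_top_eq HAut_def trees_along)
    qed
    have "subgroup (realisation ` carrier (lim_G C E rep)) (BijGroup TT)"
      by (rule group_hom.img_is_subgroup) (simp add: group_hom_def group_hom_axioms_def lim_G_group group_BijGroup hom)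
    from subgroup.subgroup_is_group[OF this group_BijGroup]
    have "group ((BijGroup TT)\<lparr>carrier := realisation ` carrier (lim_G C E rep)\<rparr>)" .
    moreover have "HAut_top C E = (BijGroup TT)\<lparr>carrier := realisation ` carrier (lim_G C E rep)\<rparr>"
    proof -
      have "realisation ` carrier (lim_G C E rep) = carrier (HAut_top C E)" using realisation_iso by (auto simp: iso_def bij_betw_def)
      moreover have "HAut_top C E = (BijGroup TT)\<lparr>carrier := carrier (HAut_top C E)\<rparr>"
        by (simp add: HAut_top_eq HAut_def trees_along)
      ultimately show ?thesis by simp
    qed
    ultimately show ?thesis using group.is_monoid by metis
  qed
  then show ?thesis using group.iso_imp_group[OF lim_G_group is_isoI[OF realisation_iso]] by blast
qed

end

section \<open>The algebraic part\<close>

text \<open>On \<open>A\<close> the map \<open>f\<close> factors through \<open>p\<close>. This is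
  used in both directions between orbits and cosets.\<close>

lemma finite_image_factor:
  assumes "finite (p ` A)" and "\<And>a b. a \<in> A \<Longrightarrow> b \<in> A \<Longrightarrow> p a = p b \<Longrightarrow> f a = f b"
  shows "finite (f ` A)"
proof (rule finite_subset)
  show "f ` A \<subseteq> (\<lambda>y. f (SOME a. a \<in> A \<and> p a = y)) ` p ` A"
  proof
    fix z assume "z \<in> f ` A"
    then obtain a where a: "a \<in> A" "z = f a" by blast
    have "(SOME b. b \<in> A \<and> p b = p a) \<in> A \<and> p (SOME b. b \<in> A \<and> p b = p a) = p a"
      by (rule someI[of _ a]) (use a in simp)
    then have "z = f (SOME b. b \<in> A \<and> p b = p a)" using assms(2) a by metis
    then show "z \<in> (\<lambda>y. f (SOME a. a \<in> A \<and> p a = y)) ` p ` A" using a(1) by blast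
  qed
qed (use assms(1) in blast)

text \<open>Makes exactness of a row formal once its left entry is the kernel with the inherited
  operations.\<close>

lemma kernel_left_exact:
  assumes G: "group G" and H: "group H" and f: "f \<in> hom G H"
  shows "left_exact (G\<lparr>carrier := kernel G H f\<rparr>) id G f H"
proof -
  interpret group_hom G H f using assms by (simp add: group_hom_def group_hom_axioms_def)
  have "group (G\<lparr>carrier := kernel G H f\<rparr>)" by (rule subgroup.subgroup_is_group[OF subgroup_kernel G])
  moreover have "id \<in> hom (G\<lparr>carrier := kernel G H f\<rparr>) G" by (auto simp: hom_def kernel_def)
  ultimately show ?thesis using assms by (simp add: left_exact_def)
qed

lemma Gal_group:
  assumes E: "field E" and B: "B \<subseteq> carrier E" shows "group (Gal E B)"
proof -
  interpret field E by (rule E)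
  let ?S = "carrier E"
  let ?X = "{\<sigma> \<in> Bij ?S. \<sigma> \<in> ring_hom E E \<and> (\<forall>x\<in>B. \<sigma> x = x)}"
  interpret b: group "BijGroup ?S" by (rule group_BijGroup)
  have "subgroup ?X (BijGroup ?S)"
  proof (rule b.subgroupI)
    show "?X \<subseteq> carrier (BijGroup ?S)" by (auto simp: BijGroup_def)
    have "(\<lambda>x\<in>?S. x) \<in> ring_hom E E" by (rule ring_hom_memI) auto
    then have "(\<lambda>x\<in>?S. x) \<in> ?X" using B id_Bij by auto
    then show "?X \<noteq> {}" by blast
  next
    fix \<sigma> assume \<sigma>: "\<sigma> \<in> ?X"
    then have bij: "bij_betw \<sigma> ?S ?S" by (simp add: Bij_def)
    then have "\<sigma> \<in> ring_iso E E" using \<sigma> by (simp add: ring_iso_def)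
    then have "inv_into ?S \<sigma> \<in> ring_iso E E" by (rule ring_iso_set_sym[OF ring_axioms])
    then have "inv_into ?S \<sigma> \<in> ring_hom E E" by (simp add: ring_iso_def)
    then have hom: "(\<lambda>x\<in>?S. inv_into ?S \<sigma> x) \<in> ring_hom E E" by (rule ring_hom_restrict) simp
    have fx: "inv_into ?S \<sigma> x = x" if "x \<in> B" for x
      using inv_into_f_f[OF bij_betw_imp_inj_on[OF bij], of x] that \<sigma> B by auto
    have \<sigma>B: "\<sigma> \<in> Bij ?S" using \<sigma> by blast
    have "(\<lambda>x\<in>?S. inv_into ?S \<sigma> x) \<in> ?X"
      using restrict_inv_into_Bij[OF \<sigma>B] hom fx B by (simp add: subset_iff)
    then show "inv\<^bsub>BijGroup ?S\<^esub> \<sigma> \<in> ?X" unfolding inv_BijGroup[OF \<sigma>B] .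
  next
    fix \<sigma> \<tau> assume st: "\<sigma> \<in> ?X" "\<tau> \<in> ?X"
    then have h: "\<tau> \<in> ring_hom E E" "\<sigma> \<in> ring_hom E E" and b: "\<sigma> \<in> Bij ?S" "\<tau> \<in> Bij ?S"
      and fx: "\<forall>x\<in>B. \<sigma> x = x" "\<forall>x\<in>B. \<tau> x = x" by simp_all
    from ring_hom_trans[OF h] have "compose ?S \<sigma> \<tau> \<in> ring_hom E E"
      by (rule ring_hom_restrict) (simp add: compose_def)
    moreover have "compose ?S \<sigma> \<tau> x = x" if "x \<in> B" for x using that B fx by (simp add: compose_def subset_iff)
    ultimately have "compose ?S \<sigma> \<tau> \<in> ?X" using compose_Bij[OF b] by blast
    then show "\<sigma> \<otimes>\<^bsub>BijGroup ?S\<^esub> \<tau> \<in> ?X" using b by (simp add: BijGroup_def)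
  qed
  from subgroup.subgroup_is_group[OF this b.group_axioms] show ?thesis by (simp add: Gal_def)
qed

lemma hom_Gal:
  assumes f: "f \<in> hom G (BijGroup (carrier E))" and "\<And>g. g \<in> carrier G \<Longrightarrow> f g \<in> ring_hom E E"
    and "\<And>g x. g \<in> carrier G \<Longrightarrow> x \<in> B \<Longrightarrow> f g x = x"
  shows "f \<in> hom G (Gal E B)"
proof (rule homI)
  show "f g \<in> carrier (Gal E B)" if "g \<in> carrier G" for g
    using hom_in_carrier[OF f that] assms(2)[OF that] assms(3)[OF that] by (simp add: Gal_def BijGroup_def)
  show "f (g \<otimes>\<^bsub>G\<^esub> h) = f g \<otimes>\<^bsub>Gal E B\<^esub> f h" if "g \<in> carrier G" "h \<in> carrier G" for g h
    using hom_mult[OF f that] by (simp add: Gal_def)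
qed

lemma Gal_D:
  assumes "\<sigma> \<in> carrier (Gal E B)"
  shows "\<sigma> \<in> Bij (carrier E)" "\<sigma> \<in> ring_hom E E" "\<And>x. x \<in> B \<Longrightarrow> \<sigma> x = x" "\<And>x. x \<in> carrier E \<Longrightarrow> \<sigma> x \<in> carrier E"
proof -
  show b: "\<sigma> \<in> Bij (carrier E)" "\<sigma> \<in> ring_hom E E" "\<And>x. x \<in> B \<Longrightarrow> \<sigma> x = x" using assms by (simp_all add: Gal_def)
  show "\<sigma> x \<in> carrier E" if "x \<in> carrier E" for x using funcset_mem[OF Bij_imp_funcset[OF b(1)] that] .
qed

lemma Gal_mult:
  assumes "\<sigma> \<in> carrier (Gal E B)" "\<tau> \<in> carrier (Gal E B)" "x \<in> carrier E"
  shows "(\<sigma> \<otimes>\<^bsub>Gal E B\<^esub> \<tau>) x = \<sigma> (\<tau> x)"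
  using Gal_D(1)[OF assms(1)] Gal_D(1)[OF assms(2)] assms(3) by (simp add: Gal_def BijGroup_def compose_def)

lemma Gal_one: "x \<in> carrier E \<Longrightarrow> \<one>\<^bsub>Gal E B\<^esub> x = x"
  by (simp add: Gal_def BijGroup_def)

lemma alg_part_subfield:
  assumes "field E" "subfield B E"
  shows "subfield (alg_part E B) E" "B \<subseteq> alg_part E B"
proof -
  interpret field E by (rule assms(1))
  show "subfield (alg_part E B) E"
    using subfield_of_algebraics[OF assms(2)] by (simp add: alg_part_def over_def)
  show "B \<subseteq> alg_part E B"
    using algebraic_self[OF subfieldE(1)[OF assms(2)]] subfieldE(3)[OF assms(2)] by (auto simp: alg_part_def over_def)
qed

lemma alg_part_hom:
  assumes "h \<in> ring_hom R S" "field R" "field S" "subfield B R" "x \<in> alg_part R B"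
  shows "h x \<in> alg_part S (h ` B)"
  using algebraic_hom[OF assms(1-4), of x] assms(5) ring_hom_closed[OF assms(1)] by (simp add: alg_part_def over_def)

lemma alg_Gal_group:
  assumes "field E" "subfield B E" shows "group (Gal (E\<lparr>carrier := alg_part E B\<rparr>) B)"
proof -
  interpret field E by (rule assms(1))
  show ?thesis
    using Gal_group[OF subfield_iff(2)[OF alg_part_subfield(1)[OF assms]]] alg_part_subfield(2)[OF assms] by simp
qed

section \<open>Algebraic elements, finite orbits and finite index\<close>

context field_action
begin

lemma subfield_fixed: "subfield B K"
proof (rule K.subfieldI'[OF K.subringI])
  have h: "ring_hom_ring K K (act g)" if "g \<in> carrier G" for g
    using ring_hom_ringI2[OF K.is_ring K.is_ring act_hom[OF that]] .
  show "B \<subseteq> carrier K" using fixed by blast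
  show "\<one>\<^bsub>K\<^esub> \<in> B" using ring_hom_one[OF act_hom] unfolding fixed by simp
  show "\<ominus>\<^bsub>K\<^esub> x \<in> B" if "x \<in> B" for x
    using that ring_hom_cring.hom_a_inv[OF hom_act] unfolding fixed by simp
  show "x \<otimes>\<^bsub>K\<^esub> y \<in> B" if "x \<in> B" "y \<in> B" for x y
    using that ring_hom_mult[OF act_hom] unfolding fixed by simp
  show "x \<oplus>\<^bsub>K\<^esub> y \<in> B" if "x \<in> B" "y \<in> B" for x y
    using that ring_hom_add[OF act_hom] unfolding fixed by simp
  show "inv\<^bsub>K\<^esub> x \<in> B" if x: "x \<in> B - {\<zero>\<^bsub>K\<^esub>}" for x
  proof -
    have xU: "x \<in> Units K" "x \<in> carrier K" using x K.field_Units unfolding fixed by auto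
    have "act g (inv\<^bsub>K\<^esub> x) = inv\<^bsub>K\<^esub> x" if g: "g \<in> carrier G" for g
    proof -
      have "act g x = x" using x g unfolding fixed by blast
      then have "x \<otimes>\<^bsub>K\<^esub> act g (inv\<^bsub>K\<^esub> x) = act g (x \<otimes>\<^bsub>K\<^esub> inv\<^bsub>K\<^esub> x)"
        using ring_hom_mult[OF act_hom[OF g] xU(2) K.Units_inv_closed[OF xU(1)]] by (simp only:)
      also have "\<dots> = \<one>\<^bsub>K\<^esub>" using xU ring_hom_one[OF act_hom[OF g]] by simp
      finally show ?thesis using K.comm_inv_char[of x "act g (inv\<^bsub>K\<^esub> x)"] xU g by simp
    qed
    then show ?thesis using xU unfolding fixed by simp
  qed
qed

abbreviation A where "A \<equiv> alg_part K B"
abbreviation AK where "AK \<equiv> K\<lparr>carrier := A\<rparr>"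

lemma alg_iff: "x \<in> A \<longleftrightarrow> x \<in> carrier K \<and> finite (orbit x)"
  using algebraic_iff[OF subfieldE(1)[OF subfield_fixed]] by (auto simp: alg_part_def)

lemma orbit_act: assumes g: "g \<in> carrier G" and x: "x \<in> carrier K" shows "orbit (act g x) \<subseteq> orbit x"
  using act_mult[OF _ g x, symmetric] g by (auto simp: orbit_def)

lemma act_alg: "g \<in> carrier G \<Longrightarrow> x \<in> A \<Longrightarrow> act g x \<in> A"
  using orbit_act by (auto simp: alg_iff intro: finite_subset)

lemma alg_act_hom: "(\<lambda>g. restrict (act g) A) \<in> hom G (Gal AK B)"
proof (rule hom_Gal)
  have A: "A \<subseteq> carrier K" by (auto simp: alg_part_def)
  have "(\<lambda>g. restrict (act g) A) \<in> hom G (BijGroup A)"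
    by (rule action_hom_BijGroup[OF G.group_axioms act_alg act_mult act_one]) (use A in auto)
  then show "(\<lambda>g. restrict (act g) A) \<in> hom G (BijGroup (carrier AK))" by simp
  show "restrict (act g) A \<in> ring_hom AK AK" if g: "g \<in> carrier G" for g
  proof -
    note s = subfieldE(1)[OF alg_part_subfield(1)[OF K.field_axioms subfield_fixed]]
    have "act g \<in> ring_hom AK AK"
      using act_alg[OF g] A ring_hom_mult[OF act_hom[OF g]] ring_hom_add[OF act_hom[OF g]] ring_hom_one[OF act_hom[OF g]]
      by (intro ring_hom_memI) (auto simp: subset_iff)
    from ring.ring_hom_restrict[OF K.subring_is_ring[OF s] this] show ?thesis by simp
  qed
  show "restrict (act g) A x = x" if "g \<in> carrier G" "x \<in> B" for g x
    using that alg_part_subfield(2)[OF K.field_axioms subfield_fixed] fixed by auto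
qed

lemma stabiliser_subgroup: "x \<in> carrier K \<Longrightarrow> subgroup {g \<in> carrier G. act g x = x} G"
  by (rule G.subgroupI) (auto simp: act_mult act_one intro!: exI[of _ "\<one>\<^bsub>G\<^esub>"] dest: act_inv(1))

lemma rcos_eq_iff:
  assumes "subgroup H G" "g \<in> carrier G" "h \<in> carrier G"
  shows "H #>\<^bsub>G\<^esub> h = H #>\<^bsub>G\<^esub> g \<longleftrightarrow> h \<otimes>\<^bsub>G\<^esub> inv\<^bsub>G\<^esub> g \<in> H"
proof
  assume "H #>\<^bsub>G\<^esub> h = H #>\<^bsub>G\<^esub> g"
  then have "h \<in> H #>\<^bsub>G\<^esub> g" using G.rcos_self[OF assms(3,1)] by simp
  then show "h \<otimes>\<^bsub>G\<^esub> inv\<^bsub>G\<^esub> g \<in> H" using subgroup.rcos_module_imp[OF assms(1) G.group_axioms assms(2)] by simp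
next
  assume "h \<otimes>\<^bsub>G\<^esub> inv\<^bsub>G\<^esub> g \<in> H"
  then have "H #>\<^bsub>G\<^esub> (h \<otimes>\<^bsub>G\<^esub> inv\<^bsub>G\<^esub> g) = H" using assms by (intro G.coset_join2) auto
  then show "H #>\<^bsub>G\<^esub> h = H #>\<^bsub>G\<^esub> g" by (rule G.coset_mult_inv1) (use assms subgroup.subset in auto)
qed

text \<open>The right coset of \<open>g\<close> is determined by the image of \<open>x\<close> under
  the inverse of \<open>g\<close>; inverses appear because the cosets are right cosets. A finite
  orbit therefore leaves finitely many cosets.\<close>

lemma stabiliser_index:
  assumes x: "x \<in> A" shows "finite (rcosets\<^bsub>G\<^esub> {g \<in> carrier G. act g x = x})"
proof -
  let ?H = "{g \<in> carrier G. act g x = x}"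
  have xK: "x \<in> carrier K" and fin: "finite (orbit x)" using x by (auto simp: alg_iff)
  have "finite ((\<lambda>g. ?H #>\<^bsub>G\<^esub> g) ` carrier G)"
  proof (rule finite_image_factor[where p = "\<lambda>g. act (inv\<^bsub>G\<^esub> g) x"])
    show "finite ((\<lambda>g. act (inv\<^bsub>G\<^esub> g) x) ` carrier G)"
      by (rule finite_subset[OF _ fin]) (auto simp: orbit_def)
    fix g h assume gh: "g \<in> carrier G" "h \<in> carrier G" "act (inv\<^bsub>G\<^esub> g) x = act (inv\<^bsub>G\<^esub> h) x"
    then have "g \<otimes>\<^bsub>G\<^esub> inv\<^bsub>G\<^esub> h \<in> ?H" using xK by (simp add: act_mult flip: gh(3))
    then show "?H #>\<^bsub>G\<^esub> g = ?H #>\<^bsub>G\<^esub> h" using rcos_eq_iff[OF stabiliser_subgroup[OF xK] gh(2,1)] by simp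
  qed
  moreover have "rcosets\<^bsub>G\<^esub> ?H = (\<lambda>g. ?H #>\<^bsub>G\<^esub> g) ` carrier G" by (auto simp: RCOSETS_def)
  ultimately show ?thesis by simp
qed

text \<open>Conversely the image of \<open>x\<close> under the inverse of \<open>g\<close> depends
  only on the right coset of \<open>g\<close>, so there are no more images than cosets.\<close>

lemma finite_index_alg:
  assumes H: "subgroup H G" and fin: "finite (rcosets\<^bsub>G\<^esub> H)" and x: "x \<in> carrier K" and fx: "\<And>h. h \<in> H \<Longrightarrow> act h x = x"
  shows "x \<in> A"
proof -
  have "finite ((\<lambda>g. act (inv\<^bsub>G\<^esub> g) x) ` carrier G)"
  proof (rule finite_image_factor[where p = "\<lambda>g. H #>\<^bsub>G\<^esub> g"])
    show "finite ((\<lambda>g. H #>\<^bsub>G\<^esub> g) ` carrier G)" using fin by (rule rev_finite_subset) (auto simp: RCOSETS_def)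
    fix g h assume gh: "g \<in> carrier G" "h \<in> carrier G" "H #>\<^bsub>G\<^esub> g = H #>\<^bsub>G\<^esub> h"
    then have "act (g \<otimes>\<^bsub>G\<^esub> inv\<^bsub>G\<^esub> h) x = x" using fx rcos_eq_iff[OF H gh(2,1)] by blast
    then have "act g (act (inv\<^bsub>G\<^esub> h) x) = x" using gh x by (simp add: act_mult)
    then show "act (inv\<^bsub>G\<^esub> g) x = act (inv\<^bsub>G\<^esub> h) x" using act_inv(1)[of g "act (inv\<^bsub>G\<^esub> h) x"] gh x by simp
  qed
  moreover have "orbit x \<subseteq> (\<lambda>g. act (inv\<^bsub>G\<^esub> g) x) ` carrier G"
  proof
    fix y assume "y \<in> orbit x"
    then obtain g where "g \<in> carrier G" "y = act g x" by (auto simp: orbit_def)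
    then show "y \<in> (\<lambda>g. act (inv\<^bsub>G\<^esub> g) x) ` carrier G" by (intro image_eqI[of _ _ "inv\<^bsub>G\<^esub> g"]) simp_all
  qed
  ultimately show ?thesis using x finite_subset by (auto simp: alg_iff)
qed

text \<open>An automorphism of the algebraic part of a larger field permutes the finite orbits of the
  smaller one, hence restricts to its algebraic part.\<close>

lemma restr_Gal:
  assumes L: "field L" and j: "j \<in> ring_hom K L" and j_inj: "inj_on j (carrier K)" and B': "j ` B = B'"
  defines "A' \<equiv> alg_part L B'"
  shows "restr_along j A \<in> hom (Gal (L\<lparr>carrier := A'\<rparr>) B') (Gal AK B)"
    and "\<And>\<tau> x. \<tau> \<in> carrier (Gal (L\<lparr>carrier := A'\<rparr>) B') \<Longrightarrow> x \<in> A \<Longrightarrow> restr_along j A \<tau> x \<in> A \<and> j (restr_along j A \<tau> x) = \<tau> (j x)"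
    and "\<And>x. x \<in> A \<Longrightarrow> j x \<in> A'"
proof -
  let ?GA = "Gal (L\<lparr>carrier := A'\<rparr>) B'"
  interpret L: field L by (rule L)
  interpret j: ring_hom_ring K L j using ring_hom_ringI2[OF K.is_ring L.is_ring j] .
  have B'_sub: "subfield B' L"
    using j.img_is_subfield(2)[OF subfield_fixed] B' by simp
  have A'_sub: "subfield A' L" "B' \<subseteq> A'"
    using alg_part_subfield[OF L B'_sub] by (simp_all add: A'_def)
  have AK: "A \<subseteq> carrier K" by (auto simp: alg_part_def)
  show jA: "j x \<in> A'" if "x \<in> A" for x
    using alg_part_hom[OF j K.field_axioms L subfield_fixed that] B' by (simp add: A'_def)
  have injA: "inj_on j A" using j_inj AK by (rule inj_on_subset)
  have img: "\<tau> (j x) \<in> j ` A" if \<tau>: "\<tau> \<in> carrier ?GA" and x: "x \<in> A" for \<tau> x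
  proof -
    have xK: "x \<in> carrier K" "finite (orbit x)" using x by (auto simp: alg_iff)
    have "\<tau> (j x) \<in> j ` orbit x"
      by (rule hom_orbit[OF L j subfieldE(1)[OF A'_sub(1)] xK jA[OF x]]) (use Gal_D(2,3)[OF \<tau>] A'_sub(2) B' in auto)
    moreover have "orbit x \<subseteq> A" using act_alg[OF _ x] by (auto simp: orbit_def)
    ultimately show ?thesis by blast
  qed
  define r where "r \<tau> x = the_inv_into A j (\<tau> (j x))" for \<tau> x
  have r: "r \<tau> x \<in> A" "j (r \<tau> x) = \<tau> (j x)" if "\<tau> \<in> carrier ?GA" "x \<in> A" for \<tau> x
    unfolding r_def using the_inv_into_into[OF injA img[OF that] subset_refl] f_the_inv_into_f[OF injA img[OF that]] by auto
  have restr: "restr_along j A = (\<lambda>\<tau>. restrict (r \<tau>) A)" by (simp add: restr_along_def r_def fun_eq_iff)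
  show "restr_along j A \<tau> x \<in> A \<and> j (restr_along j A \<tau> x) = \<tau> (j x)" if "\<tau> \<in> carrier ?GA" "x \<in> A" for \<tau> x
    using r[OF that] that by (simp add: restr)
  \<comment> \<open>Every law for the pulled back map \<open>r\<close> is checked after applying
    \<open>j\<close>, where it becomes the law for the given automorphism.\<close>
  have jD: "x = y" if "j x = j y" "x \<in> A" "y \<in> A" for x y using inj_onD[OF injA that] .
  have GA: "group ?GA"
    using alg_Gal_group[OF L B'_sub] by (simp add: A'_def)
  note s = subfieldE(1)[OF alg_part_subfield(1)[OF K.field_axioms subfield_fixed]]
  show "restr_along j A \<in> hom ?GA (Gal AK B)" unfolding restr
  proof (rule hom_Gal)
    have "(\<lambda>\<tau>. restrict (r \<tau>) A) \<in> hom ?GA (BijGroup A)"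
    proof (rule action_hom_BijGroup[OF GA r(1)])
      show "r (\<sigma> \<otimes>\<^bsub>?GA\<^esub> \<tau>) x = r \<sigma> (r \<tau> x)" if "\<sigma> \<in> carrier ?GA" "\<tau> \<in> carrier ?GA" "x \<in> A" for \<sigma> \<tau> x
      proof (rule jD)
        have "\<sigma> \<otimes>\<^bsub>?GA\<^esub> \<tau> \<in> carrier ?GA" using that monoid.m_closed[OF group.is_monoid[OF GA]] by blast
        note m = r[OF this that(3)]
        show "j (r (\<sigma> \<otimes>\<^bsub>?GA\<^esub> \<tau>) x) = j (r \<sigma> (r \<tau> x))"
          using m(2) r(2)[OF that(1) r(1)[OF that(2,3)]] r(2)[OF that(2,3)] Gal_mult[OF that(1,2)] jA[OF that(3)] by simp
        show "r (\<sigma> \<otimes>\<^bsub>?GA\<^esub> \<tau>) x \<in> A" by (rule m(1))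
        show "r \<sigma> (r \<tau> x) \<in> A" by (rule r(1)[OF that(1) r(1)[OF that(2,3)]])
      qed
      show "r \<one>\<^bsub>?GA\<^esub> x = x" if x: "x \<in> A" for x
      proof (rule jD[OF _ _ x])
        note m = r[OF monoid.one_closed[OF group.is_monoid[OF GA]] x]
        show "j (r \<one>\<^bsub>?GA\<^esub> x) = j x" using m(2) Gal_one[of "j x" "L\<lparr>carrier := A'\<rparr>" B'] jA[OF x] by simp
        show "r \<one>\<^bsub>?GA\<^esub> x \<in> A" by (rule m(1))
      qed
    qed
    then show "(\<lambda>\<tau>. restrict (r \<tau>) A) \<in> hom ?GA (BijGroup (carrier AK))" by simp
    fix \<tau> assume \<tau>: "\<tau> \<in> carrier ?GA"
    note t = Gal_D(2)[OF \<tau>]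
    have "r \<tau> \<in> ring_hom AK AK"
    proof (rule ring_hom_memI)
      fix x y assume "x \<in> carrier AK" "y \<in> carrier AK"
      then have xy: "x \<in> A" "y \<in> A" "x \<in> carrier K" "y \<in> carrier K" using AK by auto
      have c: "x \<otimes>\<^bsub>K\<^esub> y \<in> A" "x \<oplus>\<^bsub>K\<^esub> y \<in> A" "r \<tau> x \<otimes>\<^bsub>K\<^esub> r \<tau> y \<in> A" "r \<tau> x \<oplus>\<^bsub>K\<^esub> r \<tau> y \<in> A"
        using xy(1,2) r(1)[OF \<tau>] subringE(6,7)[OF s] by blast+
      have rK: "r \<tau> x \<in> carrier K" "r \<tau> y \<in> carrier K" using r(1)[OF \<tau>] xy AK by auto
      show "r \<tau> (x \<otimes>\<^bsub>AK\<^esub> y) = r \<tau> x \<otimes>\<^bsub>AK\<^esub> r \<tau> y"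
        using ring_hom_mult[OF t, of "j x" "j y"] jA xy c r[OF \<tau>] rK
        by (intro jD) simp_all
      show "r \<tau> (x \<oplus>\<^bsub>AK\<^esub> y) = r \<tau> x \<oplus>\<^bsub>AK\<^esub> r \<tau> y"
        using ring_hom_add[OF t, of "j x" "j y"] jA xy c r[OF \<tau>] rK
        by (intro jD) simp_all
    next
      have "\<one>\<^bsub>K\<^esub> \<in> A" using subringE(3)[OF s] .
      then show "r \<tau> \<one>\<^bsub>AK\<^esub> = \<one>\<^bsub>AK\<^esub>" using r[OF \<tau>] ring_hom_one[OF t] by (intro jD) simp_all
    qed (use r(1)[OF \<tau>] in simp)
    from ring.ring_hom_restrict[OF K.subring_is_ring[OF s] this] show "restrict (r \<tau>) A \<in> ring_hom AK AK" by simp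
    fix b assume b: "b \<in> B"
    then have bA: "b \<in> A" using alg_part_subfield(2)[OF K.field_axioms subfield_fixed] by blast
    have "r \<tau> b = b" using r[OF \<tau> bA] Gal_D(3)[OF \<tau>, of "j b"] b B' bA by (intro jD) auto
    then show "restrict (r \<tau>) A b = b" using bA by simp
  qed
qed

end

section \<open>The product action and its kernel on the algebraic part\<close>

context galois_hyper
begin

abbreviation HK where "HK l \<equiv> cprod_ring C (along (lev E) l)"
abbreviation HB where "HB l \<equiv> base_image C (base E) (along (lev E) l) (along (lev_base E) l)"
abbreviation hact where "hact l \<equiv> cmap2 C (carriers (along (lev E) l)) (along (act E) l)"
abbreviation TK where "TK \<equiv> cprod_ring C (\<lambda>_. Some (top_field E))"
abbreviation TB where "TB \<equiv> base_image C (base E) (\<lambda>_. Some (top_field E)) (\<lambda>_. Some (emb E))"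

lemma hact_cl:
  assumes "hidx C l" "el SG l g" "el SK l t"
  shows "hact l (cl SG l g) (cl SK l t) = cl SK l (\<lambda>i. act E (the (l i)) (g i) (t i))"
    "el SK l (\<lambda>i. act E (the (l i)) (g i) (t i))"
  unfolding carriers_along
  by (rule act_cl[OF assms, THEN conjunct1], rule act_cl[OF assms, THEN conjunct2])

lemma HK_field: "hidx C l \<Longrightarrow> hyper_field C (lev E) l"
  by (rule hyper_ext.axioms(1)[OF lev_ext])

lemma HK_elim:
  assumes "hidx C l" "x \<in> carrier (HK l)" obtains t where "el SK l t" "x = cl SK l t"
  using hyper_field.carrier_elim[OF HK_field[OF assms(1)] assms(2)] by blast

lemma HK_intro: "hidx C l \<Longrightarrow> el SK l t \<Longrightarrow> cl SK l t \<in> carrier (HK l)"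
  by (rule hyper_field.carrier_intro[OF HK_field])

lemma base_carrier: "carrier (cprod_ring C (\<lambda>_. Some (base E))) = cprod C (along SB l0)"
  unfolding cprod_ring_carrier[of C "\<lambda>_. base E" l0, unfolded along_const] along_const ..

lemma HB_iff:
  assumes l: "hidx C l"
  shows "x \<in> HB l \<longleftrightarrow> (\<exists>c. el SB l0 c \<and> x = cl SK l (\<lambda>i. lev_base E (the (l i)) (c i)))"
proof -
  interpret X: hyper_ext C "lev E" l "base E" "lev_base E" by (rule lev_ext[OF l])
  have "\<exists>c. el SB l0 c \<and> x = cl SK l (\<lambda>i. lev_base E (the (l i)) (c i))" if x: "x \<in> HB l"
  proof -
    obtain y where y: "y \<in> cprod C (along SB l0)" "x = cmap C (carriers (along (lev E) l)) (along (lev_base E) l) y"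
      using x unfolding base_image_def base_carrier by blast
    obtain c where c: "el SB l0 c" "y = cl SB l0 c" by (rule cprodE[OF y(1)])
    show ?thesis using y(2) c(1) X.base_cl[OF c(1), THEN conjunct1] unfolding c(2) carriers_along by blast
  qed
  moreover have "cl SK l (\<lambda>i. lev_base E (the (l i)) (c i)) \<in> HB l" if c: "el SB l0 c" for c
    unfolding base_image_def base_carrier carriers_along X.base_cl[OF c, THEN conjunct1, symmetric]
    by (rule imageI, rule cprodI[OF hidx_const B.usd_carrier c])
  ultimately show ?thesis by blast
qed

lemma TB_iff: "x \<in> TB \<longleftrightarrow> (\<exists>c. el SB l0 c \<and> x = cl ST l0 (\<lambda>i. emb E (c i)))"
proof -
  have car: "carriers (\<lambda>_. Some (top_field E)) = along ST l0" by (simp add: fun_eq_iff carriers_def along_def)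
  note b = top.base_cl[unfolded along_const[of "emb E"]]
  have "\<exists>c. el SB l0 c \<and> x = cl ST l0 (\<lambda>i. emb E (c i))" if x: "x \<in> TB"
  proof -
    obtain y where y: "y \<in> cprod C (along SB l0)" "x = cmap C (carriers (\<lambda>_. Some (top_field E))) (\<lambda>_. Some (emb E)) y"
      using x unfolding base_image_def base_carrier by blast
    obtain c where c: "el SB l0 c" "y = cl SB l0 c" by (rule cprodE[OF y(1)])
    show ?thesis using y(2) c(1) b[OF c(1), THEN conjunct1] unfolding c(2) car by blast
  qed
  moreover have "cl ST l0 (\<lambda>i. emb E (c i)) \<in> TB" if c: "el SB l0 c" for c
    unfolding base_image_def base_carrier car b[OF c, THEN conjunct1, symmetric]
    by (rule imageI, rule cprodI[OF hidx_const B.usd_carrier c])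
  ultimately show ?thesis by blast
qed

lemma hact_hom:
  assumes l: "hidx C l" and g: "el SG l g" shows "hact l (cl SG l g) \<in> ring_hom (HK l) (HK l)"
proof -
  interpret X: hyper_field C "lev E" l by (rule HK_field[OF l])
  note h = act_props(1)
  show ?thesis
  proof (rule ring_hom_memI)
    show "hact l (cl SG l g) x \<in> carrier (HK l)" if "x \<in> carrier (HK l)" for x
    proof -
      obtain t where t: "el SK l t" "x = cl SK l t" by (rule HK_elim[OF l \<open>x \<in> carrier (HK l)\<close>])
      show ?thesis unfolding t(2) hact_cl(1)[OF l g t(1)] by (rule HK_intro[OF l hact_cl(2)[OF l g t(1)]])
    qed
    fix x y assume "x \<in> carrier (HK l)" "y \<in> carrier (HK l)"
    then obtain s t where s: "el SK l s" "x = cl SK l s" and t: "el SK l t" "y = cl SK l t"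
      by (elim HK_elim[OF l]) blast
    note hs = hact_cl[OF l g s(1)] and ht = hact_cl[OF l g t(1)]
    show "hact l (cl SG l g) (x \<otimes>\<^bsub>HK l\<^esub> y) = hact l (cl SG l g) x \<otimes>\<^bsub>HK l\<^esub> hact l (cl SG l g) y"
      unfolding s(2) t(2) X.mult_cl(1)[OF s(1) t(1)] hs(1) ht(1) X.mult_cl(1)[OF hs(2) ht(2)]
        hact_cl(1)[OF l g X.mult_cl(2)[OF s(1) t(1)]]
      by (rule cl_cong, use el_ae[OF g] el_ae[OF s(1)] el_ae[OF t(1)] in eventually_elim) (rule ring_hom_mult[OF h])
    show "hact l (cl SG l g) (x \<oplus>\<^bsub>HK l\<^esub> y) = hact l (cl SG l g) x \<oplus>\<^bsub>HK l\<^esub> hact l (cl SG l g) y"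
      unfolding s(2) t(2) X.add_cl(1)[OF s(1) t(1)] hs(1) ht(1) X.add_cl(1)[OF hs(2) ht(2)]
        hact_cl(1)[OF l g X.add_cl(2)[OF s(1) t(1)]]
      by (rule cl_cong, use el_ae[OF g] el_ae[OF s(1)] el_ae[OF t(1)] in eventually_elim) (rule ring_hom_add[OF h])
  next
    show "hact l (cl SG l g) \<one>\<^bsub>HK l\<^esub> = \<one>\<^bsub>HK l\<^esub>"
      unfolding X.one_cl(1) hact_cl(1)[OF l g X.one_cl(2)]
      by (rule cl_cong, use el_ae[OF g] in eventually_elim) (rule ring_hom_one[OF h])
  qed
qed

text \<open>If at almost every index some group element moved the entry, a search would produce an
  element of the product group moving the class of \<open>t\<close>. By cohesiveness the entry is
  therefore fixed by the whole finite group almost everywhere, so it lies in the base field there,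
  and preimages in the base field are again found by search.\<close>

lemma hact_fixed:
  assumes l: "hidx C l" and t: "el SK l t" and fx: "\<And>g. el SG l g \<Longrightarrow> hact l (cl SG l g) (cl SK l t) = cl SK l t"
  shows "cl SK l t \<in> HB l"
proof -
  define P where "P z g \<longleftrightarrow> g \<in> SG (pfst z) \<and> actt (pfst z) g (psnd z) \<noteq> psnd z" for z g
  have dec: "decidable (\<lambda>w. P (pfst w) (psnd w))" unfolding P_def by (intro tc_intros)
  have hc: "hc C (\<lambda>i. ppair (the (l i)) (t i))" by (intro hc_pair hidx_val[OF l] el_hc[OF t])
  have no: "\<forall>\<^sub>F i in F. \<not> (\<exists>g. P (ppair (the (l i)) (t i)) g)"
  proof (rule ccontr)
    assume "\<not> ?thesis"
    then have "\<forall>\<^sub>F i in F. \<exists>g. P (ppair (the (l i)) (t i)) g" using hc_dichotomy_ex[OF dec hc] by blast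
    from hc_search[OF dec hc this] obtain g where g: "hc C g" "\<forall>\<^sub>F i in F. P (ppair (the (l i)) (t i)) (g i)" by blast
    have eg: "el SG l g" by (rule elI[OF g(1)], rule eventually_mono[OF g(2)]) (simp add: P_def)
    have "cl SK l (\<lambda>i. act E (the (l i)) (g i) (t i)) = cl SK l t" using fx[OF eg] unfolding hact_cl(1)[OF l eg t] .
    then have "\<forall>\<^sub>F i in F. act E (the (l i)) (g i) (t i) = t i"
      by (rule iffD1[OF cl_eq_iff[OF l K.usd_carrier hact_cl(2)[OF l eg t]]])
    with g(2) el_ae[OF t] have "\<forall>\<^sub>F i in F. False" by eventually_elim (simp add: P_def actt_def split: if_splits)
    then show False by simp
  qed
  define Q where "Q z c \<longleftrightarrow> c \<in> carrier (base E) \<and> lbaset (pfst z) c = psnd z" for z c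
  have decQ: "decidable (\<lambda>w. Q (pfst w) (psnd w))" unfolding Q_def by (intro tc_intros B.dec_carrier[of "\<lambda>_. 0"])
  have "\<forall>\<^sub>F i in F. \<exists>c. Q (ppair (the (l i)) (t i)) c"
    using no el_ae[OF t]
  proof eventually_elim
    case (elim i)
    have "act E (the (l i)) g (t i) = t i" if "g \<in> SG (the (l i))" for g
      using elim that by (auto simp: P_def actt_def)
    then have "t i \<in> bimg (the (l i))" unfolding act.fixed[of "the (l i)"] using elim(2) by blast
    then show ?case by (auto simp: Q_def lbaset_def)
  qed
  from hc_search[OF decQ hc this] obtain c where c: "hc C c" "\<forall>\<^sub>F i in F. Q (ppair (the (l i)) (t i)) (c i)" by blast
  have "el SB l0 c" by (rule elI[OF c(1)], rule eventually_mono[OF c(2)]) (simp add: Q_def)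
  moreover have "cl SK l t = cl SK l (\<lambda>i. lev_base E (the (l i)) (c i))"
    by (rule cl_cong, use c(2) in eventually_elim) (auto simp: Q_def lbaset_def)
  ultimately show ?thesis unfolding HB_iff[OF l] by blast
qed

lemma hyper_action: assumes l: "hidx C l" shows "field_action (HK l) (G_lev C E l) (hact l) (HB l)"
proof (intro field_action.intro field_action_axioms.intro)
  show "field (HK l)" by (rule hyper_field.field_P[OF HK_field[OF l]])
  show "group (G_lev C E l)" by (rule G_group[OF l])
next
  fix G assume "G \<in> carrier (G_lev C E l)"
  then obtain g where g: "el SG l g" "G = cl SG l g" by (rule G_elim[OF l])
  show "hact l G \<in> ring_hom (HK l) (HK l)" unfolding g(2) by (rule hact_hom[OF l g(1)])
next
  fix G H x assume "G \<in> carrier (G_lev C E l)" "H \<in> carrier (G_lev C E l)" "x \<in> carrier (HK l)"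
  then obtain g h t where g: "el SG l g" "G = cl SG l g" and h: "el SG l h" "H = cl SG l h" and t: "el SK l t" "x = cl SK l t"
    by (elim G_elim[OF l] HK_elim[OF l]) blast
  note ht = hact_cl[OF l h(1) t(1)]
  show "hact l (G \<otimes>\<^bsub>G_lev C E l\<^esub> H) x = hact l G (hact l H x)"
    unfolding g(2) h(2) t(2) G_mult(1)[OF l g(1) h(1)] ht(1) hact_cl(1)[OF l g(1) ht(2)] hact_cl(1)[OF l G_mult(2)[OF l g(1) h(1)] t(1)]
    by (rule cl_cong, use el_ae[OF g(1)] el_ae[OF h(1)] el_ae[OF t(1)] in eventually_elim) (rule act_mult)
next
  fix x assume "x \<in> carrier (HK l)"
  then obtain t where t: "el SK l t" "x = cl SK l t" by (rule HK_elim[OF l])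
  show "hact l \<one>\<^bsub>G_lev C E l\<^esub> x = x"
    unfolding t(2) G_one(1)[OF l] hact_cl(1)[OF l G_one(2)[OF l] t(1)]
    by (rule cl_cong, use el_ae[OF t(1)] in eventually_elim) (rule act.act_one)
next
  have "x \<in> carrier (HK l) \<and> (\<forall>G\<in>carrier (G_lev C E l). hact l G x = x)" if "x \<in> HB l" for x
  proof -
    obtain c where c: "el SB l0 c" "x = cl SK l (\<lambda>i. lev_base E (the (l i)) (c i))" using \<open>x \<in> HB l\<close> unfolding HB_iff[OF l] by blast
    interpret X: hyper_ext C "lev E" l "base E" "lev_base E" by (rule lev_ext[OF l])
    note e = X.base_cl[OF c(1), THEN conjunct2]
    have "hact l G x = x" if "G \<in> carrier (G_lev C E l)" for G
    proof -
      obtain g where g: "el SG l g" "G = cl SG l g" by (rule G_elim[OF l \<open>G \<in> carrier (G_lev C E l)\<close>])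
      show ?thesis unfolding g(2) c(2) hact_cl(1)[OF l g(1) e]
        by (rule cl_cong, use el_ae[OF g(1)] el_ae[OF c(1)] in eventually_elim) (rule base_fixed)
    qed
    then show ?thesis unfolding c(2) using HK_intro[OF l e] by blast
  qed
  moreover have "x \<in> HB l" if x: "x \<in> carrier (HK l)" "\<forall>G\<in>carrier (G_lev C E l). hact l G x = x" for x
  proof -
    obtain t where t: "el SK l t" "x = cl SK l t" by (rule HK_elim[OF l x(1)])
    show ?thesis unfolding t(2) by (rule hact_fixed[OF l t(1)]) (use x(2) G_intro[OF l] in \<open>simp add: t(2)\<close>)
  qed
  ultimately show "HB l = {x \<in> carrier (HK l). \<forall>G\<in>carrier (G_lev C E l). hact l G x = x}" by blast
qed

lemma alg_lev_eq: "alg_lev C E l = alg_part (HK l) (HB l)"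
  by (simp add: alg_lev_def hyper_alg_def)

lemma Gal_lev_eq: "Gal_lev C E l = Gal ((HK l)\<lparr>carrier := alg_lev C E l\<rparr>) (HB l)"
  by (simp add: Gal_lev_def gal_alg_def alg_lev_def)

lemma alg_act_eq: "alg_act C E l = (\<lambda>g. restrict (hact l g) (alg_lev C E l))"
  by (simp add: alg_act_def fun_eq_iff)

lemma alg_lev_carrier: "x \<in> alg_lev C E l \<Longrightarrow> x \<in> carrier (HK l)"
  by (simp add: alg_lev_eq alg_part_def)

lemma Gal_lev_group: assumes l: "hidx C l" shows "group (Gal_lev C E l)"
proof -
  interpret X: field_action "HK l" "G_lev C E l" "hact l" "HB l" by (rule hyper_action[OF l])
  show ?thesis unfolding Gal_lev_eq alg_lev_eq by (rule alg_Gal_group[OF X.K.field_axioms X.subfield_fixed])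
qed

lemma alg_act_lev_hom: assumes l: "hidx C l" shows "alg_act C E l \<in> hom (G_lev C E l) (Gal_lev C E l)"
  unfolding Gal_lev_eq alg_act_eq alg_lev_eq by (rule field_action.alg_act_hom[OF hyper_action[OF l]])

lemma kernel_alg_act_iff:
  assumes l: "hidx C l"
  shows "g \<in> kernel (G_lev C E l) (Gal_lev C E l) (alg_act C E l) \<longleftrightarrow>
    g \<in> carrier (G_lev C E l) \<and> (\<forall>x\<in>alg_lev C E l. hact l g x = x)"
proof -
  have "\<one>\<^bsub>Gal_lev C E l\<^esub> = (\<lambda>x\<in>alg_lev C E l. x)" by (simp add: Gal_lev_eq Gal_def BijGroup_def)
  then show ?thesis by (auto simp: kernel_def alg_act_eq fun_eq_iff)
qed

lemma usd_code: "usd (\<lambda>c. set (list_decode c))"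
proof -
  have "decidable (\<lambda>z. \<exists>y\<in>set (list_decode (pfst z)). y = psnd z)" by (intro tc_intros)
  then show ?thesis by (simp add: usd_def)
qed

text \<open>Replaces the coded description of an internal subgroup by the condition that the values
  lie in the coded sets almost everywhere, the form used in calculations.\<close>

lemma internal_elements:
  assumes h: "hidx C h" and sub: "\<And>i c. h i = Some c \<Longrightarrow> \<exists>n. l i = Some n \<and> set (list_decode c) \<subseteq> SG n"
  shows "ccls C (carriers (along (grp E) l)) ` cpre C (\<lambda>i. map_option (\<lambda>c. set (list_decode c)) (h i)) =
    {cl SG l g | g. el SG l g \<and> (\<forall>\<^sub>F i in F. g i \<in> set (list_decode (the (h i))))}" (is "?L = ?R")
proof -
  let ?D = "along (\<lambda>c. set (list_decode c)) h"
  have D: "(\<lambda>i. map_option (\<lambda>c. set (list_decode c)) (h i)) = ?D" by (simp add: along_def fun_eq_iff)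
  have pre: "\<phi> \<in> cpre C (along SG l)" if \<phi>: "\<phi> \<in> cpre C ?D" for \<phi>
  proof -
    have "\<exists>n. l i = Some n \<and> x \<in> SG n" if "\<phi> i = Some x" for i x
    proof -
      obtain c where "h i = Some c" "x \<in> set (list_decode c)" using \<phi> \<open>\<phi> i = Some x\<close> unfolding cpre_along by blast
      then show ?thesis using sub by blast
    qed
    then show ?thesis using \<phi> unfolding cpre_along by blast
  qed
  show ?thesis unfolding D carriers_along
  proof
    show "ccls C (along SG l) ` cpre C ?D \<subseteq> ?R"
    proof
      fix x assume "x \<in> ccls C (along SG l) ` cpre C ?D"
      then obtain \<phi> where \<phi>: "\<phi> \<in> cpre C ?D" "x = ccls C (along SG l) \<phi>" by blast
      have "x = cl SG l (\<lambda>i. the (\<phi> i))" using cl_ccls[OF cpre_el(2)[OF pre[OF \<phi>(1)]]] \<phi>(2) by simp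
      then show "x \<in> ?R" using cpre_el(1)[OF pre[OF \<phi>(1)]] el_ae[OF cpre_el(1)[OF \<phi>(1)]] by blast
    qed
    show "?R \<subseteq> ccls C (along SG l) ` cpre C ?D"
    proof
      fix x assume "x \<in> ?R"
      then obtain g where g: "el SG l g" "\<forall>\<^sub>F i in F. g i \<in> set (list_decode (the (h i)))" "x = cl SG l g" by blast
      have "el (\<lambda>c. set (list_decode c)) h g" by (rule elI[OF el_hc[OF g(1)] g(2)])
      from cl_member[OF h usd_code this] obtain \<phi> where "\<phi> \<in> cl (\<lambda>c. set (list_decode c)) h g" .
      then have \<phi>: "\<phi> \<in> cpre C ?D" "\<forall>\<^sub>F i in F. \<phi> i = Some (g i)" by (simp_all add: cl_def)
      then show "x \<in> ccls C (along SG l) ` cpre C ?D" unfolding g(3) using ccls_cl[OF pre[OF \<phi>(1)] \<phi>(2)] by blast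
    qed
  qed
qed

text \<open>The pointwise stabilisers are computed by filtering the lists of group elements. The
  filter is applied to a genuine representative \<open>\<chi>\<close> instead of \<open>t\<close>,
  because the coded sets have to be subgroups at every index at which they are defined, not only
  almost everywhere.\<close>

lemma stabiliser_internal:
  assumes l: "hidx C l" and x: "x \<in> carrier (HK l)"
  shows "internal_subgroup C E l {g \<in> carrier (G_lev C E l). hact l g x = x}" (is "internal_subgroup C E l ?S")
proof -
  interpret X: field_action "HK l" "G_lev C E l" "hact l" "HB l" by (rule hyper_action[OF l])
  obtain t where t: "el SK l t" "x = cl SK l t" by (rule HK_elim[OF l x])
  obtain \<chi> where "\<chi> \<in> cl SK l t" by (rule cl_member[OF l K.usd_carrier t(1)])
  then have "\<chi> \<in> cpre C (along SK l)" and \<chi>t: "\<forall>\<^sub>F i in F. \<chi> i = Some (t i)" by (simp_all add: cl_def)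
  then have \<chi>: "partial_computable \<chi>" "\<And>i y. \<chi> i = Some y \<Longrightarrow> \<exists>n. l i = Some n \<and> y \<in> SK n" unfolding cpre_along by blast+
  define sc where "sc n y = list_encode (filter (\<lambda>g. actt n g y = y) (list_decode (G.gcode n)))" for n y
  have sc_set: "set (list_decode (sc n y)) = {g \<in> SG n. act E n g y = y}" if "y \<in> SK n" for n y
    using that by (auto simp: sc_def actt_def G.gcode(2) split: if_splits)
  define h where "h i = Option.bind (l i) (\<lambda>n. Option.bind (\<chi> i) (\<lambda>y. Some (sc n y)))" for i
  have "tc (\<lambda>z. sc (pfst z) (psnd z))" unfolding sc_def by (intro tc_intros)
  then have "partial_computable (\<lambda>z. Some (sc (pfst z) (psnd z)))" by (simp add: tc_def)
  from pc_bind2[OF _ \<chi>(1) this, of l] l have pc: "partial_computable h"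
    unfolding h_def[abs_def] hidx_def prod_encode_inverse fst_conv snd_conv by blast
  have val: "\<forall>\<^sub>F i in F. h i = Some (sc (the (l i)) (t i))"
    using hidx_ex[OF l] \<chi>t by eventually_elim (auto simp: h_def)
  then have ae: "\<forall>\<^sub>F i in F. h i \<noteq> None" by eventually_elim simp
  have hsub: "\<exists>n y. l i = Some n \<and> y \<in> SK n \<and> set (list_decode c) = {g \<in> SG n. act E n g y = y}" if "h i = Some c" for i c
  proof -
    obtain n y where n: "l i = Some n" "\<chi> i = Some y" "c = sc n y"
      using \<open>h i = Some c\<close> by (auto simp: h_def Option.bind_eq_Some_conv)
    then have "y \<in> SK n" using \<chi>(2)[of i y] by auto
    then show ?thesis using n(1,3) sc_set by blast
  qed
  have S: "?S = {cl SG l g | g. el SG l g \<and> (\<forall>\<^sub>F i in F. g i \<in> set (list_decode (the (h i))))}"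
  proof -
    have iff: "hact l (cl SG l g) x = x \<longleftrightarrow> (\<forall>\<^sub>F i in F. g i \<in> set (list_decode (the (h i))))" if g: "el SG l g" for g
    proof -
      have "hact l (cl SG l g) x = x \<longleftrightarrow> (\<forall>\<^sub>F i in F. act E (the (l i)) (g i) (t i) = t i)"
        unfolding t(2) hact_cl(1)[OF l g t(1)] by (rule cl_eq_iff[OF l K.usd_carrier hact_cl(2)[OF l g t(1)]])
      also have "\<dots> \<longleftrightarrow> (\<forall>\<^sub>F i in F. g i \<in> set (list_decode (the (h i))))"
      proof (rule eventually_cong[OF eventually_conj[OF val eventually_conj[OF el_ae[OF g] el_ae[OF t(1)]]]])
        fix i assume "h i = Some (sc (the (l i)) (t i)) \<and> g i \<in> SG (the (l i)) \<and> t i \<in> SK (the (l i))"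
        then show "act E (the (l i)) (g i) (t i) = t i \<longleftrightarrow> g i \<in> set (list_decode (the (h i)))" by (simp add: sc_set)
      qed
      finally show ?thesis .
    qed
    show ?thesis
    proof (intro equalityI subsetI)
      fix y assume "y \<in> ?S"
      then have y: "y \<in> carrier (G_lev C E l)" "hact l y x = x" by blast+
      obtain g where g: "el SG l g" "y = cl SG l g" by (rule G_elim[OF l y(1)])
      then show "y \<in> {cl SG l g | g. el SG l g \<and> (\<forall>\<^sub>F i in F. g i \<in> set (list_decode (the (h i))))}" using iff[OF g(1)] y(2) by blast
    next
      fix y assume "y \<in> {cl SG l g | g. el SG l g \<and> (\<forall>\<^sub>F i in F. g i \<in> set (list_decode (the (h i))))}"
      then obtain g where g: "y = cl SG l g" "el SG l g" "\<forall>\<^sub>F i in F. g i \<in> set (list_decode (the (h i)))" by blast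
      then show "y \<in> ?S" using iff[OF g(2)] G_intro[OF l g(2)] by simp
    qed
  qed
  have h_idx: "hidx C h" using pc ae by (simp add: hidx_def)
  have "subgroup (set (list_decode c)) (grp E n)" if "h i = Some c" "l i = Some n" for i c n
  proof -
    obtain y where "y \<in> SK n" "set (list_decode c) = {g \<in> SG n. act E n g y = y}" using hsub[OF \<open>h i = Some c\<close>] \<open>l i = Some n\<close> by auto
    then show ?thesis using act.stabiliser_subgroup[of y n] by simp
  qed
  then have hsubg: "\<exists>n. l i = Some n \<and> subgroup (set (list_decode c)) (grp E n)" if "h i = Some c" for i c
    using hsub[OF that] that by blast
  have hset: "\<exists>n. l i = Some n \<and> set (list_decode c) \<subseteq> SG n" if "h i = Some c" for i c
    using hsubg[OF that] subgroup.subset by blast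
  have "C \<subseteq>\<^sup>* dom h" using ae by (simp add: almost_subset_iff dom_def)
  moreover have "?S = ccls C (carriers (along (grp E) l)) ` cpre C (\<lambda>i. map_option (\<lambda>c. set (list_decode c)) (h i))"
    unfolding S by (rule internal_elements[OF h_idx hset, symmetric])
  ultimately show ?thesis unfolding internal_subgroup_def
    by (intro conjI X.stabiliser_subgroup[OF x] exI[of _ h] allI impI pc hsubg)
qed

lemma internal_separation:
  assumes l: "hidx C l" and S: "internal_subgroup C E l S" and g: "g \<in> carrier (G_lev C E l)" "g \<notin> S"
  shows "\<exists>x\<in>carrier (HK l). (\<forall>s\<in>S. hact l s x = x) \<and> hact l g x \<noteq> x"
proof -
  obtain h where h: "partial_computable h" "C \<subseteq>\<^sup>* dom h"
    "\<And>i c. h i = Some c \<Longrightarrow> \<exists>n. l i = Some n \<and> subgroup (set (list_decode c)) (grp E n)"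
    "S = ccls C (carriers (along (grp E) l)) ` cpre C (\<lambda>i. map_option (\<lambda>c. set (list_decode c)) (h i))"
    using S unfolding internal_subgroup_def by blast
  have ae: "\<forall>\<^sub>F i in F. h i \<noteq> None" using h(2) by (simp add: almost_subset_iff dom_def)
  then have h_idx: "hidx C h" using h(1) by (simp add: hidx_def)
  have hset: "\<exists>n. l i = Some n \<and> set (list_decode c) \<subseteq> SG n" if "h i = Some c" for i c
    using h(3)[OF that] subgroup.subset by blast
  have Sel: "S = {cl SG l g | g. el SG l g \<and> (\<forall>\<^sub>F i in F. g i \<in> set (list_decode (the (h i))))}"
    unfolding h(4) by (rule internal_elements[OF h_idx hset])
  obtain \<gamma> where \<gamma>: "el SG l \<gamma>" "g = cl SG l \<gamma>" by (rule G_elim[OF l g(1)])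
  have hcp: "hc C (\<lambda>i. ppair (the (h i)) (\<gamma> i))" by (intro hc_pair hidx_val[OF h_idx] el_hc[OF \<gamma>(1)])
  \<comment> \<open>Not lying in \<open>S\<close> becomes, by cohesiveness, not lying in the coded
    subgroup at almost every index, which is what the pointwise separation requires.\<close>
  have "\<not> (\<forall>\<^sub>F i in F. \<gamma> i \<in> set (list_decode (the (h i))))" using g(2) \<gamma> unfolding Sel by blast
  then have out: "\<forall>\<^sub>F i in F. \<gamma> i \<notin> set (list_decode (the (h i)))"
    using hc_dichotomy[OF usd_code[unfolded usd_def] hcp] by simp
  \<comment> \<open>Invariance under the coded subgroup is a quantifier over a coded list, so the
    separating elements can be searched for.\<close>
  define P where "P z x \<longleftrightarrow> x \<in> SK (pfst z) \<and> (\<forall>k\<in>set (list_decode (pfst (psnd z))). actt (pfst z) k x = x) \<and>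
    actt (pfst z) (psnd (psnd z)) x \<noteq> x" for z x
  have dec: "decidable (\<lambda>w. P (pfst w) (psnd w))" unfolding P_def by (intro tc_intros)
  have sg: "\<forall>\<^sub>F i in F. subgroup (set (list_decode (the (h i)))) (grp E (the (l i)))"
    using ae
  proof eventually_elim
    case (elim i)
    then obtain c where c: "h i = Some c" by blast
    then show ?case using h(3)[OF c] by auto
  qed
  have "\<forall>\<^sub>F i in F. \<exists>x. P (ppair (the (l i)) (ppair (the (h i)) (\<gamma> i))) x"
    using sg out el_ae[OF \<gamma>(1)]
  proof eventually_elim
    case (elim i)
    obtain x where x: "x \<in> SK (the (l i))" "\<And>k. k \<in> set (list_decode (the (h i))) \<Longrightarrow> act E (the (l i)) k x = x"
      "act E (the (l i)) (\<gamma> i) x \<noteq> x"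
      using act.subgroup_separation[OF elim(1,3,2)] by blast
    have "k \<in> SG (the (l i))" if "k \<in> set (list_decode (the (h i)))" for k using that subgroup.subset[OF elim(1)] by blast
    then show ?case using x elim(3) by (intro exI[of _ x]) (auto simp: P_def actt_def)
  qed
  moreover have "hc C (\<lambda>i. ppair (the (l i)) (ppair (the (h i)) (\<gamma> i)))" by (intro hc_pair[OF hidx_val[OF l] hcp])
  ultimately obtain x where x: "hc C x" "\<forall>\<^sub>F i in F. P (ppair (the (l i)) (ppair (the (h i)) (\<gamma> i))) (x i)"
    using hc_search[OF dec] by blast
  have ex: "el SK l x" by (rule elI[OF x(1)], rule eventually_mono[OF x(2)]) (simp add: P_def)
  show ?thesis
  proof (rule bexI[of _ "cl SK l x"], intro conjI ballI)
    show "cl SK l x \<in> carrier (HK l)" by (rule HK_intro[OF l ex])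
    show "hact l s (cl SK l x) = cl SK l x" if "s \<in> S" for s
    proof -
      obtain k where k: "s = cl SG l k" "el SG l k" "\<forall>\<^sub>F i in F. k i \<in> set (list_decode (the (h i)))"
        using \<open>s \<in> S\<close> unfolding Sel by blast
      show ?thesis unfolding k(1) hact_cl(1)[OF l k(2) ex]
        by (rule cl_cong, use x(2) k(3) el_ae[OF k(2)] in eventually_elim) (auto simp: P_def actt_def)
    qed
    show "hact l g (cl SK l x) \<noteq> cl SK l x"
    proof
      assume "hact l g (cl SK l x) = cl SK l x"
      then have "\<forall>\<^sub>F i in F. act E (the (l i)) (\<gamma> i) (x i) = x i"
        unfolding \<gamma>(2) hact_cl(1)[OF l \<gamma>(1) ex] by (rule iffD1[OF cl_eq_iff[OF l K.usd_carrier hact_cl(2)[OF l \<gamma>(1) ex]]])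
      with x(2) el_ae[OF \<gamma>(1)] have "\<forall>\<^sub>F i in F. False" by eventually_elim (auto simp: P_def actt_def)
      then show False by simp
    qed
  qed
qed

lemma I_lev_kernel:
  assumes l: "hidx C l"
  shows "I_lev C E l = (G_lev C E l)\<lparr>carrier := kernel (G_lev C E l) (Gal_lev C E l) (alg_act C E l)\<rparr>"
proof -
  interpret X: field_action "HK l" "G_lev C E l" "hact l" "HB l" by (rule hyper_action[OF l])
  let ?Is = "{S. internal_subgroup C E l S \<and> finite (rcosets\<^bsub>G_lev C E l\<^esub> S)}"
  have iff: "g \<in> carrier (G_lev C E l) \<inter> \<Inter>?Is \<longleftrightarrow> g \<in> carrier (G_lev C E l) \<and> (\<forall>x\<in>alg_lev C E l. hact l g x = x)" for g
  proof (intro iffI conjI ballI)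
    fix x assume g: "g \<in> carrier (G_lev C E l) \<inter> \<Inter>?Is" and x: "x \<in> alg_lev C E l"
    have "{g \<in> carrier (G_lev C E l). hact l g x = x} \<in> ?Is"
      using stabiliser_internal[OF l alg_lev_carrier[OF x]] X.stabiliser_index[OF x[unfolded alg_lev_eq]] by blast
    then show "hact l g x = x" using g by blast
  next
    assume g: "g \<in> carrier (G_lev C E l) \<and> (\<forall>x\<in>alg_lev C E l. hact l g x = x)"
    have "g \<in> S" if S: "S \<in> ?Is" for S
    proof (rule ccontr)
      assume "g \<notin> S"
      have S1: "internal_subgroup C E l S" "finite (rcosets\<^bsub>G_lev C E l\<^esub> S)" "subgroup S (G_lev C E l)"
        using S by (simp_all add: internal_subgroup_def)
      obtain x where x: "x \<in> carrier (HK l)" "\<forall>s\<in>S. hact l s x = x" "hact l g x \<noteq> x"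
        using internal_separation[OF l S1(1) conjunct1[OF g] \<open>g \<notin> S\<close>] by blast
      have "x \<in> alg_lev C E l" unfolding alg_lev_eq by (rule X.finite_index_alg[OF S1(3,2) x(1) bspec[OF x(2)]])
      then show False using g x(3) by blast
    qed
    then show "g \<in> carrier (G_lev C E l) \<inter> \<Inter>?Is" using g by blast
  qed blast
  have "carrier (G_lev C E l) \<inter> \<Inter>?Is = kernel (G_lev C E l) (Gal_lev C E l) (alg_act C E l)"
  proof (intro equalityI subsetI)
    show "g \<in> kernel (G_lev C E l) (Gal_lev C E l) (alg_act C E l)" if "g \<in> carrier (G_lev C E l) \<inter> \<Inter>?Is" for g
      using iffD1[OF iff that] unfolding kernel_alg_act_iff[OF l] .
    show "g \<in> carrier (G_lev C E l) \<inter> \<Inter>?Is" if "g \<in> kernel (G_lev C E l) (Gal_lev C E l) (alg_act C E l)" for g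
      using that unfolding kernel_alg_act_iff[OF l] by (rule iffD2[OF iff])
  qed
  then show ?thesis by (simp add: I_lev_def)
qed

theorem lev_left_exact:
  assumes l: "hidx C l"
  shows "left_exact (I_lev C E l) id (G_lev C E l) (alg_act C E l) (Gal_lev C E l)"
  unfolding I_lev_kernel[OF l] by (rule kernel_left_exact[OF G_group[OF l] Gal_lev_group[OF l] alg_act_lev_hom[OF l]])

end

section \<open>Embeddings and restriction\<close>

text \<open>The coefficients of an annihilating polynomial of \<open>j x\<close> lie in the image of
  \<open>B\<close>; pulled back they give a polynomial over \<open>B\<close>, and injectivity of
  \<open>j\<close> shows that it annihilates \<open>x\<close>.\<close>

lemma alg_part_reflect:
  assumes K: "field K" and L: "field L" and j: "j \<in> ring_hom K L" and B: "subfield B K"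
    and x: "x \<in> carrier K" and alg: "j x \<in> alg_part L (j ` B)"
  shows "x \<in> alg_part K B"
proof -
  interpret K: field K by (rule K)
  interpret L: field L by (rule L)
  interpret j: ring_hom_ring K L j using ring_hom_ringI2[OF K.is_ring L.is_ring j] .
  have j_inj: "inj_on j (carrier K)" by (rule non_trivial_field_hom_is_inj[OF j K L])
  have B': "subfield (j ` B) L" using j.img_is_subfield(2)[OF B] by simp
  have BK: "B \<subseteq> carrier K" by (rule subfieldE(3)[OF B])
  have "(L.algebraic over (j ` B)) (j x)" using alg by (simp add: alg_part_def over_def)
  then obtain p where p: "p \<in> carrier ((j ` B)[X]\<^bsub>L\<^esub>)" "p \<noteq> []" "L.eval p (j x) = \<zero>\<^bsub>L\<^esub>"
    by (rule L.algebraicE[OF subfieldE(1)[OF B'] j.hom_closed[OF x]])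
  have pB: "set p \<subseteq> j ` B" "hd p \<noteq> \<zero>\<^bsub>L\<^esub>" using p(1,2) by (auto simp: univ_poly_carrier[symmetric] polynomial_def)
  obtain q where q: "set q \<subseteq> B" "p = map j q" by (rule map_preimage[OF pB(1)])
  have "q \<noteq> []" using p(2) q(2) by simp
  moreover have qB: "q \<in> carrier (B[X]\<^bsub>K\<^esub>)"
    using q pB(2) \<open>q \<noteq> []\<close> by (auto simp: univ_poly_carrier[symmetric] polynomial_def hd_map)
  moreover have "K.eval q x = \<zero>\<^bsub>K\<^esub>"
  proof -
    have "K.eval q x \<in> carrier K" using K.eval_in_carrier[OF _ x] q(1) BK by blast
    moreover have "j (K.eval q x) = j \<zero>\<^bsub>K\<^esub>" using j.eval_hom[OF subfieldE(1)[OF B] x qB] p(3) q(2) by simp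
    ultimately show ?thesis using inj_onD[OF j_inj] by blast
  qed
  ultimately have "(K.algebraic over B) x" by (intro K.algebraicI)
  then show ?thesis using x by (simp add: alg_part_def over_def)
qed

text \<open>In a commuting square, an isomorphism on the left carries kernel to kernel when the map
  \<open>h\<close> on the right is injective and preserves the identity. This yields the isomorphism
  of the kernels in the upper rows from the other two.\<close>

lemma kernel_iso:
  assumes f: "f \<in> iso G G'" and h: "inj_on h (carrier H)" "\<one>\<^bsub>H'\<^esub> = h \<one>\<^bsub>H\<^esub>" "\<one>\<^bsub>H\<^esub> \<in> carrier H"
    and p: "\<And>x. x \<in> carrier G \<Longrightarrow> p x \<in> carrier H"
    and sq: "\<And>x. x \<in> carrier G \<Longrightarrow> h (p x) = q (f x)"
  shows "f \<in> iso (G\<lparr>carrier := kernel G H p\<rparr>) (G'\<lparr>carrier := kernel G' H' q\<rparr>)"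
proof -
  have surj: "f ` carrier G = carrier G'" and inj: "inj_on f (carrier G)" and hom: "f \<in> hom G G'"
    using f by (auto simp: iso_def bij_betw_def)
  have iff: "f x \<in> kernel G' H' q \<longleftrightarrow> x \<in> kernel G H p" if x: "x \<in> carrier G" for x
  proof -
    have "q (f x) = \<one>\<^bsub>H'\<^esub> \<longleftrightarrow> p x = \<one>\<^bsub>H\<^esub>"
      using sq[OF x] h inj_onD[OF h(1), of "p x" "\<one>\<^bsub>H\<^esub>"] p[OF x] by auto
    then show ?thesis using x surj by (auto simp: kernel_def)
  qed
  have sub: "kernel G H p \<subseteq> carrier G" "kernel G' H' q \<subseteq> carrier G'" by (auto simp: kernel_def)
  have "f ` kernel G H p = kernel G' H' q"
  proof
    show "f ` kernel G H p \<subseteq> kernel G' H' q" using iff sub(1) by blast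
    show "kernel G' H' q \<subseteq> f ` kernel G H p"
    proof
      fix y assume y: "y \<in> kernel G' H' q"
      then obtain x where "x \<in> carrier G" "y = f x" using sub(2) surj by blast
      then show "y \<in> f ` kernel G H p" using iff y by blast
    qed
  qed
  moreover have "f \<in> hom (G\<lparr>carrier := kernel G H p\<rparr>) (G'\<lparr>carrier := kernel G' H' q\<rparr>)"
    using iff sub hom_mult[OF hom] by (intro homI) (auto simp: subset_iff)
  ultimately show ?thesis using inj_on_subset[OF inj sub(1)] by (simp add: iso_def bij_betw_def)
qed

text \<open>Covers the embeddings of a level into a higher level and into the top field. The
  pointwise homomorphisms are assumed almost everywhere, matching the order relation between two
  indices; injectivity is automatic between fields.\<close>

lemma (in hyper_field) pointwise_hom:
  assumes Y: "hyper_field C R' l'"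
    and j: "\<And>t. el S l t \<Longrightarrow> j (cl S l t) = cl (\<lambda>n. carrier (R' n)) l' (\<lambda>i. e i (t i)) \<and> el (\<lambda>n. carrier (R' n)) l' (\<lambda>i. e i (t i))"
    and e: "\<forall>\<^sub>F i in F. e i \<in> ring_hom (R (v i)) (R' (the (l' i)))"
  shows "j \<in> ring_hom P (cprod_ring C (along R' l'))" "inj_on j (carrier P)"
proof -
  interpret Y: hyper_field C R' l' by (rule Y)
  note j1 = j[THEN conjunct1] and j2 = j[THEN conjunct2]
  show hom: "j \<in> ring_hom P Y.P"
  proof (rule ring_hom_memI)
    show "j x \<in> carrier Y.P" if "x \<in> carrier P" for x
    proof -
      obtain t where t: "el S l t" "x = cl S l t" by (rule carrier_elim[OF \<open>x \<in> carrier P\<close>])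
      show ?thesis unfolding t(2) j1[OF t(1)] by (rule Y.carrier_intro[OF j2[OF t(1)]])
    qed
    fix x y assume "x \<in> carrier P" "y \<in> carrier P"
    then obtain s t where s: "el S l s" "x = cl S l s" and t: "el S l t" "y = cl S l t"
      by (elim carrier_elim) blast
    show "j (x \<otimes>\<^bsub>P\<^esub> y) = j x \<otimes>\<^bsub>Y.P\<^esub> j y"
      unfolding s(2) t(2) mult_cl(1)[OF s(1) t(1)] j1[OF s(1)] j1[OF t(1)] Y.mult_cl(1)[OF j2[OF s(1)] j2[OF t(1)]]
        j1[OF mult_cl(2)[OF s(1) t(1)]]
      by (rule cl_cong, use e el_ae[OF s(1)] el_ae[OF t(1)] in eventually_elim) (rule ring_hom_mult)
    show "j (x \<oplus>\<^bsub>P\<^esub> y) = j x \<oplus>\<^bsub>Y.P\<^esub> j y"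
      unfolding s(2) t(2) add_cl(1)[OF s(1) t(1)] j1[OF s(1)] j1[OF t(1)] Y.add_cl(1)[OF j2[OF s(1)] j2[OF t(1)]]
        j1[OF add_cl(2)[OF s(1) t(1)]]
      by (rule cl_cong, use e el_ae[OF s(1)] el_ae[OF t(1)] in eventually_elim) (rule ring_hom_add)
  next
    show "j \<one>\<^bsub>P\<^esub> = \<one>\<^bsub>Y.P\<^esub>"
      unfolding one_cl(1) Y.one_cl(1) j1[OF one_cl(2)]
      by (rule cl_cong, use e in eventually_elim) (rule ring_hom_one)
  qed
  show "inj_on j (carrier P)" by (rule non_trivial_field_hom_is_inj[OF hom field_P Y.field_P])
qed

context galois_hyper
begin

lemma TK_eq: "TK = cprod_ring C (along (\<lambda>_. top_field E) l0)"
  by (simp add: along_const)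

lemma TK_field: "hyper_field C (\<lambda>_. top_field E) l0"
  by (rule hyper_ext.axioms(1)[OF top_ext])

lemma TK_is_field: "field TK"
  unfolding TK_eq by (rule hyper_field.field_P[OF TK_field])

lemma HK_is_field: "hidx C l \<Longrightarrow> field (HK l)"
  by (rule hyper_field.field_P[OF HK_field])

lemma TK_elim:
  assumes "x \<in> carrier TK" obtains t where "el ST l0 t" "x = cl ST l0 t"
  using hyper_field.carrier_elim[OF TK_field assms[unfolded TK_eq]] by blast

lemma lbase_el: assumes "hidx C l" "el SB l0 c" shows "el SK l (\<lambda>i. lev_base E (the (l i)) (c i))"
  using hyper_ext.base_cl[OF lev_ext[OF assms(1)] assms(2), THEN conjunct2] .

lemma lev_embed_hom:
  assumes m: "hidx C m" and n: "hidx C n" and le: "\<forall>\<^sub>F i in F. the (n i) \<le> the (m i)"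
  shows "lev_embed C E m n \<in> ring_hom (HK n) (HK m)" "inj_on (lev_embed C E m n) (carrier (HK n))"
    "lev_embed C E m n ` HB n = HB m"
proof -
  have e: "\<forall>\<^sub>F i in F. lev_incl E (the (m i)) (the (n i)) \<in> ring_hom (lev E (the (n i))) (lev E (the (m i)))"
    using le by eventually_elim (rule lev_incl_hom)
  show "lev_embed C E m n \<in> ring_hom (HK n) (HK m)"
    by (rule hyper_field.pointwise_hom(1)[OF HK_field[OF n] HK_field[OF m] incl_cl[OF m n le] e])
  show "inj_on (lev_embed C E m n) (carrier (HK n))"
    by (rule hyper_field.pointwise_hom(2)[OF HK_field[OF n] HK_field[OF m] incl_cl[OF m n le] e])
  have *: "lev_embed C E m n (cl SK n (\<lambda>i. lev_base E (the (n i)) (c i))) = cl SK m (\<lambda>i. lev_base E (the (m i)) (c i))"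
    if c: "el SB l0 c" for c
    unfolding incl_cl[OF m n le lbase_el[OF n c], THEN conjunct1]
    by (rule cl_cong, use le el_ae[OF c] in eventually_elim) (rule lev_incl_base)
  show "lev_embed C E m n ` HB n = HB m"
  proof (intro equalityI subsetI)
    fix y assume "y \<in> lev_embed C E m n ` HB n"
    then obtain x where x: "x \<in> HB n" "y = lev_embed C E m n x" by blast
    obtain c where c: "el SB l0 c" "x = cl SK n (\<lambda>i. lev_base E (the (n i)) (c i))" using iffD1[OF HB_iff[OF n] x(1)] by blast
    show "y \<in> HB m" unfolding x(2) c(2) *[OF c(1)] by (rule iffD2[OF HB_iff[OF m] exI[of _ c]]) (simp add: c(1))
  next
    fix y assume "y \<in> HB m"
    then obtain c where c: "el SB l0 c" "y = cl SK m (\<lambda>i. lev_base E (the (m i)) (c i))" using iffD1[OF HB_iff[OF m]] by blast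
    show "y \<in> lev_embed C E m n ` HB n" unfolding c(2) *[OF c(1), symmetric] by (rule imageI, rule iffD2[OF HB_iff[OF n] exI[of _ c]]) (simp add: c(1))
  qed
qed

lemma top_embed_hom:
  assumes l: "hidx C l"
  shows "top_embed C E l \<in> ring_hom (HK l) TK" "inj_on (top_embed C E l) (carrier (HK l))" "top_embed C E l ` HB l = TB"
proof -
  have e: "\<forall>\<^sub>F i in F. lev_emb E (the (l i)) \<in> ring_hom (lev E (the (l i))) (top_field E)"
    by (simp add: lev_emb_hom)
  show "top_embed C E l \<in> ring_hom (HK l) TK"
    unfolding TK_eq by (rule hyper_field.pointwise_hom(1)[OF HK_field[OF l] TK_field emb_cl[OF l] e])
  show "inj_on (top_embed C E l) (carrier (HK l))"
    by (rule hyper_field.pointwise_hom(2)[OF HK_field[OF l] TK_field emb_cl[OF l] e])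
  have *: "top_embed C E l (cl SK l (\<lambda>i. lev_base E (the (l i)) (c i))) = cl ST l0 (\<lambda>i. emb E (c i))"
    if c: "el SB l0 c" for c
    unfolding emb_cl[OF l lbase_el[OF l c], THEN conjunct1]
    by (rule cl_cong, use el_ae[OF c] in eventually_elim) (rule lev_base(2))
  show "top_embed C E l ` HB l = TB"
  proof (intro equalityI subsetI)
    fix y assume "y \<in> top_embed C E l ` HB l"
    then obtain x where x: "x \<in> HB l" "y = top_embed C E l x" by blast
    obtain c where c: "el SB l0 c" "x = cl SK l (\<lambda>i. lev_base E (the (l i)) (c i))" using iffD1[OF HB_iff[OF l] x(1)] by blast
    show "y \<in> TB" unfolding x(2) c(2) *[OF c(1)] by (rule iffD2[OF TB_iff exI[of _ c]]) (simp add: c(1))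
  next
    fix y assume "y \<in> TB"
    then obtain c where c: "el SB l0 c" "y = cl ST l0 (\<lambda>i. emb E (c i))" using iffD1[OF TB_iff] by blast
    show "y \<in> top_embed C E l ` HB l" unfolding c(2) *[OF c(1), symmetric] by (rule imageI, rule iffD2[OF HB_iff[OF l] exI[of _ c]]) (simp add: c(1))
  qed
qed

lemma top_embed_lev:
  assumes m: "hidx C m" and n: "hidx C n" and le: "\<forall>\<^sub>F i in F. the (n i) \<le> the (m i)" and x: "x \<in> carrier (HK n)"
  shows "top_embed C E m (lev_embed C E m n x) = top_embed C E n x"
proof -
  obtain t where t: "el SK n t" "x = cl SK n t" by (rule HK_elim[OF n x])
  note i = incl_cl[OF m n le t(1)]
  show ?thesis unfolding t(2) i[THEN conjunct1] emb_cl[OF m i[THEN conjunct2], THEN conjunct1] emb_cl[OF n t(1), THEN conjunct1]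
    by (rule cl_cong, use le el_ae[OF t(1)] in eventually_elim) (rule lev_incl(2))
qed

abbreviation sg where "sg l \<equiv> single C (along (lev E) l)"

lemma sg_cl:
  assumes "hidx C l" "el SK l t"
  shows "sg l (cl SK l t) = cl STK l (\<lambda>i. list_encode [t i])" "el STK l (\<lambda>i. list_encode [t i])"
  using hyper_ext.single_cl[OF lev_ext[OF assms(1)] assms(2)] by (rule conjunct1, rule conjunct2)

lemma sg_inj: assumes l: "hidx C l" shows "inj_on (sg l) (carrier (HK l))"
proof (rule inj_onI)
  fix x y assume "x \<in> carrier (HK l)" "y \<in> carrier (HK l)" and eq: "sg l x = sg l y"
  then obtain s t where s: "el SK l s" "x = cl SK l s" and t: "el SK l t" "y = cl SK l t"
    by (elim HK_elim[OF l]) blast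
  show "x = y" using hyper_ext.single_inj[OF lev_ext[OF l] s(1) t(1)] eq unfolding s(2) t(2) .
qed

lemma map_tuple_single: "map_tuple f (list_encode [x]) = list_encode [f x]"
  by (simp add: map_tuple_def del: list_encode.simps)

lemma tree_act_single:
  assumes l: "hidx C l" and g: "g \<in> carrier (G_lev C E l)" and x: "x \<in> carrier (HK l)"
  shows "tree_act C E l g (sg l x) = sg l (hact l g x)"
proof -
  obtain \<gamma> where \<gamma>: "el SG l \<gamma>" "g = cl SG l \<gamma>" by (rule G_elim[OF l g])
  obtain t where t: "el SK l t" "x = cl SK l t" by (rule HK_elim[OF l x])
  note h = hact_cl[OF l \<gamma>(1) t(1)]
  show ?thesis unfolding \<gamma>(2) t(2) sg_cl(1)[OF l t(1)] tree_act_cl(1)[OF l \<gamma>(1) sg_cl(2)[OF l t(1)]] h(1) sg_cl(1)[OF l h(2)]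
    map_tuple_single ..
qed

lemma hact_alg: "hidx C l \<Longrightarrow> g \<in> carrier (G_lev C E l) \<Longrightarrow> x \<in> alg_lev C E l \<Longrightarrow> hact l g x \<in> alg_lev C E l"
  unfolding alg_lev_eq by (rule field_action.act_alg[OF hyper_action])

lemma alg_act_restr:
  assumes l: "hidx C l" and g: "g \<in> carrier (G_lev C E l)"
  shows "alg_act C E l g = alg_restr_lev C E l (tree_act C E l g)"
proof -
  have inj: "inj_on (sg l) (alg_lev C E l)" by (rule inj_on_subset[OF sg_inj[OF l]]) (use alg_lev_carrier in blast)
  have "the_inv_into (alg_lev C E l) (sg l) (tree_act C E l g (sg l x)) = hact l g x" if x: "x \<in> alg_lev C E l" for x
    unfolding tree_act_single[OF l g alg_lev_carrier[OF x]] by (rule the_inv_into_f_f[OF inj hact_alg[OF l g x]])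
  then show ?thesis
    by (auto simp: alg_act_eq alg_restr_lev_def alg_restr_def restr_along_def fun_eq_iff simp flip: alg_lev_def)
qed

lemma Gal_trans_props:
  assumes m: "hidx C m" and n: "hidx C n" and le: "\<forall>\<^sub>F i in F. the (n i) \<le> the (m i)"
  shows "Gal_trans C E m n \<in> hom (Gal_lev C E m) (Gal_lev C E n)"
    "\<And>\<tau> x. \<tau> \<in> carrier (Gal_lev C E m) \<Longrightarrow> x \<in> alg_lev C E n \<Longrightarrow>
      Gal_trans C E m n \<tau> x \<in> alg_lev C E n \<and> lev_embed C E m n (Gal_trans C E m n \<tau> x) = \<tau> (lev_embed C E m n x)"
    "\<And>x. x \<in> alg_lev C E n \<Longrightarrow> lev_embed C E m n x \<in> alg_lev C E m"
  unfolding Gal_trans_def Gal_lev_eq alg_lev_eq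
  by (rule field_action.restr_Gal[OF hyper_action[OF n] HK_is_field[OF m] lev_embed_hom[OF m n le]]; assumption)+

abbreviation TA where "TA \<equiv> alg_part TK TB"

lemma Gal_top_eq: "Gal_top C E = Gal (TK\<lparr>carrier := TA\<rparr>) TB"
  by (simp add: Gal_top_def gal_alg_def hyper_alg_def)

lemma top_restr_props:
  assumes l: "hidx C l"
  shows "restr_along (top_embed C E l) (alg_lev C E l) \<in> hom (Gal_top C E) (Gal_lev C E l)"
    "\<And>\<tau> x. \<tau> \<in> carrier (Gal_top C E) \<Longrightarrow> x \<in> alg_lev C E l \<Longrightarrow>
      restr_along (top_embed C E l) (alg_lev C E l) \<tau> x \<in> alg_lev C E l \<and>
      top_embed C E l (restr_along (top_embed C E l) (alg_lev C E l) \<tau> x) = \<tau> (top_embed C E l x)"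
    "\<And>x. x \<in> alg_lev C E l \<Longrightarrow> top_embed C E l x \<in> TA"
  unfolding Gal_top_eq Gal_lev_eq alg_lev_eq
  by (rule field_action.restr_Gal[OF hyper_action[OF l] TK_is_field top_embed_hom[OF l]]; assumption)+

text \<open>The criterion by finite orbits is available at the levels, where a product group acts;
  algebraic elements of the top product are brought there by reflecting algebraicity.\<close>

lemma top_embed_reflect:
  assumes l: "hidx C l" and x: "x \<in> carrier (HK l)" "top_embed C E l x \<in> TA" shows "x \<in> alg_lev C E l"
  unfolding alg_lev_eq
  by (rule alg_part_reflect[OF HK_is_field[OF l] TK_is_field top_embed_hom(1)[OF l]
    field_action.subfield_fixed[OF hyper_action[OF l]] x(1)]) (use x(2) top_embed_hom(3)[OF l] in simp)

lemma hact_trans: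
  assumes m: "hidx C m" and n: "hidx C n" and less: "\<forall>\<^sub>F i in F. the (n i) < the (m i)"
    and g: "g \<in> carrier (G_lev C E m)" and x: "x \<in> carrier (HK n)"
  shows "lev_embed C E m n (hact n (G_trans C E m n g) x) = hact m g (lev_embed C E m n x)"
proof -
  have le: "\<forall>\<^sub>F i in F. the (n i) \<le> the (m i)" using less by eventually_elim simp
  obtain \<gamma> where \<gamma>: "el SG m \<gamma>" "g = cl SG m \<gamma>" by (rule G_elim[OF m g])
  obtain t where t: "el SK n t" "x = cl SK n t" by (rule HK_elim[OF n x])
  note q = quot_cl[OF m n less \<gamma>(1)] and i = incl_cl[OF m n le t(1)]
  note h = hact_cl[OF n q[THEN conjunct2] t(1)]
  show ?thesis
    unfolding \<gamma>(2) t(2) q[THEN conjunct1] h(1) i[THEN conjunct1] incl_cl[OF m n le h(2), THEN conjunct1]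
      hact_cl(1)[OF m \<gamma>(1) i[THEN conjunct2]]
    by (rule cl_cong, use less el_ae[OF \<gamma>(1)] el_ae[OF t(1)] in eventually_elim) (rule quot_act)
qed

text \<open>After the injective embedding into the upper level, both sides are given by the upper
  group element, because the restriction maps intertwine the actions.\<close>

lemma Gal_trans_alg_act:
  assumes m: "hidx C m" and n: "hidx C n" and less: "\<forall>\<^sub>F i in F. the (n i) < the (m i)"
    and g: "g \<in> carrier (G_lev C E m)"
  shows "Gal_trans C E m n (alg_act C E m g) = alg_act C E n (G_trans C E m n g)"
proof -
  have le: "\<forall>\<^sub>F i in F. the (n i) \<le> the (m i)" using less by eventually_elim simp
  have qg: "G_trans C E m n g \<in> carrier (G_lev C E n)" by (rule hom_in_carrier[OF G_trans_hom[OF m n less] g])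
  have ag: "alg_act C E m g \<in> carrier (Gal_lev C E m)" by (rule hom_in_carrier[OF alg_act_lev_hom[OF m] g])
  show ?thesis
  proof (rule extensionalityI[of _ "alg_lev C E n"])
    show "Gal_trans C E m n (alg_act C E m g) \<in> extensional (alg_lev C E n)" by (simp add: Gal_trans_def restr_along_def)
    show "alg_act C E n (G_trans C E m n g) \<in> extensional (alg_lev C E n)" by (simp add: alg_act_eq)
    fix x assume x: "x \<in> alg_lev C E n"
    note p = Gal_trans_props(2)[OF m n le ag x]
    have "lev_embed C E m n (Gal_trans C E m n (alg_act C E m g) x) = hact m g (lev_embed C E m n x)"
      using p Gal_trans_props(3)[OF m n le x] by (simp add: alg_act_eq)
    also have "\<dots> = lev_embed C E m n (hact n (G_trans C E m n g) x)"
      by (rule hact_trans[OF m n less g alg_lev_carrier[OF x], symmetric])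
    finally have "Gal_trans C E m n (alg_act C E m g) x = hact n (G_trans C E m n g) x"
      by (rule inj_onD[OF lev_embed_hom(2)[OF m n le] _ alg_lev_carrier[OF p[THEN conjunct1]] alg_lev_carrier[OF hact_alg[OF n qg x]]])
    then show "Gal_trans C E m n (alg_act C E m g) x = alg_act C E n (G_trans C E m n g) x"
      using x by (simp add: alg_act_eq)
  qed
qed

text \<open>The definition by internal subgroups does not show that transition maps respect
  \<open>I_lev\<close>; with the kernel description it follows from the square with the Galois
  groups.\<close>

lemma G_trans_I_hom:
  assumes m: "hidx C m" and n: "hidx C n" and less: "\<forall>\<^sub>F i in F. the (n i) < the (m i)"
  shows "G_trans C E m n \<in> hom (I_lev C E m) (I_lev C E n)"
proof -
  have le: "\<forall>\<^sub>F i in F. the (n i) \<le> the (m i)" using less by eventually_elim simp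
  interpret h: group_hom "Gal_lev C E m" "Gal_lev C E n" "Gal_trans C E m n"
    using Gal_lev_group[OF m] Gal_lev_group[OF n] Gal_trans_props(1)[OF m n le] by (simp add: group_hom_def group_hom_axioms_def)
  note hom = G_trans_hom[OF m n less]
  have "G_trans C E m n g \<in> kernel (G_lev C E n) (Gal_lev C E n) (alg_act C E n)"
    if g: "g \<in> kernel (G_lev C E m) (Gal_lev C E m) (alg_act C E m)" for g
  proof -
    have g': "g \<in> carrier (G_lev C E m)" "alg_act C E m g = \<one>\<^bsub>Gal_lev C E m\<^esub>" using g by (simp_all add: kernel_def)
    then show ?thesis
      using Gal_trans_alg_act[OF m n less g'(1), symmetric] hom_in_carrier[OF hom g'(1)] by (simp add: kernel_def)
  qed
  moreover have "g \<in> carrier (G_lev C E m)" if "g \<in> kernel (G_lev C E m) (Gal_lev C E m) (alg_act C E m)" for g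
    using that by (simp add: kernel_def)
  ultimately show ?thesis unfolding I_lev_kernel[OF m] I_lev_kernel[OF n]
    using hom_mult[OF hom] by (intro homI) simp_all
qed

end

section \<open>Inverse limits\<close>

lemma inverse_limit_carrier:
  "x \<in> carrier (inverse_limit I lt A f) \<longleftrightarrow>
    x \<in> (\<Pi>\<^sub>E i\<in>I. carrier (A i)) \<and> (\<forall>m\<in>I. \<forall>n\<in>I. lt n m \<longrightarrow> f m n (x m) = x n)"
  by (simp add: inverse_limit_def)

lemma inverse_limit_mult: "x \<otimes>\<^bsub>inverse_limit I lt A f\<^esub> y = (\<lambda>i\<in>I. x i \<otimes>\<^bsub>A i\<^esub> y i)"
  by (simp add: inverse_limit_def)

lemma inverse_limit_proj:
  assumes "i \<in> I" shows "(\<lambda>x. x i) \<in> hom (inverse_limit I lt A f) (A i)"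
proof (rule homI)
  show "x i \<in> carrier (A i)" if "x \<in> carrier (inverse_limit I lt A f)" for x
    using that assms unfolding inverse_limit_carrier by (blast dest: PiE_mem)
  show "(x \<otimes>\<^bsub>inverse_limit I lt A f\<^esub> y) i = x i \<otimes>\<^bsub>A i\<^esub> y i" for x y
    using assms by (simp add: inverse_limit_mult)
qed

lemma inverse_limit_map:
  assumes h: "\<And>i. i \<in> I \<Longrightarrow> h i \<in> hom (A i) (B i)"
    and sq: "\<And>m n x. m \<in> I \<Longrightarrow> n \<in> I \<Longrightarrow> lt n m \<Longrightarrow> x \<in> carrier (A m) \<Longrightarrow> g m n (h m x) = h n (f m n x)"
  shows "(\<lambda>x. \<lambda>i\<in>I. h i (x i)) \<in> hom (inverse_limit I lt A f) (inverse_limit I lt B g)"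
proof (rule homI)
  fix x assume x: "x \<in> carrier (inverse_limit I lt A f)"
  then have xi: "x i \<in> carrier (A i)" if "i \<in> I" for i
    using that unfolding inverse_limit_carrier by (blast dest: PiE_mem)
  have "g m n (h m (x m)) = h n (x n)" if "m \<in> I" "n \<in> I" "lt n m" for m n
    using sq[OF that xi[OF that(1)]] x that unfolding inverse_limit_carrier by simp
  moreover have "h i (x i) \<in> carrier (B i)" if "i \<in> I" for i by (rule hom_in_carrier[OF h[OF that] xi[OF that]])
  ultimately show "(\<lambda>i\<in>I. h i (x i)) \<in> carrier (inverse_limit I lt B g)"
    unfolding inverse_limit_carrier by simp
  fix y assume y: "y \<in> carrier (inverse_limit I lt A f)"
  then have yi: "y i \<in> carrier (A i)" if "i \<in> I" for i
    using that unfolding inverse_limit_carrier by (blast dest: PiE_mem)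
  show "(\<lambda>i\<in>I. h i ((x \<otimes>\<^bsub>inverse_limit I lt A f\<^esub> y) i)) =
      (\<lambda>i\<in>I. h i (x i)) \<otimes>\<^bsub>inverse_limit I lt B g\<^esub> (\<lambda>i\<in>I. h i (y i))"
    unfolding inverse_limit_mult by (rule restrict_ext) (simp add: hom_mult[OF h xi yi])
qed

text \<open>Limits commute with kernels, as both are formed coordinatewise. The equation holds
  between records, so the operations are compared too; those of \<open>J i\<close> and
  \<open>A i\<close> agree.\<close>

lemma inverse_limit_kernel:
  assumes J: "\<And>i. i \<in> I \<Longrightarrow> J i = (A i)\<lparr>carrier := kernel (A i) (B i) (h i)\<rparr>"
  shows "inverse_limit I lt J f = (inverse_limit I lt A f)\<lparr>carrier :=
    kernel (inverse_limit I lt A f) (inverse_limit I lt B g) (\<lambda>x. \<lambda>i\<in>I. h i (x i))\<rparr>"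
proof -
  have mult: "(\<lambda>x y. \<lambda>i\<in>I. x i \<otimes>\<^bsub>J i\<^esub> y i) = (\<lambda>x y. \<lambda>i\<in>I. x i \<otimes>\<^bsub>A i\<^esub> y i)" "(\<lambda>i\<in>I. \<one>\<^bsub>J i\<^esub>) = (\<lambda>i\<in>I. \<one>\<^bsub>A i\<^esub>)"
    by (auto intro!: ext restrict_ext simp: J)
  have "x \<in> (\<Pi>\<^sub>E i\<in>I. carrier (J i)) \<longleftrightarrow> x \<in> (\<Pi>\<^sub>E i\<in>I. carrier (A i)) \<and> (\<lambda>i\<in>I. h i (x i)) = (\<lambda>i\<in>I. \<one>\<^bsub>B i\<^esub>)" for x
  proof -
    have "(\<lambda>i\<in>I. h i (x i)) = (\<lambda>i\<in>I. \<one>\<^bsub>B i\<^esub>) \<longleftrightarrow> (\<forall>i\<in>I. h i (x i) = \<one>\<^bsub>B i\<^esub>)"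
      by (auto simp: fun_eq_iff restrict_def)
    then show ?thesis by (auto simp: PiE_iff J kernel_def)
  qed
  then have "{x \<in> (\<Pi>\<^sub>E i\<in>I. carrier (J i)). \<forall>m\<in>I. \<forall>n\<in>I. lt n m \<longrightarrow> f m n (x m) = x n} =
      {x \<in> (\<Pi>\<^sub>E i\<in>I. carrier (A i)). (\<forall>m\<in>I. \<forall>n\<in>I. lt n m \<longrightarrow> f m n (x m) = x n) \<and> (\<lambda>i\<in>I. h i (x i)) = (\<lambda>i\<in>I. \<one>\<^bsub>B i\<^esub>)}"
    by blast
  then show ?thesis
    by (simp add: inverse_limit_def kernel_def product_group_def mult)
qed

section \<open>The algebraic part of the top product as a directed union of levels\<close>

context galois_limit
begin

abbreviation AL where "AL L \<equiv> alg_lev C E (rep L)"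
abbreviation re where "re L \<equiv> top_embed C E (rep L)"
abbreviation le where "le M L \<equiv> lev_embed C E (rep M) (rep L)"

lemma less_ae: "L \<in> I \<Longrightarrow> M \<in> I \<Longrightarrow> Sup L M \<Longrightarrow> \<forall>\<^sub>F i in F. val L i < val M i"
  using less_iff by blast

lemma le_ae: assumes "L \<in> I" "M \<in> I" "Sup L M" shows "\<forall>\<^sub>F i in F. val L i \<le> val M i"
  using less_ae[OF assms] by eventually_elim simp

lemma re_inj: "L \<in> I \<Longrightarrow> inj_on (re L) (AL L)"
  by (rule inj_on_subset[OF top_embed_hom(2)[OF rep_hidx]]) (assumption, rule subsetI, erule alg_lev_carrier)

lemma re_le: "L \<in> I \<Longrightarrow> M \<in> I \<Longrightarrow> Sup L M \<Longrightarrow> x \<in> AL L \<Longrightarrow> re M (le M L x) = re L x"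
  by (rule top_embed_lev[OF rep_hidx rep_hidx le_ae alg_lev_carrier])

lemma le_alg: "L \<in> I \<Longrightarrow> M \<in> I \<Longrightarrow> Sup L M \<Longrightarrow> x \<in> AL L \<Longrightarrow> le M L x \<in> AL M"
  by (rule Gal_trans_props(3)[OF rep_hidx rep_hidx le_ae])

lemma re_alg: "L \<in> I \<Longrightarrow> x \<in> AL L \<Longrightarrow> re L x \<in> TA"
  by (rule top_restr_props(3)[OF rep_hidx])

text \<open>An element is covered by a level because the corresponding tuple of length one
  is.\<close>

lemma re_cover:
  assumes x: "x \<in> carrier TK"
  shows "\<exists>L\<in>I. \<exists>y\<in>carrier (HK (rep L)). x = re L y"
proof -
  obtain t where t: "el ST l0 t" "x = cl ST l0 t" by (rule TK_elim[OF x])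
  have "el STT l0 (\<lambda>i. list_encode [t i])" by (rule top.single_cl[OF t(1), THEN conjunct2])
  then obtain L s where L: "L \<in> I" "el STK (rep L) s" "\<forall>\<^sub>F i in F. list_encode [t i] = map_tuple (lev_emb E (val L i)) (s i)"
    by (rule te_cover)
  define P where "P z y \<longleftrightarrow> y \<in> SK (pfst z) \<and> lembt (pfst z) y = psnd z" for z y
  have dec: "decidable (\<lambda>w. P (pfst w) (psnd w))" unfolding P_def by (intro tc_intros)
  have "\<forall>\<^sub>F i in F. \<exists>y. P (ppair (val L i) (t i)) y"
    using el_ae[OF L(2)] L(3)
  proof eventually_elim
    case (elim i)
    have "[t i] = map (lev_emb E (val L i)) (list_decode (s i))"
      using arg_cong[OF elim(2), of list_decode] by (simp del: list_encode.simps)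
    then obtain y where "list_decode (s i) = [y]" "t i = lev_emb E (val L i) y" by auto
    then show ?case using elim(1) by (auto simp: P_def lembt_def tuples_iff)
  qed
  from hc_search[OF dec hc_pair[OF hidx_val[OF rep_hidx[OF L(1)]] el_hc[OF t(1)]] this]
  obtain y where y: "hc C y" "\<forall>\<^sub>F i in F. P (ppair (val L i) (t i)) (y i)" by blast
  have ey: "el SK (rep L) y" by (rule elI[OF y(1)], rule eventually_mono[OF y(2)]) (simp add: P_def)
  have "x = re L (cl SK (rep L) y)"
    unfolding t(2) emb_cl[OF rep_hidx[OF L(1)] ey, THEN conjunct1]
    by (rule cl_cong, use y(2) in eventually_elim) (auto simp: P_def lembt_def)
  then show ?thesis using L(1) HK_intro[OF rep_hidx[OF L(1)] ey] by blast
qed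

lemma re_cover_alg:
  assumes x: "x \<in> TA" shows "\<exists>L\<in>I. \<exists>y\<in>AL L. x = re L y"
proof -
  have "x \<in> carrier TK" using x by (simp add: alg_part_def)
  then obtain L y where L: "L \<in> I" "y \<in> carrier (HK (rep L))" "x = re L y" using re_cover by blast
  have "y \<in> AL L" by (rule top_embed_reflect[OF rep_hidx[OF L(1)] L(2)]) (use x L(3) in simp)
  then show ?thesis using L by blast
qed

lemma common_alg:
  assumes "x \<in> TA" "y \<in> TA" shows "\<exists>N\<in>I. \<exists>a\<in>AL N. \<exists>b\<in>AL N. x = re N a \<and> y = re N b"
proof -
  obtain L a where L: "L \<in> I" "a \<in> AL L" "x = re L a" using re_cover_alg[OF assms(1)] by blast
  obtain M b where M: "M \<in> I" "b \<in> AL M" "y = re M b" using re_cover_alg[OF assms(2)] by blast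
  obtain N where N: "N \<in> I" "Sup L N" "Sup M N" using directed[OF L(1) M(1)] by blast
  show ?thesis
  proof (intro bexI conjI)
    show "x = re N (le N L a)" using re_le[OF L(1) N(1,2) L(2)] L(3) by simp
    show "y = re N (le N M b)" using re_le[OF M(1) N(1,3) M(2)] M(3) by simp
  qed (use N(1) le_alg[OF L(1) N(1,2) L(2)] le_alg[OF M(1) N(1,3) M(2)] in simp_all)
qed

lemma lim_Gal_eq: "lim_Gal C E rep = inverse_limit I (hless C) (\<lambda>L. Gal_lev C E (rep L)) (\<lambda>M L. Gal_trans C E (rep M) (rep L))"
  by (simp add: lim_Gal_def)

lemma Gal_trans_lim_hom:
  "M \<in> I \<Longrightarrow> L \<in> I \<Longrightarrow> Sup L M \<Longrightarrow> Gal_trans C E (rep M) (rep L) \<in> hom (Gal_lev C E (rep M)) (Gal_lev C E (rep L))"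
  by (rule Gal_trans_props(1)[OF rep_hidx rep_hidx le_ae])

lemma lim_Gal_group: "group (lim_Gal C E rep)"
  unfolding lim_Gal_eq
  by (rule inverse_limit_group[OF Gal_lev_group[OF rep_hidx] Gal_trans_lim_hom])

text \<open>The image of the base field in the top product passes through the level of constant
  index 0, where it is the fixed field of an action.\<close>

lemma TB_subfield: "subfield TB TK"
proof -
  have "hidx C l0" by simp
  note l = this
  interpret j: ring_hom_ring "HK l0" TK "top_embed C E l0"
    using ring_hom_ringI2[OF field.is_ring[OF HK_is_field[OF l]] field.is_ring[OF TK_is_field] top_embed_hom(1)[OF l]] .
  have "\<one>\<^bsub>TK\<^esub> \<noteq> \<zero>\<^bsub>TK\<^esub>" using one_not_zero[OF TK_is_field] .
  from j.img_is_subfield(2)[OF field_action.subfield_fixed[OF hyper_action[OF l]] this]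
  show ?thesis unfolding top_embed_hom(3)[OF l] .
qed

lemma Gal_top_group: "group (Gal_top C E)"
  unfolding Gal_top_eq by (rule alg_Gal_group[OF TK_is_field TB_subfield])

lemma Gal_to_lim_apply:
  assumes "\<tau> \<in> carrier (Gal_top C E)" "L \<in> I" "x \<in> AL L"
  shows "Gal_to_lim C E rep \<tau> L x \<in> AL L" "re L (Gal_to_lim C E rep \<tau> L x) = \<tau> (re L x)"
  using top_restr_props(2)[OF rep_hidx[OF assms(2)] assms(1,3)] assms(2) by (simp_all add: Gal_to_lim_def)

lemma Gal_top_D:
  assumes "\<tau> \<in> carrier (Gal_top C E)"
  shows "\<tau> \<in> extensional TA" "x \<in> TA \<Longrightarrow> \<tau> x \<in> TA"
  using Gal_D(1,4)[OF assms[unfolded Gal_top_eq]] Bij_imp_extensional by simp_all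

lemma Gal_lev_D:
  assumes "\<tau> \<in> carrier (Gal_lev C E l)"
  shows "\<tau> \<in> extensional (alg_lev C E l)" "x \<in> alg_lev C E l \<Longrightarrow> \<tau> x \<in> alg_lev C E l"
  using Gal_D(1,4)[OF assms[unfolded Gal_lev_eq]] Bij_imp_extensional by simp_all

lemma Gal_to_lim_hom: "Gal_to_lim C E rep \<in> hom (Gal_top C E) (lim_Gal C E rep)"
proof (rule homI)
  note r = top_restr_props(1)[OF rep_hidx]
  fix \<tau> assume \<tau>: "\<tau> \<in> carrier (Gal_top C E)"
  have c: "Gal_to_lim C E rep \<tau> L \<in> carrier (Gal_lev C E (rep L))" if "L \<in> I" for L
    using hom_in_carrier[OF r[OF that] \<tau>] that by (simp add: Gal_to_lim_def)
  have "Gal_trans C E (rep M) (rep L) (Gal_to_lim C E rep \<tau> M) = Gal_to_lim C E rep \<tau> L"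
    if mn: "M \<in> I" "L \<in> I" "Sup L M" for L M
  proof (rule extensionalityI[of _ "AL L"])
    show "Gal_trans C E (rep M) (rep L) (Gal_to_lim C E rep \<tau> M) \<in> extensional (AL L)" by (simp add: Gal_trans_def restr_along_def)
    show "Gal_to_lim C E rep \<tau> L \<in> extensional (AL L)" by (rule Gal_lev_D(1)[OF c[OF mn(2)]])
    fix x assume x: "x \<in> AL L"
    note p = Gal_trans_props(2)[OF rep_hidx[OF mn(1)] rep_hidx[OF mn(2)] le_ae[OF mn(2,1,3)] c[OF mn(1)] x]
    note g = Gal_to_lim_apply(2)[OF \<tau> mn(1) le_alg[OF mn(2,1,3) x]]
    have "re L (Gal_trans C E (rep M) (rep L) (Gal_to_lim C E rep \<tau> M) x) = \<tau> (re L x)"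
      using p g re_le[OF mn(2,1,3) p[THEN conjunct1]] re_le[OF mn(2,1,3) x] by simp
    then have "re L (Gal_trans C E (rep M) (rep L) (Gal_to_lim C E rep \<tau> M) x) = re L (Gal_to_lim C E rep \<tau> L x)"
      using Gal_to_lim_apply(2)[OF \<tau> mn(2) x] by simp
    then show "Gal_trans C E (rep M) (rep L) (Gal_to_lim C E rep \<tau> M) x = Gal_to_lim C E rep \<tau> L x"
      by (rule inj_onD[OF re_inj[OF mn(2)] _ p[THEN conjunct1] Gal_to_lim_apply(1)[OF \<tau> mn(2) x]])
  qed
  moreover have "Gal_to_lim C E rep \<tau> \<in> (\<Pi>\<^sub>E L\<in>I. carrier (Gal_lev C E (rep L)))"
    by (rule PiE_I[OF c]) (simp_all add: Gal_to_lim_def)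
  ultimately show "Gal_to_lim C E rep \<tau> \<in> carrier (lim_Gal C E rep)"
    unfolding lim_Gal_eq inverse_limit_carrier by blast
  fix \<sigma> assume \<sigma>: "\<sigma> \<in> carrier (Gal_top C E)"
  show "Gal_to_lim C E rep (\<tau> \<otimes>\<^bsub>Gal_top C E\<^esub> \<sigma>) = Gal_to_lim C E rep \<tau> \<otimes>\<^bsub>lim_Gal C E rep\<^esub> Gal_to_lim C E rep \<sigma>"
    unfolding lim_Gal_eq inverse_limit_mult unfolding Gal_to_lim_def
    by (rule restrict_ext) (simp add: hom_mult[OF r \<tau> \<sigma>])
qed

lemma Gal_top_eqI:
  assumes "\<sigma> \<in> extensional TA" "\<tau> \<in> extensional TA" "\<And>L x. L \<in> I \<Longrightarrow> x \<in> AL L \<Longrightarrow> \<sigma> (re L x) = \<tau> (re L x)"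
  shows "\<sigma> = \<tau>"
proof (rule extensionalityI[OF assms(1,2)])
  fix x assume "x \<in> TA"
  then obtain L y where "L \<in> I" "y \<in> AL L" "x = re L y" using re_cover_alg by blast
  then show "\<sigma> x = \<tau> x" using assms(3) by simp
qed

text \<open>The components are glued along the directed union of the algebraic parts. Any two
  algebraic elements come from a common level, so sums and products are compared there.\<close>

lemma Gal_realise:
  assumes x: "x \<in> carrier (lim_Gal C E rep)"
  shows "\<exists>\<tau>\<in>carrier (Gal_top C E). \<forall>L\<in>I. \<forall>y\<in>AL L. \<tau> (re L y) = re L (x L y)"
proof -
  have xL: "x L \<in> carrier (Gal_lev C E (rep L))" if "L \<in> I" for L
    using x that unfolding lim_Gal_eq inverse_limit_carrier by (blast dest: PiE_mem)
  have xt: "Gal_trans C E (rep M) (rep L) (x M) = x L" if "M \<in> I" "L \<in> I" "Sup L M" for L M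
    using x that unfolding lim_Gal_eq inverse_limit_carrier by blast
  have bij: "bij_betw (x L) (AL L) (AL L)" if "L \<in> I" for L
    using Gal_D(1)[OF xL[OF that, unfolded Gal_lev_eq]] by (simp add: Bij_def)
  have mono: "\<exists>y\<in>AL M. re M y = re L z" if "L \<in> I" "M \<in> I" "Sup L M" "z \<in> AL L" for L M z
    using le_alg[OF that] re_le[OF that] by blast
  have compat: "re M (x M y) = re L (x L z)"
    if LM: "L \<in> I" "M \<in> I" "Sup L M" and z: "z \<in> AL L" and y: "y \<in> AL M" and eq: "re M y = re L z" for L M y z
  proof -
    have "re M y = re M (le M L z)" using eq re_le[OF LM z] by simp
    then have y_eq: "y = le M L z" by (rule inj_onD[OF re_inj[OF LM(2)] _ y le_alg[OF LM z]])
    note p = Gal_trans_props(2)[OF rep_hidx[OF LM(2)] rep_hidx[OF LM(1)] le_ae[OF LM] xL[OF LM(2)] z, unfolded xt[OF LM(2,1,3)]]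
    show ?thesis using p re_le[OF LM p[THEN conjunct1]] by (simp add: y_eq)
  qed
  obtain \<tau> where \<tau>: "\<tau> \<in> Bij TA" "\<And>L y. L \<in> I \<Longrightarrow> y \<in> AL L \<Longrightarrow> \<tau> (re L y) = re L (x L y)"
    by (rule direct_limit_bij[where S = TA and I = I and SL = AL and e = re and lt = Sup and \<tau> = x,
      OF re_cover_alg re_alg re_inj directed mono bij compat]; (assumption | (rule that, assumption, blast)))
  have alg_ring: "subring (AL L) (HK (rep L))" if "L \<in> I" for L
    unfolding alg_lev_eq
    using alg_part_subfield(1)[OF HK_is_field field_action.subfield_fixed[OF hyper_action]] rep_hidx[OF that] subfieldE(1) by blast
  have TA_sub: "subring TA TK" by (rule subfieldE(1)[OF alg_part_subfield(1)[OF TK_is_field TB_subfield]])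
  have "\<tau> \<in> ring_hom (TK\<lparr>carrier := TA\<rparr>) (TK\<lparr>carrier := TA\<rparr>)"
  proof (rule ring_hom_memI)
    show "\<tau> a \<in> carrier (TK\<lparr>carrier := TA\<rparr>)" if "a \<in> carrier (TK\<lparr>carrier := TA\<rparr>)" for a
      using funcset_mem[OF Bij_imp_funcset[OF \<tau>(1)]] that by simp
    fix a b assume "a \<in> carrier (TK\<lparr>carrier := TA\<rparr>)" "b \<in> carrier (TK\<lparr>carrier := TA\<rparr>)"
    then have "a \<in> TA" "b \<in> TA" by simp_all
    then obtain N c d where N: "N \<in> I" "c \<in> AL N" "d \<in> AL N" "a = re N c" "b = re N d" using common_alg by blast
    note h = top_embed_hom(1)[OF rep_hidx[OF N(1)]]
    note xh = Gal_D(2)[OF xL[OF N(1), unfolded Gal_lev_eq]]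
    note cd = alg_lev_carrier[OF N(2)] alg_lev_carrier[OF N(3)]
    have xc: "x N c \<in> AL N" "x N d \<in> AL N" using Gal_lev_D(2)[OF xL[OF N(1)]] N(2,3) by blast+
    have m: "c \<otimes>\<^bsub>HK (rep N)\<^esub> d \<in> AL N" "c \<oplus>\<^bsub>HK (rep N)\<^esub> d \<in> AL N"
      using subringE(6,7)[OF alg_ring[OF N(1)] N(2,3)] .
    show "\<tau> (a \<otimes>\<^bsub>TK\<lparr>carrier := TA\<rparr>\<^esub> b) = \<tau> a \<otimes>\<^bsub>TK\<lparr>carrier := TA\<rparr>\<^esub> \<tau> b"
      using ring_hom_mult[OF h cd] ring_hom_mult[OF xh, of c d] ring_hom_mult[OF h alg_lev_carrier[OF xc(1)] alg_lev_carrier[OF xc(2)]]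
        \<tau>(2)[OF N(1,2)] \<tau>(2)[OF N(1,3)] \<tau>(2)[OF N(1) m(1)] N(2-5) by simp
    show "\<tau> (a \<oplus>\<^bsub>TK\<lparr>carrier := TA\<rparr>\<^esub> b) = \<tau> a \<oplus>\<^bsub>TK\<lparr>carrier := TA\<rparr>\<^esub> \<tau> b"
      using ring_hom_add[OF h cd] ring_hom_add[OF xh, of c d] ring_hom_add[OF h alg_lev_carrier[OF xc(1)] alg_lev_carrier[OF xc(2)]]
        \<tau>(2)[OF N(1,2)] \<tau>(2)[OF N(1,3)] \<tau>(2)[OF N(1) m(2)] N(2-5) by simp
  next
    obtain L where L: "L \<in> I" using common_alg[OF subringE(3)[OF TA_sub] subringE(3)[OF TA_sub]] by blast
    note h = ring_hom_one[OF top_embed_hom(1)[OF rep_hidx[OF L]]]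
    have "x L \<one>\<^bsub>HK (rep L)\<^esub> = \<one>\<^bsub>HK (rep L)\<^esub>" using ring_hom_one[OF Gal_D(2)[OF xL[OF L, unfolded Gal_lev_eq]]] by simp
    then show "\<tau> \<one>\<^bsub>TK\<lparr>carrier := TA\<rparr>\<^esub> = \<one>\<^bsub>TK\<lparr>carrier := TA\<rparr>\<^esub>"
      using \<tau>(2)[OF L subringE(3)[OF alg_ring[OF L]]] h by simp
  qed
  moreover have "\<tau> b = b" if b: "b \<in> TB" for b
  proof -
    have "b \<in> TA" using b alg_part_subfield(2)[OF TK_is_field TB_subfield] by blast
    then obtain L where L: "L \<in> I" using re_cover_alg by blast
    obtain c where c: "c \<in> HB (rep L)" "b = re L c" using b top_embed_hom(3)[OF rep_hidx[OF L]] by blast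
    have "c \<in> AL L" unfolding alg_lev_eq
      using alg_part_subfield(2)[OF HK_is_field field_action.subfield_fixed[OF hyper_action]] rep_hidx[OF L] c(1) by blast
    then show ?thesis using \<tau>(2)[OF L] Gal_D(3)[OF xL[OF L, unfolded Gal_lev_eq] c(1)] c(2) by simp
  qed
  ultimately have "\<tau> \<in> carrier (Gal_top C E)" using \<tau>(1) by (simp add: Gal_top_eq Gal_def)
  then show ?thesis using \<tau>(2) by blast
qed

theorem Gal_to_lim_iso: "Gal_to_lim C E rep \<in> iso (Gal_top C E) (lim_Gal C E rep)"
proof -
  have inj: "inj_on (Gal_to_lim C E rep) (carrier (Gal_top C E))"
  proof (rule inj_onI)
    fix \<sigma> \<tau> assume st: "\<sigma> \<in> carrier (Gal_top C E)" "\<tau> \<in> carrier (Gal_top C E)" and eq: "Gal_to_lim C E rep \<sigma> = Gal_to_lim C E rep \<tau>"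
    show "\<sigma> = \<tau>"
    proof (rule Gal_top_eqI[OF Gal_top_D(1)[OF st(1)] Gal_top_D(1)[OF st(2)]])
      show "\<sigma> (re L x) = \<tau> (re L x)" if "L \<in> I" "x \<in> AL L" for L x
        using Gal_to_lim_apply(2)[OF st(1) that] Gal_to_lim_apply(2)[OF st(2) that] eq by simp
    qed
  qed
  have "x \<in> Gal_to_lim C E rep ` carrier (Gal_top C E)" if x: "x \<in> carrier (lim_Gal C E rep)" for x
  proof -
    obtain \<tau> where \<tau>: "\<tau> \<in> carrier (Gal_top C E)" "\<And>L y. L \<in> I \<Longrightarrow> y \<in> AL L \<Longrightarrow> \<tau> (re L y) = re L (x L y)"
      using Gal_realise[OF x] by blast
    have xP: "x \<in> (\<Pi>\<^sub>E L\<in>I. carrier (Gal_lev C E (rep L)))" using x unfolding lim_Gal_eq inverse_limit_carrier by blast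
    have "x = Gal_to_lim C E rep \<tau>"
    proof (rule extensionalityI[of _ I])
      show "x \<in> extensional I" using xP by (simp add: PiE_def)
      show "Gal_to_lim C E rep \<tau> \<in> extensional I" by (simp add: Gal_to_lim_def)
      fix L assume L: "L \<in> I"
      have xL: "x L \<in> carrier (Gal_lev C E (rep L))" by (rule PiE_mem[OF xP L])
      show "x L = Gal_to_lim C E rep \<tau> L"
      proof (rule extensionalityI[OF Gal_lev_D(1)[OF xL]])
        show "Gal_to_lim C E rep \<tau> L \<in> extensional (AL L)" using L by (simp add: Gal_to_lim_def restr_along_def)
        fix y assume y: "y \<in> AL L"
        note g = Gal_to_lim_apply[OF \<tau>(1) L y]
        have "re L (x L y) = re L (Gal_to_lim C E rep \<tau> L y)" using \<tau>(2)[OF L y] g(2) by simp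
        then show "x L y = Gal_to_lim C E rep \<tau> L y"
          by (rule inj_onD[OF re_inj[OF L] _ Gal_lev_D(2)[OF xL y] g(1)])
      qed
    qed
    then show ?thesis using \<tau>(1) by blast
  qed
  then have "Gal_to_lim C E rep ` carrier (Gal_top C E) = carrier (lim_Gal C E rep)"
    using hom_in_carrier[OF Gal_to_lim_hom] by blast
  then show ?thesis using inj Gal_to_lim_hom by (simp add: iso_def bij_betw_def)
qed

section \<open>The right horizontal maps of the two upper rows\<close>

lemma lim_alg_act_eq: "lim_alg_act C E rep = (\<lambda>x. \<lambda>L\<in>I. alg_act C E (rep L) (x L))"
  by (simp add: lim_alg_act_def fun_eq_iff)

lemma lim_alg_act_hom: "lim_alg_act C E rep \<in> hom (lim_G C E rep) (lim_Gal C E rep)"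
  unfolding lim_alg_act_eq lim_G_def lim_Gal_def
proof (rule inverse_limit_map[where h = "\<lambda>L. alg_act C E (rep L)"])
  show "alg_act C E (rep L) \<in> hom (G_lev C E (rep L)) (Gal_lev C E (rep L))" if "L \<in> I" for L
    by (rule alg_act_lev_hom[OF rep_hidx[OF that]])
  show "Gal_trans C E (rep M) (rep L) (alg_act C E (rep M) x) = alg_act C E (rep L) (G_trans C E (rep M) (rep L) x)"
    if "M \<in> I" "L \<in> I" "Sup L M" "x \<in> carrier (G_lev C E (rep M))" for L M x
    by (rule Gal_trans_alg_act[OF rep_hidx[OF that(1)] rep_hidx[OF that(2)] less_ae[OF that(2,1,3)] that(4)])
qed

lemma lim_I_kernel:
  "lim_I C E rep = (lim_G C E rep)\<lparr>carrier := kernel (lim_G C E rep) (lim_Gal C E rep) (lim_alg_act C E rep)\<rparr>"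
  unfolding lim_alg_act_eq lim_G_def lim_Gal_def lim_I_def
  by (rule inverse_limit_kernel[OF I_lev_kernel[OF rep_hidx]])

text \<open>Links the two upper rows: the embeddings of fields and of trees commute with passing to
  tuples of length one, so the action of \<sigma> on tuples from level \<open>L\<close> determines
  its action on field elements from that level.\<close>

lemma Psi_apply:
  assumes \<sigma>: "\<sigma> \<in> carrier (HAut_top C E)" and L: "L \<in> I" and x: "x \<in> AL L"
  shows "Psi_top C E \<sigma> (re L x) = re L (alg_act C E (rep L) (HAut_to_lim C E rep \<sigma> L) x)"
proof -
  let ?G = "HAut_to_lim C E rep \<sigma> L"
  let ?sg = "single C (\<lambda>_. Some (top_field E))"
  note l = rep_hidx[OF L]
  have sg: "?sg = single C (along (\<lambda>_. top_field E) l0)" by (simp add: along_const)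
  have inj: "inj_on ?sg TA"
  proof (rule inj_onI)
    fix y z assume "y \<in> TA" "z \<in> TA" and eq: "?sg y = ?sg z"
    then have "y \<in> carrier TK" "z \<in> carrier TK" by (simp_all add: alg_part_def)
    then obtain s t where s: "el ST l0 s" "y = cl ST l0 s" and t: "el ST l0 t" "z = cl ST l0 t"
      by (elim TK_elim) blast
    show "y = z" using top.single_inj[OF s(1) t(1)] eq unfolding s(2) t(2) sg .
  qed
  have sq: "?sg (re L y) = te L (sg (rep L) y)" if "y \<in> carrier (HK (rep L))" for y
  proof -
    obtain t where t: "el SK (rep L) t" "y = cl SK (rep L) t" by (rule HK_elim[OF l \<open>y \<in> carrier (HK (rep L))\<close>])
    note e = emb_cl[OF l t(1)]
    show ?thesis unfolding t(2) e[THEN conjunct1] sg sg_cl(1)[OF l t(1)] te_cl(1)[OF L sg_cl(2)[OF l t(1)]]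
      top.single_cl[OF e[THEN conjunct2], THEN conjunct1] map_tuple_single ..
  qed
  have ac: "acts \<sigma> L ?G" by (rule HAut_to_lim_carrier(2)[OF \<sigma> L])
  then have cG: "?G \<in> carrier (G_lev C E (rep L))" by (simp add: acts_def)
  have xK: "x \<in> carrier (HK (rep L))" by (rule alg_lev_carrier[OF x])
  obtain t where t: "el SK (rep L) t" "x = cl SK (rep L) t" by (rule HK_elim[OF l xK])
  have "sg (rep L) x \<in> TL L" unfolding t(2) sg_cl(1)[OF l t(1)] by (rule cprodI[OF l usd_STK sg_cl(2)[OF l t(1)]])
  then have "\<sigma> (te L (sg (rep L) x)) = te L (tree_act C E (rep L) ?G (sg (rep L) x))"
    using ac by (simp add: acts_def)
  also have "\<dots> = ?sg (re L (hact (rep L) ?G x))"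
    unfolding tree_act_single[OF l cG xK] by (rule sq[OF alg_lev_carrier[OF hact_alg[OF l cG x]], symmetric])
  finally have "\<sigma> (?sg (re L x)) = ?sg (re L (hact (rep L) ?G x))" unfolding sq[OF xK] .
  moreover have "the_inv_into TA ?sg (?sg (re L (hact (rep L) ?G x))) = re L (hact (rep L) ?G x)"
    by (rule the_inv_into_f_f[OF inj re_alg[OF L hact_alg[OF l cG x]]])
  ultimately have "Psi_top C E \<sigma> (re L x) = re L (hact (rep L) ?G x)"
    using re_alg[OF L x] by (simp add: Psi_top_def alg_restr_def restr_along_def hyper_alg_def)
  then show ?thesis using x by (simp add: alg_act_eq)
qed

lemma Psi_extensional: "Psi_top C E \<sigma> \<in> extensional TA"
  by (simp add: Psi_top_def alg_restr_def restr_along_def hyper_alg_def)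

text \<open>That \<open>Psi_top C E \<sigma>\<close> belongs to the Galois group is obtained
  backwards: the thread on the right-hand side comes from some \<tau> in that group because
  \<open>Gal_to_lim\<close> is surjective, and \<tau> agrees with
  \<open>Psi_top C E \<sigma>\<close> on every level.\<close>

lemma Gal_to_lim_Psi:
  assumes \<sigma>: "\<sigma> \<in> carrier (HAut_top C E)"
  shows "Gal_to_lim C E rep (Psi_top C E \<sigma>) = lim_alg_act C E rep (HAut_to_lim C E rep \<sigma>)"
    "Psi_top C E \<sigma> \<in> carrier (Gal_top C E)"
proof -
  let ?x = "lim_alg_act C E rep (HAut_to_lim C E rep \<sigma>)"
  have "?x \<in> carrier (lim_Gal C E rep)"
    by (rule hom_in_carrier[OF lim_alg_act_hom HAut_to_lim_carrier(1)[OF \<sigma>]])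
  moreover have "carrier (lim_Gal C E rep) = Gal_to_lim C E rep ` carrier (Gal_top C E)"
    using Gal_to_lim_iso by (auto simp: iso_def bij_betw_def)
  ultimately obtain \<tau> where \<tau>: "\<tau> \<in> carrier (Gal_top C E)" "?x = Gal_to_lim C E rep \<tau>" by blast
  have "Psi_top C E \<sigma> = \<tau>"
  proof (rule Gal_top_eqI[OF Psi_extensional Gal_top_D(1)[OF \<tau>(1)]])
    fix L x assume L: "L \<in> I" "x \<in> AL L"
    have "\<tau> (re L x) = re L (?x L x)" using Gal_to_lim_apply(2)[OF \<tau>(1) L] \<tau>(2) by simp
    also have "\<dots> = Psi_top C E \<sigma> (re L x)" using Psi_apply[OF \<sigma> L] L(1) by (simp add: lim_alg_act_eq)
    finally show "Psi_top C E \<sigma> (re L x) = \<tau> (re L x)" ..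
  qed
  then show "Gal_to_lim C E rep (Psi_top C E \<sigma>) = ?x" "Psi_top C E \<sigma> \<in> carrier (Gal_top C E)" using \<tau> by simp_all
qed

text \<open>Multiplicativity is inherited, along the injective map \<open>Gal_to_lim\<close>, from
  the limit row, where it holds coordinatewise.\<close>

lemma Psi_hom: "Psi_top C E \<in> hom (HAut_top C E) (Gal_top C E)"
proof (rule homI[OF Gal_to_lim_Psi(2)])
  fix \<sigma> \<tau> assume st: "\<sigma> \<in> carrier (HAut_top C E)" "\<tau> \<in> carrier (HAut_top C E)"
  note H = iso_imp_homomorphism[OF HAut_to_lim_iso]
  have stc: "\<sigma> \<otimes>\<^bsub>HAut_top C E\<^esub> \<tau> \<in> carrier (HAut_top C E)" by (rule monoid.m_closed[OF group.is_monoid[OF HAut_top_group] st])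
  have pc: "Psi_top C E \<sigma> \<otimes>\<^bsub>Gal_top C E\<^esub> Psi_top C E \<tau> \<in> carrier (Gal_top C E)"
    by (rule monoid.m_closed[OF group.is_monoid[OF Gal_top_group] Gal_to_lim_Psi(2)[OF st(1)] Gal_to_lim_Psi(2)[OF st(2)]])
  have "Gal_to_lim C E rep (Psi_top C E (\<sigma> \<otimes>\<^bsub>HAut_top C E\<^esub> \<tau>)) =
      Gal_to_lim C E rep (Psi_top C E \<sigma> \<otimes>\<^bsub>Gal_top C E\<^esub> Psi_top C E \<tau>)"
    unfolding Gal_to_lim_Psi(1)[OF stc] hom_mult[OF Gal_to_lim_hom Gal_to_lim_Psi(2)[OF st(1)] Gal_to_lim_Psi(2)[OF st(2)]]
      Gal_to_lim_Psi(1)[OF st(1)] Gal_to_lim_Psi(1)[OF st(2)] hom_mult[OF H st]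
    by (rule hom_mult[OF lim_alg_act_hom HAut_to_lim_carrier(1)[OF st(1)] HAut_to_lim_carrier(1)[OF st(2)]])
  moreover have "inj_on (Gal_to_lim C E rep) (carrier (Gal_top C E))"
    using Gal_to_lim_iso by (simp add: iso_def bij_betw_def)
  ultimately show "Psi_top C E (\<sigma> \<otimes>\<^bsub>HAut_top C E\<^esub> \<tau>) = Psi_top C E \<sigma> \<otimes>\<^bsub>Gal_top C E\<^esub> Psi_top C E \<tau>"
    using Gal_to_lim_Psi(2)[OF stc] pc by (auto dest: inj_onD)
qed

lemma ker_lim_iso: "HAut_to_lim C E rep \<in> iso (ker_top C E) (lim_I C E rep)"
  unfolding ker_top_def lim_I_kernel
proof (rule kernel_iso[OF HAut_to_lim_iso, where h = "Gal_to_lim C E rep"])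
  interpret h: group_hom "Gal_top C E" "lim_Gal C E rep" "Gal_to_lim C E rep"
    using Gal_top_group lim_Gal_group Gal_to_lim_hom by (simp add: group_hom_def group_hom_axioms_def)
  show "inj_on (Gal_to_lim C E rep) (carrier (Gal_top C E))" using Gal_to_lim_iso by (simp add: iso_def bij_betw_def)
  show "\<one>\<^bsub>lim_Gal C E rep\<^esub> = Gal_to_lim C E rep \<one>\<^bsub>Gal_top C E\<^esub>" by simp
qed (use Gal_to_lim_Psi group.is_monoid[OF Gal_top_group] in \<open>simp_all add: monoid.one_closed\<close>)

lemma ker_top_left_exact: "left_exact (ker_top C E) id (HAut_top C E) (Psi_top C E) (Gal_top C E)"
  unfolding ker_top_def by (rule kernel_left_exact[OF HAut_top_group Gal_top_group Psi_hom])

lemma lim_left_exact: "left_exact (lim_I C E rep) id (lim_G C E rep) (lim_alg_act C E rep) (lim_Gal C E rep)"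
  unfolding lim_I_kernel by (rule kernel_left_exact[OF lim_G_group lim_Gal_group lim_alg_act_hom])

end

text \<open>\<open>rep\<close> is an arbitrary choice of representatives for the indices. The left
  horizontal maps are inclusions, hence \<open>id\<close>, and the left squares express that the two
  left columns use the same map; their content lies in the homomorphism and isomorphism claims for
  the first column.\<close>

theorem theorem5p31:
  fixes E :: galois_data and C :: "nat set" and rep :: "hyper \<Rightarrow> pfun" and N M :: hyper
  assumes "fully_computable E"
    and "cohesive C"
    and "\<And>L. L \<in> hnat C \<Longrightarrow> rep L \<in> L"
    and "N \<in> hnat C" and "M \<in> hnat C" and "hless C N M"
  shows
    "\<comment> \<open>rows\<close>
     left_exact (ker_top C E) id (HAut_top C E) (Psi_top C E) (Gal_top C E) \<and>
     left_exact (lim_I C E rep) id (lim_G C E rep) (lim_alg_act C E rep) (lim_Gal C E rep) \<and>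
     left_exact (I_lev C E (rep M)) id (G_lev C E (rep M))
       (alg_act C E (rep M)) (Gal_lev C E (rep M)) \<and>
     left_exact (I_lev C E (rep N)) id (G_lev C E (rep N))
       (alg_act C E (rep N)) (Gal_lev C E (rep N)) \<and>

     \<comment> \<open>identifications inside the lower rows, compatible with restriction to the algebraic part\<close>
     tree_act C E (rep M) \<in> iso (G_lev C E (rep M)) (HAut_lev C E (rep M)) \<and>
     tree_act C E (rep N) \<in> iso (G_lev C E (rep N)) (HAut_lev C E (rep N)) \<and>
     (\<forall>g\<in>carrier (G_lev C E (rep M)).
        alg_act C E (rep M) g = alg_restr_lev C E (rep M) (tree_act C E (rep M) g)) \<and>
     (\<forall>g\<in>carrier (G_lev C E (rep N)).
        alg_act C E (rep N) g = alg_restr_lev C E (rep N) (tree_act C E (rep N) g)) \<and>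

     \<comment> \<open>vertical maps\<close>
     HAut_to_lim C E rep \<in> iso (ker_top C E) (lim_I C E rep) \<and>
     HAut_to_lim C E rep \<in> iso (HAut_top C E) (lim_G C E rep) \<and>
     Gal_to_lim C E rep \<in> iso (Gal_top C E) (lim_Gal C E rep) \<and>
     (\<lambda>x. x M) \<in> hom (lim_I C E rep) (I_lev C E (rep M)) \<and>
     (\<lambda>x. x M) \<in> hom (lim_G C E rep) (G_lev C E (rep M)) \<and>
     (\<lambda>x. x M) \<in> hom (lim_Gal C E rep) (Gal_lev C E (rep M)) \<and>
     G_trans C E (rep M) (rep N) \<in> hom (I_lev C E (rep M)) (I_lev C E (rep N)) \<and>
     G_trans C E (rep M) (rep N) \<in> hom (G_lev C E (rep M)) (G_lev C E (rep N)) \<and>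
     Gal_trans C E (rep M) (rep N) \<in> hom (Gal_lev C E (rep M)) (Gal_lev C E (rep N)) \<and>

     \<comment> \<open>left squares, then right squares\<close>
     commutes (ker_top C E) id (HAut_to_lim C E rep) (HAut_to_lim C E rep) id \<and>
     commutes (lim_I C E rep) id (\<lambda>x. x M) (\<lambda>x. x M) id \<and>
     commutes (I_lev C E (rep M)) id
       (G_trans C E (rep M) (rep N)) (G_trans C E (rep M) (rep N)) id \<and>
     commutes (HAut_top C E) (Psi_top C E) (Gal_to_lim C E rep)
       (HAut_to_lim C E rep) (lim_alg_act C E rep) \<and>
     commutes (lim_G C E rep) (lim_alg_act C E rep) (\<lambda>x. x M)
       (\<lambda>x. x M) (alg_act C E (rep M)) \<and>
     commutes (G_lev C E (rep M)) (alg_act C E (rep M)) (Gal_trans C E (rep M) (rep N))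
       (G_trans C E (rep M) (rep N)) (alg_act C E (rep N))"
proof -
  interpret galois_limit C E rep
    using assms(1-3) by unfold_locales auto
  note n = rep_hidx[OF assms(4)] and m = rep_hidx[OF assms(5)]
  note less = less_ae[OF assms(4-6)] and le = le_ae[OF assms(4-6)]
  show ?thesis
  proof (intro conjI ballI)
    show "left_exact (ker_top C E) id (HAut_top C E) (Psi_top C E) (Gal_top C E)" by (rule ker_top_left_exact)
    show "left_exact (lim_I C E rep) id (lim_G C E rep) (lim_alg_act C E rep) (lim_Gal C E rep)" by (rule lim_left_exact)
    show "HAut_to_lim C E rep \<in> iso (ker_top C E) (lim_I C E rep)" by (rule ker_lim_iso)
    show "HAut_to_lim C E rep \<in> iso (HAut_top C E) (lim_G C E rep)" by (rule HAut_to_lim_iso)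
    show "Gal_to_lim C E rep \<in> iso (Gal_top C E) (lim_Gal C E rep)" by (rule Gal_to_lim_iso)
    show "(\<lambda>x. x M) \<in> hom (lim_I C E rep) (I_lev C E (rep M))"
      unfolding lim_I_def using assms(5) by (rule inverse_limit_proj)
    show "(\<lambda>x. x M) \<in> hom (lim_G C E rep) (G_lev C E (rep M))"
      unfolding lim_G_def using assms(5) by (rule inverse_limit_proj)
    show "(\<lambda>x. x M) \<in> hom (lim_Gal C E rep) (Gal_lev C E (rep M))"
      unfolding lim_Gal_def using assms(5) by (rule inverse_limit_proj)
    show "commutes (HAut_top C E) (Psi_top C E) (Gal_to_lim C E rep) (HAut_to_lim C E rep) (lim_alg_act C E rep)"
      unfolding commutes_def by (intro ballI Gal_to_lim_Psi(1))
    show "commutes (lim_G C E rep) (lim_alg_act C E rep) (\<lambda>x. x M) (\<lambda>x. x M) (alg_act C E (rep M))"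
      using assms(5) by (simp add: commutes_def lim_alg_act_eq)
    show "commutes (G_lev C E (rep M)) (alg_act C E (rep M)) (Gal_trans C E (rep M) (rep N))
       (G_trans C E (rep M) (rep N)) (alg_act C E (rep N))"
      unfolding commutes_def by (intro ballI Gal_trans_alg_act[OF m n less])
  qed (use lev_left_exact[OF m] lev_left_exact[OF n] tree_act_iso[OF m] tree_act_iso[OF n]
      alg_act_restr[OF m] alg_act_restr[OF n] G_trans_I_hom[OF m n less] G_trans_hom[OF m n less]
      Gal_trans_props(1)[OF m n le] in \<open>simp_all add: commutes_def\<close>)
qed

end
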